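(* Let $\Lambda$ be a finite abelian group, $A$ a unital Fréchet algebra and $(A,\Lambda,\alpha)$ a trivial noncommutative principal $\Lambda$-bundle such that $C_A^{\Lambda}$ is isomorphic to $\mathbb{C}$. Further, let $M$ be a manifold, $(U_i)_{i\in I}$ an open cover of $M$ and $U_{ij}:=U_i\cap U_j$ for $i,j\in I$. If $(g_{ij})_{i,j\in I}$ is a collection of functions $g_{ij}\in C^{\infty}(U_{ij},\mathrm{Aut}_{\Lambda}(A))$ satisfying \[g_{ii}=\mathbf{1}\quad\text{and}\quad g_{ij}g_{jk}=g_{ik}\ \text{ on }\ U_{ijk}:=U_i\cap U_j\cap U_k,\] then the following assertions hold: (a) There exists an algebra bundle $(\mathbb{A},M,A,q)$ (total space $\mathbb{A}$, base $M$, fibre $A$, projection $q$) and bundle charts $\varphi_i:U_i\times A\rightarrow\mathbb{A}_{U_i}:=q^{-1}(U_i)$ such that $(\varphi_i^{-1}\circ\varphi_j)(x,a)=(x,g_{ij}(x).a)$. Moreover, the map \[\sigma:\Lambda\times\mathbb{A}\rightarrow\mathbb{A},\quad(\lambda,a)\mapsto\varphi_i(x,\alpha(\lambda).a_0),\] where $i\in I$ with $x=q(a)\in U_i$ and $a_0\in A$ with $\varphi_i(x,a_0)=a$, defines an action of $\Lambda$ on $\mathbb{A}$ by fibrewise algebra automorphisms. (b) The map \[\beta:\Lambda\times\Gamma\mathbb{A}\rightarrow\Gamma\mathbb{A},\quad\beta(\lambda,s)(m):=\sigma(\lambda,s(m)),\] defines an action of $\Lambda$ on the corresponding space $\Gamma\mathbb{A}$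 of (smooth) sections by algebra automorphisms. Furthermore, the triple $(\Gamma\mathbb{A},\Lambda,\beta)$ is a noncommutative principal $\Lambda$-bundle.
   Context: Manifolds are finite-dimensional, paracompact, second countable and smooth; algebras are associative and complex. For an algebra $A$, $\Gamma_A$ denotes the set of nonzero algebra homomorphisms $A\to\mathbb{C}$; $C_A$ is the center of $A$. A dynamical system $(A,\Lambda,\alpha)$ consists of a unital locally convex algebra $A$ and a group homomorphism $\alpha:\Lambda\to\mathrm{Aut}(A)$ inducing a continuous action. $C_A^\Lambda$ is the fixed point algebra of the induced $\Lambda$-action on $C_A$. For $\chi\in\widehat{\Lambda}=\mathrm{Hom}(\Lambda,\mathbb{T})$, $A_\chi=\{a\in A:\alpha(\lambda)a=\chi(\lambda)a\ \forall\lambda\in\Lambda\}$. $\mathrm{Aut}_{\Lambda}(A):=\{\varphi\in\mathrm{Aut}(A):\alpha(\lambda)\circ\varphi=\varphi\circ\alpha(\lambda)\ \forall\lambda\in\Lambda\}$. A function $g:U\to\mathrm{Aut}_\Lambda(A)$ on an open set $U\subseteq M$ is understood to be smooth, $g\in C^\infty(U,\mathrm{Aut}_\Lambda(A))$, if $U\times A\to A$, $(x,a)\mapsto g(x).a$ is smooth. The space $\Gamma\mathbb{A}$ of smooth sections is a unital algebra under pointwise operations with its usual locally convex topology (of uniform convergence of local representatives and all derivatives on compact sets). Trivial bundles: let $\{\lambda_1,\ldots,\lambda_k\}$ be a set of generators of $\Lambda$ of minimal cardinality, of orders $n_1,\ldots,n_k$, such that $\Lambda$ is the internal direct product of the cyclic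 subgroups $\langle\lambda_i\rangle$. Define $\widehat{\lambda}_i\in\widehat{\Lambda}$ by $\widehat{\lambda}_i(\lambda_i)=\exp(2\pi i/n_i)$ (imaginary unit in the exponent) and $\widehat{\lambda}_i(\lambda_j)=1$ for $j\neq i$. $(A,\Lambda,\alpha)$ is a trivial noncommutative principal $\Lambda$-bundle if there exists such a set of generators for which each $A_{\widehat{\lambda}_i}$ contains an invertible element $a_i$ with $a_i^{n_i}=1_A$. Smooth localization: for a unital locally convex algebra $A$ and $a\in A$, let $f_a\in C^\infty(\mathbb{R},A)$, $f_a(t)=1_A-ta$, where $C^\infty(\mathbb{R},A)$ carries the smooth compact-open topology, let $I_a$ be the closure of the two-sided ideal generated by $f_a$, and set $A_{\{a\}}:=C^\infty(\mathbb{R},A)/I_a$. For $z\in C_A^\Lambda$, $\alpha_{\{z\}}(\lambda,[f]):=[\alpha(\lambda)\circ f]$ defines an action of $\Lambda$ on $A_{\{z\}}$, giving a dynamical system $(A_{\{z\}},\Lambda,\alpha_{\{z\}})$. A dynamical system $(A,\Lambda,\alpha)$ is a noncommutative principal $\Lambda$-bundle if for each $\chi\in\Gamma_{C_A^\Lambda}$ there exists $z\in C_A^\Lambda$ with $\chi(z)\neq0$ such that $(A_{\{z\}},\Lambda,\alpha_{\{z\}})$ is a trivial noncommutative principal $\Lambda$-bundle. *)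

theory Defs
  imports
    "HOL-Analysis.Analysis"
    "HOL-Algebra.Module"
    "HOL-Algebra.QuotRing"
    "HOL-Algebra.Generated_Groups"
    "HOL-Algebra.Product_Groups"
    "HOL-Algebra.Group_Action"
    "HOL-Algebra.Multiplicative_Group"
begin

section \<open>Locally convex spaces and locally convex algebras\<close>

text \<open>Vector spaces and algebras are records with an explicit carrier, since function algebras
  and their quotients occur. For a mere vector space the fields \<open>mult\<close> and \<open>one\<close> inherited from
  \<open>ring\<close> are irrelevant: the locale \<open>Module.module\<close> does not mention them.\<close>

record ('k, 'v) tvs = "('k, 'v) module" +
  topo :: "'v topology"

definition scalars :: "('k::real_normed_field, 'k) tvs" where
  "scalars = \<lparr>carrier = UNIV, mult = (*), one = 1, ring.zero = 0, add = (+), smult = (*),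
    topo = euclidean\<rparr>"

definition lc_space :: "('k::real_normed_field, 'v) tvs \<Rightarrow> bool" where
  "lc_space V \<longleftrightarrow>
     Module.module (scalars :: ('k, 'k) tvs) V \<and>
     topspace (topo V) = carrier V \<and>
     Hausdorff_space (topo V) \<and>
     continuous_map (prod_topology (topo V) (topo V)) (topo V) (\<lambda>(x, y). x \<oplus>\<^bsub>V\<^esub> y) \<and>
     continuous_map (prod_topology euclidean (topo V)) (topo V) (\<lambda>(c, x). c \<odot>\<^bsub>V\<^esub> x) \<and>
     (\<forall>W. openin (topo V) W \<and> \<zero>\<^bsub>V\<^esub> \<in> W \<longrightarrow>
        (\<exists>C. openin (topo V) C \<and> \<zero>\<^bsub>V\<^esub> \<in> C \<and> C \<subseteq> W \<and>
          (\<forall>x\<in>C. \<forall>y\<in>C. \<forall>t\<in>{0..1}.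
             (of_real t \<odot>\<^bsub>V\<^esub> x) \<oplus>\<^bsub>V\<^esub> (of_real (1 - t) \<odot>\<^bsub>V\<^esub> y) \<in> C)))"

definition unital_algebra :: "(complex, 'a, 'x) module_scheme \<Rightarrow> bool" where
  "unital_algebra A \<longleftrightarrow>
     ring A \<and> Module.module (scalars :: (complex, complex) tvs) A \<and>
     (\<forall>c. \<forall>x\<in>carrier A. \<forall>y\<in>carrier A.
        (c \<odot>\<^bsub>A\<^esub> x) \<otimes>\<^bsub>A\<^esub> y = c \<odot>\<^bsub>A\<^esub> (x \<otimes>\<^bsub>A\<^esub> y) \<and>
        x \<otimes>\<^bsub>A\<^esub> (c \<odot>\<^bsub>A\<^esub> y) = c \<odot>\<^bsub>A\<^esub> (x \<otimes>\<^bsub>A\<^esub> y))"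

definition lc_algebra :: "(complex, 'a) tvs \<Rightarrow> bool" where
  "lc_algebra A \<longleftrightarrow>
     unital_algebra A \<and> lc_space A \<and>
     continuous_map (prod_topology (topo A) (topo A)) (topo A) (\<lambda>(x, y). x \<otimes>\<^bsub>A\<^esub> y)"

definition frechet_algebra :: "(complex, 'a) tvs \<Rightarrow> bool" where
  "frechet_algebra A \<longleftrightarrow>
     lc_algebra A \<and>
     (\<exists>d. Metric_space (carrier A) d \<and>
          Metric_space.mtopology (carrier A) d = topo A \<and>
          Metric_space.mcomplete (carrier A) d \<and>
          (\<forall>x\<in>carrier A. \<forall>y\<in>carrier A. \<forall>z\<in>carrier A.
             d (x \<oplus>\<^bsub>A\<^esub> z) (y \<oplus>\<^bsub>A\<^esub> z) = d x y))"

definition alg_hom ::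
  "(complex, 'a, 'x) module_scheme \<Rightarrow> (complex, 'b, 'y) module_scheme \<Rightarrow> ('a \<Rightarrow> 'b) set" where
  "alg_hom A B =
     {h. h \<in> carrier A \<rightarrow> carrier B \<and>
         (\<forall>x\<in>carrier A. \<forall>y\<in>carrier A. h (x \<oplus>\<^bsub>A\<^esub> y) = h x \<oplus>\<^bsub>B\<^esub> h y) \<and>
         (\<forall>x\<in>carrier A. \<forall>y\<in>carrier A. h (x \<otimes>\<^bsub>A\<^esub> y) = h x \<otimes>\<^bsub>B\<^esub> h y) \<and>
         (\<forall>c. \<forall>x\<in>carrier A. h (c \<odot>\<^bsub>A\<^esub> x) = c \<odot>\<^bsub>B\<^esub> h x)}"

definition alg_iso ::
  "(complex, 'a, 'x) module_scheme \<Rightarrow> (complex, 'b, 'y) module_scheme \<Rightarrow> ('a \<Rightarrow> 'b) set" where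
  "alg_iso A B = {h \<in> alg_hom A B. bij_betw h (carrier A) (carrier B)}"

definition alg_auto :: "(complex, 'a, 'x) module_scheme \<Rightarrow> ('a \<Rightarrow> 'a) set" where
  "alg_auto A = alg_hom A A \<inter> Bij (carrier A)"

definition AlgAut :: "(complex, 'a, 'x) module_scheme \<Rightarrow> ('a \<Rightarrow> 'a) monoid" where
  "AlgAut A = BijGroup (carrier A) \<lparr>carrier := alg_auto A\<rparr>"

definition alg_characters :: "(complex, 'a, 'x) module_scheme \<Rightarrow> ('a \<Rightarrow> complex) set" where
  "alg_characters A =
     {\<xi> \<in> alg_hom A (scalars :: (complex, complex) tvs). \<exists>x\<in>carrier A. \<xi> x \<noteq> 0}"

definition alg_center :: "(complex, 'a, 'x) module_scheme \<Rightarrow> 'a set" where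
  "alg_center A = {z \<in> carrier A. \<forall>x\<in>carrier A. z \<otimes>\<^bsub>A\<^esub> x = x \<otimes>\<^bsub>A\<^esub> z}"


section \<open>Smooth maps between locally convex spaces\<close>

definition real_tvs :: "(complex, 'a) tvs \<Rightarrow> (real, 'a) tvs" where
  "real_tvs A = \<lparr>carrier = carrier A, mult = mult A, one = \<one>\<^bsub>A\<^esub>, ring.zero = \<zero>\<^bsub>A\<^esub>, add = add A,
    smult = (\<lambda>r. smult A (complex_of_real r)), topo = topo A\<rparr>"

definition prod_tvs :: "(real, 'v) tvs \<Rightarrow> (real, 'w) tvs \<Rightarrow> (real, 'v \<times> 'w) tvs" where
  "prod_tvs V W = \<lparr>carrier = carrier V \<times> carrier W,
    mult = (\<lambda>(x, y) (x', y'). (x \<otimes>\<^bsub>V\<^esub> x', y \<otimes>\<^bsub>W\<^esub> y')), one = (\<one>\<^bsub>V\<^esub>, \<one>\<^bsub>W\<^esub>),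
    ring.zero = (\<zero>\<^bsub>V\<^esub>, \<zero>\<^bsub>W\<^esub>), add = (\<lambda>(x, y) (x', y'). (x \<oplus>\<^bsub>V\<^esub> x', y \<oplus>\<^bsub>W\<^esub> y')),
    smult = (\<lambda>r (x, y). (r \<odot>\<^bsub>V\<^esub> x, r \<odot>\<^bsub>W\<^esub> y)),
    topo = prod_topology (topo V) (topo W)\<rparr>"

definition Rn :: "nat \<Rightarrow> (real, nat \<Rightarrow> real) tvs" where
  "Rn n = \<lparr>carrier = {x. \<forall>i\<ge>n. x i = 0}, mult = (\<lambda>x y i. x i * y i),
    one = (\<lambda>i. if i < n then 1 else 0), ring.zero = (\<lambda>i. 0), add = (\<lambda>x y i. x i + y i),
    smult = (\<lambda>r x i. r * x i), topo = Euclidean_space n\<rparr>"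

definition diff_quot ::
  "(real, 'v) tvs \<Rightarrow> (real, 'w) tvs \<Rightarrow> ('v \<Rightarrow> 'w) \<Rightarrow> 'v \<Rightarrow> 'v \<Rightarrow> real \<Rightarrow> 'w" where
  "diff_quot E F f x v t = (1 / t) \<odot>\<^bsub>F\<^esub> (f (x \<oplus>\<^bsub>E\<^esub> (t \<odot>\<^bsub>E\<^esub> v)) \<ominus>\<^bsub>F\<^esub> f x)"

text \<open>\<open>dder E F f k x v\<close> is the iterated directional derivative
  $d^k f(x; v_0, \dots, v_{k-1})$; only the first \<open>k\<close> entries of \<open>v\<close> matter.\<close>

primrec dder ::
  "(real, 'v) tvs \<Rightarrow> (real, 'w) tvs \<Rightarrow> ('v \<Rightarrow> 'w) \<Rightarrow> nat \<Rightarrow> 'v \<Rightarrow> (nat \<Rightarrow> 'v) \<Rightarrow> 'w" where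
  "dder E F f 0 x v = f x"
| "dder E F f (Suc k) x v =
     (THE l. limitin (topo F) (diff_quot E F (\<lambda>y. dder E F f k y v) x (v k)) l (at 0))"

definition jet_topology :: "(real, 'v) tvs \<Rightarrow> 'v set \<Rightarrow> nat \<Rightarrow> ('v \<times> (nat \<Rightarrow> 'v)) topology" where
  "jet_topology E U k =
     prod_topology (subtopology (topo E) U) (product_topology (\<lambda>_. topo E) {..<k})"

text \<open>Smoothness in the sense of Michal and Bastiani: all iterated directional derivatives
  exist and are jointly continuous as maps on $U \times E^k$.\<close>

definition smooth_on :: "(real, 'v) tvs \<Rightarrow> (real, 'w) tvs \<Rightarrow> 'v set \<Rightarrow> ('v \<Rightarrow> 'w) \<Rightarrow> bool" where
  "smooth_on E F U f \<longleftrightarrow>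
     openin (topo E) U \<and>
     (\<forall>k. continuous_map (jet_topology E U k) (topo F) (\<lambda>(x, v). dder E F f k x v)) \<and>
     (\<forall>k. \<forall>x\<in>U. \<forall>v \<in> {..<Suc k} \<rightarrow>\<^sub>E carrier E.
        \<exists>l. limitin (topo F) (diff_quot E F (\<lambda>y. dder E F f k y v) x (v k)) l (at 0))"

text \<open>\<open>f\<close> lies in the basic neighbourhood of \<open>h\<close>, for the topology of uniform convergence of the
  \<open>k\<close>-th derivative on compact sets, given by the compact set \<open>K\<close> and the zero neighbourhood \<open>W\<close>.\<close>

definition dclose ::
  "(real, 'v) tvs \<Rightarrow> (real, 'w) tvs \<Rightarrow> nat \<Rightarrow> ('v \<times> (nat \<Rightarrow> 'v)) set \<Rightarrow> 'w set
    \<Rightarrow> ('v \<Rightarrow> 'w) \<Rightarrow> ('v \<Rightarrow> 'w) \<Rightarrow> bool" where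
  "dclose E F k K W f h \<longleftrightarrow> (\<forall>(x, v)\<in>K. dder E F f k x v \<ominus>\<^bsub>F\<^esub> dder E F h k x v \<in> W)"


section \<open>Smooth manifolds modelled on locally convex spaces\<close>

record ('m, 'v) manifold =
  mtopo :: "'m topology"
  model :: "(real, 'v) tvs"
  atlas :: "('m set \<times> ('m \<Rightarrow> 'v)) set"

definition smooth_manifold :: "('m, 'v) manifold \<Rightarrow> bool" where
  "smooth_manifold X \<longleftrightarrow>
     Hausdorff_space (mtopo X) \<and> lc_space (model X) \<and>
     \<Union> (fst ` atlas X) = topspace (mtopo X) \<and>
     (\<forall>(U, \<phi>)\<in>atlas X.
        openin (mtopo X) U \<and> openin (topo (model X)) (\<phi> ` U) \<and>
        homeomorphic_map (subtopology (mtopo X) U) (subtopology (topo (model X)) (\<phi> ` U)) \<phi>) \<and>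
     (\<forall>(U, \<phi>)\<in>atlas X. \<forall>(V, \<psi>)\<in>atlas X.
        smooth_on (model X) (model X) (\<phi> ` (U \<inter> V)) (\<psi> \<circ> inv_into U \<phi>))"

definition paracompact_space :: "'m topology \<Rightarrow> bool" where
  "paracompact_space X \<longleftrightarrow>
     (\<forall>\<U>. (\<forall>U\<in>\<U>. openin X U) \<and> \<Union>\<U> = topspace X \<longrightarrow>
        (\<exists>\<V>. (\<forall>V\<in>\<V>. openin X V) \<and> \<Union>\<V> = topspace X \<and>
             (\<forall>V\<in>\<V>. \<exists>U\<in>\<U>. V \<subseteq> U) \<and> locally_finite_in X \<V>))"

definition findim_manifold :: "nat \<Rightarrow> ('m, nat \<Rightarrow> real) manifold \<Rightarrow> bool" where
  "findim_manifold n M \<longleftrightarrow>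
     smooth_manifold M \<and> model M = Rn n \<and>
     paracompact_space (mtopo M) \<and> second_countable (mtopo M)"

definition prod_manifold ::
  "('m, 'v) manifold \<Rightarrow> ('p, 'w) manifold \<Rightarrow> ('m \<times> 'p, 'v \<times> 'w) manifold" where
  "prod_manifold X Y = \<lparr>mtopo = prod_topology (mtopo X) (mtopo Y),
    model = prod_tvs (model X) (model Y),
    atlas = {(U \<times> V, map_prod \<phi> \<psi>) |U \<phi> V \<psi>. (U, \<phi>) \<in> atlas X \<and> (V, \<psi>) \<in> atlas Y}\<rparr>"

definition tvs_manifold :: "(real, 'v) tvs \<Rightarrow> ('v, 'v) manifold" where
  "tvs_manifold E = \<lparr>mtopo = topo E, model = E, atlas = {(carrier E, id)}\<rparr>"

definition smooth_map ::
  "('m, 'v) manifold \<Rightarrow> ('p, 'w) manifold \<Rightarrow> 'm set \<Rightarrow> ('m \<Rightarrow> 'p) \<Rightarrow> bool" where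
  "smooth_map X Y W f \<longleftrightarrow>
     openin (mtopo X) W \<and>
     continuous_map (subtopology (mtopo X) W) (mtopo Y) f \<and>
     (\<forall>(U, \<phi>)\<in>atlas X. \<forall>(V, \<psi>)\<in>atlas Y.
        smooth_on (model X) (model Y) (\<phi> ` (U \<inter> W \<inter> f -` V)) (\<psi> \<circ> f \<circ> inv_into U \<phi>))"


section \<open>Dynamical systems and noncommutative principal bundles\<close>

text \<open>The acting groups are discrete.\<close>

definition dynamical_system ::
  "(complex, 'a) tvs \<Rightarrow> ('l, 'z) monoid_scheme \<Rightarrow> ('l \<Rightarrow> 'a \<Rightarrow> 'a) \<Rightarrow> bool" where
  "dynamical_system A \<Lambda> \<alpha> \<longleftrightarrow>
     lc_algebra A \<and> group \<Lambda> \<and> \<alpha> \<in> hom \<Lambda> (AlgAut A) \<and>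
     continuous_map (prod_topology (discrete_topology (carrier \<Lambda>)) (topo A)) (topo A)
       (\<lambda>(l, a). \<alpha> l a)"

definition fixed_center ::
  "(complex, 'a) tvs \<Rightarrow> ('l, 'z) monoid_scheme \<Rightarrow> ('l \<Rightarrow> 'a \<Rightarrow> 'a) \<Rightarrow> (complex, 'a) tvs" where
  "fixed_center A \<Lambda> \<alpha> = A\<lparr>carrier := {z \<in> alg_center A. \<forall>l\<in>carrier \<Lambda>. \<alpha> l z = z}\<rparr>"

definition equivariant_auto ::
  "(complex, 'a) tvs \<Rightarrow> ('l, 'z) monoid_scheme \<Rightarrow> ('l \<Rightarrow> 'a \<Rightarrow> 'a) \<Rightarrow> ('a \<Rightarrow> 'a) set" where
  "equivariant_auto A \<Lambda> \<alpha> =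
     {\<phi> \<in> alg_auto A. \<forall>l\<in>carrier \<Lambda>. \<forall>a\<in>carrier A. \<alpha> l (\<phi> a) = \<phi> (\<alpha> l a)}"

definition circle_group :: "complex monoid" where
  "circle_group = \<lparr>carrier = {z. cmod z = 1}, mult = (*), one = 1\<rparr>"

definition isotypic ::
  "(complex, 'a) tvs \<Rightarrow> ('l, 'z) monoid_scheme \<Rightarrow> ('l \<Rightarrow> 'a \<Rightarrow> 'a) \<Rightarrow> ('l \<Rightarrow> complex) \<Rightarrow> 'a set" where
  "isotypic A \<Lambda> \<alpha> \<xi> = {a \<in> carrier A. \<forall>l\<in>carrier \<Lambda>. \<alpha> l a = \<xi> l \<odot>\<^bsub>A\<^esub> a}"

definition minimal_generators :: "('l, 'z) monoid_scheme \<Rightarrow> 'l set \<Rightarrow> bool" where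
  "minimal_generators \<Lambda> S \<longleftrightarrow>
     finite S \<and> S \<subseteq> carrier \<Lambda> \<and> generate \<Lambda> S = carrier \<Lambda> \<and>
     (\<forall>S'. finite S' \<and> S' \<subseteq> carrier \<Lambda> \<and> generate \<Lambda> S' = carrier \<Lambda> \<longrightarrow> card S \<le> card S')"

definition internal_direct_product :: "('l, 'z) monoid_scheme \<Rightarrow> 'l set \<Rightarrow> bool" where
  "internal_direct_product \<Lambda> S \<longleftrightarrow>
     (\<lambda>h. finprod \<Lambda> h S) \<in> iso (product_group S (\<lambda>s. \<Lambda>\<lparr>carrier := generate \<Lambda> {s}\<rparr>)) \<Lambda>"

definition trivial_ncp_bundle ::
  "(complex, 'a) tvs \<Rightarrow> ('l, 'z) monoid_scheme \<Rightarrow> ('l \<Rightarrow> 'a \<Rightarrow> 'a) \<Rightarrow> bool" where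
  "trivial_ncp_bundle A \<Lambda> \<alpha> \<longleftrightarrow>
     dynamical_system A \<Lambda> \<alpha> \<and>
     (\<exists>S. minimal_generators \<Lambda> S \<and> internal_direct_product \<Lambda> S \<and>
        (\<forall>s\<in>S. \<exists>\<xi> \<in> hom \<Lambda> circle_group.
           \<xi> s = exp (2 * of_real pi * \<i> / of_nat (group.ord \<Lambda> s)) \<and>
           (\<forall>t\<in>S - {s}. \<xi> t = 1) \<and>
           (\<exists>a \<in> isotypic A \<Lambda> \<alpha> \<xi> \<inter> Units A. a [^]\<^bsub>A\<^esub> group.ord \<Lambda> s = \<one>\<^bsub>A\<^esub>)))"

definition smooth_curves :: "(complex, 'a) tvs \<Rightarrow> (real \<Rightarrow> 'a) set" where
  "smooth_curves A = {f. smooth_on scalars (real_tvs A) UNIV f}"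

text \<open>$C^\infty(\mathbb{R}, A)$ with pointwise operations. Its smooth compact-open topology is the
  initial topology for the maps $f \mapsto d^k f$ into the spaces
  $C(\mathbb{R} \times \mathbb{R}^k, A)$ with the topology of uniform convergence on compact sets.\<close>

definition smooth_curve_algebra :: "(complex, 'a) tvs \<Rightarrow> (complex, real \<Rightarrow> 'a) tvs" where
  "smooth_curve_algebra A = \<lparr>carrier = smooth_curves A,
    mult = (\<lambda>f h t. f t \<otimes>\<^bsub>A\<^esub> h t), one = (\<lambda>t. \<one>\<^bsub>A\<^esub>), ring.zero = (\<lambda>t. \<zero>\<^bsub>A\<^esub>),
    add = (\<lambda>f h t. f t \<oplus>\<^bsub>A\<^esub> h t), smult = (\<lambda>c f t. c \<odot>\<^bsub>A\<^esub> f t),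
    topo = topology_generated_by (insert (smooth_curves A)
      {{f \<in> smooth_curves A. dclose scalars (real_tvs A) k K W f h} |h k K W.
         h \<in> smooth_curves A \<and> compactin (jet_topology scalars UNIV k) K \<and>
         openin (topo A) W \<and> \<zero>\<^bsub>A\<^esub> \<in> W})\<rparr>"

definition quotient_tvs :: "(complex, 'a) tvs \<Rightarrow> 'a set \<Rightarrow> (complex, 'a set) tvs" where
  "quotient_tvs B J = \<lparr>carrier = carrier (B Quot J), mult = mult (B Quot J),
    one = \<one>\<^bsub>B Quot J\<^esub>, ring.zero = \<zero>\<^bsub>B Quot J\<^esub>, add = add (B Quot J),
    smult = (\<lambda>c X. \<Union>x\<in>X. J +>\<^bsub>B\<^esub> (c \<odot>\<^bsub>B\<^esub> x)),
    topo = topology (\<lambda>S. S \<subseteq> carrier (B Quot J) \<and>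
      openin (topo B) {x \<in> topspace (topo B). J +>\<^bsub>B\<^esub> x \<in> S})\<rparr>"

definition loc_ideal :: "(complex, 'a) tvs \<Rightarrow> 'a \<Rightarrow> (real \<Rightarrow> 'a) set" where
  "loc_ideal A a = Abstract_Topology.closure_of (topo (smooth_curve_algebra A))
     (genideal (smooth_curve_algebra A) {\<lambda>t. \<one>\<^bsub>A\<^esub> \<ominus>\<^bsub>A\<^esub> (complex_of_real t \<odot>\<^bsub>A\<^esub> a)})"

definition smooth_localization :: "(complex, 'a) tvs \<Rightarrow> 'a \<Rightarrow> (complex, (real \<Rightarrow> 'a) set) tvs" where
  "smooth_localization A a = quotient_tvs (smooth_curve_algebra A) (loc_ideal A a)"

definition loc_action ::
  "(complex, 'a) tvs \<Rightarrow> ('l \<Rightarrow> 'a \<Rightarrow> 'a) \<Rightarrow> 'a \<Rightarrow> 'l \<Rightarrow> (real \<Rightarrow> 'a) set \<Rightarrow> (real \<Rightarrow> 'a) set" where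
  "loc_action A \<alpha> z l = (\<lambda>X \<in> carrier (smooth_localization A z).
     \<Union>f\<in>X. loc_ideal A z +>\<^bsub>smooth_curve_algebra A\<^esub> (\<alpha> l \<circ> f))"

definition nc_principal_bundle ::
  "(complex, 'a) tvs \<Rightarrow> ('l, 'z) monoid_scheme \<Rightarrow> ('l \<Rightarrow> 'a \<Rightarrow> 'a) \<Rightarrow> bool" where
  "nc_principal_bundle A \<Lambda> \<alpha> \<longleftrightarrow>
     dynamical_system A \<Lambda> \<alpha> \<and>
     (\<forall>\<xi> \<in> alg_characters (fixed_center A \<Lambda> \<alpha>).
        \<exists>z \<in> carrier (fixed_center A \<Lambda> \<alpha>).
          \<xi> z \<noteq> 0 \<and> trivial_ncp_bundle (smooth_localization A z) \<Lambda> (loc_action A \<alpha> z))"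


section \<open>Algebra bundles and their sections\<close>

text \<open>An algebra bundle consists of a total space \<open>T\<close>, a base \<open>M\<close>, a typical fibre \<open>A\<close>, a
  projection \<open>q\<close> and the algebra structures \<open>fib x\<close> on the fibres of \<open>q\<close>.\<close>

definition bundle_chart ::
  "('e, 'u) manifold \<Rightarrow> ('m, 'v) manifold \<Rightarrow> (complex, 'a) tvs \<Rightarrow> ('e \<Rightarrow> 'm)
    \<Rightarrow> ('m \<Rightarrow> (complex, 'e) module) \<Rightarrow> 'm set \<Rightarrow> ('m \<times> 'a \<Rightarrow> 'e) \<Rightarrow> bool" where
  "bundle_chart T M A q fib U \<phi> \<longleftrightarrow>
     openin (mtopo M) U \<and>
     bij_betw \<phi> (U \<times> carrier A) {e \<in> topspace (mtopo T). q e \<in> U} \<and>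
     smooth_map (prod_manifold M (tvs_manifold (real_tvs A))) T (U \<times> carrier A) \<phi> \<and>
     smooth_map T (prod_manifold M (tvs_manifold (real_tvs A)))
       {e \<in> topspace (mtopo T). q e \<in> U} (inv_into (U \<times> carrier A) \<phi>) \<and>
     (\<forall>x\<in>U. \<forall>a\<in>carrier A. q (\<phi> (x, a)) = x) \<and>
     (\<forall>x\<in>U. (\<lambda>a. \<phi> (x, a)) \<in> alg_iso A (fib x))"

definition algebra_bundle ::
  "('e, 'u) manifold \<Rightarrow> ('m, 'v) manifold \<Rightarrow> (complex, 'a) tvs \<Rightarrow> ('e \<Rightarrow> 'm)
    \<Rightarrow> ('m \<Rightarrow> (complex, 'e) module) \<Rightarrow> bool" where
  "algebra_bundle T M A q fib \<longleftrightarrow>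
     smooth_manifold T \<and> smooth_manifold M \<and> lc_algebra A \<and>
     smooth_map T M (topspace (mtopo T)) q \<and>
     q ` topspace (mtopo T) = topspace (mtopo M) \<and>
     (\<forall>x\<in>topspace (mtopo M).
        unital_algebra (fib x) \<and> carrier (fib x) = {e \<in> topspace (mtopo T). q e = x}) \<and>
     (\<forall>x\<in>topspace (mtopo M). \<exists>U \<phi>. x \<in> U \<and> bundle_chart T M A q fib U \<phi>)"

definition smooth_sections ::
  "('e, 'u) manifold \<Rightarrow> ('m, 'v) manifold \<Rightarrow> ('e \<Rightarrow> 'm) \<Rightarrow> ('m \<Rightarrow> 'e) set" where
  "smooth_sections T M q =
     {s \<in> extensional (topspace (mtopo M)).
        smooth_map M T (topspace (mtopo M)) s \<and> (\<forall>x\<in>topspace (mtopo M). q (s x) = x)}"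

text \<open>The representative of a section with respect to a bundle chart \<open>\<phi>\<close> over \<open>U\<close> and a chart
  \<open>\<psi>\<close> of the base with domain \<open>V\<close>; it is an \<open>A\<close>-valued function on \<open>\<psi> ` (U \<inter> V)\<close>.\<close>

definition local_rep ::
  "(complex, 'a) tvs \<Rightarrow> 'm set \<Rightarrow> ('m \<times> 'a \<Rightarrow> 'e) \<Rightarrow> 'm set \<Rightarrow> ('m \<Rightarrow> 'v)
    \<Rightarrow> ('m \<Rightarrow> 'e) \<Rightarrow> 'v \<Rightarrow> 'a" where
  "local_rep A U \<phi> V \<psi> s = (\<lambda>y. snd (inv_into (U \<times> carrier A) \<phi> (s (inv_into V \<psi> y))))"

definition section_algebra ::
  "('e, 'u) manifold \<Rightarrow> ('m, 'v) manifold \<Rightarrow> (complex, 'a) tvs \<Rightarrow> ('e \<Rightarrow> 'm)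
    \<Rightarrow> ('m \<Rightarrow> (complex, 'e) module) \<Rightarrow> (complex, 'm \<Rightarrow> 'e) tvs" where
  "section_algebra T M A q fib = \<lparr>carrier = smooth_sections T M q,
    mult = (\<lambda>s r. \<lambda>x\<in>topspace (mtopo M). s x \<otimes>\<^bsub>fib x\<^esub> r x),
    one = (\<lambda>x\<in>topspace (mtopo M). \<one>\<^bsub>fib x\<^esub>),
    ring.zero = (\<lambda>x\<in>topspace (mtopo M). \<zero>\<^bsub>fib x\<^esub>),
    add = (\<lambda>s r. \<lambda>x\<in>topspace (mtopo M). s x \<oplus>\<^bsub>fib x\<^esub> r x),
    smult = (\<lambda>c s. \<lambda>x\<in>topspace (mtopo M). c \<odot>\<^bsub>fib x\<^esub> s x),
    topo = topology_generated_by (insert (smooth_sections T M q)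
      {{s \<in> smooth_sections T M q.
          dclose (model M) (real_tvs A) k K W (local_rep A U \<phi> V \<psi> s) (local_rep A U \<phi> V \<psi> r)}
        |r U \<phi> V \<psi> k K W.
         r \<in> smooth_sections T M q \<and> bundle_chart T M A q fib U \<phi> \<and> (V, \<psi>) \<in> atlas M \<and>
         compactin (jet_topology (model M) (\<psi> ` (U \<inter> V)) k) K \<and>
         openin (topo A) W \<and> \<zero>\<^bsub>A\<^esub> \<in> W})\<rparr>"

definition section_action ::
  "('e, 'u) manifold \<Rightarrow> ('m, 'v) manifold \<Rightarrow> ('e \<Rightarrow> 'm) \<Rightarrow> ('l \<Rightarrow> 'e \<Rightarrow> 'e)
    \<Rightarrow> 'l \<Rightarrow> ('m \<Rightarrow> 'e) \<Rightarrow> ('m \<Rightarrow> 'e)" where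
  "section_action T M q \<sigma> l =
     (\<lambda>s \<in> smooth_sections T M q. \<lambda>m \<in> topspace (mtopo M). \<sigma> l (s m))"

end

theory Submission
  imports Defs
begin

text \<open>
  The total space is glued from the sets \<open>U\<^sub>i \<times> A\<close>. A section is given by \<open>A\<close>-valued functions on
  the \<open>U\<^sub>i\<close>; for these only the chain rule for maps that are linear in the fibre is needed. All
  derivatives are taken jointly continuous in an additional parameter. Since evaluation of
  functions on a locally compact space is jointly continuous, and since a jointly continuous family
  of functions is continuous in the topology of compact convergence, this one calculus also yields
  the continuity of all algebra operations on section algebras and on algebras of smooth curves.

  If \<open>z\<close> is a real function times the unit section and \<open>p\<close> is a cut-off function with \<open>p z = z\<close>
  that is supported in \<open>U\<^sub>i\<close>, then \<open>1 - p = (1 - p) (1 - t z)\<close> lies in the ideal defining the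
  localization at \<open>z\<close>. Hence the sections \<open>p a\<^sub>s\<close>, formed in the chart over \<open>U\<^sub>i\<close> from the
  invertible elements \<open>a\<^sub>s\<close> that trivialize \<open>A\<close>, trivialize the localization.

  It remains to see that a character \<open>\<xi>\<close> of the fixed centre, continuous or not, cannot vanish on all
  such \<open>z\<close>. Choose countably many cut-off functions \<open>0 \<le> e\<^sub>k \<le> 1\<close> such that the interiors of the
  sets \<open>{e\<^sub>k = 1}\<close> cover \<open>M\<close>, and let \<open>f = \<Sum>\<^sub>k \<Prod>\<^sub>j\<^sub>\<le>\<^sub>k (1 - e\<^sub>j)\<close>, a locally finite sum. If \<open>\<xi>\<close>
  vanishes on all \<open>e\<^sub>k\<close>, put \<open>c = \<xi>(f)\<close> and take \<open>N > |c|\<close>. The function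
  \<open>u = |f - c|\<^sup>2 + e\<^sub>0 + \<dots> + e\<^bsub>N-1\<^esub>\<close> is positive, because \<open>f \<ge> N\<close> where \<open>e\<^sub>0, \<dots>, e\<^bsub>N-1\<^esub>\<close> vanish;
  thus it is invertible, although \<open>\<xi>(u) = 0\<close>.
\<close>

text \<open>The obstacle that shapes the calculus is the chain rule between general locally convex
  spaces. Everything is arranged so that only three kinds of composites occur: substitution of
  affine maps, maps that are linear in a fibre variable, and real functions of one variable applied
  to real-valued maps. For this reason the fibre \<open>A\<close> enters the analysis of sections as
  a space of continuous parameters. The predicate \<open>Ck\<close> only asserts that suitable
  derivatives exist, so product rules can name them freely; uniqueness of limits leads back to
  \<open>dder\<close>.

  The two functions in the argument about characters have simple origins. The function
  \<open>f\<close> is a substitute for an exhaustion function: it is large wherever the first few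
  cut-offs vanish. Its value \<open>c\<close> under the character may a priori be complex, while the
  central elements at hand are real multiples of the unit section; therefore \<open>f - c\<close> is
  replaced by its squared modulus, a real polynomial in \<open>f\<close> with root
  \<open>c\<close>.\<close>

lemma scalars_simps [simp]:
  "carrier scalars = UNIV" "mult scalars = (*)" "one scalars = 1" "ring.zero scalars = 0"
  "add scalars = (+)" "smult scalars = (*)" "topo scalars = euclidean"
  by (simp_all add: scalars_def)

lemma cring_scalars: "cring (scalars :: ('k::real_normed_field, 'k) tvs)"
proof (rule cringI)
  show "abelian_group (scalars :: ('k, 'k) tvs)"
  proof (rule abelian_groupI)
    fix x :: 'k
    show "\<exists>y\<in>carrier scalars. y \<oplus>\<^bsub>scalars\<^esub> x = \<zero>\<^bsub>scalars\<^esub>"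
      by (rule bexI[of _ "- x"]) auto
  qed (auto simp: algebra_simps)
  show "Group.comm_monoid (scalars :: ('k, 'k) tvs)"
    by (rule comm_monoidI) auto
qed (auto simp: algebra_simps)

lemma module_scalarsI:
  assumes "abelian_group V"
    and "\<And>c x. x \<in> carrier V \<Longrightarrow> c \<odot>\<^bsub>V\<^esub> x \<in> carrier V"
    and "\<And>a b x. x \<in> carrier V \<Longrightarrow> (a + b) \<odot>\<^bsub>V\<^esub> x = a \<odot>\<^bsub>V\<^esub> x \<oplus>\<^bsub>V\<^esub> b \<odot>\<^bsub>V\<^esub> x"
    and "\<And>a x y. x \<in> carrier V \<Longrightarrow> y \<in> carrier V \<Longrightarrow>
           a \<odot>\<^bsub>V\<^esub> (x \<oplus>\<^bsub>V\<^esub> y) = a \<odot>\<^bsub>V\<^esub> x \<oplus>\<^bsub>V\<^esub> a \<odot>\<^bsub>V\<^esub> y"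
    and "\<And>a b x. x \<in> carrier V \<Longrightarrow> (a * b) \<odot>\<^bsub>V\<^esub> x = a \<odot>\<^bsub>V\<^esub> (b \<odot>\<^bsub>V\<^esub> x)"
    and "\<And>x. x \<in> carrier V \<Longrightarrow> 1 \<odot>\<^bsub>V\<^esub> x = x"
  shows "Module.module (scalars :: ('k::real_normed_field, 'k) tvs) V"
  by (rule moduleI[OF cring_scalars assms(1)]) (use assms in auto)

lemma module_scalarsD:
  assumes "Module.module (scalars :: ('k::real_normed_field, 'k) tvs) V"
  shows "abelian_group V"
    and "\<And>c x. x \<in> carrier V \<Longrightarrow> c \<odot>\<^bsub>V\<^esub> x \<in> carrier V"
    and "\<And>a b x. x \<in> carrier V \<Longrightarrow> (a + b) \<odot>\<^bsub>V\<^esub> x = a \<odot>\<^bsub>V\<^esub> x \<oplus>\<^bsub>V\<^esub> b \<odot>\<^bsub>V\<^esub> x"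
    and "\<And>a x y. x \<in> carrier V \<Longrightarrow> y \<in> carrier V \<Longrightarrow>
           a \<odot>\<^bsub>V\<^esub> (x \<oplus>\<^bsub>V\<^esub> y) = a \<odot>\<^bsub>V\<^esub> x \<oplus>\<^bsub>V\<^esub> a \<odot>\<^bsub>V\<^esub> y"
    and "\<And>a b x. x \<in> carrier V \<Longrightarrow> (a * b) \<odot>\<^bsub>V\<^esub> x = a \<odot>\<^bsub>V\<^esub> (b \<odot>\<^bsub>V\<^esub> x)"
    and "\<And>x. x \<in> carrier V \<Longrightarrow> 1 \<odot>\<^bsub>V\<^esub> x = x"
    and "\<And>x. x \<in> carrier V \<Longrightarrow> 0 \<odot>\<^bsub>V\<^esub> x = \<zero>\<^bsub>V\<^esub>"
    and "\<And>a. a \<odot>\<^bsub>V\<^esub> \<zero>\<^bsub>V\<^esub> = \<zero>\<^bsub>V\<^esub>"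
    and "\<And>a x. x \<in> carrier V \<Longrightarrow> a \<odot>\<^bsub>V\<^esub> (\<ominus>\<^bsub>V\<^esub> x) = \<ominus>\<^bsub>V\<^esub> (a \<odot>\<^bsub>V\<^esub> x)"
  using Module.module.smult_closed[OF assms] Module.module.smult_l_distr[OF assms]
    Module.module.smult_r_distr[OF assms] Module.module.smult_assoc1[OF assms]
    Module.module.smult_one[OF assms] Module.module.smult_l_null[OF assms]
    Module.module.smult_r_null[OF assms] Module.module.smult_r_minus[OF assms]
    Module.module.axioms(2)[OF assms]
  by auto

lemma continuous_map_real_fun:
  assumes "continuous_map X euclidean f" "continuous_on UNIV h"
  shows "continuous_map X euclidean (\<lambda>x. h (f x))"
  using continuous_map_compose[OF assms(1), of euclidean h] assms(2) by (simp add: o_def)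

section \<open>Locally convex spaces over a normed field: continuity, limits and neighbourhoods of
  zero\<close>

locale lcs =
  fixes V :: "('k::real_normed_field, 'v) tvs" (structure)
  assumes lc: "lc_space V"
begin

lemma mod: "Module.module (scalars :: ('k, 'k) tvs) V"
  using lc by (simp add: lc_space_def)

sublocale abelian_group V
  using module_scalarsD(1)[OF mod] .

lemmas smult_closed [simp, intro] = module_scalarsD(2)[OF mod]
lemmas smult_ldistr = module_scalarsD(3)[OF mod]
lemmas smult_rdistr = module_scalarsD(4)[OF mod]
lemmas smult_assoc = module_scalarsD(5)[OF mod]
lemmas smult_one [simp] = module_scalarsD(6)[OF mod]
lemmas smult_zero_left [simp] = module_scalarsD(7)[OF mod]
lemmas smult_zero_right [simp] = module_scalarsD(8)[OF mod]
lemmas smult_neg = module_scalarsD(9)[OF mod]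

lemma smult_minus:
  "x \<in> carrier V \<Longrightarrow> y \<in> carrier V \<Longrightarrow> c \<odot> (x \<ominus> y) = c \<odot> x \<ominus> c \<odot> y"
  by (simp add: a_minus_def smult_rdistr smult_neg)

text \<open>Turns negation into a scalar multiple. Continuity of negation and the compatibility of
  additive homogeneous maps with differences both come from this.\<close>

lemma smult_uminus_one: "x \<in> carrier V \<Longrightarrow> (- 1) \<odot> x = \<ominus> x"
proof -
  assume x: "x \<in> carrier V"
  have "(- 1) \<odot> x \<oplus> x = ((- 1) + 1) \<odot> x"
    using x smult_ldistr[of x "- 1" 1] by simp
  then show ?thesis
    using x by (simp add: minus_equality)
qed

lemma topspace [simp]: "topspace (topo V) = carrier V"
  using lc by (simp add: lc_space_def)

lemma hausdorff: "Hausdorff_space (topo V)"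
  using lc by (simp add: lc_space_def)

lemma cont_add0: "continuous_map (prod_topology (topo V) (topo V)) (topo V) (\<lambda>(x, y). x \<oplus> y)"
  using lc by (simp add: lc_space_def)

lemma cont_smult0: "continuous_map (prod_topology euclidean (topo V)) (topo V) (\<lambda>(c, x). c \<odot> x)"
  using lc by (simp add: lc_space_def)

lemma convex_nbhd:
  "openin (topo V) W \<Longrightarrow> \<zero> \<in> W \<Longrightarrow>
     \<exists>C. openin (topo V) C \<and> \<zero> \<in> C \<and> C \<subseteq> W \<and>
          (\<forall>x\<in>C. \<forall>y\<in>C. \<forall>t\<in>{0..1}. (of_real t \<odot> x) \<oplus> (of_real (1 - t) \<odot> y) \<in> C)"
  using lc by (simp add: lc_space_def)

lemma cont_carrier: "continuous_map X (topo V) f \<Longrightarrow> x \<in> topspace X \<Longrightarrow> f x \<in> carrier V"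
  using continuous_map_image_subset_topspace by fastforce

lemma cont_add:
  assumes "continuous_map X (topo V) f" "continuous_map X (topo V) g"
  shows "continuous_map X (topo V) (\<lambda>x. f x \<oplus> g x)"
  using continuous_map_compose[OF continuous_map_pairedI[OF assms] cont_add0] by (simp add: o_def)

lemma cont_smult:
  assumes "continuous_map X euclidean c" "continuous_map X (topo V) g"
  shows "continuous_map X (topo V) (\<lambda>x. c x \<odot> g x)"
  using continuous_map_compose[OF continuous_map_pairedI[OF assms] cont_smult0] by (simp add: o_def)

lemma cont_neg:
  assumes "continuous_map X (topo V) f"
  shows "continuous_map X (topo V) (\<lambda>x. \<ominus> f x)"
  by (rule continuous_map_eq[OF cont_smult[of X "\<lambda>_. - 1" f]])
    (use assms in \<open>auto simp: smult_uminus_one cont_carrier\<close>)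

lemma cont_minus:
  assumes "continuous_map X (topo V) f" "continuous_map X (topo V) g"
  shows "continuous_map X (topo V) (\<lambda>x. f x \<ominus> g x)"
  unfolding a_minus_def by (intro cont_add cont_neg assms)

lemma lim_carrier: "limitin (topo V) f l G \<Longrightarrow> l \<in> carrier V"
  by (simp add: limitin_def)

end

lemma limitin_compose:
  assumes "continuous_map X Y g" and "limitin X f l F"
  shows "limitin Y (\<lambda>x. g (f x)) (g l) F"
  using continuous_map_limit[OF assms] by (simp add: o_def)

lemma limitin_pairI:
  assumes "limitin X f l F" "limitin Y g m F"
  shows "limitin (prod_topology X Y) (\<lambda>x. (f x, g x)) (l, m) F"
  using assms by (simp add: limitin_pairwise o_def)

context lcs begin

lemma lim_add:
  assumes "limitin (topo V) f l G" "limitin (topo V) g m G"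
  shows "limitin (topo V) (\<lambda>x. f x \<oplus> g x) (l \<oplus> m) G"
  using limitin_compose[OF cont_add0 limitin_pairI[OF assms]] by simp

lemma lim_smult:
  assumes "(c \<longlongrightarrow> d) G" "limitin (topo V) g m G"
  shows "limitin (topo V) (\<lambda>x. c x \<odot> g x) (d \<odot> m) G"
  using limitin_compose[OF cont_smult0 limitin_pairI[of euclidean c d G]] assms by simp

lemma lim_unique:
  assumes "limitin (topo V) f l G" "limitin (topo V) f m G" "G \<noteq> bot"
  shows "l = m"
  using limitin_Hausdorff_unique[OF assms(1,2)] assms(3) hausdorff by auto

text \<open>Wallace's theorem (the tube lemma) for addition, applied to the compact set of pairs of
  zero and a point of \<open>K\<close>. It provides one zero neighbourhood for all points of
  \<open>K\<close> at once, in place of a uniform structure or seminorms.\<close>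

lemma compact_add_nbhd:
  assumes K: "compactin (topo V) K" and W: "openin (topo V) W" "K \<subseteq> W"
  shows "\<exists>C. openin (topo V) C \<and> \<zero> \<in> C \<and> (\<forall>x\<in>K. \<forall>y\<in>C. y \<oplus> x \<in> W)"
proof -
  let ?P = "prod_topology (topo V) (topo V)"
  let ?W = "{z \<in> topspace ?P. (case z of (x, y) \<Rightarrow> x \<oplus> y) \<in> W}"
  have o: "openin ?P ?W"
    using cont_add0 W(1) by (rule openin_continuous_map_preimage)
  have Kc: "K \<subseteq> carrier V"
    using compactin_subset_topspace[OF K] by simp
  have "{\<zero>} \<times> K \<subseteq> ?W"
    using W(2) Kc by (auto simp: subsetD)
  then obtain C D where "openin (topo V) C" "openin (topo V) D" "{\<zero>} \<subseteq> C" "K \<subseteq> D" "C \<times> D \<subseteq> ?W"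
    using Wallace_theorem_prod_topology[of "topo V" "{\<zero>}" "topo V" K ?W] K o
    by (auto simp: compactin_sing)
  note CD = this
  have "y \<oplus> x \<in> W" if "x \<in> K" "y \<in> C" for x y
  proof -
    have "(y, x) \<in> ?W" using CD that by blast
    then show ?thesis by simp
  qed
  then show ?thesis
    using CD by (intro exI[of _ C]) auto
qed

end

section \<open>Examples of locally convex spaces\<close>

lemma lcs_scalars: "lcs (scalars :: ('k::real_normed_field, 'k) tvs)"
proof
  have conv: "\<exists>C. open C \<and> 0 \<in> C \<and> C \<subseteq> W \<and>
     (\<forall>x\<in>C. \<forall>y\<in>C. \<forall>t\<in>{0..1}. (of_real t * x) + (of_real (1 - t) * y) \<in> C)"
    if "open W" "0 \<in> W" for W :: "'k set"
  proof -
    obtain e where e: "e > 0" "ball 0 e \<subseteq> W"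
      using openE[OF \<open>open W\<close> \<open>0 \<in> W\<close>] by metis
    have "of_real t * x + of_real (1 - t) * y \<in> ball 0 e"
      if "x \<in> ball 0 e" "y \<in> ball 0 e" "t \<in> {0..1}" for x y :: "'k" and t :: real
      using convexD[OF convex_ball, of x 0 e y t "1 - t"] that by (simp add: scaleR_conv_of_real)
    then show ?thesis using e by (intro exI[of _ "ball 0 e"]) auto
  qed
  show "lc_space (scalars :: ('k, 'k) tvs)"
    unfolding lc_space_def
  proof (intro conjI)
    have "abelian_group (scalars :: ('k, 'k) tvs)"
      using cring_scalars cring.axioms(1) ring.is_abelian_group by blast
    then show "Module.module (scalars :: ('k, 'k) tvs) (scalars :: ('k, 'k) tvs)"
      by (rule module_scalarsI) (simp_all add: distrib_left distrib_right mult.assoc)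
    show "continuous_map (prod_topology (topo scalars) (topo scalars)) (topo scalars)
       (\<lambda>(x, y). x \<oplus>\<^bsub>scalars\<^esub> (y :: 'k))"
      by (simp add: case_prod_unfold) (intro continuous_intros)
    show "continuous_map (prod_topology euclidean (topo scalars)) (topo scalars)
       (\<lambda>(x, y). x \<odot>\<^bsub>scalars\<^esub> (y :: 'k))"
      by (simp add: case_prod_unfold) (intro continuous_intros)
  qed (use conv in \<open>simp_all add: Hausdorff_space_euclidean\<close>)
qed

lemma real_tvs_simps [simp]:
  "carrier (real_tvs A) = carrier A" "mult (real_tvs A) = mult A" "one (real_tvs A) = one A"
  "ring.zero (real_tvs A) = ring.zero A" "add (real_tvs A) = add A"
  "smult (real_tvs A) = (\<lambda>r. smult A (complex_of_real r))" "topo (real_tvs A) = topo A"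
  by (simp_all add: real_tvs_def)

lemma a_inv_cong:
  assumes "carrier A = carrier B" "add A = add B" "ring.zero A = ring.zero B"
  shows "a_inv A = a_inv B" "a_minus A = a_minus B"
  using assms by (auto simp: a_inv_def m_inv_def a_minus_def fun_eq_iff)

lemma real_tvs_minus [simp]: "a_inv (real_tvs A) = a_inv A" "a_minus (real_tvs A) = a_minus A"
  by (rule a_inv_cong; simp)+

text \<open>Derivatives are taken in real directions, so a complex algebra enters the calculus by
  restriction of scalars.\<close>

lemma lcs_real_tvs:
  assumes "lc_space A" shows "lcs (real_tvs A)"
proof
  interpret lcs A by (rule lcs.intro[OF assms])
  show "lc_space (real_tvs A)"
    unfolding lc_space_def
  proof (intro conjI)
    show "Module.module (scalars :: (real, real) tvs) (real_tvs A)"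
    proof (rule module_scalarsI)
      show "abelian_group (real_tvs A)"
      proof (rule abelian_groupI)
        fix x assume "x \<in> carrier (real_tvs A)"
        then show "\<exists>y\<in>carrier (real_tvs A). y \<oplus>\<^bsub>real_tvs A\<^esub> x = \<zero>\<^bsub>real_tvs A\<^esub>"
          by (intro bexI[of _ "\<ominus>\<^bsub>A\<^esub> x"]) (auto simp: l_neg)
      qed (auto simp: a_ac)
    qed (auto simp: smult_ldistr smult_rdistr smult_assoc)
    show "continuous_map (prod_topology euclidean (topo (real_tvs A))) (topo (real_tvs A))
       (\<lambda>(c, x). c \<odot>\<^bsub>real_tvs A\<^esub> x)"
      unfolding case_prod_unfold real_tvs_simps
      by (intro cont_smult continuous_map_snd continuous_map_real_fun[where h=complex_of_real]
          continuous_map_fst continuous_intros)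
    show "\<forall>W. openin (topo (real_tvs A)) W \<and> \<zero>\<^bsub>real_tvs A\<^esub> \<in> W \<longrightarrow>
        (\<exists>C. openin (topo (real_tvs A)) C \<and> \<zero>\<^bsub>real_tvs A\<^esub> \<in> C \<and> C \<subseteq> W \<and>
          (\<forall>x\<in>C. \<forall>y\<in>C. \<forall>t\<in>{0..1}.
             (of_real t \<odot>\<^bsub>real_tvs A\<^esub> x) \<oplus>\<^bsub>real_tvs A\<^esub> (of_real (1 - t) \<odot>\<^bsub>real_tvs A\<^esub> y) \<in> C))"
      using convex_nbhd by simp
  qed (simp_all add: hausdorff cont_add0)
qed

text \<open>Tuples of directions are extensional because they are the points of the product topology
  in \<open>jet_topology\<close>. This is why dropping the last direction is written
  \<open>restrict v {..<m}\<close> throughout.\<close>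

abbreviation dirs :: "(real, 'v) tvs \<Rightarrow> nat \<Rightarrow> (nat \<Rightarrow> 'v) set" where
  "dirs E m \<equiv> {..<m} \<rightarrow>\<^sub>E carrier E"

abbreviation pjet :: "'s topology \<Rightarrow> (real, 'v) tvs \<Rightarrow> 'v set \<Rightarrow> nat \<Rightarrow> ('s \<times> 'v \<times> (nat \<Rightarrow> 'v)) topology" where
  "pjet S E U m \<equiv> prod_topology S (jet_topology E U m)"

section \<open>Directional derivatives\<close>

text \<open>The relational form of the derivative. It can be combined by limit rules, while
  \<open>dder\<close> is a definite description that has a meaning only once existence and
  uniqueness are known.\<close>

definition has_dder ::
  "(real, 'v) tvs \<Rightarrow> (real, 'w) tvs \<Rightarrow> ('v \<Rightarrow> 'w) \<Rightarrow> 'v \<Rightarrow> 'v \<Rightarrow> 'w \<Rightarrow> bool" where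
  "has_dder E F h x v l \<longleftrightarrow> limitin (topo F) (diff_quot E F h x v) l (at 0)"

lemma line_limit:
  assumes "lcs E" "x \<in> carrier E" "v \<in> carrier E"
  shows "limitin (topo E) (\<lambda>t. x \<oplus>\<^bsub>E\<^esub> (t \<odot>\<^bsub>E\<^esub> v)) x (at (0::real))"
proof -
  interpret lcs E by fact
  have "limitin (topo E) (\<lambda>t. x \<oplus>\<^bsub>E\<^esub> (t \<odot>\<^bsub>E\<^esub> v)) (x \<oplus>\<^bsub>E\<^esub> 0 \<odot>\<^bsub>E\<^esub> v) (at (0::real))"
    using assms by (intro lim_add lim_smult) (auto intro: tendsto_ident_at)
  then show ?thesis using assms by simp
qed

text \<open>Difference quotients at a point of an open set see only values in that set once
  \<open>t\<close> is small. Hence the eventual identities between difference quotients in the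
  proofs of the differentiation rules.\<close>

lemma line_eventually:
  assumes "lcs E" "openin (topo E) U" "x \<in> U" "v \<in> carrier E"
  shows "eventually (\<lambda>t. x \<oplus>\<^bsub>E\<^esub> (t \<odot>\<^bsub>E\<^esub> v) \<in> U) (at (0::real))"
proof -
  interpret lcs E by fact
  have "x \<in> carrier E" using openin_subset[OF assms(2)] assms(3) by auto
  from line_limit[OF assms(1) this assms(4)] show ?thesis
    using assms by (simp add: limitin_def)
qed

lemma has_dder_cong:
  assumes "lcs E" "openin (topo E) U" "x \<in> U" "v \<in> carrier E"
    and "\<And>y. y \<in> U \<Longrightarrow> h y = h' y" "has_dder E F h x v l"
  shows "has_dder E F h' x v l"
  unfolding has_dder_def
proof (rule limitin_transform_eventually)
  show "\<forall>\<^sub>F t in at 0. diff_quot E F h x v t = diff_quot E F h' x v t"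
    using line_eventually[OF assms(1-4)]
    by eventually_elim (use assms in \<open>simp add: diff_quot_def\<close>)
qed (use assms in \<open>simp add: has_dder_def\<close>)

lemma has_dder_unique:
  assumes "lcs F" "has_dder E F h x v l" "has_dder E F h x v l'"
  shows "l = l'"
  using lcs.lim_unique[OF assms(1) assms(2,3)[unfolded has_dder_def]] by simp

lemma has_dder_add:
  assumes "lcs E" "lcs F" "openin (topo E) U" "x \<in> U" "v \<in> carrier E"
    and "h ` U \<subseteq> carrier F" "h' ` U \<subseteq> carrier F"
    and "has_dder E F h x v l" "has_dder E F h' x v l'"
  shows "has_dder E F (\<lambda>y. h y \<oplus>\<^bsub>F\<^esub> h' y) x v (l \<oplus>\<^bsub>F\<^esub> l')"
proof -
  interpret F: lcs F by fact
  have ac: "a_minus F (a \<oplus>\<^bsub>F\<^esub> b) (c \<oplus>\<^bsub>F\<^esub> d) = a_minus F a c \<oplus>\<^bsub>F\<^esub> a_minus F b d"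
    if "a \<in> carrier F" "b \<in> carrier F" "c \<in> carrier F" "d \<in> carrier F" for a b c d
    using that by (simp add: a_minus_def F.minus_add F.a_ac)
  show ?thesis
    unfolding has_dder_def
  proof (rule limitin_transform_eventually)
    show "limitin (topo F) (\<lambda>t. diff_quot E F h x v t \<oplus>\<^bsub>F\<^esub> diff_quot E F h' x v t) (l \<oplus>\<^bsub>F\<^esub> l') (at 0)"
      using assms by (intro F.lim_add) (auto simp: has_dder_def)
    show "\<forall>\<^sub>F t in at 0. diff_quot E F h x v t \<oplus>\<^bsub>F\<^esub> diff_quot E F h' x v t =
        diff_quot E F (\<lambda>y. h y \<oplus>\<^bsub>F\<^esub> h' y) x v t"
      using line_eventually[OF assms(1,3-5)]
    proof eventually_elim
      case (elim t)
      then have c: "h (x \<oplus>\<^bsub>E\<^esub> t \<odot>\<^bsub>E\<^esub> v) \<in> carrier F" "h' (x \<oplus>\<^bsub>E\<^esub> t \<odot>\<^bsub>E\<^esub> v) \<in> carrier F"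
        "h x \<in> carrier F" "h' x \<in> carrier F" using assms by auto
      then show ?case by (simp add: diff_quot_def F.smult_rdistr ac)
    qed
  qed
qed

text \<open>A linear map commutes with the formation of difference quotients, and its continuity
  carries the limit over.\<close>

lemma has_dder_linear:
  assumes "lcs E" "lcs F" "lcs G" "openin (topo E) U" "x \<in> U" "v \<in> carrier E" "h ` U \<subseteq> carrier F"
    and L: "continuous_map (topo F) (topo G) L"
    "\<And>a b. a \<in> carrier F \<Longrightarrow> b \<in> carrier F \<Longrightarrow> L (a \<oplus>\<^bsub>F\<^esub> b) = L a \<oplus>\<^bsub>G\<^esub> L b"
    "\<And>c a. a \<in> carrier F \<Longrightarrow> L (c \<odot>\<^bsub>F\<^esub> a) = c \<odot>\<^bsub>G\<^esub> L a"
    and "has_dder E F h x v l"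
  shows "has_dder E G (\<lambda>y. L (h y)) x v (L l)"
proof -
  interpret F: lcs F by fact
  interpret G: lcs G by fact
  have Lc: "L a \<in> carrier G" if "a \<in> carrier F" for a
    using G.cont_carrier[OF L(1)] that by simp
  have Lm: "L (a_minus F a b) = a_minus G (L a) (L b)" if "a \<in> carrier F" "b \<in> carrier F" for a b
    using that L by (simp add: a_minus_def F.smult_uminus_one[symmetric] G.smult_uminus_one[symmetric] Lc)
  show ?thesis
    unfolding has_dder_def
  proof (rule limitin_transform_eventually)
    show "limitin (topo G) (\<lambda>t. L (diff_quot E F h x v t)) (L l) (at 0)"
      using assms by (intro limitin_compose[OF L(1)]) (auto simp: has_dder_def)
    show "\<forall>\<^sub>F t in at 0. L (diff_quot E F h x v t) = diff_quot E G (\<lambda>y. L (h y)) x v t"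
      using line_eventually[OF assms(1,4-6)]
    proof eventually_elim
      case (elim t)
      then have c: "h (x \<oplus>\<^bsub>E\<^esub> t \<odot>\<^bsub>E\<^esub> v) \<in> carrier F" "h x \<in> carrier F"
        using assms by auto
      then show ?case by (simp add: diff_quot_def L Lm)
    qed
  qed
qed

text \<open>The chain rule for \<open>y \<mapsto> H (h y) y\<close> with \<open>H\<close> linear in its first argument: no mean value
  theorem is needed.\<close>

lemma has_dder_fibre_linear:
  assumes E: "lcs E" and F: "lcs F" and G: "lcs G" and U: "openin (topo E) U" "x \<in> U" "v \<in> carrier E"
    and h: "h ` U \<subseteq> carrier F" "has_dder E F h x v l"
    and Hc: "continuous_map (prod_topology (topo F) (subtopology (topo E) U)) (topo G) (\<lambda>(a, y). H a y)"
    and Hadd: "\<And>a b y. a \<in> carrier F \<Longrightarrow> b \<in> carrier F \<Longrightarrow> y \<in> U \<Longrightarrow> H (a \<oplus>\<^bsub>F\<^esub> b) y = H a y \<oplus>\<^bsub>G\<^esub> H b y"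
    and Hsm: "\<And>c a y. a \<in> carrier F \<Longrightarrow> y \<in> U \<Longrightarrow> H (c \<odot>\<^bsub>F\<^esub> a) y = c \<odot>\<^bsub>G\<^esub> H a y"
    and Hd: "has_dder E G (\<lambda>y. H (h x) y) x v m"
  shows "has_dder E G (\<lambda>y. H (h y) y) x v (m \<oplus>\<^bsub>G\<^esub> H l x)"
proof -
  interpret E: lcs E by fact
  interpret F: lcs F by fact
  interpret G: lcs G by fact
  have UE: "U \<subseteq> carrier E" using openin_subset[OF U(1)] by simp
  have Hcar: "H a y \<in> carrier G" if "a \<in> carrier F" "y \<in> U" for a y
    using G.cont_carrier[OF Hc, of "(a, y)"] that UE by auto
  have Hm: "H (a_minus F a b) y = a_minus G (H a y) (H b y)" if "a \<in> carrier F" "b \<in> carrier F" "y \<in> U" for a b y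
    using that by (simp add: a_minus_def Hadd F.smult_uminus_one[symmetric] G.smult_uminus_one[symmetric] Hcar Hsm)
  have lineU: "limitin (subtopology (topo E) U) (\<lambda>t. x \<oplus>\<^bsub>E\<^esub> t \<odot>\<^bsub>E\<^esub> v) x (at (0::real))"
    using line_limit[OF E _ U(3)] line_eventually[OF E U] U UE by (auto simp: limitin_subtopology)
  have "limitin (topo G) (\<lambda>t. (\<lambda>(a, y). H a y) (diff_quot E F h x v t, x \<oplus>\<^bsub>E\<^esub> t \<odot>\<^bsub>E\<^esub> v)) ((\<lambda>(a, y). H a y) (l, x)) (at 0)"
    by (rule limitin_compose[OF Hc limitin_pairI[OF _ lineU]]) (use h in \<open>simp add: has_dder_def\<close>)
  \<comment> \<open>The quotient of \<open>H (h y) y\<close> splits into the quotient with the first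
    argument frozen at \<open>h x\<close> and, by linearity, \<open>H\<close> applied to the
    quotient of \<open>h\<close> at the moving point. The second summand converges by joint
    continuity of \<open>H\<close>.\<close>
  then have 1: "limitin (topo G) (\<lambda>t. diff_quot E G (\<lambda>y. H (h x) y) x v t \<oplus>\<^bsub>G\<^esub> H (diff_quot E F h x v t) (x \<oplus>\<^bsub>E\<^esub> t \<odot>\<^bsub>E\<^esub> v)) (m \<oplus>\<^bsub>G\<^esub> H l x) (at 0)"
    using Hd by (intro G.lim_add) (auto simp: has_dder_def)
  show ?thesis unfolding has_dder_def
  proof (rule limitin_transform_eventually[OF _ 1])
    show "\<forall>\<^sub>F t in at 0. diff_quot E G (\<lambda>y. H (h x) y) x v t \<oplus>\<^bsub>G\<^esub> H (diff_quot E F h x v t) (x \<oplus>\<^bsub>E\<^esub> t \<odot>\<^bsub>E\<^esub> v) =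
       diff_quot E G (\<lambda>y. H (h y) y) x v t"
      using line_eventually[OF E U]
    proof eventually_elim
      case (elim t)
      let ?y = "x \<oplus>\<^bsub>E\<^esub> t \<odot>\<^bsub>E\<^esub> v"
      have c: "h ?y \<in> carrier F" "h x \<in> carrier F" using elim U h by auto
      have cc: "H (h ?y) ?y \<in> carrier G" "H (h x) ?y \<in> carrier G" "H (h x) x \<in> carrier G"
        using c elim U Hcar by auto
      have eq: "H (diff_quot E F h x v t) ?y = (1/t) \<odot>\<^bsub>G\<^esub> a_minus G (H (h ?y) ?y) (H (h x) ?y)"
        using c elim by (simp add: diff_quot_def Hsm Hm)
      have "a_minus G (H (h x) ?y) (H (h x) x) \<oplus>\<^bsub>G\<^esub> a_minus G (H (h ?y) ?y) (H (h x) ?y) = a_minus G (H (h ?y) ?y) (H (h x) x)"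
        using cc by (simp add: a_minus_def G.a_ac) (simp add: G.a_assoc[symmetric] G.r_neg)
      then show ?case unfolding eq using cc by (simp add: diff_quot_def G.smult_rdistr[symmetric])
    qed
  qed
qed

section \<open>Parametrised families of \<open>C\<^sup>k\<close> maps\<close>

text \<open>\<open>Ck S E F U k m f\<close>: the map \<open>f s x v\<close> is \<open>k\<close> times differentiable in \<open>x \<in> U\<close>, with all
  derivatives jointly continuous in \<open>x\<close>, in the parameter \<open>s\<close> and in the directions. The first \<open>m\<close>
  directions \<open>v\<close> are those of the derivatives already taken, so that \<open>v m\<close> is the next one.\<close>

primrec Ck :: "'s topology \<Rightarrow> (real, 'v) tvs \<Rightarrow> (real, 'w) tvs \<Rightarrow> 'v set \<Rightarrow> nat \<Rightarrow> nat \<Rightarrow>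
    ('s \<Rightarrow> 'v \<Rightarrow> (nat \<Rightarrow> 'v) \<Rightarrow> 'w) \<Rightarrow> bool" where
  "Ck S E F U 0 m f \<longleftrightarrow> continuous_map (pjet S E U m) (topo F)
     (\<lambda>z. f (fst z) (fst (snd z)) (snd (snd z)))"
| "Ck S E F U (Suc k) m f \<longleftrightarrow> continuous_map (pjet S E U m) (topo F)
     (\<lambda>z. f (fst z) (fst (snd z)) (snd (snd z))) \<and>
     (\<exists>f'. Ck S E F U k (Suc m) f' \<and>
       (\<forall>s\<in>topspace S. \<forall>x\<in>U. \<forall>v\<in>dirs E (Suc m).
          has_dder E F (\<lambda>y. f s y (restrict v {..<m})) x (v m) (f' s x v)))"

lemma Ck_cont: "Ck S E F U k m f \<Longrightarrow> continuous_map (pjet S E U m) (topo F)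
     (\<lambda>z. f (fst z) (fst (snd z)) (snd (snd z)))"
  by (cases k) auto

lemma topspace_jet:
  assumes "lcs E" "openin (topo E) U"
  shows "topspace (jet_topology E U m) = U \<times> (dirs E m)"
  using openin_subset[OF assms(2)] lcs.topspace[OF assms(1)]
  by (auto simp: jet_topology_def)

lemma Ck_carrier:
  assumes "lcs E" "lcs F" "openin (topo E) U" "Ck S E F U k m f" "s \<in> topspace S" "x \<in> U" "v \<in> dirs E m"
  shows "f s x v \<in> carrier F"
  using lcs.cont_carrier[OF assms(2) Ck_cont[OF assms(4)], of "(s, x, v)"] assms
  by (simp add: topspace_jet)

lemma restrict_dirs: "v \<in> {..<Suc m} \<rightarrow>\<^sub>E C \<Longrightarrow> restrict v {..<m} \<in> {..<m} \<rightarrow>\<^sub>E C"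
  by (auto simp: PiE_iff)

lemma Ck_cong:
  assumes "lcs E" "openin (topo E) U" "Ck S E F U k m f"
    and eq: "\<And>s x v. s \<in> topspace S \<Longrightarrow> x \<in> U \<Longrightarrow> v \<in> dirs E m \<Longrightarrow> f s x v = g s x v"
  shows "Ck S E F U k m g"
proof -
  have c: "continuous_map (pjet S E U m) (topo F)
     (\<lambda>z. g (fst z) (fst (snd z)) (snd (snd z)))"
    by (rule continuous_map_eq[OF Ck_cont[OF assms(3)]]) (use eq in \<open>simp add: topspace_jet[OF assms(1,2)] mem_Times_iff\<close>)
  show ?thesis
  proof (cases k)
    case (Suc k')
    then obtain f' where f': "Ck S E F U k' (Suc m) f'"
      "\<And>s x v. s\<in>topspace S \<Longrightarrow> x\<in>U \<Longrightarrow> v\<in>dirs E (Suc m) \<Longrightarrow>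
          has_dder E F (\<lambda>y. f s y (restrict v {..<m})) x (v m) (f' s x v)"
      using assms(3) by auto
    have "has_dder E F (\<lambda>y. g s y (restrict v {..<m})) x (v m) (f' s x v)"
      if "s\<in>topspace S" "x\<in>U" "v\<in>dirs E (Suc m)" for s x v
      by (rule has_dder_cong[OF assms(1,2) that(2) _ _ f'(2)[OF that]])
        (use that eq restrict_dirs[OF that(3)] in auto)
    then show ?thesis using f' c Suc by auto
  qed (use c in simp)
qed

lemma Ck_SucD: "Ck S E F U (Suc k) m f \<Longrightarrow> Ck S E F U k m f"
proof (induction k arbitrary: m f)
  case (Suc k)
  then obtain f' where f': "Ck S E F U (Suc k) (Suc m) f'"
      "\<forall>s\<in>topspace S. \<forall>x\<in>U. \<forall>v\<in>dirs E (Suc m).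
          has_dder E F (\<lambda>y. f s y (restrict v {..<m})) x (v m) (f' s x v)"
    unfolding Ck.simps(2)[of S E F U "Suc k"] by (elim conjE exE)
  show ?case
    unfolding Ck.simps(2)[of S E F U k] using Suc.IH[OF f'(1)] f'(2) Ck_cont[OF Suc.prems] by (intro conjI exI[of _ f'])
qed simp

lemma continuous_map_restrict_comp:
  assumes "\<And>i. i \<in> I \<Longrightarrow> r i \<in> J"
  shows "continuous_map (product_topology (\<lambda>_. X) J) (product_topology (\<lambda>_. X) I) (\<lambda>v. restrict (v \<circ> r) I)"
  unfolding continuous_map_componentwise
proof (intro conjI ballI)
  fix i assume i: "i \<in> I"
  have "continuous_map (product_topology (\<lambda>_. X) J) X (\<lambda>v. v (r i))"
    using assms[OF i] by (rule continuous_map_product_projection)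
  then show "continuous_map (product_topology (\<lambda>_. X) J) X (\<lambda>x. restrict (x \<circ> r) I i)"
    using i by simp
qed auto

lemma continuous_map_jet_fst: "continuous_map (pjet S E U m) (subtopology (topo E) U) (\<lambda>z. fst (snd z))"
  unfolding jet_topology_def
  by (intro continuous_map_fst_of[unfolded o_def] continuous_map_snd_of continuous_map_snd continuous_map_compose[OF continuous_map_snd continuous_map_fst, unfolded o_def])

lemma continuous_map_jet_snd: "continuous_map (pjet S E U m) (product_topology (\<lambda>_. topo E) {..<m}) (\<lambda>z. snd (snd z))"
  unfolding jet_topology_def
  by (intro continuous_map_compose[OF continuous_map_snd continuous_map_snd, unfolded o_def])

text \<open>In a product rule the factor that is not differentiated must be regarded as a map with
  one more, ignored, direction. Reindexing by \<open>r\<close> is general enough for an induction in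
  which new directions are appended behind the ignored ones.\<close>

lemma Ck_reindex:
  assumes "lcs E" "openin (topo E) U"
  shows "Ck S E F U k m f \<Longrightarrow> (\<And>i. i < m \<Longrightarrow> r i < m') \<Longrightarrow>
    Ck S E F U k m' (\<lambda>s x v. f s x (restrict (v \<circ> r) {..<m}))"
proof (induction k arbitrary: m f r m')
  case (0 m f r m')
  let ?g = "\<lambda>z. (fst z, fst (snd z), restrict (snd (snd z) \<circ> r) {..<m})"
  have "continuous_map (pjet S E U m') (pjet S E U m) ?g"
    unfolding jet_topology_def[of E U m]
    by (intro continuous_map_pairedI continuous_map_fst continuous_map_jet_fst
       continuous_map_compose[OF continuous_map_jet_snd continuous_map_restrict_comp, unfolded o_def[of _ "\<lambda>z. snd (snd z)"]])
      (use 0 in auto)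
  from continuous_map_compose[OF this Ck_cont[OF 0(1)]] show ?case
    by (simp only: Ck.simps o_def fst_conv snd_conv)
next
  case (Suc k m f r m')
  obtain f' where f': "Ck S E F U k (Suc m) f'"
      "\<And>s x v. s\<in>topspace S \<Longrightarrow> x\<in>U \<Longrightarrow> v\<in>dirs E (Suc m) \<Longrightarrow>
          has_dder E F (\<lambda>y. f s y (restrict v {..<m})) x (v m) (f' s x v)"
    using Suc.prems(1) by auto
  \<comment> \<open>The next direction of \<open>f'\<close> has number \<open>m\<close>, but in the
    longer list it stands at position \<open>m'\<close>; hence the update of
    \<open>r\<close>.\<close>
  have 1: "Ck S E F U k (Suc m') (\<lambda>s x v. f' s x (restrict (v \<circ> r(m := m')) {..<Suc m}))"
    by (rule Suc.IH[OF f'(1)]) (use Suc.prems(2) less_Suc_eq in auto)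
  have 2: "has_dder E F (\<lambda>y. f s y (restrict (restrict v {..<m'} \<circ> r) {..<m})) x (v m')
      (f' s x (restrict (v \<circ> r(m := m')) {..<Suc m}))"
    if "s\<in>topspace S" "x\<in>U" "v\<in>dirs E (Suc m')" for s x v
  proof -
    let ?w = "restrict (v \<circ> r(m := m')) {..<Suc m}"
    have w: "?w \<in> dirs E (Suc m)"
      using that(3) Suc.prems(2) by (auto simp: PiE_iff less_Suc_eq)
    have "restrict ?w {..<m} = restrict (restrict v {..<m'} \<circ> r) {..<m}" "?w m = v m'"
      using Suc.prems(2) by (auto simp: fun_eq_iff restrict_def)
    then show ?thesis using f'(2)[OF that(1,2) w] by simp
  qed
  show ?case
    unfolding Ck.simps using Ck_cont[OF Suc.IH[where r=r and m'=m', OF Ck_SucD[OF Suc.prems(1)] Suc.prems(2)]] 1 2 by blast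
qed

lemma Ck_weaken:
  assumes "lcs E" "openin (topo E) U" "Ck S E F U k m f"
  shows "Ck S E F U k (Suc m) (\<lambda>s x v. f s x (restrict v {..<m}))"
  using Ck_reindex[OF assms, of "\<lambda>i. i" "Suc m"] by (simp add: o_def)

text \<open>Serves to evaluate a family at one parameter, to add idle parameters and to project from
  a product of parameter spaces.\<close>

lemma Ck_pull:
  assumes "continuous_map S' S p"
  shows "Ck S E F U k m f \<Longrightarrow> Ck S' E F U k m (\<lambda>s. f (p s))"
proof (induction k arbitrary: m f)
  have *: "continuous_map (pjet S' E U m) (topo F) (\<lambda>z. f (p (fst z)) (fst (snd z)) (snd (snd z)))"
    if "continuous_map (pjet S E U m) (topo F) (\<lambda>z. f (fst z) (fst (snd z)) (snd (snd z)))" for m f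
  proof -
    have "continuous_map (pjet S' E U m) (pjet S E U m) (\<lambda>z. (p (fst z), snd z))"
      by (intro continuous_map_pairedI continuous_map_snd continuous_map_compose[OF continuous_map_fst assms, unfolded o_def])
    from continuous_map_compose[OF this that] show ?thesis by (simp add: o_def)
  qed
  {
    case 0
    then show ?case using * by simp
  next
    case (Suc k)
    obtain f' where f': "Ck S E F U k (Suc m) f'"
      "\<And>s x v. s\<in>topspace S \<Longrightarrow> x\<in>U \<Longrightarrow> v\<in>dirs E (Suc m) \<Longrightarrow>
          has_dder E F (\<lambda>y. f s y (restrict v {..<m})) x (v m) (f' s x v)"
      using Suc.prems(1) by auto
    have "p s \<in> topspace S" if "s \<in> topspace S'" for s
      using assms that continuous_map_image_subset_topspace by fastforce
    then show ?case using * f' Suc.IH[OF f'(1)] Suc.prems by auto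
  }
qed

text \<open>Along \<open>T s\<close> with linear part \<open>L\<close>, the difference quotient in
  direction \<open>v\<close> is literally the one of the outer map in direction \<open>L v\<close>,
  so limits carry over unchanged. The linear part is the same for all \<open>s\<close>.\<close>

lemma Ck_affine:
  assumes E: "lcs E" and E': "lcs E'" and U: "openin (topo E) U" and U': "openin (topo E') U'"
    and Tc: "continuous_map (prod_topology S (subtopology (topo E') U')) (topo E) (\<lambda>z. T (fst z) (snd z))"
    and Lc: "continuous_map (topo E') (topo E) L"
    and TU: "\<And>s x. s \<in> topspace S \<Longrightarrow> x \<in> U' \<Longrightarrow> T s x \<in> U"
    and TL: "\<And>s x t v. s \<in> topspace S \<Longrightarrow> x \<in> carrier E' \<Longrightarrow> v \<in> carrier E' \<Longrightarrow>
         T s (x \<oplus>\<^bsub>E'\<^esub> t \<odot>\<^bsub>E'\<^esub> v) = T s x \<oplus>\<^bsub>E\<^esub> t \<odot>\<^bsub>E\<^esub> L v"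
  shows "Ck S E F U k m f \<Longrightarrow> Ck S E' F U' k m (\<lambda>s x v. f s (T s x) (restrict (L \<circ> v) {..<m}))"
proof (induction k arbitrary: m f)
  have "continuous_map (pjet S E' U' m) (subtopology (topo E) U) (\<lambda>z. T (fst z) (fst (snd z)))" for m
    unfolding continuous_map_in_subtopology
  proof
    have "continuous_map (pjet S E' U' m) (prod_topology S (subtopology (topo E') U')) (\<lambda>z. (fst z, fst (snd z)))"
      by (intro continuous_map_pairedI continuous_map_fst continuous_map_jet_fst)
    from continuous_map_compose[OF this Tc]
    show "continuous_map (pjet S E' U' m) (topo E) (\<lambda>z. T (fst z) (fst (snd z)))"
      by (simp add: o_def)
    show "(\<lambda>z. T (fst z) (fst (snd z))) \<in> topspace (pjet S E' U' m) \<rightarrow> U"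
      using TU by (auto simp: topspace_jet E' U')
  qed
  moreover have "continuous_map (pjet S E' U' m) (product_topology (\<lambda>_. topo E) {..<m}) (\<lambda>z. restrict (L \<circ> snd (snd z)) {..<m})" for m
    unfolding continuous_map_componentwise
  proof (intro conjI ballI)
    fix i assume i: "i \<in> {..<m}"
    have "continuous_map (product_topology (\<lambda>_. topo E') {..<m}) (topo E') (\<lambda>v. v i)"
      using i by (rule continuous_map_product_projection)
    from continuous_map_compose[OF continuous_map_compose[OF continuous_map_jet_snd this] Lc]
    show "continuous_map (pjet S E' U' m) (topo E) (\<lambda>x. restrict (L \<circ> snd (snd x)) {..<m} i)"
      using i by (simp add: o_def)
  qed auto
  ultimately have Z: "continuous_map (pjet S E' U' m) (pjet S E U m)
     (\<lambda>z. (fst z, T (fst z) (fst (snd z)), restrict (L \<circ> snd (snd z)) {..<m}))" for m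
    unfolding jet_topology_def[of E U m] by (intro continuous_map_pairedI continuous_map_fst)
  have C: "continuous_map (pjet S E' U' m) (topo F)
     (\<lambda>z. f (fst z) (T (fst z) (fst (snd z))) (restrict (L \<circ> snd (snd z)) {..<m}))"
    if "Ck S E F U k m f" for k m f
    using continuous_map_compose[OF Z Ck_cont[OF that]] by (simp add: o_def)
  have Lcar: "L v \<in> carrier E" if "v \<in> carrier E'" for v
    using lcs.cont_carrier[OF E Lc] that lcs.topspace[OF E'] by simp
  {
    case 0
    then show ?case using C[OF 0] by (simp only: Ck.simps)
  next
    case (Suc k)
    obtain f' where f': "Ck S E F U k (Suc m) f'"
      "\<And>s x v. s\<in>topspace S \<Longrightarrow> x\<in>U \<Longrightarrow> v\<in>dirs E (Suc m) \<Longrightarrow>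
          has_dder E F (\<lambda>y. f s y (restrict v {..<m})) x (v m) (f' s x v)"
      using Suc.prems(1) by auto
    have "has_dder E' F (\<lambda>y. f s (T s y) (restrict (L \<circ> restrict v {..<m}) {..<m})) x (v m)
            (f' s (T s x) (restrict (L \<circ> v) {..<Suc m}))"
      if s: "s\<in>topspace S" and x: "x\<in>U'" and v: "v\<in>dirs E' (Suc m)" for s x v
    proof -
      let ?w = "restrict (L \<circ> v) {..<Suc m}"
      have w: "?w \<in> dirs E (Suc m)"
        using v Lcar by (auto simp: PiE_iff)
      have e: "restrict ?w {..<m} = restrict (L \<circ> restrict v {..<m}) {..<m}" "?w m = L (v m)"
        by (auto simp: fun_eq_iff restrict_def)
      have "x \<in> carrier E'" "v m \<in> carrier E'"
        using openin_subset[OF U'] lcs.topspace[OF E'] x v by (auto simp: PiE_iff)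
      then have "diff_quot E' F (\<lambda>y. f s (T s y) (restrict (L \<circ> restrict v {..<m}) {..<m})) x (v m)
        = diff_quot E F (\<lambda>y. f s y (restrict ?w {..<m})) (T s x) (?w m)"
        unfolding e by (auto simp: diff_quot_def fun_eq_iff TL s)
      then show ?thesis
        using f'(2)[OF s TU[OF s x] w] by (simp add: has_dder_def)
    qed
    then show ?case unfolding Ck.simps using C[OF Suc.prems] Suc.IH[OF f'(1)] by blast
  }
qed

lemma Ck_SucE:
  assumes "Ck S E F U (Suc k) m f"
  obtains f' where "Ck S E F U k (Suc m) f'"
      "\<And>s x v. s\<in>topspace S \<Longrightarrow> x\<in>U \<Longrightarrow> v\<in>dirs E (Suc m) \<Longrightarrow>
          has_dder E F (\<lambda>y. f s y (restrict v {..<m})) x (v m) (f' s x v)"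
  using assms by auto

lemma Ck_SucI:
  assumes "continuous_map (pjet S E U m) (topo F)
     (\<lambda>z. f (fst z) (fst (snd z)) (snd (snd z)))" "Ck S E F U k (Suc m) f'"
    "\<And>s x v. s\<in>topspace S \<Longrightarrow> x\<in>U \<Longrightarrow> v\<in>dirs E (Suc m) \<Longrightarrow>
          has_dder E F (\<lambda>y. f s y (restrict v {..<m})) x (v m) (f' s x v)"
  shows "Ck S E F U (Suc k) m f"
  unfolding Ck.simps using assms by blast

lemma Ck_add:
  assumes E: "lcs E" and F: "lcs F" and U: "openin (topo E) U"
  shows "Ck S E F U k m f \<Longrightarrow> Ck S E F U k m g \<Longrightarrow> Ck S E F U k m (\<lambda>s x v. f s x v \<oplus>\<^bsub>F\<^esub> g s x v)"
proof (induction k arbitrary: m f g)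
  case 0
  then show ?case by (simp add: lcs.cont_add[OF F])
next
  case (Suc k)
  obtain f' where f': "Ck S E F U k (Suc m) f'"
      "\<And>s x v. s\<in>topspace S \<Longrightarrow> x\<in>U \<Longrightarrow> v\<in>dirs E (Suc m) \<Longrightarrow>
          has_dder E F (\<lambda>y. f s y (restrict v {..<m})) x (v m) (f' s x v)"
    by (rule Ck_SucE[OF Suc.prems(1)]) (rule that)
  obtain g' where g': "Ck S E F U k (Suc m) g'"
      "\<And>s x v. s\<in>topspace S \<Longrightarrow> x\<in>U \<Longrightarrow> v\<in>dirs E (Suc m) \<Longrightarrow>
          has_dder E F (\<lambda>y. g s y (restrict v {..<m})) x (v m) (g' s x v)"
    by (rule Ck_SucE[OF Suc.prems(2)]) (rule that)
  show ?case
  proof (rule Ck_SucI[OF _ Suc.IH[OF f'(1) g'(1)]])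
    fix s x v assume *: "s\<in>topspace S" "x\<in>U" "v\<in>dirs E (Suc m)"
    have "v m \<in> carrier E" using *(3) by auto
    moreover have "(\<lambda>y. f s y (restrict v {..<m})) ` U \<subseteq> carrier F" "(\<lambda>y. g s y (restrict v {..<m})) ` U \<subseteq> carrier F"
      using Ck_carrier[OF E F U Suc.prems(1) *(1) _ restrict_dirs[OF *(3)]]
        Ck_carrier[OF E F U Suc.prems(2) *(1) _ restrict_dirs[OF *(3)]] by blast+
    ultimately show "has_dder E F (\<lambda>y. f s y (restrict v {..<m}) \<oplus>\<^bsub>F\<^esub> g s y (restrict v {..<m})) x (v m) (f' s x v \<oplus>\<^bsub>F\<^esub> g' s x v)"
      using has_dder_add[OF E F U *(2) _ _ _ f'(2)[OF *] g'(2)[OF *]] by simp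
  qed (use Ck_cont[OF Suc.prems(1)] Ck_cont[OF Suc.prems(2)] lcs.cont_add[OF F] in blast)
qed

text \<open>The linear map may depend continuously on the parameter. With the second factor of a
  product taken as parameter this yields the bilinear case.\<close>

lemma Ck_postlin:
  assumes E: "lcs E" and F: "lcs F" and G: "lcs G" and U: "openin (topo E) U"
    and Lc: "continuous_map (prod_topology S (topo F)) (topo G) (\<lambda>z. L (fst z) (snd z))"
    and Ladd: "\<And>s a b. s \<in> topspace S \<Longrightarrow> a \<in> carrier F \<Longrightarrow> b \<in> carrier F \<Longrightarrow> L s (a \<oplus>\<^bsub>F\<^esub> b) = L s a \<oplus>\<^bsub>G\<^esub> L s b"
    and Lsm: "\<And>s c a. s \<in> topspace S \<Longrightarrow> a \<in> carrier F \<Longrightarrow> L s (c \<odot>\<^bsub>F\<^esub> a) = c \<odot>\<^bsub>G\<^esub> L s a"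
  shows "Ck S E F U k m f \<Longrightarrow> Ck S E G U k m (\<lambda>s x v. L s (f s x v))"
proof (induction k arbitrary: m f)
  have C: "continuous_map (pjet S E U m) (topo G)
     (\<lambda>z. L (fst z) (f (fst z) (fst (snd z)) (snd (snd z))))" if "Ck S E F U k m f" for k m f
    using continuous_map_compose[OF continuous_map_pairedI[OF continuous_map_fst Ck_cont[OF that]] Lc]
    by (simp add: o_def)
  {
    case 0
    then show ?case using C[OF 0] by simp
  next
    case (Suc k)
    obtain f' where f': "Ck S E F U k (Suc m) f'"
        "\<And>s x v. s\<in>topspace S \<Longrightarrow> x\<in>U \<Longrightarrow> v\<in>dirs E (Suc m) \<Longrightarrow>
            has_dder E F (\<lambda>y. f s y (restrict v {..<m})) x (v m) (f' s x v)"
      by (rule Ck_SucE[OF Suc.prems(1)]) (rule that)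
    show ?case
    proof (rule Ck_SucI[OF C[OF Suc.prems] Suc.IH[OF f'(1)]])
      fix s x v assume *: "s\<in>topspace S" "x\<in>U" "v\<in>dirs E (Suc m)"
      have "v m \<in> carrier E" using *(3) by auto
      moreover have "(\<lambda>y. f s y (restrict v {..<m})) ` U \<subseteq> carrier F"
        using Ck_carrier[OF E F U Suc.prems(1) *(1) _ restrict_dirs[OF *(3)]] by blast
      moreover have "continuous_map (topo F) (topo G) (L s)"
        using continuous_map_compose[OF continuous_map_pairedI[of "topo F" S "\<lambda>_. s" "topo F" "\<lambda>x. x"] Lc] *
        by (simp add: o_def)
      ultimately show "has_dder E G (\<lambda>y. L s (f s y (restrict v {..<m}))) x (v m) (L s (f' s x v))"
        using has_dder_linear[OF E F G U *(2) _ _ _ Ladd[OF *(1)] Lsm[OF *(1)] f'(2)[OF *]] by simp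
    qed
  }
qed

text \<open>The derivative is the sum of \<open>H'\<close> at \<open>f\<close> and of
  \<open>H\<close> at \<open>f'\<close>. Both summands have the same shape as the original map, so
  the induction over \<open>k\<close> applies to each. The fibre variable of \<open>H\<close> is a
  mere parameter: \<open>H\<close> is differentiated in the base point only and is continuous in the
  fibre variable.\<close>

lemma Ck_fibre_linear:
  assumes E: "lcs E" and F: "lcs F" and G: "lcs G" and U: "openin (topo E) U"
  shows "Ck S E F U k m f \<Longrightarrow> Ck (prod_topology S (topo F)) E G U k m H \<Longrightarrow>
    (\<And>s x v a b. s \<in> topspace S \<Longrightarrow> x \<in> U \<Longrightarrow> v \<in> dirs E m \<Longrightarrow> a \<in> carrier F \<Longrightarrow> b \<in> carrier F \<Longrightarrow>
        H (s, a \<oplus>\<^bsub>F\<^esub> b) x v = H (s, a) x v \<oplus>\<^bsub>G\<^esub> H (s, b) x v) \<Longrightarrow>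
    (\<And>s x v a c. s \<in> topspace S \<Longrightarrow> x \<in> U \<Longrightarrow> v \<in> dirs E m \<Longrightarrow> a \<in> carrier F \<Longrightarrow>
        H (s, c \<odot>\<^bsub>F\<^esub> a) x v = c \<odot>\<^bsub>G\<^esub> H (s, a) x v) \<Longrightarrow>
    Ck S E G U k m (\<lambda>s x v. H (s, f s x v) x v)"
proof (induction k arbitrary: m f H)
  interpret E: lcs E by fact
  interpret F: lcs F by fact
  interpret G: lcs G by fact
  have C: "continuous_map (pjet S E U m) (topo G)
     (\<lambda>z. H (fst z, f (fst z) (fst (snd z)) (snd (snd z))) (fst (snd z)) (snd (snd z)))"
    if "Ck S E F U k m f" "Ck (prod_topology S (topo F)) E G U k m H" for k m f H
    using continuous_map_compose[OF continuous_map_pairedI[OF continuous_map_pairedI[OF continuous_map_fst Ck_cont[OF that(1)]] continuous_map_snd] Ck_cont[OF that(2)]]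
    by (simp add: o_def)
  {
    case (0 m f H)
    show ?case using C[OF 0(1,2)] by simp
  next
    case (Suc k m f H)
    note Hadd = Suc.prems(3) and Hsm = Suc.prems(4)
    obtain f' where f': "Ck S E F U k (Suc m) f'"
        "\<And>s x v. s\<in>topspace S \<Longrightarrow> x\<in>U \<Longrightarrow> v\<in>dirs E (Suc m) \<Longrightarrow>
            has_dder E F (\<lambda>y. f s y (restrict v {..<m})) x (v m) (f' s x v)"
      by (rule Ck_SucE[OF Suc.prems(1)]) (rule that)
    obtain H' where H': "Ck (prod_topology S (topo F)) E G U k (Suc m) H'"
        "\<And>p x v. p\<in>topspace (prod_topology S (topo F)) \<Longrightarrow> x\<in>U \<Longrightarrow> v\<in>dirs E (Suc m) \<Longrightarrow>
            has_dder E G (\<lambda>y. H p y (restrict v {..<m})) x (v m) (H' p x v)"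
      by (rule Ck_SucE[OF Suc.prems(2)]) (rule that)
    have Hcar: "H (s, a) y w \<in> carrier G" if "s \<in> topspace S" "a \<in> carrier F" "y \<in> U" "w \<in> dirs E m" for s a y w
      using Ck_carrier[OF E G U Suc.prems(2)] that by simp
    \<comment> \<open>The induction hypothesis also demands linearity of \<open>H'\<close>. It is
      inherited from \<open>H\<close> by uniqueness of derivatives, as both sides are derivatives of
      the same map.\<close>
    have H'add: "H' (s, a \<oplus>\<^bsub>F\<^esub> b) x v = H' (s, a) x v \<oplus>\<^bsub>G\<^esub> H' (s, b) x v"
      if *: "s \<in> topspace S" "x \<in> U" "v \<in> dirs E (Suc m)" "a \<in> carrier F" "b \<in> carrier F" for s x v a b
    proof (rule has_dder_unique[OF G])
      let ?w = "restrict v {..<m}"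
      have vm: "v m \<in> carrier E" and w: "?w \<in> dirs E m" using * restrict_dirs[OF *(3)] by auto
      show "has_dder E G (\<lambda>y. H (s, a \<oplus>\<^bsub>F\<^esub> b) y ?w) x (v m) (H' (s, a \<oplus>\<^bsub>F\<^esub> b) x v)"
        using * by (intro H'(2)) auto
      have "has_dder E G (\<lambda>y. H (s, a) y ?w \<oplus>\<^bsub>G\<^esub> H (s, b) y ?w) x (v m) (H' (s, a) x v \<oplus>\<^bsub>G\<^esub> H' (s, b) x v)"
        using * w by (intro has_dder_add[OF E G U *(2) vm] H'(2)) (auto intro!: Hcar)
      then show "has_dder E G (\<lambda>y. H (s, a \<oplus>\<^bsub>F\<^esub> b) y ?w) x (v m) (H' (s, a) x v \<oplus>\<^bsub>G\<^esub> H' (s, b) x v)"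
        by (rule has_dder_cong[OF E U *(2) vm, rotated]) (rule Hadd[OF *(1) _ w *(4,5), symmetric])
    qed
    have H'sm: "H' (s, c \<odot>\<^bsub>F\<^esub> a) x v = c \<odot>\<^bsub>G\<^esub> H' (s, a) x v"
      if *: "s \<in> topspace S" "x \<in> U" "v \<in> dirs E (Suc m)" "a \<in> carrier F" for s x v a c
    proof (rule has_dder_unique[OF G])
      let ?w = "restrict v {..<m}"
      have vm: "v m \<in> carrier E" and w: "?w \<in> dirs E m" using * restrict_dirs[OF *(3)] by auto
      show "has_dder E G (\<lambda>y. H (s, c \<odot>\<^bsub>F\<^esub> a) y ?w) x (v m) (H' (s, c \<odot>\<^bsub>F\<^esub> a) x v)"
        using * by (intro H'(2)) auto
      have "has_dder E G (\<lambda>y. c \<odot>\<^bsub>G\<^esub> H (s, a) y ?w) x (v m) (c \<odot>\<^bsub>G\<^esub> H' (s, a) x v)"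
      proof (rule has_dder_linear[OF E G G U *(2) vm, where L="smult G c"])
        show "has_dder E G (\<lambda>y. H (s, a) y ?w) x (v m) (H' (s, a) x v)" using * by (intro H'(2)) auto
        show "continuous_map (topo G) (topo G) ((\<odot>\<^bsub>G\<^esub>) c)"
          by (intro G.cont_smult) auto
      qed (use * w in \<open>auto intro!: Hcar simp: G.smult_rdistr G.smult_assoc[symmetric] mult.commute\<close>)
      then show "has_dder E G (\<lambda>y. H (s, c \<odot>\<^bsub>F\<^esub> a) y ?w) x (v m) (c \<odot>\<^bsub>G\<^esub> H' (s, a) x v)"
        by (rule has_dder_cong[OF E U *(2) vm, rotated]) (rule Hsm[OF *(1) _ w *(4), symmetric])
    qed
    \<comment> \<open>In each summand the factor that was not differentiated is weakened by one
      ignored direction, so that both factors live on the same jets.\<close>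
    have 1: "Ck S E G U k (Suc m) (\<lambda>s x v. H' (s, f s x (restrict v {..<m})) x v)"
      by (rule Suc.IH[OF Ck_weaken[OF E U Ck_SucD[OF Suc.prems(1)]] H'(1)]) (use H'add H'sm in auto)
    have 2: "Ck S E G U k (Suc m) (\<lambda>s x v. H (s, f' s x v) x (restrict v {..<m}))"
      by (rule Suc.IH[OF f'(1) Ck_weaken[OF E U Ck_SucD[OF Suc.prems(2)]]]) (rule Hadd[OF _ _ restrict_dirs] Hsm[OF _ _ restrict_dirs]; assumption)+
    show ?case
    proof (rule Ck_SucI[OF C[OF Suc.prems(1,2)] Ck_add[OF E G U 1 2]])
      fix s x v assume *: "s\<in>topspace S" "x\<in>U" "v\<in>dirs E (Suc m)"
      let ?w = "restrict v {..<m}"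
      have vm: "v m \<in> carrier E" and w: "?w \<in> dirs E m" using * restrict_dirs[OF *(3)] by auto
      show "has_dder E G (\<lambda>y. H (s, f s y ?w) y ?w) x (v m) (H' (s, f s x ?w) x v \<oplus>\<^bsub>G\<^esub> H (s, f' s x v) x ?w)"
      proof (rule has_dder_fibre_linear[OF E F G U *(2) vm _ f'(2)[OF *], where H="\<lambda>a y. H (s, a) y ?w"])
        have fcar: "f s y ?w \<in> carrier F" if "y \<in> U" for y
          using Ck_carrier[OF E F U Suc.prems(1) *(1) that restrict_dirs[OF *(3)]] .
        then show "(\<lambda>y. f s y ?w) ` U \<subseteq> carrier F" by auto
        have "continuous_map (prod_topology (topo F) (subtopology (topo E) U))
            (prod_topology (prod_topology S (topo F)) (jet_topology E U m)) (\<lambda>z. ((s, fst z), snd z, ?w))"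
          unfolding jet_topology_def
          by (intro continuous_map_pairedI continuous_map_fst continuous_map_snd) (use *(1) w in auto)
        from continuous_map_compose[OF this Ck_cont[OF Suc.prems(2)]]
        show "continuous_map (prod_topology (topo F) (subtopology (topo E) U)) (topo G) (\<lambda>(a, y). H (s, a) y ?w)"
          by (simp add: o_def case_prod_unfold)
        show "has_dder E G (\<lambda>y. H (s, f s x ?w) y ?w) x (v m) (H' (s, f s x ?w) x v)"
          using * fcar by (intro H'(2)) auto
      qed (rule Hadd[OF *(1) _ w] Hsm[OF *(1) _ w]; assumption)+
    qed
  }
qed

text \<open>Freeze the second factor as a parameter \<open>c\<close>: then
  \<open>\<beta> (f s x v) c\<close> is a postcomposition with a linear map and is itself linear in
  \<open>c\<close>, which is the situation of \<open>Ck_fibre_linear\<close>.\<close>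

lemma Ck_bilinear:
  assumes E: "lcs E" and F1: "lcs F1" and F2: "lcs F2" and G: "lcs G" and U: "openin (topo E) U"
    and bc: "continuous_map (prod_topology (topo F1) (topo F2)) (topo G) (\<lambda>z. \<beta> (fst z) (snd z))"
    and b1: "\<And>a b c. a \<in> carrier F1 \<Longrightarrow> b \<in> carrier F1 \<Longrightarrow> c \<in> carrier F2 \<Longrightarrow> \<beta> (a \<oplus>\<^bsub>F1\<^esub> b) c = \<beta> a c \<oplus>\<^bsub>G\<^esub> \<beta> b c"
    and b2: "\<And>a b c. a \<in> carrier F1 \<Longrightarrow> b \<in> carrier F2 \<Longrightarrow> c \<in> carrier F2 \<Longrightarrow> \<beta> a (b \<oplus>\<^bsub>F2\<^esub> c) = \<beta> a b \<oplus>\<^bsub>G\<^esub> \<beta> a c"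
    and b3: "\<And>r a b. a \<in> carrier F1 \<Longrightarrow> b \<in> carrier F2 \<Longrightarrow> \<beta> (r \<odot>\<^bsub>F1\<^esub> a) b = r \<odot>\<^bsub>G\<^esub> \<beta> a b"
    and b4: "\<And>r a b. a \<in> carrier F1 \<Longrightarrow> b \<in> carrier F2 \<Longrightarrow> \<beta> a (r \<odot>\<^bsub>F2\<^esub> b) = r \<odot>\<^bsub>G\<^esub> \<beta> a b"
    and f: "Ck S E F1 U k m f" and g: "Ck S E F2 U k m g"
  shows "Ck S E G U k m (\<lambda>s x v. \<beta> (f s x v) (g s x v))"
proof -
  interpret F2: lcs F2 by fact
  interpret F1: lcs F1 by fact
  have "Ck (prod_topology S (topo F2)) E G U k m (\<lambda>p x v. \<beta> (f (fst p) x v) (snd p))"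
  proof (rule Ck_postlin[OF E F1 G U, where L="\<lambda>p a. \<beta> a (snd p)"])
    show "Ck (prod_topology S (topo F2)) E F1 U k m (\<lambda>p. f (fst p))"
      by (rule Ck_pull[OF continuous_map_fst f])
    have "continuous_map (prod_topology (prod_topology S (topo F2)) (topo F1)) (prod_topology (topo F1) (topo F2)) (\<lambda>z. (snd z, snd (fst z)))"
      by (intro continuous_map_pairedI continuous_map_snd continuous_map_compose[OF continuous_map_fst continuous_map_snd, unfolded o_def])
    from continuous_map_compose[OF this bc] show "continuous_map (prod_topology (prod_topology S (topo F2)) (topo F1)) (topo G)
     (\<lambda>z. \<beta> (snd z) (snd (fst z)))" by (simp add: o_def)
  qed (use b1 b3 in auto)
  from Ck_fibre_linear[OF E F2 G U g this] show ?thesis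
    using b2 b4 Ck_carrier[OF E F1 U f] by simp
qed

lemma Ck_zero:
  assumes E: "lcs E" and F: "lcs F" and U: "openin (topo E) U"
  shows "Ck S E F U k m (\<lambda>s x v. \<zero>\<^bsub>F\<^esub>)"
proof (induction k arbitrary: m)
  interpret F: lcs F by fact
  {
    case 0
    then show ?case by simp
  next
    case (Suc k)
    show ?case by (rule Ck_SucI[OF _ Suc]) (auto simp: has_dder_def diff_quot_def[abs_def] F.minus_eq F.r_neg)
  }
qed

lemma Ck_const:
  assumes E: "lcs E" and F: "lcs F" and U: "openin (topo E) U"
    and c: "continuous_map (prod_topology S (product_topology (\<lambda>_. topo E) {..<m})) (topo F) (\<lambda>z. c (fst z) (snd z))"
  shows "Ck S E F U k m (\<lambda>s x v. c s v)"
proof -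
  interpret F: lcs F by fact
  interpret E: lcs E by fact
  have C: "continuous_map (pjet S E U m) (topo F) (\<lambda>z. c (fst z) (snd (snd z)))"
    using continuous_map_compose[OF continuous_map_pairedI[OF continuous_map_fst continuous_map_jet_snd] c] by (simp add: o_def)
  show ?thesis
  proof (cases k)
    case (Suc k')
    have "has_dder E F (\<lambda>y. c s (restrict v {..<m})) x (v m) \<zero>\<^bsub>F\<^esub>"
      if "s \<in> topspace S" "x \<in> U" "v\<in>dirs E (Suc m)" for s x v
    proof -
      have "c s (restrict v {..<m}) \<in> carrier F"
        using F.cont_carrier[OF c, of "(s, restrict v {..<m})"] that restrict_dirs[OF that(3)] by simp
      then show ?thesis by (simp add: has_dder_def diff_quot_def[abs_def] a_minus_def F.r_neg)
    qed
    then show ?thesis unfolding Suc by (rule Ck_SucI[OF C Ck_zero[OF E F U]])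
  qed (use C in simp)
qed

lemma Ck_linear:
  assumes E: "lcs E" and F: "lcs F" and U: "openin (topo E) U"
    and Lc: "continuous_map (topo E) (topo F) L"
    and Ladd: "\<And>a b. a \<in> carrier E \<Longrightarrow> b \<in> carrier E \<Longrightarrow> L (a \<oplus>\<^bsub>E\<^esub> b) = L a \<oplus>\<^bsub>F\<^esub> L b"
    and Lsm: "\<And>c a. a \<in> carrier E \<Longrightarrow> L (c \<odot>\<^bsub>E\<^esub> a) = c \<odot>\<^bsub>F\<^esub> L a"
  shows "Ck S E F U k m (\<lambda>s x v. L x)"
proof -
  interpret F: lcs F by fact
  interpret E: lcs E by fact
  have C: "continuous_map (pjet S E U m) (topo F) (\<lambda>z. L (fst (snd z)))"
    using continuous_map_compose[OF continuous_map_into_fulltopology[OF continuous_map_jet_fst] Lc] by (simp add: o_def)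
  have Lcar: "L x \<in> carrier F" if "x \<in> carrier E" for x
    using F.cont_carrier[OF Lc] that by simp
  show ?thesis
  proof (cases k)
    case (Suc k')
    have d: "has_dder E F L x (v m) (L (v m))"
      if "x \<in> U" "v\<in>dirs E (Suc m)" for x v
    proof -
      have x: "x \<in> carrier E" "v m \<in> carrier E"
        using openin_subset[OF U] that by auto
      have "\<forall>\<^sub>F t in at 0. L (v m) = diff_quot E F L x (v m) t"
        using eventually_neq_at_within[of 0]
      proof eventually_elim
        case (elim t)
        have "a_minus F (L x \<oplus>\<^bsub>F\<^esub> t \<odot>\<^bsub>F\<^esub> L (v m)) (L x) = t \<odot>\<^bsub>F\<^esub> L (v m)"
          using x by (simp add: a_minus_def Lcar F.a_comm[of "L x \<oplus>\<^bsub>F\<^esub> _"] F.r_neg1)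
        then show ?case using x elim by (simp add: diff_quot_def Ladd Lsm Lcar F.smult_assoc[symmetric])
      qed
      then show ?thesis unfolding has_dder_def
        by (rule limitin_transform_eventually) (use x Lcar in auto)
    qed
    have "continuous_map (prod_topology S (product_topology (\<lambda>_. topo E) {..<Suc m})) (topo F) (\<lambda>z. L (snd z m))"
      using continuous_map_compose[OF continuous_map_compose[OF continuous_map_snd[of S] continuous_map_product_projection[of m "{..<Suc m}" "\<lambda>_. topo E"]] Lc]
      by (simp add: o_def)
    then show ?thesis
      unfolding Suc by (intro Ck_SucI[where f'="\<lambda>s x v. L (v m)"] C Ck_const[OF E F U] d)
  qed (use C in simp)
qed

lemma scalars_a_minus [simp]: "a_minus (scalars :: ('k::real_normed_field, 'k) tvs) x y = x - y"
proof -
  interpret lcs "scalars :: ('k, 'k) tvs" by (rule lcs_scalars)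
  have "a_inv scalars y = - y"
    by (rule minus_equality) auto
  then show ?thesis by (simp add: a_minus_def)
qed

text \<open>Identifies a directional derivative of a real-valued map with an ordinary derivative at
  zero along a line, so that the chain rule for real functions can be quoted.\<close>

lemma has_dder_real:
  assumes "lcs E" "x \<in> carrier E" "v \<in> carrier E"
  shows "has_dder E scalars h x v l \<longleftrightarrow> ((\<lambda>t. h (x \<oplus>\<^bsub>E\<^esub> t \<odot>\<^bsub>E\<^esub> v)) has_real_derivative l) (at 0)"
proof -
  interpret lcs E by fact
  show ?thesis using assms
    by (simp add: has_dder_def diff_quot_def[abs_def] DERIV_def)
qed

lemma Ck_real_mult:
  assumes E: "lcs E" and U: "openin (topo E) U" and f: "Ck S E scalars U k m f" and g: "Ck S E scalars U k m g"
  shows "Ck S E (scalars :: (real, real) tvs) U k m (\<lambda>s x v. f s x v * g s x v)"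
  by (rule Ck_bilinear[OF E lcs_scalars lcs_scalars lcs_scalars U _ _ _ _ _ f g])
    (auto simp: algebra_simps intro!: continuous_intros)

text \<open>The outer function comes with the whole sequence \<open>d\<close> of its derivatives.
  Differentiation leads from \<open>d j\<close> to \<open>d (Suc j)\<close>, so the induction over
  \<open>k\<close> has to keep \<open>j\<close> arbitrary.\<close>

lemma Ck_real_comp:
  fixes d :: "nat \<Rightarrow> real \<Rightarrow> real"
  assumes E: "lcs E" and U: "openin (topo E) U"
    and d: "\<And>j t. t \<in> D \<Longrightarrow> (d j has_real_derivative d (Suc j) t) (at t)"
  shows "Ck S E scalars U k m f \<Longrightarrow>
    (\<And>s x v. s \<in> topspace S \<Longrightarrow> x \<in> U \<Longrightarrow> v \<in> dirs E m \<Longrightarrow> f s x v \<in> D) \<Longrightarrow>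
    Ck S E scalars U k m (\<lambda>s x v. d j (f s x v))"
proof (induction k arbitrary: m f j)
  interpret E: lcs E by fact
  have C: "continuous_map (pjet S E U m) euclideanreal
     (\<lambda>z. d j (f (fst z) (fst (snd z)) (snd (snd z))))"
    if "Ck S E scalars U k m f"
    "\<And>s x v. s \<in> topspace S \<Longrightarrow> x \<in> U \<Longrightarrow> v \<in> dirs E m \<Longrightarrow> f s x v \<in> D" for k m f j
  proof -
    have "continuous_map (pjet S E U m) (top_of_set D) (\<lambda>z. f (fst z) (fst (snd z)) (snd (snd z)))"
      using Ck_cont[OF that(1)] that(2) by (auto simp: continuous_map_in_subtopology topspace_jet[OF E U])
    moreover have "continuous_map (top_of_set D) euclideanreal (d j)"
      using d by (auto intro!: continuous_at_imp_continuous_on DERIV_isCont)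
    ultimately have "continuous_map (pjet S E U m) euclideanreal
       (d j \<circ> (\<lambda>z. f (fst z) (fst (snd z)) (snd (snd z))))" by (rule continuous_map_compose)
    then show ?thesis by (simp add: o_def)
  qed
  {
    case (0 m f j)
    then show ?case using C[OF 0(1)] by simp
  next
    case (Suc k m f j)
    obtain f' where f': "Ck S E scalars U k (Suc m) f'"
        "\<And>s x v. s\<in>topspace S \<Longrightarrow> x\<in>U \<Longrightarrow> v\<in>dirs E (Suc m) \<Longrightarrow>
            has_dder E scalars (\<lambda>y. f s y (restrict v {..<m})) x (v m) (f' s x v)"
      by (rule Ck_SucE[OF Suc.prems(1)]) (rule that)
    have 1: "Ck S E scalars U k (Suc m) (\<lambda>s x v. d (Suc j) (f s x (restrict v {..<m})))"
      by (rule Suc.IH[OF Ck_weaken[OF E U Ck_SucD[OF Suc.prems(1)]]]) (rule Suc.prems(2)[OF _ _ restrict_dirs])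
    show ?case
    proof (rule Ck_SucI[OF _ Ck_real_mult[OF E U 1 f'(1)]])
      show "continuous_map (pjet S E U m) (topo scalars)
         (\<lambda>z. d j (f (fst z) (fst (snd z)) (snd (snd z))))" using C[OF Suc.prems] by simp
      fix s x v assume *: "s\<in>topspace S" "x\<in>U" "v\<in>dirs E (Suc m)"
      let ?w = "restrict v {..<m}"
      have vm: "v m \<in> carrier E" and w: "?w \<in> dirs E m" and x: "x \<in> carrier E"
        using * restrict_dirs[OF *(3)] openin_subset[OF U] by auto
      \<comment> \<open>The chain rule wants the outer derivative at the value that the inner
        function takes at parameter zero of the line.\<close>
      have x0: "x \<oplus>\<^bsub>E\<^esub> 0 \<odot>\<^bsub>E\<^esub> v m = x" using x vm by simp
      have "(d j has_real_derivative d (Suc j) (f s x ?w)) (at (f s (x \<oplus>\<^bsub>E\<^esub> 0 \<odot>\<^bsub>E\<^esub> v m) ?w))"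
        unfolding x0 by (rule d[OF Suc.prems(2)[OF *(1,2) w]])
      from DERIV_chain2[OF this f'(2)[OF *, unfolded has_dder_real[OF E x vm]]]
      show "has_dder E scalars (\<lambda>y. d j (f s y ?w)) x (v m) (d (Suc j) (f s x ?w) * f' s x v)"
        unfolding has_dder_real[OF E x vm] .
    qed
  }
qed


section \<open>Products of locally convex spaces and pairs of maps\<close>

lemma prod_tvs_simps [simp]:
  "carrier (prod_tvs V W) = carrier V \<times> carrier W" "ring.zero (prod_tvs V W) = (\<zero>\<^bsub>V\<^esub>, \<zero>\<^bsub>W\<^esub>)"
  "add (prod_tvs V W) (x, y) (x', y') = (x \<oplus>\<^bsub>V\<^esub> x', y \<oplus>\<^bsub>W\<^esub> y')"
  "smult (prod_tvs V W) r (x, y) = (r \<odot>\<^bsub>V\<^esub> x, r \<odot>\<^bsub>W\<^esub> y)"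
  "topo (prod_tvs V W) = prod_topology (topo V) (topo W)"
  by (simp_all add: prod_tvs_def)

lemma lcs_prod_tvs:
  assumes V: "lcs V" and W: "lcs W"
  shows "lcs (prod_tvs V W)"
proof
  interpret V: lcs V by fact
  interpret W: lcs W by fact
  let ?P = "prod_tvs V W"
  show "lc_space ?P"
    unfolding lc_space_def
  proof (intro conjI allI impI)
    have "abelian_group ?P"
    proof (rule abelian_groupI)
      fix z assume "z \<in> carrier ?P"
      then show "\<exists>y\<in>carrier ?P. y \<oplus>\<^bsub>?P\<^esub> z = \<zero>\<^bsub>?P\<^esub>"
        by (intro bexI[of _ "(\<ominus>\<^bsub>V\<^esub> fst z, \<ominus>\<^bsub>W\<^esub> snd z)"]) (auto simp: V.l_neg W.l_neg)
    qed (auto simp: V.a_ac W.a_ac)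
    then show "Module.module (scalars :: (real, real) tvs) ?P"
      by (rule module_scalarsI)
        (auto simp: V.smult_ldistr W.smult_ldistr V.smult_rdistr W.smult_rdistr V.smult_assoc W.smult_assoc)
    show "Hausdorff_space (topo ?P)"
      using V.hausdorff W.hausdorff by (simp add: Hausdorff_space_prod_topology)
    have c: "continuous_map (prod_topology X (prod_topology A B)) A (\<lambda>z. fst (snd z))"
         "continuous_map (prod_topology X (prod_topology A B)) B (\<lambda>z. snd (snd z))"
         "continuous_map (prod_topology (prod_topology A B) X) A (\<lambda>z. fst (fst z))"
         "continuous_map (prod_topology (prod_topology A B) X) B (\<lambda>z. snd (fst z))" for X A B
      by (intro continuous_map_compose[OF continuous_map_snd continuous_map_fst, unfolded o_def]
          continuous_map_compose[OF continuous_map_snd continuous_map_snd, unfolded o_def]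
          continuous_map_compose[OF continuous_map_fst continuous_map_fst, unfolded o_def]
          continuous_map_compose[OF continuous_map_fst continuous_map_snd, unfolded o_def])+
    show "continuous_map (prod_topology (topo ?P) (topo ?P)) (topo ?P) (\<lambda>(x, y). x \<oplus>\<^bsub>?P\<^esub> y)"
      using continuous_map_pairedI[OF V.cont_add[OF c(3) c(1)] W.cont_add[OF c(4) c(2)]]
      by (simp add: prod_tvs_def case_prod_unfold)
    show "continuous_map (prod_topology euclidean (topo ?P)) (topo ?P) (\<lambda>(x, y). x \<odot>\<^bsub>?P\<^esub> y)"
      using continuous_map_pairedI[OF V.cont_smult[OF continuous_map_fst c(1)] W.cont_smult[OF continuous_map_fst c(2)]]
      by (simp add: prod_tvs_def case_prod_unfold)
    fix N assume N: "openin (topo ?P) N \<and> \<zero>\<^bsub>?P\<^esub> \<in> N"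
    then obtain A B where AB: "openin (topo V) A" "openin (topo W) B" "\<zero>\<^bsub>V\<^esub> \<in> A" "\<zero>\<^bsub>W\<^esub> \<in> B" "A \<times> B \<subseteq> N"
      unfolding prod_tvs_simps openin_prod_topology_alt by metis
    obtain C where C: "openin (topo V) C" "\<zero>\<^bsub>V\<^esub> \<in> C" "C \<subseteq> A"
      "\<forall>x\<in>C. \<forall>y\<in>C. \<forall>t\<in>{0..1}. (of_real t \<odot>\<^bsub>V\<^esub> x) \<oplus>\<^bsub>V\<^esub> (of_real (1 - t) \<odot>\<^bsub>V\<^esub> y) \<in> C"
      using V.convex_nbhd[OF AB(1,3)] by blast
    obtain D where D: "openin (topo W) D" "\<zero>\<^bsub>W\<^esub> \<in> D" "D \<subseteq> B"
      "\<forall>x\<in>D. \<forall>y\<in>D. \<forall>t\<in>{0..1}. (of_real t \<odot>\<^bsub>W\<^esub> x) \<oplus>\<^bsub>W\<^esub> (of_real (1 - t) \<odot>\<^bsub>W\<^esub> y) \<in> D"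
      using W.convex_nbhd[OF AB(2,4)] by blast
    show "\<exists>C. openin (topo ?P) C \<and> \<zero>\<^bsub>?P\<^esub> \<in> C \<and> C \<subseteq> N \<and>
          (\<forall>x\<in>C. \<forall>y\<in>C. \<forall>t\<in>{0..1}. (of_real t \<odot>\<^bsub>?P\<^esub> x) \<oplus>\<^bsub>?P\<^esub> (of_real (1 - t) \<odot>\<^bsub>?P\<^esub> y) \<in> C)"
      using C D AB by (intro exI[of _ "C \<times> D"]) (auto simp: openin_prod_Times_iff)
  qed simp
qed

lemma prod_tvs_minus:
  assumes V: "lcs V" and W: "lcs W" and "a \<in> carrier V" "b \<in> carrier W" "c \<in> carrier V" "d \<in> carrier W"
  shows "a_minus (prod_tvs V W) (a, b) (c, d) = (a \<ominus>\<^bsub>V\<^esub> c, b \<ominus>\<^bsub>W\<^esub> d)"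
proof -
  interpret V: lcs V by fact
  interpret W: lcs W by fact
  interpret P: lcs "prod_tvs V W" by (rule lcs_prod_tvs[OF V W])
  have "a_inv (prod_tvs V W) (c, d) = (\<ominus>\<^bsub>V\<^esub> c, \<ominus>\<^bsub>W\<^esub> d)"
    by (rule P.minus_equality) (use assms in \<open>auto simp: V.l_neg W.l_neg\<close>)
  then show ?thesis by (simp add: a_minus_def)
qed

lemma Ck_pair:
  assumes E: "lcs E" and F: "lcs F" and G: "lcs G" and U: "openin (topo E) U"
  shows "Ck S E F U k m f \<Longrightarrow> Ck S E G U k m g \<Longrightarrow> Ck S E (prod_tvs F G) U k m (\<lambda>s x v. (f s x v, g s x v))"
proof (induction k arbitrary: m f g)
  have C: "continuous_map (pjet S E U m) (topo (prod_tvs F G))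
     (\<lambda>z. (f (fst z) (fst (snd z)) (snd (snd z)), g (fst z) (fst (snd z)) (snd (snd z))))"
    if "Ck S E F U k m f" "Ck S E G U k m g" for k m f g
    using continuous_map_pairedI[OF Ck_cont[OF that(1)] Ck_cont[OF that(2)]] by (simp add: prod_tvs_def)
  {
    case 0
    then show ?case using C[OF 0] by simp
  next
    case (Suc k)
    obtain f' where f': "Ck S E F U k (Suc m) f'"
        "\<And>s x v. s\<in>topspace S \<Longrightarrow> x\<in>U \<Longrightarrow> v\<in>dirs E (Suc m) \<Longrightarrow>
            has_dder E F (\<lambda>y. f s y (restrict v {..<m})) x (v m) (f' s x v)"
      by (rule Ck_SucE[OF Suc.prems(1)]) (rule that)
    obtain g' where g': "Ck S E G U k (Suc m) g'"
        "\<And>s x v. s\<in>topspace S \<Longrightarrow> x\<in>U \<Longrightarrow> v\<in>dirs E (Suc m) \<Longrightarrow>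
            has_dder E G (\<lambda>y. g s y (restrict v {..<m})) x (v m) (g' s x v)"
      by (rule Ck_SucE[OF Suc.prems(2)]) (rule that)
    show ?case
    proof (rule Ck_SucI[OF C[OF Suc.prems] Suc.IH[OF f'(1) g'(1)]])
      fix s x v assume *: "s\<in>topspace S" "x\<in>U" "v\<in>dirs E (Suc m)"
      let ?w = "restrict v {..<m}"
      have vm: "v m \<in> carrier E" using *(3) by auto
      have fc: "f s y ?w \<in> carrier F" "g s y ?w \<in> carrier G" if "y \<in> U" for y
        using Ck_carrier[OF E F U Suc.prems(1) *(1) that restrict_dirs[OF *(3)]]
          Ck_carrier[OF E G U Suc.prems(2) *(1) that restrict_dirs[OF *(3)]] .
      have lim: "limitin (prod_topology (topo F) (topo G))
          (\<lambda>t. (diff_quot E F (\<lambda>y. f s y ?w) x (v m) t, diff_quot E G (\<lambda>y. g s y ?w) x (v m) t)) (f' s x v, g' s x v) (at 0)"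
        using f'(2)[OF *] g'(2)[OF *] unfolding has_dder_def by (rule limitin_pairI)
      show "has_dder E (prod_tvs F G) (\<lambda>y. (f s y ?w, g s y ?w)) x (v m) (f' s x v, g' s x v)"
        unfolding has_dder_def
      proof (rule limitin_transform_eventually)
        show "\<forall>\<^sub>F t in at 0. (diff_quot E F (\<lambda>y. f s y ?w) x (v m) t, diff_quot E G (\<lambda>y. g s y ?w) x (v m) t)
            = diff_quot E (prod_tvs F G) (\<lambda>y. (f s y ?w, g s y ?w)) x (v m) t"
          using line_eventually[OF E U *(2) vm]
        proof eventually_elim
          case (elim t)
          show ?case
            unfolding diff_quot_def prod_tvs_minus[OF F G fc(1)[OF elim] fc(2)[OF elim] fc(1)[OF *(2)] fc(2)[OF *(2)]]
            by (simp add: prod_tvs_def)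
        qed
        show "limitin (topo (prod_tvs F G)) (\<lambda>t. (diff_quot E F (\<lambda>y. f s y ?w) x (v m) t, diff_quot E G (\<lambda>y. g s y ?w) x (v m) t)) (f' s x v, g' s x v) (at 0)"
          using lim by (simp add: prod_tvs_def)
      qed
    qed
  }
qed

section \<open>Smooth families\<close>

text \<open>No direction has been taken yet, hence \<open>0\<close> directions and a family that
  ignores \<open>v\<close>. Over a point this is \<open>smooth_on\<close>; with a space of functions
  as parameter space it expresses continuity in the function together with all derivatives.\<close>

definition smooth_family :: "'s topology \<Rightarrow> (real, 'v) tvs \<Rightarrow> (real, 'w) tvs \<Rightarrow> 'v set \<Rightarrow> ('s \<Rightarrow> 'v \<Rightarrow> 'w) \<Rightarrow> bool" where
  "smooth_family S E F U f \<longleftrightarrow> openin (topo E) U \<and> (\<forall>k. Ck S E F U k 0 (\<lambda>s x v. f s x))"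

lemma dder_cong_dirs: "(\<And>i. i < k \<Longrightarrow> v i = w i) \<Longrightarrow> dder E F f k x v = dder E F f k x w"
  by (induction k arbitrary: x) (auto simp: less_Suc_eq fun_eq_iff)

lemma dder_restrict: "dder E F f k x (restrict v {..<k}) = dder E F f k x v"
  by (rule dder_cong_dirs) simp

lemma dder_eqI:
  assumes "lcs F" "has_dder E F (\<lambda>y. dder E F f k y v) x (v k) l"
  shows "dder E F f (Suc k) x v = l"
  using assms has_dder_unique[OF assms(1)] unfolding has_dder_def by (auto intro!: the_equality)

text \<open>The iterated derivatives \<open>dder\<close> themselves serve as the witnesses required
  by \<open>Ck\<close>.\<close>

lemma smooth_familyI:
  assumes E: "lcs E" and F: "lcs F" and U: "openin (topo E) U"
    and ex: "\<And>s k x v. s \<in> topspace S \<Longrightarrow> x \<in> U \<Longrightarrow> v \<in> dirs E (Suc k) \<Longrightarrow>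
      \<exists>l. has_dder E F (\<lambda>y. dder E F (f s) k y v) x (v k) l"
    and c: "\<And>k. continuous_map (pjet S E U k) (topo F) (\<lambda>z. dder E F (f (fst z)) k (fst (snd z)) (snd (snd z)))"
  shows "smooth_family S E F U f"
proof -
  have "Ck S E F U k m (\<lambda>s x v. dder E F (f s) m x v)" for k m
  proof (induction k arbitrary: m)
    case (Suc k)
    show ?case
    proof (rule Ck_SucI[OF c Suc])
      fix s x v assume *: "s\<in>topspace S" "x\<in>U" "v\<in>dirs E (Suc m)"
      obtain l where l: "has_dder E F (\<lambda>y. dder E F (f s) m y v) x (v m) l"
        using ex[OF *] by blast
      then show "has_dder E F (\<lambda>y. dder E F (f s) m y (restrict v {..<m})) x (v m) (dder E F (f s) (Suc m) x v)"
        unfolding dder_restrict dder_eqI[OF F l] .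
    qed
  qed (use c in simp)
  from this[of _ 0] show ?thesis using U by (simp add: smooth_family_def)
qed

lemma smooth_familyD:
  assumes E: "lcs E" and F: "lcs F" and f: "smooth_family S E F U f"
  shows "continuous_map (pjet S E U k) (topo F) (\<lambda>z. dder E F (f (fst z)) k (fst (snd z)) (snd (snd z)))"
    and "s \<in> topspace S \<Longrightarrow> smooth_on E F U (f s)"
proof -
  have U: "openin (topo E) U" using f by (simp add: smooth_family_def)
  \<comment> \<open>The witnesses in \<open>Ck\<close> are identified with \<open>dder\<close> one
    order at a time by uniqueness of limits: \<open>k\<close> decreases while the number
    \<open>m\<close> of directions grows. Starting at order \<open>Suc k\<close> leaves one
    derivative in reserve, which gives existence of the next one.\<close>
  have big: "Ck S E F U (Suc k) m h \<Longrightarrow>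
    (\<And>s x v. s \<in> topspace S \<Longrightarrow> x \<in> U \<Longrightarrow> v \<in> dirs E m \<Longrightarrow> h s x v = dder E F (f s) m x v) \<Longrightarrow>
    continuous_map (pjet S E U (m + k)) (topo F) (\<lambda>z. dder E F (f (fst z)) (m + k) (fst (snd z)) (snd (snd z))) \<and>
    (\<forall>s\<in>topspace S. \<forall>x\<in>U. \<forall>v \<in> dirs E (Suc (m + k)). \<exists>l. has_dder E F (\<lambda>y. dder E F (f s) (m + k) y v) x (v (m + k)) l)" for m k h
  proof (induction k arbitrary: m h)
    case (0 m h)
    obtain h' where h': 
        "\<And>s x v. s\<in>topspace S \<Longrightarrow> x\<in>U \<Longrightarrow> v\<in>dirs E (Suc m) \<Longrightarrow>
            has_dder E F (\<lambda>y. h s y (restrict v {..<m})) x (v m) (h' s x v)"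
      by (rule Ck_SucE[OF 0(1)]) (rule that)
    have "has_dder E F (\<lambda>y. dder E F (f s) m y v) x (v m) (h' s x v)"
      if *: "s\<in>topspace S" "x\<in>U" "v\<in>dirs E (Suc m)" for s x v
      by (rule has_dder_cong[OF E U *(2) _ _ h'[OF *]])
        (use *(3) 0(2)[OF *(1) _ restrict_dirs[OF *(3)], unfolded dder_restrict] in blast)+
    moreover have "continuous_map (pjet S E U m) (topo F) (\<lambda>z. dder E F (f (fst z)) m (fst (snd z)) (snd (snd z)))"
      by (rule continuous_map_eq[OF Ck_cont[OF 0(1)]]) (use 0(2) in \<open>simp add: topspace_jet[OF E U] mem_Times_iff\<close>)
    ultimately show ?case by auto
  next
    case (Suc k m h)
    obtain h' where h': "Ck S E F U (Suc k) (Suc m) h'"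
        "\<And>s x v. s\<in>topspace S \<Longrightarrow> x\<in>U \<Longrightarrow> v\<in>dirs E (Suc m) \<Longrightarrow>
            has_dder E F (\<lambda>y. h s y (restrict v {..<m})) x (v m) (h' s x v)"
      by (rule Ck_SucE[OF Suc.prems(1)]) (rule that)
    have "h' s x v = dder E F (f s) (Suc m) x v"
      if *: "s\<in>topspace S" "x\<in>U" "v\<in>dirs E (Suc m)" for s x v
    proof -
      have "has_dder E F (\<lambda>y. dder E F (f s) m y v) x (v m) (h' s x v)"
        by (rule has_dder_cong[OF E U *(2) _ _ h'(2)[OF *]])
          (use *(3) Suc.prems(2)[OF *(1) _ restrict_dirs[OF *(3)], unfolded dder_restrict] in blast)+
      from dder_eqI[OF F this] show ?thesis by (rule sym)
    qed
    from Suc.IH[OF h'(1) this] show ?case by simp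
  qed
  have *: "continuous_map (pjet S E U k) (topo F) (\<lambda>z. dder E F (f (fst z)) k (fst (snd z)) (snd (snd z))) \<and>
    (\<forall>s\<in>topspace S. \<forall>x\<in>U. \<forall>v \<in> dirs E (Suc k). \<exists>l. has_dder E F (\<lambda>y. dder E F (f s) k y v) x (v k) l)" for k
  proof -
    have "Ck S E F U (Suc k) 0 (\<lambda>s x v. f s x)" using f unfolding smooth_family_def by blast
    from big[OF this] show ?thesis by simp
  qed
  show "continuous_map (pjet S E U k) (topo F) (\<lambda>z. dder E F (f (fst z)) k (fst (snd z)) (snd (snd z)))"
    using * by blast
  assume s: "s \<in> topspace S"
  have "continuous_map (jet_topology E U k) (topo F) (\<lambda>(x, v). dder E F (f s) k x v)" for k
    using continuous_map_compose[OF continuous_map_pairedI[of "jet_topology E U k" S "\<lambda>_. s" "jet_topology E U k" "\<lambda>x. x"] conjunct1[OF *, of k]] s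
    by (simp add: o_def case_prod_unfold)
  then show "smooth_on E F U (f s)"
    using * s U by (auto simp: smooth_on_def has_dder_def)
qed

text \<open>A single map is a family over a one-point space; in this way \<open>smooth_on\<close>
  inherits the calculus of families.\<close>

lemma smooth_on_iff_family:
  assumes E: "lcs E" and F: "lcs F"
  shows "smooth_on E F U f \<longleftrightarrow> smooth_family (discrete_topology {()}) E F U (\<lambda>_. f)"
proof
  assume f: "smooth_on E F U f"
  show "smooth_family (discrete_topology {()}) E F U (\<lambda>_. f)"
  proof (rule smooth_familyI[OF E F])
    fix k
    have "continuous_map (jet_topology E U k) (topo F) (\<lambda>(x, v). dder E F f k x v)"
      using f by (simp add: smooth_on_def)
    from continuous_map_compose[OF continuous_map_snd this]
    show "continuous_map (prod_topology (discrete_topology {()}) (jet_topology E U k)) (topo F) (\<lambda>z. dder E F f k (fst (snd z)) (snd (snd z)))"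
      by (simp add: o_def case_prod_unfold)
  qed (use f[unfolded smooth_on_def] in \<open>unfold has_dder_def, blast+\<close>)
next
  assume "smooth_family (discrete_topology {()}) E F U (\<lambda>_. f)"
  from smooth_familyD(2)[OF E F this] show "smooth_on E F U f" by simp
qed

lemma smooth_family_open: "smooth_family S E F U f \<Longrightarrow> openin (topo E) U"
  by (simp add: smooth_family_def)

lemma smooth_family_cong:
  assumes "lcs E" "smooth_family S E F U f" "\<And>s x. s \<in> topspace S \<Longrightarrow> x \<in> U \<Longrightarrow> f s x = g s x"
  shows "smooth_family S E F U g"
  unfolding smooth_family_def
proof (intro conjI allI)
  fix k
  show "Ck S E F U k 0 (\<lambda>s x v. g s x)"
    by (rule Ck_cong[OF assms(1) smooth_family_open[OF assms(2)], where f="\<lambda>s x v. f s x"])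
      (use assms in \<open>auto simp: smooth_family_def\<close>)
qed (rule smooth_family_open[OF assms(2)])

lemma smooth_family_carrier:
  assumes "lcs E" "lcs F" "smooth_family S E F U f" "s \<in> topspace S" "x \<in> U"
  shows "f s x \<in> carrier F"
proof -
  have "Ck S E F U 0 0 (\<lambda>s x v. f s x)" using assms(3) unfolding smooth_family_def by blast
  from Ck_carrier[OF assms(1,2) smooth_family_open[OF assms(3)] this assms(4,5), of "\<lambda>_. undefined"]
  show ?thesis by simp
qed

lemma smooth_family_pull:
  assumes "continuous_map S' S p" "smooth_family S E F U f"
  shows "smooth_family S' E F U (\<lambda>s. f (p s))"
  using assms Ck_pull[OF assms(1), where f="\<lambda>s x v. f s x"] by (simp add: smooth_family_def)

lemma smooth_family_bilinear:
  assumes E: "lcs E" and F1: "lcs F1" and F2: "lcs F2" and G: "lcs G"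
    and bc: "continuous_map (prod_topology (topo F1) (topo F2)) (topo G) (\<lambda>z. \<beta> (fst z) (snd z))"
    and b: "\<And>a b c. a \<in> carrier F1 \<Longrightarrow> b \<in> carrier F1 \<Longrightarrow> c \<in> carrier F2 \<Longrightarrow> \<beta> (a \<oplus>\<^bsub>F1\<^esub> b) c = \<beta> a c \<oplus>\<^bsub>G\<^esub> \<beta> b c"
    "\<And>a b c. a \<in> carrier F1 \<Longrightarrow> b \<in> carrier F2 \<Longrightarrow> c \<in> carrier F2 \<Longrightarrow> \<beta> a (b \<oplus>\<^bsub>F2\<^esub> c) = \<beta> a b \<oplus>\<^bsub>G\<^esub> \<beta> a c"
    "\<And>r a b. a \<in> carrier F1 \<Longrightarrow> b \<in> carrier F2 \<Longrightarrow> \<beta> (r \<odot>\<^bsub>F1\<^esub> a) b = r \<odot>\<^bsub>G\<^esub> \<beta> a b"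
    "\<And>r a b. a \<in> carrier F1 \<Longrightarrow> b \<in> carrier F2 \<Longrightarrow> \<beta> a (r \<odot>\<^bsub>F2\<^esub> b) = r \<odot>\<^bsub>G\<^esub> \<beta> a b"
    and f: "smooth_family S E F1 U f" and g: "smooth_family S E F2 U g"
  shows "smooth_family S E G U (\<lambda>s x. \<beta> (f s x) (g s x))"
  unfolding smooth_family_def
proof (intro conjI allI)
  fix k
  show "Ck S E G U k 0 (\<lambda>s x v. \<beta> (f s x) (g s x))"
    by (rule Ck_bilinear[OF E F1 F2 G smooth_family_open[OF f] bc b])
      (use f g in \<open>auto simp: smooth_family_def\<close>)
qed (rule smooth_family_open[OF f])

lemma smooth_family_add:
  assumes E: "lcs E" and F: "lcs F" and f: "smooth_family S E F U f" and g: "smooth_family S E F U g"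
  shows "smooth_family S E F U (\<lambda>s x. f s x \<oplus>\<^bsub>F\<^esub> g s x)"
  using f g Ck_add[OF E F smooth_family_open[OF f], of S _ 0 "\<lambda>s x v. f s x" "\<lambda>s x v. g s x"] by (simp add: smooth_family_def)

lemma smooth_family_postlin:
  assumes E: "lcs E" and F: "lcs F" and G: "lcs G"
    and L: "continuous_map (prod_topology S (topo F)) (topo G) (\<lambda>z. L (fst z) (snd z))"
    "\<And>s a b. s \<in> topspace S \<Longrightarrow> a \<in> carrier F \<Longrightarrow> b \<in> carrier F \<Longrightarrow> L s (a \<oplus>\<^bsub>F\<^esub> b) = L s a \<oplus>\<^bsub>G\<^esub> L s b"
    "\<And>s c a. s \<in> topspace S \<Longrightarrow> a \<in> carrier F \<Longrightarrow> L s (c \<odot>\<^bsub>F\<^esub> a) = c \<odot>\<^bsub>G\<^esub> L s a"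
    and f: "smooth_family S E F U f"
  shows "smooth_family S E G U (\<lambda>s x. L s (f s x))"
  unfolding smooth_family_def
proof (intro conjI allI)
  fix k
  show "Ck S E G U k 0 (\<lambda>s x v. L s (f s x))"
    by (rule Ck_postlin[OF E F G smooth_family_open[OF f] L])
      (use f in \<open>auto simp: smooth_family_def\<close>)
qed (rule smooth_family_open[OF f])

lemma smooth_family_fibre_linear:
  assumes E: "lcs E" and F: "lcs F" and G: "lcs G" and f: "smooth_family S E F U f"
    and H: "smooth_family (prod_topology S (topo F)) E G U H"
    "\<And>s x a b. s \<in> topspace S \<Longrightarrow> x \<in> U \<Longrightarrow> a \<in> carrier F \<Longrightarrow> b \<in> carrier F \<Longrightarrow>
        H (s, a \<oplus>\<^bsub>F\<^esub> b) x = H (s, a) x \<oplus>\<^bsub>G\<^esub> H (s, b) x"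
    "\<And>s x a c. s \<in> topspace S \<Longrightarrow> x \<in> U \<Longrightarrow> a \<in> carrier F \<Longrightarrow> H (s, c \<odot>\<^bsub>F\<^esub> a) x = c \<odot>\<^bsub>G\<^esub> H (s, a) x"
  shows "smooth_family S E G U (\<lambda>s x. H (s, f s x) x)"
  unfolding smooth_family_def
proof (intro conjI allI)
  fix k
  show "Ck S E G U k 0 (\<lambda>s x v. H (s, f s x) x)"
    by (rule Ck_fibre_linear[OF E F G smooth_family_open[OF f], where H="\<lambda>p x v. H p x"])
      (use f H in \<open>auto simp: smooth_family_def\<close>)
qed (rule smooth_family_open[OF f])

lemma smooth_family_affine:
  assumes E: "lcs E" and E': "lcs E'" and U': "openin (topo E') U'"
    and T: "continuous_map (prod_topology S (subtopology (topo E') U')) (topo E) (\<lambda>z. T (fst z) (snd z))"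
     "continuous_map (topo E') (topo E) L"
     "\<And>s x. s \<in> topspace S \<Longrightarrow> x \<in> U' \<Longrightarrow> T s x \<in> U"
     "\<And>s x t v. s \<in> topspace S \<Longrightarrow> x \<in> carrier E' \<Longrightarrow> v \<in> carrier E' \<Longrightarrow>
         T s (x \<oplus>\<^bsub>E'\<^esub> t \<odot>\<^bsub>E'\<^esub> v) = T s x \<oplus>\<^bsub>E\<^esub> t \<odot>\<^bsub>E\<^esub> L v"
    and f: "smooth_family S E F U f"
  shows "smooth_family S E' F U' (\<lambda>s x. f s (T s x))"
  unfolding smooth_family_def
proof (intro conjI allI)
  fix k
  show "Ck S E' F U' k 0 (\<lambda>s x v. f s (T s x))"
    by (rule Ck_affine[OF E E' smooth_family_open[OF f] U' T, where f="\<lambda>s x v. f s x"])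
      (use f in \<open>auto simp: smooth_family_def\<close>)
qed (rule U')

lemma smooth_family_pair:
  assumes E: "lcs E" and F: "lcs F" and G: "lcs G" and f: "smooth_family S E F U f" and g: "smooth_family S E G U g"
  shows "smooth_family S E (prod_tvs F G) U (\<lambda>s x. (f s x, g s x))"
  using f g Ck_pair[OF E F G smooth_family_open[OF f], of S _ 0 "\<lambda>s x v. f s x" "\<lambda>s x v. g s x"] by (simp add: smooth_family_def)

lemma smooth_family_const:
  assumes E: "lcs E" and F: "lcs F" and U: "openin (topo E) U" and c: "continuous_map S (topo F) c"
  shows "smooth_family S E F U (\<lambda>s x. c s)"
  using U Ck_const[OF E F U, of S 0 "\<lambda>s v. c s"] continuous_map_compose[OF continuous_map_fst c]
  by (auto simp: smooth_family_def o_def)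

lemma smooth_family_linear:
  assumes E: "lcs E" and F: "lcs F" and U: "openin (topo E) U"
    and L: "continuous_map (topo E) (topo F) L"
    "\<And>a b. a \<in> carrier E \<Longrightarrow> b \<in> carrier E \<Longrightarrow> L (a \<oplus>\<^bsub>E\<^esub> b) = L a \<oplus>\<^bsub>F\<^esub> L b"
    "\<And>c a. a \<in> carrier E \<Longrightarrow> L (c \<odot>\<^bsub>E\<^esub> a) = c \<odot>\<^bsub>F\<^esub> L a"
  shows "smooth_family S E F U (\<lambda>s. L)"
  unfolding smooth_family_def by (intro conjI allI U Ck_linear[OF E F U L])

lemma smooth_family_real_comp:
  fixes d :: "nat \<Rightarrow> real \<Rightarrow> real"
  assumes E: "lcs E"
    and d: "\<And>j t. t \<in> D \<Longrightarrow> (d j has_real_derivative d (Suc j) t) (at t)"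
    and f: "smooth_family S E scalars U f" "\<And>s x. s \<in> topspace S \<Longrightarrow> x \<in> U \<Longrightarrow> f s x \<in> D"
  shows "smooth_family S E scalars U (\<lambda>s x. d 0 (f s x))"
  unfolding smooth_family_def
proof (intro conjI allI)
  fix k
  have "Ck S E scalars U k 0 (\<lambda>s x v. f s x)" using f(1) unfolding smooth_family_def by blast
  then show "Ck S E scalars U k 0 (\<lambda>s x v. d 0 (f s x))"
    using Ck_real_comp[OF E smooth_family_open[OF f(1)], of D d S k 0 "\<lambda>s x v. f s x" 0] d f(2) by blast
qed (rule smooth_family_open[OF f(1)])

section \<open>Restriction and gluing of smooth families\<close>

lemma jet_subtopology:
  assumes "V \<subseteq> U"
  shows "jet_topology E V k = subtopology (jet_topology E U k) (V \<times> UNIV)"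
  using assms by (simp add: jet_topology_def subtopology_Times subtopology_subtopology Int_absorb1)

lemma smooth_family_subset:
  assumes E: "lcs E" and F: "lcs F" and f: "smooth_family S E F U f" and V: "openin (topo E) V" "V \<subseteq> U"
  shows "smooth_family S E F V f"
proof (rule smooth_familyI[OF E F V(1)])
  fix s k x v assume *: "s \<in> topspace S" "x \<in> V" "v \<in> dirs E (Suc k)"
  then show "\<exists>l. has_dder E F (\<lambda>y. dder E F (f s) k y v) x (v k) l"
    using smooth_familyD(2)[OF E F f *(1)] V unfolding smooth_on_def has_dder_def by blast
next
  fix k
  have "prod_topology S (jet_topology E V k) = subtopology (pjet S E U k) (UNIV \<times> (V \<times> UNIV))"
    by (simp add: jet_subtopology[OF V(2)] subtopology_Times)
  then show "continuous_map (prod_topology S (jet_topology E V k)) (topo F) (\<lambda>z. dder E F (f (fst z)) k (fst (snd z)) (snd (snd z)))"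
    using smooth_familyD(1)[OF E F f] by (simp add: continuous_map_from_subtopology)
qed

text \<open>\<open>dder\<close> does not mention a domain, so the derivatives over all pieces are
  one and the same function. Only its continuity has to be pasted, over the sets of jets with base
  point in \<open>V\<close>.\<close>

lemma smooth_family_local:
  assumes E: "lcs E" and F: "lcs F" and U: "openin (topo E) U"
    and loc: "\<And>x. x \<in> U \<Longrightarrow> \<exists>V. x \<in> V \<and> V \<subseteq> U \<and> smooth_family S E F V f"
  shows "smooth_family S E F U f"
proof (rule smooth_familyI[OF E F U])
  fix s k x v assume *: "s \<in> topspace S" "x \<in> U" "v \<in> dirs E (Suc k)"
  then obtain V where V: "x \<in> V" "smooth_family S E F V f" using loc by blast
  then show "\<exists>l. has_dder E F (\<lambda>y. dder E F (f s) k y v) x (v k) l"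
    using smooth_familyD(2)[OF E F V(2) *(1)] * unfolding smooth_on_def has_dder_def by blast
next
  fix k
  let ?X = "pjet S E U k"
  show "continuous_map ?X (topo F) (\<lambda>z. dder E F (f (fst z)) k (fst (snd z)) (snd (snd z)))"
  proof (rule pasting_lemma[where I="{V. V \<subseteq> U \<and> smooth_family S E F V f}" and T="\<lambda>V. topspace S \<times> (V \<times> (dirs E k))"
      and f="\<lambda>V z. dder E F (f (fst z)) k (fst (snd z)) (snd (snd z))"])
    fix V assume V: "V \<in> {V. V \<subseteq> U \<and> smooth_family S E F V f}"
    have oV: "openin (topo E) V" using V smooth_family_open by blast
    have te: "topspace (topo E) = carrier E" using lcs.topspace[OF E] .
    have "openin (product_topology (\<lambda>_. topo E) {..<k}) (dirs E k)"
      using openin_topspace[of "product_topology (\<lambda>_. topo E) {..<k}"] te by simp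
    then show "openin ?X (topspace S \<times> (V \<times> (dirs E k)))"
      using oV V U unfolding jet_topology_def by (auto simp: openin_prod_Times_iff openin_subtopology)
    have "V \<subseteq> U" using V by blast
    then have "subtopology ?X (topspace S \<times> (V \<times> (dirs E k))) = prod_topology S (jet_topology E V k)"
      using te subtopology_topspace[of "product_topology (\<lambda>_. topo E) {..<k}"]
      by (simp add: jet_topology_def subtopology_Times subtopology_subtopology Int_absorb1)
    then show "continuous_map (subtopology ?X (topspace S \<times> (V \<times> (dirs E k)))) (topo F) (\<lambda>z. dder E F (f (fst z)) k (fst (snd z)) (snd (snd z)))"
      using smooth_familyD(1)[OF E F] V by auto
  next
    fix z assume "z \<in> topspace ?X"
    then show "\<exists>V. V \<in> {V. V \<subseteq> U \<and> smooth_family S E F V f} \<and> z \<in> topspace S \<times> V \<times> (dirs E k) \<and>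
      dder E F (f (fst z)) k (fst (snd z)) (snd (snd z)) = dder E F (f (fst z)) k (fst (snd z)) (snd (snd z))"
      using loc[of "fst (snd z)"] unfolding topspace_prod_topology topspace_jet[OF E U] mem_Times_iff by blast
  qed simp
qed

section \<open>Iterated derivatives as linear functions of the map\<close>

lemma dder_cong:
  assumes E: "lcs E" and U: "openin (topo E) U" and eq: "\<And>y. y \<in> U \<Longrightarrow> f y = g y"
  shows "x \<in> U \<Longrightarrow> (\<And>i. i < k \<Longrightarrow> v i \<in> carrier E) \<Longrightarrow> dder E F f k x v = dder E F g k x v"
proof (induction k arbitrary: x)
  case (Suc k)
  have "has_dder E F (\<lambda>y. dder E F f k y v) x (v k) l \<longleftrightarrow> has_dder E F (\<lambda>y. dder E F g k y v) x (v k) l" for l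
    using has_dder_cong[OF E U Suc.prems(1), of "v k" "\<lambda>y. dder E F f k y v" "\<lambda>y. dder E F g k y v" F l]
     has_dder_cong[OF E U Suc.prems(1), of "v k" "\<lambda>y. dder E F g k y v" "\<lambda>y. dder E F f k y v" F l]
     Suc by fastforce
  then show ?case by (simp add: has_dder_def)
qed (use eq in auto)

lemma smooth_on_dder:
  assumes E: "lcs E" and F: "lcs F" and f: "smooth_on E F U f" and x: "x \<in> U" and v: "v \<in> dirs E k"
  shows "dder E F f k x v \<in> carrier F"
proof -
  have U: "openin (topo E) U" using f by (simp add: smooth_on_def)
  have "continuous_map (jet_topology E U k) (topo F) (\<lambda>(x, v). dder E F f k x v)" using f by (simp add: smooth_on_def)
  from lcs.cont_carrier[OF F this, of "(x, v)"] show ?thesis using x v by (simp add: topspace_jet[OF E U])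
qed

lemma smooth_on_has_dder:
  assumes E: "lcs E" and F: "lcs F" and f: "smooth_on E F U f" and x: "x \<in> U" and v: "v \<in> dirs E (Suc k)"
  shows "has_dder E F (\<lambda>y. dder E F f k y v) x (v k) (dder E F f (Suc k) x v)"
proof -
  obtain l where l: "has_dder E F (\<lambda>y. dder E F f k y v) x (v k) l"
    using f x v unfolding smooth_on_def has_dder_def by blast
  then show ?thesis using dder_eqI[OF F l] by simp
qed

text \<open>Applied to multiplication by a complex scalar this makes the jets of a function depend
  complex linearly on it, although the derivatives are real.\<close>

lemma dder_postlin:
  assumes E: "lcs E" and F: "lcs F" and G: "lcs G" and f: "smooth_on E F U f"
    and L: "continuous_map (topo F) (topo G) L"
    "\<And>a b. a \<in> carrier F \<Longrightarrow> b \<in> carrier F \<Longrightarrow> L (a \<oplus>\<^bsub>F\<^esub> b) = L a \<oplus>\<^bsub>G\<^esub> L b"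
    "\<And>c a. a \<in> carrier F \<Longrightarrow> L (c \<odot>\<^bsub>F\<^esub> a) = c \<odot>\<^bsub>G\<^esub> L a"
  shows "x \<in> U \<Longrightarrow> v \<in> dirs E k \<Longrightarrow> dder E G (\<lambda>y. L (f y)) k x v = L (dder E F f k x v)"
proof (induction k arbitrary: x v)
  case (Suc k x v)
  have U: "openin (topo E) U" using f by (simp add: smooth_on_def)
  have vk: "v k \<in> carrier E" using Suc.prems by auto
  note w = restrict_dirs[OF Suc.prems(2)]
  have "has_dder E G (\<lambda>y. L (dder E F f k y v)) x (v k) (L (dder E F f (Suc k) x v))"
    by (rule has_dder_linear[OF E F G U Suc.prems(1) vk _ L smooth_on_has_dder[OF E F f Suc.prems]])
      (use smooth_on_dder[OF E F f _ w, unfolded dder_restrict] in blast)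
  then have "has_dder E G (\<lambda>y. dder E G (\<lambda>y. L (f y)) k y v) x (v k) (L (dder E F f (Suc k) x v))"
    by (rule has_dder_cong[OF E U Suc.prems(1) vk, rotated]) (rule Suc.IH[OF _ w, unfolded dder_restrict, symmetric])
  from dder_eqI[OF G this] show ?case .
qed simp

lemma dder_add:
  assumes E: "lcs E" and F: "lcs F" and f: "smooth_on E F U f" and g: "smooth_on E F U g"
  shows "x \<in> U \<Longrightarrow> v \<in> dirs E k \<Longrightarrow> dder E F (\<lambda>y. f y \<oplus>\<^bsub>F\<^esub> g y) k x v = dder E F f k x v \<oplus>\<^bsub>F\<^esub> dder E F g k x v"
proof (induction k arbitrary: x v)
  case (Suc k x v)
  have U: "openin (topo E) U" using f by (simp add: smooth_on_def)
  have vk: "v k \<in> carrier E" using Suc.prems by auto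
  note w = restrict_dirs[OF Suc.prems(2)]
  have "has_dder E F (\<lambda>y. dder E F f k y v \<oplus>\<^bsub>F\<^esub> dder E F g k y v) x (v k) (dder E F f (Suc k) x v \<oplus>\<^bsub>F\<^esub> dder E F g (Suc k) x v)"
    by (rule has_dder_add[OF E F U Suc.prems(1) vk _ _ smooth_on_has_dder[OF E F f Suc.prems] smooth_on_has_dder[OF E F g Suc.prems]])
      (use smooth_on_dder[OF E F f _ w, unfolded dder_restrict] smooth_on_dder[OF E F g _ w, unfolded dder_restrict] in blast)+
  then have "has_dder E F (\<lambda>y. dder E F (\<lambda>y. f y \<oplus>\<^bsub>F\<^esub> g y) k y v) x (v k) (dder E F f (Suc k) x v \<oplus>\<^bsub>F\<^esub> dder E F g (Suc k) x v)"
    by (rule has_dder_cong[OF E U Suc.prems(1) vk, rotated]) (rule Suc.IH[OF _ w, unfolded dder_restrict, symmetric])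
  from dder_eqI[OF F this] show ?case .
qed simp

section \<open>Spaces of functions with the topology of compact convergence\<close>

text \<open>An abstract space of functions seen through the maps \<open>e j\<close>. For smooth
  functions \<open>j\<close> will consist of a chart and an order of differentiation, and
  \<open>X j\<close> will be a space of jets. The subbasis has arbitrary centres \<open>r\<close>,
  as in the topologies that it models.\<close>

locale function_space =
  fixes A :: "(complex, 'a) tvs" and B :: "(complex, 'b) tvs"
    and J :: "'j set" and X :: "'j \<Rightarrow> 'x topology" and e :: "'j \<Rightarrow> 'b \<Rightarrow> 'x \<Rightarrow> 'a"
  assumes A: "lc_space A"
    and X: "\<And>j. j \<in> J \<Longrightarrow> locally_compact_space (X j) \<and> Hausdorff_space (X j)"
    and e_cont: "\<And>j b. j \<in> J \<Longrightarrow> b \<in> carrier B \<Longrightarrow> continuous_map (X j) (topo A) (e j b)"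
    and topo_B: "topo B = topology_generated_by (insert (carrier B)
       {{b \<in> carrier B. \<forall>x\<in>K. e j b x \<ominus>\<^bsub>A\<^esub> e j r x \<in> W} |r j K W.
          r \<in> carrier B \<and> j \<in> J \<and> compactin (X j) K \<and> openin (topo A) W \<and> \<zero>\<^bsub>A\<^esub> \<in> W})"
    and mod_B: "Module.module (scalars :: (complex, complex) tvs) B"
    and e_add: "\<And>j b b' x. j \<in> J \<Longrightarrow> b \<in> carrier B \<Longrightarrow> b' \<in> carrier B \<Longrightarrow> x \<in> topspace (X j) \<Longrightarrow>
        e j (b \<oplus>\<^bsub>B\<^esub> b') x = e j b x \<oplus>\<^bsub>A\<^esub> e j b' x"
    and e_smult: "\<And>j b c x. j \<in> J \<Longrightarrow> b \<in> carrier B \<Longrightarrow> x \<in> topspace (X j) \<Longrightarrow>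
        e j (c \<odot>\<^bsub>B\<^esub> b) x = c \<odot>\<^bsub>A\<^esub> e j b x"
    and e_sep: "\<And>b b'. b \<in> carrier B \<Longrightarrow> b' \<in> carrier B \<Longrightarrow>
        (\<And>j x. j \<in> J \<Longrightarrow> x \<in> topspace (X j) \<Longrightarrow> e j b x = e j b' x) \<Longrightarrow> b = b'"
begin

sublocale A: lcs A by (rule lcs.intro[OF A])

sublocale B: abelian_group B using module_scalarsD(1)[OF mod_B] .

lemma e_carrier: "j \<in> J \<Longrightarrow> b \<in> carrier B \<Longrightarrow> x \<in> topspace (X j) \<Longrightarrow> e j b x \<in> carrier A"
  using A.cont_carrier[OF e_cont] .

lemma topspace_B: "topspace (topo B) = carrier B"
  unfolding topo_B topology_generated_by_topspace by auto

lemma open_basic: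
  assumes "r \<in> carrier B" "j \<in> J" "compactin (X j) K" "openin (topo A) W" "\<zero>\<^bsub>A\<^esub> \<in> W"
  shows "openin (topo B) {b \<in> carrier B. \<forall>x\<in>K. e j b x \<ominus>\<^bsub>A\<^esub> e j r x \<in> W}"
  unfolding topo_B by (rule topology_generated_by_Basis) (use assms in blast)

text \<open>For fixed \<open>s\<close> the open condition on pairs holds on
  \<open>{s} \<times> K\<close> with \<open>K\<close> compact; Wallace's theorem extends it to a
  neighbourhood of \<open>s\<close>.\<close>

lemma continuous_into:
  assumes F: "\<And>s. s \<in> topspace S \<Longrightarrow> F s \<in> carrier B"
    and c: "\<And>j. j \<in> J \<Longrightarrow> continuous_map (prod_topology S (X j)) (topo A) (\<lambda>z. e j (F (fst z)) (snd z))"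
  shows "continuous_map S (topo B) F"
  unfolding topo_B
proof (rule continuous_on_generated_topo)
  fix N assume "N \<in> insert (carrier B)
       {{b \<in> carrier B. \<forall>x\<in>K. e j b x \<ominus>\<^bsub>A\<^esub> e j r x \<in> W} |r j K W.
          r \<in> carrier B \<and> j \<in> J \<and> compactin (X j) K \<and> openin (topo A) W \<and> \<zero>\<^bsub>A\<^esub> \<in> W}"
  then consider "N = carrier B" | r j K W where "N = {b \<in> carrier B. \<forall>x\<in>K. e j b x \<ominus>\<^bsub>A\<^esub> e j r x \<in> W}"
     "r \<in> carrier B" "j \<in> J" "compactin (X j) K" "openin (topo A) W" by blast
  then show "openin S (F -` N \<inter> topspace S)"
  proof cases
    case 1
    then have "F -` N \<inter> topspace S = topspace S" using F by auto
    then show ?thesis by simp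
  next
    case 2
    let ?G = "{z \<in> topspace (prod_topology S (X j)). e j (F (fst z)) (snd z) \<ominus>\<^bsub>A\<^esub> e j r (snd z) \<in> W}"
    have "continuous_map (prod_topology S (X j)) (topo A) (\<lambda>z. e j (F (fst z)) (snd z) \<ominus>\<^bsub>A\<^esub> e j r (snd z))"
      by (intro A.cont_minus c 2(3) continuous_map_compose[OF continuous_map_snd e_cont, unfolded o_def] 2(2))
    then have oG: "openin (prod_topology S (X j)) ?G"
      using 2(5) by (rule openin_continuous_map_preimage)
    show ?thesis
    proof (subst openin_subopen, intro ballI)
      fix s assume "s \<in> F -` N \<inter> topspace S"
      then have s: "s \<in> topspace S" "{s} \<times> K \<subseteq> ?G"
        using 2 compactin_subset_topspace[OF 2(4)] by auto
      obtain C D where CD: "openin S C" "openin (X j) D" "{s} \<subseteq> C" "K \<subseteq> D" "C \<times> D \<subseteq> ?G"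
        using Wallace_theorem_prod_topology[of S "{s}" "X j" K ?G] s 2(4) oG by auto
      have "C \<subseteq> F -` N \<inter> topspace S"
      proof
        fix t assume t: "t \<in> C"
        then have ts: "t \<in> topspace S" using CD(1) openin_subset by blast
        have "\<forall>x\<in>K. (t, x) \<in> ?G" using t CD by blast
        then show "t \<in> F -` N \<inter> topspace S" using ts F 2(1) by auto
      qed
      then show "\<exists>T. openin S T \<and> s \<in> T \<and> T \<subseteq> F -` N \<inter> topspace S" using CD by blast
    qed
  qed
qed (use F in auto)

text \<open>Write \<open>e j b' y\<close> as \<open>e j b x\<close> plus the two errors
  \<open>e j b' y - e j b y\<close> and \<open>e j b y - e j b x\<close>. The first is small for
  \<open>b'\<close> in a subbasic set belonging to a compact neighbourhood of \<open>x\<close>, the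
  second by continuity of the single function \<open>e j b\<close>.\<close>

lemma continuous_eval:
  assumes j: "j \<in> J"
  shows "continuous_map (prod_topology (topo B) (X j)) (topo A) (\<lambda>z. e j (fst z) (snd z))"
  unfolding continuous_map_def
proof (intro conjI allI impI)
  show "(\<lambda>z. e j (fst z) (snd z)) \<in> topspace (prod_topology (topo B) (X j)) \<rightarrow> topspace (topo A)"
    using e_carrier[OF j] topspace_B by auto
  fix W0 assume W0: "openin (topo A) W0"
  let ?G = "{z \<in> topspace (prod_topology (topo B) (X j)). e j (fst z) (snd z) \<in> W0}"
  show "openin (prod_topology (topo B) (X j)) ?G"
  proof (subst openin_subopen, intro ballI)
    fix z assume "z \<in> ?G"
    then obtain b x where z: "z = (b, x)" and b: "b \<in> carrier B" and x: "x \<in> topspace (X j)" and bx: "e j b x \<in> W0"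
      using topspace_B by auto
    have "compactin (topo A) {e j b x}" using e_carrier[OF j b x] by simp
    then obtain W1 where W1: "openin (topo A) W1" "\<zero>\<^bsub>A\<^esub> \<in> W1" "\<And>y. y \<in> W1 \<Longrightarrow> y \<oplus>\<^bsub>A\<^esub> e j b x \<in> W0"
      using A.compact_add_nbhd[OF _ W0, of "{e j b x}"] bx by blast
    have "continuous_map (prod_topology (topo A) (topo A)) (topo A) (\<lambda>z. fst z \<oplus>\<^bsub>A\<^esub> snd z)"
      by (intro A.cont_add continuous_map_fst continuous_map_snd)
    from openin_continuous_map_preimage[OF this W1(1)]
    have o1: "openin (prod_topology (topo A) (topo A)) {z \<in> topspace (prod_topology (topo A) (topo A)). fst z \<oplus>\<^bsub>A\<^esub> snd z \<in> W1}" .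
    have "(\<zero>\<^bsub>A\<^esub>, \<zero>\<^bsub>A\<^esub>) \<in> {z \<in> topspace (prod_topology (topo A) (topo A)). fst z \<oplus>\<^bsub>A\<^esub> snd z \<in> W1}" using W1(2) by simp
    from o1[unfolded openin_prod_topology_alt, rule_format, OF this] obtain C D where CD: "openin (topo A) C" "openin (topo A) D" "\<zero>\<^bsub>A\<^esub> \<in> C" "\<zero>\<^bsub>A\<^esub> \<in> D"
       "C \<times> D \<subseteq> {z \<in> topspace (prod_topology (topo A) (topo A)). fst z \<oplus>\<^bsub>A\<^esub> snd z \<in> W1}"
      by blast
    have "continuous_map (X j) (topo A) (\<lambda>y. e j b y \<ominus>\<^bsub>A\<^esub> e j b x)"
      by (intro A.cont_minus e_cont j b) (simp add: e_carrier[OF j b x])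
    from openin_continuous_map_preimage[OF this CD(2)]
    have oY: "openin (X j) {y \<in> topspace (X j). e j b y \<ominus>\<^bsub>A\<^esub> e j b x \<in> D}" .
    have nb: "neighbourhood_base_of (compactin (X j)) (X j)"
      using X[OF j] locally_compact_space_neighbourhood_base[of "X j"] by blast
    have xY: "x \<in> {y \<in> topspace (X j). e j b y \<ominus>\<^bsub>A\<^esub> e j b x \<in> D}"
      using x CD(4) e_carrier[OF j b x] by (simp add: a_minus_def A.r_neg)
    from nb[unfolded neighbourhood_base_of, rule_format, OF conjI[OF oY xY]] obtain N K where NK: "openin (X j) N" "compactin (X j) K" "x \<in> N" "N \<subseteq> K"
       "K \<subseteq> {y \<in> topspace (X j). e j b y \<ominus>\<^bsub>A\<^esub> e j b x \<in> D}"
      by (elim exE conjE)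
    let ?M = "{b' \<in> carrier B. \<forall>x\<in>K. e j b' x \<ominus>\<^bsub>A\<^esub> e j b x \<in> C}"
    have oM: "openin (topo B) ?M" by (rule open_basic[OF b j NK(2) CD(1,3)])
    have "b \<in> ?M" using b CD(3) compactin_subset_topspace[OF NK(2)] e_carrier[OF j b]
      by (auto simp: a_minus_def A.r_neg)
    moreover have "?M \<times> N \<subseteq> ?G"
    proof
      fix w assume "w \<in> ?M \<times> N"
      then obtain b' y where w: "w = (b', y)" "b' \<in> carrier B" "y \<in> N" "e j b' y \<ominus>\<^bsub>A\<^esub> e j b y \<in> C" using NK by auto
      have y: "y \<in> topspace (X j)" "e j b y \<ominus>\<^bsub>A\<^esub> e j b x \<in> D" using NK w by auto
      note c = e_carrier[OF j b x] e_carrier[OF j b y(1)] e_carrier[OF j w(2) y(1)]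
      have "(e j b' y \<ominus>\<^bsub>A\<^esub> e j b y) \<oplus>\<^bsub>A\<^esub> (e j b y \<ominus>\<^bsub>A\<^esub> e j b x) \<in> W1" using CD(5) w y by auto
      then have "((e j b' y \<ominus>\<^bsub>A\<^esub> e j b y) \<oplus>\<^bsub>A\<^esub> (e j b y \<ominus>\<^bsub>A\<^esub> e j b x)) \<oplus>\<^bsub>A\<^esub> e j b x \<in> W0" using W1 by auto
      also have "((e j b' y \<ominus>\<^bsub>A\<^esub> e j b y) \<oplus>\<^bsub>A\<^esub> (e j b y \<ominus>\<^bsub>A\<^esub> e j b x)) \<oplus>\<^bsub>A\<^esub> e j b x = e j b' y"
        using c by (simp add: a_minus_def A.a_assoc A.l_neg A.r_neg1)
      finally show "w \<in> ?G" using w y topspace_B by auto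
    qed
    ultimately show "\<exists>T. openin (prod_topology (topo B) (X j)) T \<and> z \<in> T \<and> T \<subseteq> ?G"
      using oM NK(1,3) z by (intro exI[of _ "?M \<times> N"]) (auto simp: openin_prod_Times_iff)
  qed
qed

lemma continuous_eval_compose:
  assumes "j \<in> J" "continuous_map S (topo B) p" "continuous_map S (X j) q"
  shows "continuous_map S (topo A) (\<lambda>s. e j (p s) (q s))"
  using continuous_map_compose[OF continuous_map_pairedI[OF assms(2,3)] continuous_eval[OF assms(1)]]
  by (simp add: o_def)

lemma lc_space_B: "lc_space B"
  unfolding lc_space_def
proof (intro conjI allI impI)
  have f1: "continuous_map (prod_topology (prod_topology P Q) R) P (\<lambda>z. fst (fst z))"
    and f2: "continuous_map (prod_topology (prod_topology P Q) R) Q (\<lambda>z. snd (fst z))" for P Q R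
    by (intro continuous_map_compose[OF continuous_map_fst continuous_map_fst, unfolded o_def]
          continuous_map_compose[OF continuous_map_fst continuous_map_snd, unfolded o_def])+
  show "continuous_map (prod_topology (topo B) (topo B)) (topo B) (\<lambda>(x, y). x \<oplus>\<^bsub>B\<^esub> y)"
    unfolding case_prod_unfold
  proof (rule continuous_into)
    fix j assume j: "j \<in> J"
    have "continuous_map (prod_topology (prod_topology (topo B) (topo B)) (X j)) (topo A) (\<lambda>z. e j (fst (fst z)) (snd z) \<oplus>\<^bsub>A\<^esub> e j (snd (fst z)) (snd z))"
      by (intro A.cont_add continuous_eval_compose j f1 f2 continuous_map_snd)
    then show "continuous_map (prod_topology (prod_topology (topo B) (topo B)) (X j)) (topo A) (\<lambda>z. e j (fst (fst z) \<oplus>\<^bsub>B\<^esub> snd (fst z)) (snd z))"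
      by (rule continuous_map_eq) (use topspace_B in \<open>auto simp: e_add[OF j]\<close>)
  qed (simp add: topspace_B mem_Times_iff)
  show "continuous_map (prod_topology euclidean (topo B)) (topo B) (\<lambda>(c, y). c \<odot>\<^bsub>B\<^esub> y)"
    unfolding case_prod_unfold
  proof (rule continuous_into)
    fix j assume j: "j \<in> J"
    have "continuous_map (prod_topology (prod_topology euclidean (topo B)) (X j)) (topo A) (\<lambda>z. fst (fst z) \<odot>\<^bsub>A\<^esub> e j (snd (fst z)) (snd z))"
      by (intro A.cont_smult continuous_eval_compose j f1 f2 continuous_map_snd)
    then show "continuous_map (prod_topology (prod_topology euclidean (topo B)) (X j)) (topo A) (\<lambda>z. e j (fst (fst z) \<odot>\<^bsub>B\<^esub> snd (fst z)) (snd z))"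
      by (rule continuous_map_eq) (use topspace_B in \<open>auto simp: e_smult[OF j]\<close>)
  qed (simp add: topspace_B mem_Times_iff module_scalarsD(2)[OF mod_B])
  show "Hausdorff_space (topo B)"
    unfolding Hausdorff_space_def
  proof (intro allI impI, elim conjE)
    fix b b' assume b: "b \<in> topspace (topo B)" "b' \<in> topspace (topo B)" "b \<noteq> b'"
    then obtain j x where jx: "j \<in> J" "x \<in> topspace (X j)" "e j b x \<noteq> e j b' x"
      using e_sep topspace_B by metis
    have "e j b x \<in> topspace (topo A)" "e j b' x \<in> topspace (topo A)" using jx b topspace_B e_carrier by auto
    then obtain V W where VW: "openin (topo A) V" "openin (topo A) W" "e j b x \<in> V" "e j b' x \<in> W" "disjnt V W"
      using A.hausdorff jx(3) unfolding Hausdorff_space_def by metis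
    have "continuous_map (topo B) (topo A) (\<lambda>b. e j b x)"
      using jx by (intro continuous_eval_compose) auto
    from openin_continuous_map_preimage[OF this VW(1)] openin_continuous_map_preimage[OF this VW(2)]
    show "\<exists>U V. openin (topo B) U \<and> openin (topo B) V \<and> b \<in> U \<and> b' \<in> V \<and> disjnt U V"
      using VW b by (intro exI[of _ "{b \<in> topspace (topo B). e j b x \<in> V}"] exI[of _ "{b \<in> topspace (topo B). e j b x \<in> W}"]) (auto simp: disjnt_def)
  qed
  fix N assume "openin (topo B) N \<and> \<zero>\<^bsub>B\<^esub> \<in> N"
  then have gen: "generate_topology_on (insert (carrier B)
       {{b \<in> carrier B. \<forall>x\<in>K. e j b x \<ominus>\<^bsub>A\<^esub> e j r x \<in> W} |r j K W.
          r \<in> carrier B \<and> j \<in> J \<and> compactin (X j) K \<and> openin (topo A) W \<and> \<zero>\<^bsub>A\<^esub> \<in> W}) N" and N0: "\<zero>\<^bsub>B\<^esub> \<in> N"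
    unfolding topo_B openin_topology_generated_by_iff by auto
  define cvx where "cvx C \<longleftrightarrow> (\<forall>x\<in>C. \<forall>y\<in>C. \<forall>t\<in>{0..1}. (of_real t \<odot>\<^bsub>B\<^esub> x) \<oplus>\<^bsub>B\<^esub> (of_real (1 - t) \<odot>\<^bsub>B\<^esub> y) \<in> C)" for C
  have smB: "c \<odot>\<^bsub>B\<^esub> x \<in> carrier B" if "x \<in> carrier B" for c x using module_scalarsD(2)[OF mod_B that] .
  \<comment> \<open>Convex open zero neighbourhoods are found by induction over the generation of
    \<open>N\<close>: they are stable under intersection, and for a union one member containing zero
    suffices.\<close>
  have "\<exists>C. openin (topo B) C \<and> \<zero>\<^bsub>B\<^esub> \<in> C \<and> C \<subseteq> N \<and> cvx C"
    using gen N0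
  proof (induction rule: generate_topology_on.induct)
    case (Int a b)
    then obtain C D where "openin (topo B) C \<and> \<zero>\<^bsub>B\<^esub> \<in> C \<and> C \<subseteq> a \<and> cvx C" "openin (topo B) D \<and> \<zero>\<^bsub>B\<^esub> \<in> D \<and> D \<subseteq> b \<and> cvx D" by blast
    then show ?case by (intro exI[of _ "C \<inter> D"]) (auto simp: cvx_def)
  next
    case (UN K)
    then obtain k where k: "k \<in> K" "\<zero>\<^bsub>B\<^esub> \<in> k" by blast
    from UN.IH[OF k] k(1) show ?case by (meson Union_upper subset_trans)
  next
    case (Basis s)
    then consider "s = carrier B" | r j K W where "s = {b \<in> carrier B. \<forall>x\<in>K. e j b x \<ominus>\<^bsub>A\<^esub> e j r x \<in> W}"
     "r \<in> carrier B" "j \<in> J" "compactin (X j) K" "openin (topo A) W" by blast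
    then show ?case
    proof cases
      case 1
      have "openin (topo B) (carrier B)" using openin_topspace[of "topo B"] topspace_B by simp
      then show ?thesis using 1 smB by (intro exI[of _ "carrier B"]) (auto simp: cvx_def)
    next
      case 2
      have e0: "e j \<zero>\<^bsub>B\<^esub> x = \<zero>\<^bsub>A\<^esub>" if "x \<in> topspace (X j)" for x
        using e_smult[OF 2(3) B.zero_closed that, of 0] e_carrier[OF 2(3) B.zero_closed that] module_scalarsD(7)[OF mod_B B.zero_closed] by simp
      have Kt: "K \<subseteq> topspace (X j)" using compactin_subset_topspace[OF 2(4)] .
      \<comment> \<open>The centre \<open>r\<close> is arbitrary, so \<open>W\<close> has to be
        shrunk. Since zero lies in the subbasic set, the compact set of the values
        \<open>\<ominus> e j r x\<close> with \<open>x \<in> K\<close> lies in \<open>W\<close>, and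
        some zero neighbourhood can be added to it within \<open>W\<close>.\<close>
      have Km: "compactin (topo A) ((\<lambda>x. \<ominus>\<^bsub>A\<^esub> e j r x) ` K)"
        by (rule image_compactin[OF 2(4)]) (intro A.cont_neg e_cont 2)
      have KW: "(\<lambda>x. \<ominus>\<^bsub>A\<^esub> e j r x) ` K \<subseteq> W"
      proof (rule image_subsetI)
        fix x assume x: "x \<in> K"
        then have "e j \<zero>\<^bsub>B\<^esub> x \<ominus>\<^bsub>A\<^esub> e j r x \<in> W" using 2(1) Basis.prems by blast
        then show "\<ominus>\<^bsub>A\<^esub> e j r x \<in> W" using e0 x Kt e_carrier[OF 2(3,2)] by (auto simp: a_minus_def)
      qed
      obtain W1 where W1: "openin (topo A) W1" "\<zero>\<^bsub>A\<^esub> \<in> W1" "\<And>x y. x \<in> (\<lambda>x. \<ominus>\<^bsub>A\<^esub> e j r x) ` K \<Longrightarrow> y \<in> W1 \<Longrightarrow> y \<oplus>\<^bsub>A\<^esub> x \<in> W"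
        using A.compact_add_nbhd[OF Km 2(5) KW] by blast
      obtain C where C: "openin (topo A) C" "\<zero>\<^bsub>A\<^esub> \<in> C" "C \<subseteq> W1"
         "\<forall>x\<in>C. \<forall>y\<in>C. \<forall>t\<in>{0..1}. (of_real t \<odot>\<^bsub>A\<^esub> x) \<oplus>\<^bsub>A\<^esub> (of_real (1 - t) \<odot>\<^bsub>A\<^esub> y) \<in> C"
        using A.convex_nbhd[OF W1(1,2)] by blast
      let ?D = "{b \<in> carrier B. \<forall>x\<in>K. e j b x \<in> C}"
      have "\<ominus>\<^bsub>A\<^esub> \<zero>\<^bsub>A\<^esub> = \<zero>\<^bsub>A\<^esub>" by (rule A.minus_equality) auto
      then have "e j b x \<ominus>\<^bsub>A\<^esub> e j \<zero>\<^bsub>B\<^esub> x = e j b x" if "b \<in> carrier B" "x \<in> K" for b x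
        using that Kt e0 e_carrier[OF 2(3)] by (auto simp: a_minus_def subset_iff)
      then have "?D = {b \<in> carrier B. \<forall>x\<in>K. e j b x \<ominus>\<^bsub>A\<^esub> e j \<zero>\<^bsub>B\<^esub> x \<in> C}"
        by auto
      then have "openin (topo B) ?D" using open_basic[OF B.zero_closed 2(3,4) C(1,2)] by simp
      moreover have "\<zero>\<^bsub>B\<^esub> \<in> ?D" using e0 Kt C(2) by (auto simp: subset_iff)
      moreover have "cvx ?D"
        unfolding cvx_def using C(4) smB Kt by (auto simp: e_add[OF 2(3)] e_smult[OF 2(3)] subset_iff)
      moreover have "?D \<subseteq> s"
        unfolding 2(1) using C(3) W1(3) by (auto simp: a_minus_def)
      ultimately show ?thesis by blast
    qed
  qed simp
  then show "\<exists>C. openin (topo B) C \<and> \<zero>\<^bsub>B\<^esub> \<in> C \<and> C \<subseteq> N \<and>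
          (\<forall>x\<in>C. \<forall>y\<in>C. \<forall>t\<in>{0..1}. (of_real t \<odot>\<^bsub>B\<^esub> x) \<oplus>\<^bsub>B\<^esub> (of_real (1 - t) \<odot>\<^bsub>B\<^esub> y) \<in> C)"
    unfolding cvx_def .
qed (rule mod_B topspace_B)+

end

section \<open>Algebras with pointwise operations, and topological algebras of smooth
  functions\<close>

lemma unital_algebraD:
  assumes "unital_algebra A"
  shows "ring A" "Module.module (scalars :: (complex, complex) tvs) A"
    "\<And>c x y. x \<in> carrier A \<Longrightarrow> y \<in> carrier A \<Longrightarrow> (c \<odot>\<^bsub>A\<^esub> x) \<otimes>\<^bsub>A\<^esub> y = c \<odot>\<^bsub>A\<^esub> (x \<otimes>\<^bsub>A\<^esub> y)"
    "\<And>c x y. x \<in> carrier A \<Longrightarrow> y \<in> carrier A \<Longrightarrow> x \<otimes>\<^bsub>A\<^esub> (c \<odot>\<^bsub>A\<^esub> y) = c \<odot>\<^bsub>A\<^esub> (x \<otimes>\<^bsub>A\<^esub> y)"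
  using assms by (auto simp: unital_algebra_def)

text \<open>The axioms are identities, hence can be tested under the separating evaluations
  \<open>ev x\<close>, whose target \<open>F x\<close> may vary with the point as the fibre of a
  bundle does. Negatives are obtained as multiples by \<open>- 1\<close>.\<close>

lemma unital_algebra_pointwise:
  assumes alg: "\<And>x. x \<in> X \<Longrightarrow> unital_algebra (F x)"
    and ev: "\<And>x b. x \<in> X \<Longrightarrow> b \<in> carrier B \<Longrightarrow> ev x b \<in> carrier (F x)"
    and sep: "\<And>b b'. b \<in> carrier B \<Longrightarrow> b' \<in> carrier B \<Longrightarrow> (\<And>x. x \<in> X \<Longrightarrow> ev x b = ev x b') \<Longrightarrow> b = b'"
    and add: "\<And>b b'. b \<in> carrier B \<Longrightarrow> b' \<in> carrier B \<Longrightarrow> b \<oplus>\<^bsub>B\<^esub> b' \<in> carrier B"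
      "\<And>x b b'. x \<in> X \<Longrightarrow> b \<in> carrier B \<Longrightarrow> b' \<in> carrier B \<Longrightarrow> ev x (b \<oplus>\<^bsub>B\<^esub> b') = ev x b \<oplus>\<^bsub>F x\<^esub> ev x b'"
    and mult: "\<And>b b'. b \<in> carrier B \<Longrightarrow> b' \<in> carrier B \<Longrightarrow> b \<otimes>\<^bsub>B\<^esub> b' \<in> carrier B"
      "\<And>x b b'. x \<in> X \<Longrightarrow> b \<in> carrier B \<Longrightarrow> b' \<in> carrier B \<Longrightarrow> ev x (b \<otimes>\<^bsub>B\<^esub> b') = ev x b \<otimes>\<^bsub>F x\<^esub> ev x b'"
    and smult: "\<And>c b. b \<in> carrier B \<Longrightarrow> c \<odot>\<^bsub>B\<^esub> b \<in> carrier B"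
      "\<And>x c b. x \<in> X \<Longrightarrow> b \<in> carrier B \<Longrightarrow> ev x (c \<odot>\<^bsub>B\<^esub> b) = c \<odot>\<^bsub>F x\<^esub> ev x b"
    and one: "\<one>\<^bsub>B\<^esub> \<in> carrier B" "\<And>x. x \<in> X \<Longrightarrow> ev x \<one>\<^bsub>B\<^esub> = \<one>\<^bsub>F x\<^esub>"
    and zero: "\<zero>\<^bsub>B\<^esub> \<in> carrier B" "\<And>x. x \<in> X \<Longrightarrow> ev x \<zero>\<^bsub>B\<^esub> = \<zero>\<^bsub>F x\<^esub>"
  shows "unital_algebra B"
proof -
  note R = unital_algebraD(1)[OF alg] and M = unital_algebraD(2)[OF alg]
  have ag: "abelian_group (F x)" if "x \<in> X" for x using ring.is_abelian_group[OF R[OF that]] .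
  have am: "abelian_monoid (F x)" if "x \<in> X" for x using abelian_group.axioms(1)[OF ag[OF that]] .
  have mo: "Group.monoid (F x)" if "x \<in> X" for x using ring.is_monoid[OF R[OF that]] .
  note fs = ev add mult smult one zero
  have AG: "abelian_group B"
  proof (rule abelian_groupI)
    fix b assume b: "b \<in> carrier B"
    have "(- 1) \<odot>\<^bsub>B\<^esub> b \<oplus>\<^bsub>B\<^esub> b = \<zero>\<^bsub>B\<^esub>"
    proof (rule sep)
      fix x assume x: "x \<in> X"
      have "((- 1) + 1) \<odot>\<^bsub>F x\<^esub> ev x b = \<zero>\<^bsub>F x\<^esub>"
        using module_scalarsD(7)[OF M[OF x] ev[OF x b]] by simp
      then show "ev x ((- 1) \<odot>\<^bsub>B\<^esub> b \<oplus>\<^bsub>B\<^esub> b) = ev x \<zero>\<^bsub>B\<^esub>"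
        using module_scalarsD(3)[OF M[OF x] ev[OF x b], of "- 1" 1] x b module_scalarsD(6)[OF M[OF x] ev[OF x b]]
        by (simp add: fs)
    qed (use b fs in auto)
    then show "\<exists>y\<in>carrier B. y \<oplus>\<^bsub>B\<^esub> b = \<zero>\<^bsub>B\<^esub>" using b fs by blast
  next
    fix a b c assume "a \<in> carrier B" "b \<in> carrier B" "c \<in> carrier B"
    then show "a \<oplus>\<^bsub>B\<^esub> b \<oplus>\<^bsub>B\<^esub> c = a \<oplus>\<^bsub>B\<^esub> (b \<oplus>\<^bsub>B\<^esub> c)"
      by (intro sep) (auto simp: fs abelian_monoid.a_assoc[OF am])
  next
    fix a b assume "a \<in> carrier B" "b \<in> carrier B"
    then show "a \<oplus>\<^bsub>B\<^esub> b = b \<oplus>\<^bsub>B\<^esub> a"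
      by (intro sep) (auto simp: fs abelian_monoid.a_comm[OF am])
  next
    fix a assume "a \<in> carrier B"
    then show "\<zero>\<^bsub>B\<^esub> \<oplus>\<^bsub>B\<^esub> a = a"
      by (intro sep) (auto simp: fs abelian_monoid.l_zero[OF am])
  qed (auto simp: fs)
  have MO: "Group.monoid B"
    by (rule monoidI; (intro sep)?)
      (auto simp: fs Group.monoid.m_assoc[OF mo] Group.monoid.l_one[OF mo] Group.monoid.r_one[OF mo])
  have distr: "(a \<oplus>\<^bsub>F x\<^esub> b) \<otimes>\<^bsub>F x\<^esub> c = a \<otimes>\<^bsub>F x\<^esub> c \<oplus>\<^bsub>F x\<^esub> b \<otimes>\<^bsub>F x\<^esub> c"
     "c \<otimes>\<^bsub>F x\<^esub> (a \<oplus>\<^bsub>F x\<^esub> b) = c \<otimes>\<^bsub>F x\<^esub> a \<oplus>\<^bsub>F x\<^esub> c \<otimes>\<^bsub>F x\<^esub> b"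
    if "x \<in> X" "a \<in> carrier (F x)" "b \<in> carrier (F x)" "c \<in> carrier (F x)" for x a b c
  proof -
    interpret ring "F x" by (rule R[OF that(1)])
    show "(a \<oplus>\<^bsub>F x\<^esub> b) \<otimes>\<^bsub>F x\<^esub> c = a \<otimes>\<^bsub>F x\<^esub> c \<oplus>\<^bsub>F x\<^esub> b \<otimes>\<^bsub>F x\<^esub> c"
      "c \<otimes>\<^bsub>F x\<^esub> (a \<oplus>\<^bsub>F x\<^esub> b) = c \<otimes>\<^bsub>F x\<^esub> a \<oplus>\<^bsub>F x\<^esub> c \<otimes>\<^bsub>F x\<^esub> b"
      using that by (simp_all add: l_distr r_distr)
  qed
  have "ring B"
    by (rule ringI[OF AG MO]; intro sep) (auto simp: fs distr)
  moreover have "Module.module (scalars :: (complex, complex) tvs) B"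
    by (rule module_scalarsI[OF AG]; (intro sep)?)
      (auto simp: fs module_scalarsD(3)[OF M] module_scalarsD(4)[OF M] module_scalarsD(5)[OF M] module_scalarsD(6)[OF M])
  moreover have "(c \<odot>\<^bsub>B\<^esub> x) \<otimes>\<^bsub>B\<^esub> y = c \<odot>\<^bsub>B\<^esub> (x \<otimes>\<^bsub>B\<^esub> y)" "x \<otimes>\<^bsub>B\<^esub> (c \<odot>\<^bsub>B\<^esub> y) = c \<odot>\<^bsub>B\<^esub> (x \<otimes>\<^bsub>B\<^esub> y)"
    if "x \<in> carrier B" "y \<in> carrier B" for c x y
    by (intro sep; use that in \<open>auto simp: fs unital_algebraD(3,4)[OF alg]\<close>)+
  ultimately show ?thesis by (simp add: unital_algebra_def)
qed

locale lca =
  fixes A :: "(complex, 'a) tvs" (structure)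
  assumes lca: "lc_algebra A"
begin

lemma ua: "unital_algebra A" using lca by (simp add: lc_algebra_def)

sublocale lcs A
  by unfold_locales (use lca in \<open>simp add: lc_algebra_def\<close>)

sublocale ring A using unital_algebraD(1)[OF ua] .

lemmas smult_mult_left = unital_algebraD(3)[OF ua]
lemmas smult_mult_right = unital_algebraD(4)[OF ua]

lemma cont_mult0: "continuous_map (prod_topology (topo A) (topo A)) (topo A) (\<lambda>(x, y). x \<otimes> y)"
  using lca by (simp add: lc_algebra_def)

lemma cont_mult:
  assumes "continuous_map X (topo A) f" "continuous_map X (topo A) g"
  shows "continuous_map X (topo A) (\<lambda>x. f x \<otimes> g x)"
  using continuous_map_compose[OF continuous_map_pairedI[OF assms] cont_mult0] by (simp add: o_def)

lemma real_lcs: "lcs (real_tvs A)"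
  by (rule lcs_real_tvs[OF lc])

lemma smooth_family_mult:
  assumes E: "lcs E" and f: "smooth_family S E (real_tvs A) U f" and g: "smooth_family S E (real_tvs A) U g"
  shows "smooth_family S E (real_tvs A) U (\<lambda>s x. f s x \<otimes> g s x)"
  by (rule smooth_family_bilinear[OF E real_lcs real_lcs real_lcs _ _ _ _ _ f g])
    (auto simp: l_distr r_distr smult_mult_left smult_mult_right intro: cont_mult continuous_map_fst continuous_map_snd)

lemma smooth_family_smult:
  assumes E: "lcs E" and f: "smooth_family S E (real_tvs A) U f" and c: "continuous_map S euclidean c"
  shows "smooth_family S E (real_tvs A) U (\<lambda>s x. c s \<odot> f s x)"
proof (rule smooth_family_postlin[OF E real_lcs real_lcs _ _ _ f])
  show "continuous_map (prod_topology S (topo (real_tvs A))) (topo (real_tvs A)) (\<lambda>z. c (fst z) \<odot> snd z)"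
    using continuous_map_compose[OF continuous_map_fst c] by (auto simp: o_def intro!: cont_smult continuous_map_snd)
qed (auto simp: smult_rdistr smult_assoc[symmetric] mult.commute)

end

text \<open>Covers two algebras: smooth curves, with one global representative, and sections, with
  one representative for each pair of a bundle chart and a chart of the base.\<close>

locale smooth_function_space =
  fixes A :: "(complex, 'a) tvs" and B :: "(complex, 'b) tvs" and E :: "(real, 'v) tvs"
    and P :: "'p set" and D :: "'p \<Rightarrow> 'v set" and R :: "'p \<Rightarrow> 'b \<Rightarrow> 'v \<Rightarrow> 'a"
  assumes A: "lc_algebra A" and E: "lcs E" and E_lc: "locally_compact_space (topo E)"
    and D: "\<And>p. p \<in> P \<Longrightarrow> openin (topo E) (D p)"
    and R_smooth: "\<And>p b. p \<in> P \<Longrightarrow> b \<in> carrier B \<Longrightarrow> smooth_on E (real_tvs A) (D p) (R p b)"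
    and topo_B: "topo B = topology_generated_by (insert (carrier B)
       {{b \<in> carrier B. dclose E (real_tvs A) k K W (R p b) (R p r)} |r p k K W.
          r \<in> carrier B \<and> p \<in> P \<and> compactin (jet_topology E (D p) k) K \<and> openin (topo A) W \<and> \<zero>\<^bsub>A\<^esub> \<in> W})"
    and alg_B: "unital_algebra B"
    and R_add: "\<And>p b b' x. p \<in> P \<Longrightarrow> b \<in> carrier B \<Longrightarrow> b' \<in> carrier B \<Longrightarrow> x \<in> D p \<Longrightarrow>
        R p (b \<oplus>\<^bsub>B\<^esub> b') x = R p b x \<oplus>\<^bsub>A\<^esub> R p b' x"
    and R_mult: "\<And>p b b' x. p \<in> P \<Longrightarrow> b \<in> carrier B \<Longrightarrow> b' \<in> carrier B \<Longrightarrow> x \<in> D p \<Longrightarrow>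
        R p (b \<otimes>\<^bsub>B\<^esub> b') x = R p b x \<otimes>\<^bsub>A\<^esub> R p b' x"
    and R_smult: "\<And>p b c x. p \<in> P \<Longrightarrow> b \<in> carrier B \<Longrightarrow> x \<in> D p \<Longrightarrow>
        R p (c \<odot>\<^bsub>B\<^esub> b) x = c \<odot>\<^bsub>A\<^esub> R p b x"
    and R_sep: "\<And>b b'. b \<in> carrier B \<Longrightarrow> b' \<in> carrier B \<Longrightarrow>
        (\<And>p x. p \<in> P \<Longrightarrow> x \<in> D p \<Longrightarrow> R p b x = R p b' x) \<Longrightarrow> b = b'"
begin

abbreviation jets where "jets \<equiv> (\<lambda>(p, k). jet_topology E (D p) k)"

abbreviation jet_val where "jet_val \<equiv> (\<lambda>(p, k) b (x, v). dder E (real_tvs A) (R p b) k x v)"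

interpretation A: lca A by (rule lca.intro[OF A])

interpretation E: lcs E by (rule E)

text \<open>The evaluation with index \<open>(p, k)\<close> is the \<open>k\<close>-th derivative of
  the representative in \<open>p\<close>. Uniform convergence of derivatives on compact sets thus
  becomes compact convergence on jet spaces.\<close>

lemma function_space: "function_space A B (P \<times> UNIV) jets
   jet_val"
proof (rule function_space.intro)
  show "lc_space A" using A by (simp add: lc_algebra_def)
next
  fix j :: "'p \<times> nat" assume "j \<in> P \<times> UNIV"
  then obtain p k where j: "j = (p, k)" "p \<in> P" by auto
  \<comment> \<open>An open part of \<open>E\<close> times a finite power of \<open>E\<close>; this
    is where local compactness of the model space enters.\<close>
  have "locally_compact_space (jet_topology E (D p) k)"
    unfolding jet_topology_def locally_compact_space_prod_topology locally_compact_space_product_topology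
    using E_lc locally_compact_space_open_subset[OF _ E_lc D[OF j(2)]] E.hausdorff by auto
  moreover have "Hausdorff_space (jet_topology E (D p) k)"
    unfolding jet_topology_def Hausdorff_space_prod_topology Hausdorff_space_product_topology
    using E.hausdorff Hausdorff_space_subtopology by auto
  ultimately show "locally_compact_space (jets j) \<and> Hausdorff_space (jets j)"
    using j by simp
next
  fix j :: "'p \<times> nat" and b assume "j \<in> P \<times> UNIV" "b \<in> carrier B"
  then show "continuous_map (jets j) (topo A) (jet_val j b)"
    using R_smooth unfolding smooth_on_def by (auto simp: case_prod_unfold)
next
  show "topo B = topology_generated_by (insert (carrier B)
       {{b \<in> carrier B. \<forall>x\<in>K. jet_val j b x \<ominus>\<^bsub>A\<^esub> jet_val j r x \<in> W} |r j K W.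
          r \<in> carrier B \<and> j \<in> P \<times> UNIV \<and> compactin (jets j) K \<and> openin (topo A) W \<and> \<zero>\<^bsub>A\<^esub> \<in> W})"
    unfolding topo_B dclose_def
    by (rule arg_cong[where f="\<lambda>S. topology_generated_by (insert (carrier B) S)"]) (auto simp: case_prod_unfold)
next
  show "Module.module (scalars :: (complex, complex) tvs) B" using unital_algebraD(2)[OF alg_B] .
next
  fix j :: "'p \<times> nat" and b b' x
  assume *: "j \<in> P \<times> UNIV" "b \<in> carrier B" "b' \<in> carrier B" "x \<in> topspace (jets j)"
  obtain p k y v where j: "j = (p, k)" "p \<in> P" "x = (y, v)" using * by (metis SigmaE prod.exhaust)
  have y: "y \<in> D p" "v \<in> dirs E k" using * j by (auto simp: topspace_jet[OF E D])
  have "dder E (real_tvs A) (R p (b \<oplus>\<^bsub>B\<^esub> b')) k y v = dder E (real_tvs A) (\<lambda>x. R p b x \<oplus>\<^bsub>real_tvs A\<^esub> R p b' x) k y v"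
    by (rule dder_cong[OF E D[OF j(2)]]) (use * j y R_add in auto)
  also have "\<dots> = dder E (real_tvs A) (R p b) k y v \<oplus>\<^bsub>A\<^esub> dder E (real_tvs A) (R p b') k y v"
    using dder_add[OF E A.real_lcs R_smooth[OF j(2) *(2)] R_smooth[OF j(2) *(3)] y] by simp
  finally show "jet_val j (b \<oplus>\<^bsub>B\<^esub> b') x =
     jet_val j b x \<oplus>\<^bsub>A\<^esub> jet_val j b' x"
    using j by simp
next
  fix j :: "'p \<times> nat" and b c x
  assume *: "j \<in> P \<times> UNIV" "b \<in> carrier B" "x \<in> topspace (jets j)"
  obtain p k y v where j: "j = (p, k)" "p \<in> P" "x = (y, v)" using * by (metis SigmaE prod.exhaust)
  have y: "y \<in> D p" "v \<in> dirs E k" using * j by (auto simp: topspace_jet[OF E D])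
  have "dder E (real_tvs A) (R p (c \<odot>\<^bsub>B\<^esub> b)) k y v = dder E (real_tvs A) (\<lambda>x. c \<odot>\<^bsub>A\<^esub> R p b x) k y v"
    by (rule dder_cong[OF E D[OF j(2)]]) (use * j y R_smult in auto)
  also have "\<dots> = c \<odot>\<^bsub>A\<^esub> dder E (real_tvs A) (R p b) k y v"
    by (rule dder_postlin[OF E A.real_lcs A.real_lcs R_smooth[OF j(2) *(2)] _ _ _ y])
      (auto simp: A.smult_rdistr A.smult_assoc[symmetric] mult.commute intro: A.cont_smult)
  finally show "jet_val j (c \<odot>\<^bsub>B\<^esub> b) x =
     c \<odot>\<^bsub>A\<^esub> jet_val j b x"
    using j by simp
next
  fix b b' assume *: "b \<in> carrier B" "b' \<in> carrier B"
    "\<And>j x. j \<in> P \<times> UNIV \<Longrightarrow> x \<in> topspace (jets j) \<Longrightarrow>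
      jet_val j b x = jet_val j b' x"
  show "b = b'"
  proof (rule R_sep[OF *(1,2)])
    fix p x assume p: "p \<in> P" "x \<in> D p"
    then show "R p b x = R p b' x" using *(3)[of "(p, 0)" "(x, \<lambda>_. undefined)"] by (simp add: topspace_jet[OF E D])
  qed
qed

text \<open>The universal family: the parameter is the function itself. An operation on
  \<open>B\<close> is continuous as soon as the corresponding operation on this family gives a
  smooth family, by \<open>smooth_into\<close>.\<close>

lemma smooth_eval:
  assumes p: "p \<in> P"
  shows "smooth_family (topo B) E (real_tvs A) (D p) (R p)"
proof (rule smooth_familyI[OF E A.real_lcs D[OF p]])
  fix s k x v assume *: "s \<in> topspace (topo B)" "x \<in> D p" "v \<in> dirs E (Suc k)"
  have "s \<in> carrier B" using * function_space.topspace_B[OF function_space] by simp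
  then show "\<exists>l. has_dder E (real_tvs A) (\<lambda>y. dder E (real_tvs A) (R p s) k y v) x (v k) l"
    using smooth_on_has_dder[OF E A.real_lcs R_smooth[OF p] *(2,3)] by blast
next
  fix k show "continuous_map (prod_topology (topo B) (jet_topology E (D p) k)) (topo (real_tvs A)) (\<lambda>z. dder E (real_tvs A) (R p (fst z)) k (fst (snd z)) (snd (snd z)))"
    using function_space.continuous_eval[OF function_space, of "(p, k)"] p by (simp add: case_prod_unfold)
qed

lemma smooth_into:
  assumes F: "\<And>s. s \<in> topspace S \<Longrightarrow> F s \<in> carrier B"
    and sm: "\<And>p. p \<in> P \<Longrightarrow> smooth_family S E (real_tvs A) (D p) (\<lambda>s. R p (F s))"
  shows "continuous_map S (topo B) F"
proof (rule function_space.continuous_into[OF function_space F])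
  fix j :: "'p \<times> nat" assume "j \<in> P \<times> UNIV"
  then obtain p k where j: "j = (p, k)" "p \<in> P" by auto
  show "continuous_map (prod_topology S (jets j)) (topo A) (\<lambda>z. jet_val j (F (fst z)) (snd z))"
    using smooth_familyD(1)[OF E A.real_lcs sm[OF j(2)], of k] j by (simp add: case_prod_unfold)
qed

lemma topspace_B: "topspace (topo B) = carrier B"
  using function_space.topspace_B[OF function_space] .

lemma lc_algebra_B: "lc_algebra B"
  unfolding lc_algebra_def
proof (intro conjI)
  interpret B: ring B using unital_algebraD(1)[OF alg_B] .
  show "unital_algebra B" by (rule alg_B)
  show "lc_space B" using function_space.lc_space_B[OF function_space] .
  show "continuous_map (prod_topology (topo B) (topo B)) (topo B) (\<lambda>(x, y). x \<otimes>\<^bsub>B\<^esub> y)"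
  proof (rule smooth_into)
    fix p assume p: "p \<in> P"
    have "smooth_family (prod_topology (topo B) (topo B)) E (real_tvs A) (D p) (\<lambda>s x. R p (fst s) x \<otimes>\<^bsub>A\<^esub> R p (snd s) x)"
      using smooth_eval[OF p] by (intro A.smooth_family_mult E smooth_family_pull[OF continuous_map_fst] smooth_family_pull[OF continuous_map_snd])
    then show "smooth_family (prod_topology (topo B) (topo B)) E (real_tvs A) (D p) (\<lambda>s. R p (case s of (x, y) \<Rightarrow> x \<otimes>\<^bsub>B\<^esub> y))"
      by (rule smooth_family_cong[OF E]) (use R_mult[OF p] topspace_B in auto)
  qed (use topspace_B in auto)
qed

end

section \<open>The algebra of smooth curves\<close>

lemma smooth_curve_algebra_simps [simp]:
  "carrier (smooth_curve_algebra A) = smooth_curves A"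
  "mult (smooth_curve_algebra A) f h = (\<lambda>t. f t \<otimes>\<^bsub>A\<^esub> h t)" "one (smooth_curve_algebra A) = (\<lambda>t. \<one>\<^bsub>A\<^esub>)"
  "ring.zero (smooth_curve_algebra A) = (\<lambda>t. \<zero>\<^bsub>A\<^esub>)"
  "add (smooth_curve_algebra A) f h = (\<lambda>t. f t \<oplus>\<^bsub>A\<^esub> h t)"
  "smult (smooth_curve_algebra A) c f = (\<lambda>t. c \<odot>\<^bsub>A\<^esub> f t)"
  by (simp_all add: smooth_curve_algebra_def)

context lca begin

lemma smooth_curves_iff: "f \<in> smooth_curves A \<longleftrightarrow> smooth_family (discrete_topology {()}) scalars (real_tvs A) UNIV (\<lambda>_. f)"
  unfolding smooth_curves_def using smooth_on_iff_family[OF lcs_scalars real_lcs] by blast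

lemma smooth_curves_carrier: "f \<in> smooth_curves A \<Longrightarrow> f t \<in> carrier A"
  using smooth_family_carrier[OF lcs_scalars real_lcs, of "discrete_topology {()}" UNIV "\<lambda>_. f" "()" t] smooth_curves_iff by auto

lemma smooth_curves_const: "a \<in> carrier A \<Longrightarrow> (\<lambda>t. a) \<in> smooth_curves A"
  unfolding smooth_curves_iff by (intro smooth_family_const[OF lcs_scalars real_lcs]) auto

lemma smooth_curve_space:
  "smooth_function_space A (smooth_curve_algebra A) scalars {()} (\<lambda>_. UNIV) (\<lambda>_ f. f)"
proof (rule smooth_function_space.intro)
  show "lc_algebra A" by (rule lca)
  show "lcs (scalars :: (real, real) tvs)" by (rule lcs_scalars)
  show "locally_compact_space (topo (scalars :: (real, real) tvs))" by (simp add: locally_compact_space_euclidean)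
  show "topo (smooth_curve_algebra A) = topology_generated_by (insert (carrier (smooth_curve_algebra A))
       {{b \<in> carrier (smooth_curve_algebra A). dclose scalars (real_tvs A) k K W b r} |r p k K W.
          r \<in> carrier (smooth_curve_algebra A) \<and> p \<in> {()} \<and> compactin (jet_topology scalars UNIV k) K \<and> openin (topo A) W \<and> \<zero> \<in> W})"
  proof -
    have "topo (smooth_curve_algebra A) = topology_generated_by (insert (smooth_curves A)
      {{f \<in> smooth_curves A. dclose scalars (real_tvs A) k K W f h} |h k K W.
         h \<in> smooth_curves A \<and> compactin (jet_topology scalars UNIV k) K \<and>
         openin (topo A) W \<and> \<zero>\<^bsub>A\<^esub> \<in> W})" by (simp add: smooth_curve_algebra_def)
    then show ?thesis by simp
  qed
  show "unital_algebra (smooth_curve_algebra A)"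
  proof (rule unital_algebra_pointwise[where X=UNIV and F="\<lambda>_. A" and ev="\<lambda>t f. f t"])
    fix f h assume fh: "f \<in> carrier (smooth_curve_algebra A)" "h \<in> carrier (smooth_curve_algebra A)"
    then show "f \<oplus>\<^bsub>smooth_curve_algebra A\<^esub> h \<in> carrier (smooth_curve_algebra A)"
      using smooth_family_add[OF lcs_scalars real_lcs, of "discrete_topology {()}" UNIV "\<lambda>_. f" "\<lambda>_. h"] by (simp add: smooth_curves_iff)
    from fh show "f \<otimes>\<^bsub>smooth_curve_algebra A\<^esub> h \<in> carrier (smooth_curve_algebra A)"
      using smooth_family_mult[OF lcs_scalars, of "discrete_topology {()}" UNIV "\<lambda>_. f" "\<lambda>_. h"] by (simp add: smooth_curves_iff)
  next
    fix c f assume fh: "f \<in> carrier (smooth_curve_algebra A)"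
    then show "c \<odot>\<^bsub>smooth_curve_algebra A\<^esub> f \<in> carrier (smooth_curve_algebra A)"
      using smooth_family_smult[OF lcs_scalars, of "discrete_topology {()}" UNIV "\<lambda>_. f" "\<lambda>_. c"] by (simp add: smooth_curves_iff)
  qed (auto simp: ua smooth_curves_carrier smooth_curves_const)
qed (auto simp: smooth_curves_def)

lemma lca_smooth_curve_algebra: "lca (smooth_curve_algebra A)"
  by (rule lca.intro[OF smooth_function_space.lc_algebra_B[OF smooth_curve_space]])

lemma topspace_smooth_curve_algebra: "topspace (topo (smooth_curve_algebra A)) = smooth_curves A"
  using smooth_function_space.topspace_B[OF smooth_curve_space] by simp

lemma smooth_curves_postlin:
  assumes L: "continuous_map (topo A) (topo A) L" "L \<in> alg_hom A A" and f: "f \<in> smooth_curves A"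
  shows "L \<circ> f \<in> smooth_curves A"
  unfolding smooth_curves_iff o_def
  by (rule smooth_family_postlin[OF lcs_scalars real_lcs real_lcs, where L="\<lambda>_. L"])
    (use f[unfolded smooth_curves_iff] L continuous_map_compose[OF continuous_map_snd L(1)] in \<open>auto simp: alg_hom_def o_def\<close>)

text \<open>Postcomposition is tested on the universal family of curves, where it is an instance of
  the rule for linear maps.\<close>

lemma continuous_postlin:
  assumes L: "continuous_map (topo A) (topo A) L" "L \<in> alg_hom A A"
  shows "continuous_map (topo (smooth_curve_algebra A)) (topo (smooth_curve_algebra A)) (\<lambda>f. L \<circ> f)"
proof (rule smooth_function_space.smooth_into[OF smooth_curve_space])
  fix p :: unit assume p: "p \<in> {()}"
  show "smooth_family (topo (smooth_curve_algebra A)) scalars (real_tvs A) UNIV (\<lambda>s. L \<circ> s)"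
    unfolding o_def
    by (rule smooth_family_postlin[OF lcs_scalars real_lcs real_lcs _ _ _ smooth_function_space.smooth_eval[OF smooth_curve_space p], where L="\<lambda>_. L"])
     (use L continuous_map_compose[OF continuous_map_snd L(1)] in \<open>auto simp: alg_hom_def o_def\<close>)
qed (use smooth_curves_postlin[OF L] topspace_smooth_curve_algebra in auto)

end

section \<open>Quotients by closed ideals\<close>

text \<open>Negatives come from absorption of \<open>\<ominus> \<one>\<close>. For the closure of an
  ideal and for preimages of ideals it thus remains to check zero, sums and products.\<close>

lemma (in ring) ideal_criterion:
  assumes I: "I \<subseteq> carrier R" "\<zero> \<in> I" "\<And>a b. a \<in> I \<Longrightarrow> b \<in> I \<Longrightarrow> a \<oplus> b \<in> I"
    and l: "\<And>a x. a \<in> I \<Longrightarrow> x \<in> carrier R \<Longrightarrow> x \<otimes> a \<in> I"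
    and r: "\<And>a x. a \<in> I \<Longrightarrow> x \<in> carrier R \<Longrightarrow> a \<otimes> x \<in> I"
  shows "ideal I R"
proof (rule idealI[OF ring_axioms])
  have "\<ominus> a \<in> I" if "a \<in> I" for a
    using l[OF that, of "\<ominus> \<one>"] I that by (auto simp: l_minus subset_iff)
  then show "subgroup I (add_monoid R)"
    using I by (intro add.subgroupI) (auto simp: a_inv_def)
qed (use l r in auto)

text \<open>Products with a fixed element are continuous, and sums are handled by joint continuity
  because the closure of \<open>I \<times> I\<close> is the product of the closures.\<close>

lemma (in lca) ideal_closure:
  assumes "ideal I A"
  shows "ideal (topo A closure_of I) A"
proof -
  interpret I: ideal I A by fact
  let ?C = "topo A closure_of I"
  have sub: "?C \<subseteq> carrier A" using closure_of_subset_topspace by fastforce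
  have img: "f ` ?C \<subseteq> ?C" if "continuous_map (topo A) (topo A) f" "f ` I \<subseteq> I" for f
    using continuous_map_image_closure_subset[OF that(1), of I] closure_of_mono[OF that(2), of "topo A"] by blast
  show ?thesis
  proof (rule ideal_criterion[OF sub])
    show "\<zero> \<in> ?C" using closure_of_subset[of I "topo A"] I.zero_closed I.a_subset by auto
    fix a b assume ab: "a \<in> ?C" "b \<in> ?C"
    have "(\<lambda>(x, y). x \<oplus> y) ` (prod_topology (topo A) (topo A) closure_of (I \<times> I)) \<subseteq> topo A closure_of ((\<lambda>(x, y). x \<oplus> y) ` (I \<times> I))"
      by (rule continuous_map_image_closure_subset[OF cont_add0])
    moreover have "(\<lambda>(x, y). x \<oplus> y) ` (I \<times> I) \<subseteq> I" using I.a_closed by auto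
    ultimately have "(\<lambda>(x, y). x \<oplus> y) ` (?C \<times> ?C) \<subseteq> ?C"
      unfolding closure_of_Times using closure_of_mono[of "(\<lambda>(x, y). x \<oplus> y) ` (I \<times> I)" I "topo A"] by (meson subset_trans)
    then show "a \<oplus> b \<in> ?C" using ab by auto
  next
    fix a x assume ax: "a \<in> ?C" "x \<in> carrier A"
    show "x \<otimes> a \<in> ?C" using img[of "\<lambda>a. x \<otimes> a"] ax I.I_l_closed by (force intro!: cont_mult)
    show "a \<otimes> x \<in> ?C" using img[of "\<lambda>a. a \<otimes> x"] ax I.I_r_closed by (force intro!: cont_mult)
  qed
qed

text \<open>Identities pass to images under surjections that respect the operations. The quotient is
  treated in this way because the factor ring knows nothing of scalars.\<close>

lemma unital_algebra_surj:
  assumes B: "unital_algebra B" and Q: "carrier Q = p ` carrier B"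
    and add: "\<And>x y. x \<in> carrier B \<Longrightarrow> y \<in> carrier B \<Longrightarrow> p x \<oplus>\<^bsub>Q\<^esub> p y = p (x \<oplus>\<^bsub>B\<^esub> y)"
    and mult: "\<And>x y. x \<in> carrier B \<Longrightarrow> y \<in> carrier B \<Longrightarrow> p x \<otimes>\<^bsub>Q\<^esub> p y = p (x \<otimes>\<^bsub>B\<^esub> y)"
    and smult: "\<And>c x. x \<in> carrier B \<Longrightarrow> c \<odot>\<^bsub>Q\<^esub> p x = p (c \<odot>\<^bsub>B\<^esub> x)"
    and one: "\<one>\<^bsub>Q\<^esub> = p \<one>\<^bsub>B\<^esub>" and zero: "\<zero>\<^bsub>Q\<^esub> = p \<zero>\<^bsub>B\<^esub>"
  shows "unital_algebra Q"
proof -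
  interpret B: ring B by (rule unital_algebraD(1)[OF B])
  note M = module_scalarsD[OF unital_algebraD(2)[OF B]]
  note ops = add mult smult one zero
  have AG: "abelian_group Q"
  proof (rule abelian_groupI)
    fix x assume "x \<in> carrier Q"
    then obtain b where b: "b \<in> carrier B" "x = p b" using Q by auto
    then show "\<exists>y\<in>carrier Q. y \<oplus>\<^bsub>Q\<^esub> x = \<zero>\<^bsub>Q\<^esub>"
      by (intro bexI[of _ "p (\<ominus>\<^bsub>B\<^esub> b)"]) (auto simp: Q ops B.l_neg)
  next
    fix x y assume "x \<in> carrier Q" "y \<in> carrier Q"
    then show "x \<oplus>\<^bsub>Q\<^esub> y = y \<oplus>\<^bsub>Q\<^esub> x" by (auto simp: Q ops B.a_comm)
  qed (auto simp: Q ops B.a_assoc)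
  have MO: "Group.monoid Q"
    by (rule monoidI) (auto simp: Q ops B.m_assoc)
  have "ring Q"
    by (rule ringI[OF AG MO]) (auto simp: Q ops B.l_distr B.r_distr)
  moreover have "Module.module (scalars :: (complex, complex) tvs) Q"
    by (rule module_scalarsI[OF AG]) (auto simp: Q ops M)
  ultimately show ?thesis
    using unital_algebraD(3,4)[OF B] M(2) by (auto simp: unital_algebra_def Q ops)
qed

text \<open>Products of quotient maps need not be quotient maps, while products of open maps are
  open. This is why binary operations are pushed down along open maps.\<close>

lemma open_map_map_prod:
  assumes "open_map X X' p" "open_map Y Y' q"
  shows "open_map (prod_topology X Y) (prod_topology X' Y') (map_prod p q)"
  unfolding open_map_def
proof (intro allI impI)
  fix G assume G: "openin (prod_topology X Y) G"
  show "openin (prod_topology X' Y') (map_prod p q ` G)"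
    unfolding openin_prod_topology_alt
  proof (intro allI impI)
    fix x' y' assume "(x', y') \<in> map_prod p q ` G"
    then obtain x y where xy: "(x, y) \<in> G" "x' = p x" "y' = q y" by auto
    obtain C D where CD: "openin X C" "openin Y D" "x \<in> C" "y \<in> D" "C \<times> D \<subseteq> G"
      using G xy(1) unfolding openin_prod_topology_alt by meson
    have "openin X' (p ` C)" "openin Y' (q ` D)" using assms CD by (auto simp: open_map_def)
    moreover have "p ` C \<times> q ` D \<subseteq> map_prod p q ` G" using CD(5) by (force simp: map_prod_def)
    ultimately show "\<exists>U V. openin X' U \<and> openin Y' V \<and> x' \<in> U \<and> y' \<in> V \<and> U \<times> V \<subseteq> map_prod p q ` G"
      using CD xy by blast
  qed
qed

lemma continuous_map_descend:
  assumes "open_map X X' p" "p ` topspace X = topspace X'" "continuous_map X Z (\<lambda>x. f (p x))"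
  shows "continuous_map X' Z f"
  unfolding continuous_map_def
proof (intro conjI allI impI)
  show "f \<in> topspace X' \<rightarrow> topspace Z"
    using assms(2)[symmetric] continuous_map_image_subset_topspace[OF assms(3)] by auto
  fix W assume W: "openin Z W"
  have "{y \<in> topspace X'. f y \<in> W} = p ` {x \<in> topspace X. f (p x) \<in> W}"
    using assms(2) by auto
  then show "openin X' {y \<in> topspace X'. f y \<in> W}"
    using assms(1) openin_continuous_map_preimage[OF assms(3) W] by (simp add: open_map_def)
qed

locale closed_ideal = lca B for B :: "(complex, 'b) tvs" (structure) +
  fixes J :: "'b set"
  assumes ideal: "ideal J B" and closed: "closedin (topo B) J"
begin

sublocale J: ideal J B by (rule ideal)

abbreviation \<pi> where "\<pi> x \<equiv> J +> x"
abbreviation Q where "Q \<equiv> quotient_tvs B J"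

lemma pi_eq: "x \<in> carrier B \<Longrightarrow> y \<in> carrier B \<Longrightarrow> \<pi> x = \<pi> y \<longleftrightarrow> x \<ominus> y \<in> J"
  using quotient_eq_iff_same_a_r_cos[OF ideal] by simp

lemma mem_pi: "x \<in> carrier B \<Longrightarrow> y \<in> \<pi> x \<Longrightarrow> y \<in> carrier B \<and> \<pi> y = \<pi> x"
  using J.a_rcos_self J.a_repr_independence' a_r_coset_subset_G[of J x] J.a_subset by blast

lemma carrier_Q: "carrier Q = \<pi> ` carrier B"
  by (auto simp: quotient_tvs_def FactRing_def A_RCOSETS_def')

text \<open>A ring ideal of a unital algebra is a subspace, as \<open>c a = (c 1) a\<close>.\<close>

lemma smult_J: "a \<in> J \<Longrightarrow> c \<odot> a \<in> J"
  using J.I_l_closed[of a "c \<odot> \<one>"] J.Icarr[of a] smult_mult_left[of \<one> a c] by simp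

lemma Q_simps:
  "x \<in> carrier B \<Longrightarrow> y \<in> carrier B \<Longrightarrow> \<pi> x \<oplus>\<^bsub>Q\<^esub> \<pi> y = \<pi> (x \<oplus> y)"
  "x \<in> carrier B \<Longrightarrow> y \<in> carrier B \<Longrightarrow> \<pi> x \<otimes>\<^bsub>Q\<^esub> \<pi> y = \<pi> (x \<otimes> y)"
  "x \<in> carrier B \<Longrightarrow> c \<odot>\<^bsub>Q\<^esub> \<pi> x = \<pi> (c \<odot> x)"
  "\<one>\<^bsub>Q\<^esub> = \<pi> \<one>" "\<zero>\<^bsub>Q\<^esub> = \<pi> \<zero>"
proof -
  show "\<pi> x \<oplus>\<^bsub>Q\<^esub> \<pi> y = \<pi> (x \<oplus> y)" if "x \<in> carrier B" "y \<in> carrier B"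
    using J.a_rcos_sum[OF that] by (simp add: quotient_tvs_def FactRing_def)
  show "\<pi> x \<otimes>\<^bsub>Q\<^esub> \<pi> y = \<pi> (x \<otimes> y)" if "x \<in> carrier B" "y \<in> carrier B"
    using J.rcoset_mult_add[OF that] by (simp add: quotient_tvs_def FactRing_def)
  show "c \<odot>\<^bsub>Q\<^esub> \<pi> x = \<pi> (c \<odot> x)" if x: "x \<in> carrier B"
  proof -
    \<comment> \<open>In \<open>quotient_tvs\<close> the scalar multiple is a union of cosets over
      all representatives. It is a single coset because these cosets all coincide and there is at
      least one.\<close>
    have e: "\<pi> (c \<odot> y) = \<pi> (c \<odot> x)" if y: "y \<in> \<pi> x" for y
    proof -
      have "y \<in> carrier B" "y \<ominus> x \<in> J" using mem_pi[OF x y] pi_eq[of y x] x by auto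
      then show ?thesis using smult_J[of "y \<ominus> x" c] x pi_eq[of "c \<odot> y" "c \<odot> x"] by (simp add: smult_minus)
    qed
    have ne: "\<pi> x \<noteq> {}" using J.a_rcos_self[OF x] by blast
    have "(\<Union>y\<in>\<pi> x. \<pi> (c \<odot> y)) = (\<Union>y\<in>\<pi> x. \<pi> (c \<odot> x))" by (rule SUP_cong[OF refl e])
    also have "\<dots> = \<pi> (c \<odot> x)" using ne by (simp only: UN_constant if_False)
    finally show ?thesis by (simp add: quotient_tvs_def)
  qed
  show "\<one>\<^bsub>Q\<^esub> = \<pi> \<one>" by (simp add: quotient_tvs_def FactRing_def)
  have "J +> \<zero> = J" using J.a_subset by (rule a_coset_add_zero)
  then show "\<zero>\<^bsub>Q\<^esub> = \<pi> \<zero>" by (simp add: quotient_tvs_def FactRing_def)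
qed

text \<open>The constant \<open>topology\<close> has its intended meaning only for predicates
  satisfying \<open>istopology\<close>, which is checked here for the quotient topology.\<close>

lemma openin_Q: "openin (topo Q) S \<longleftrightarrow> S \<subseteq> \<pi> ` carrier B \<and> openin (topo B) {x \<in> carrier B. \<pi> x \<in> S}"
proof -
  let ?P = "\<lambda>S. S \<subseteq> \<pi> ` carrier B \<and> openin (topo B) {x \<in> carrier B. \<pi> x \<in> S}"
  have "istopology ?P"
    unfolding istopology_def
  proof (intro conjI allI impI)
    fix S T assume "?P S" "?P T"
    then show "S \<inter> T \<subseteq> \<pi> ` carrier B"  "openin (topo B) {x \<in> carrier B. \<pi> x \<in> S \<inter> T}"
      using openin_Int[of "topo B" "{x \<in> carrier B. \<pi> x \<in> S}" "{x \<in> carrier B. \<pi> x \<in> T}"]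
      by (auto simp: Int_def conj_ac cong: conj_cong)
  next
    fix K assume K: "\<forall>S\<in>K. ?P S"
    then show "\<Union>K \<subseteq> \<pi> ` carrier B" by blast
    have "{x \<in> carrier B. \<pi> x \<in> \<Union>K} = (\<Union>S\<in>K. {x \<in> carrier B. \<pi> x \<in> S})" by blast
    then show "openin (topo B) {x \<in> carrier B. \<pi> x \<in> \<Union>K}" using K by auto
  qed
  moreover have "topo Q = topology ?P"
    using carrier_Q by (simp add: quotient_tvs_def)
  ultimately show ?thesis by (simp add: topology_inverse')
qed

lemma topspace_Q: "topspace (topo Q) = carrier Q"
proof -
  have "{x \<in> carrier B. \<pi> x \<in> \<pi> ` carrier B} = topspace (topo B)" by auto
  then have "openin (topo Q) (\<pi> ` carrier B)" unfolding openin_Q by (metis openin_topspace order_refl)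
  moreover have "topspace (topo Q) \<subseteq> \<pi> ` carrier B" using openin_Q openin_topspace by blast
  ultimately show ?thesis using carrier_Q openin_subset[of "topo Q" "\<pi> ` carrier B"] by auto
qed

lemma continuous_pi: "continuous_map (topo B) (topo Q) \<pi>"
  unfolding continuous_map_def using topspace_Q carrier_Q openin_Q by auto

text \<open>The saturation of an open set is the union of its translates by elements of
  \<open>J\<close>, each of which is the preimage of the set under a continuous translation.\<close>

lemma open_pi: "open_map (topo B) (topo Q) \<pi>"
  unfolding open_map_def
proof (intro allI impI)
  fix N assume N: "openin (topo B) N"
  have Nc: "N \<subseteq> carrier B" using openin_subset[OF N] by simp
  have "{x \<in> carrier B. \<pi> x \<in> \<pi> ` N} = (\<Union>j\<in>J. {x \<in> topspace (topo B). x \<oplus> j \<in> N})"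
  proof (intro equalityI subsetI)
    fix x assume "x \<in> {x \<in> carrier B. \<pi> x \<in> \<pi> ` N}"
    then obtain y where y: "x \<in> carrier B" "y \<in> N" "\<pi> y = \<pi> x" by auto
    then have "y \<ominus> x \<in> J" "x \<oplus> (y \<ominus> x) = y" using pi_eq Nc by (auto simp: a_minus_def a_comm[of y] r_neg2 subset_iff)
    then show "x \<in> (\<Union>j\<in>J. {x \<in> topspace (topo B). x \<oplus> j \<in> N})" using y by (auto intro!: bexI[of _ "y \<ominus> x"])
  next
    fix x assume "x \<in> (\<Union>j\<in>J. {x \<in> topspace (topo B). x \<oplus> j \<in> N})"
    then obtain j where j: "j \<in> J" "x \<in> carrier B" "x \<oplus> j \<in> N" by auto
    have "(x \<oplus> j) \<ominus> x = j" using j J.Icarr by (simp add: a_minus_def a_comm[of "x \<oplus> j"] r_neg1)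
    then have "\<pi> (x \<oplus> j) = \<pi> x" using j J.Icarr pi_eq[of "x \<oplus> j" x] by simp
    then show "x \<in> {x \<in> carrier B. \<pi> x \<in> \<pi> ` N}" using j by (metis (lifting) image_eqI mem_Collect_eq)
  qed
  moreover have "openin (topo B) {x \<in> topspace (topo B). x \<oplus> j \<in> N}" if "j \<in> J" for j
    by (rule openin_continuous_map_preimage[OF _ N]) (use J.Icarr[OF that] in \<open>intro cont_add; simp\<close>)
  ultimately show "openin (topo Q) (\<pi> ` N)" unfolding openin_Q using Nc by auto
qed

lemma pi_surj: "\<pi> ` topspace (topo B) = topspace (topo Q)"
  using topspace_Q carrier_Q by simp

lemma lc_algebra_Q: "lc_algebra Q"
proof -
  have ua: "unital_algebra Q"
    by (rule unital_algebra_surj[OF ua carrier_Q Q_simps])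
  have surj2: "map_prod \<pi> \<pi> ` topspace (prod_topology (topo B) (topo B)) = topspace (prod_topology (topo Q) (topo Q))"
    using pi_surj by (simp add: map_prod_surj_on)
  have bin: "continuous_map (prod_topology (topo Q) (topo Q)) (topo Q) f"
    if "continuous_map (prod_topology (topo B) (topo B)) (topo B) g"
      "\<And>x y. x \<in> carrier B \<Longrightarrow> y \<in> carrier B \<Longrightarrow> f (\<pi> x, \<pi> y) = \<pi> (g (x, y))" for f g
    by (rule continuous_map_descend[OF open_map_map_prod[OF open_pi open_pi] surj2], rule continuous_map_eq[OF continuous_map_compose[OF that(1) continuous_pi]])
      (use that(2) in auto)
  have "lc_space Q"
    unfolding lc_space_def
  proof (intro conjI allI impI)
    show "Module.module (scalars :: (complex, complex) tvs) Q" by (rule unital_algebraD(2)[OF ua])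
    show "topspace (topo Q) = carrier Q" by (rule topspace_Q)
    show "continuous_map (prod_topology (topo Q) (topo Q)) (topo Q) (\<lambda>(x, y). x \<oplus>\<^bsub>Q\<^esub> y)"
      by (rule bin[OF cont_add0]) (simp add: Q_simps)
    show "continuous_map (prod_topology euclidean (topo Q)) (topo Q) (\<lambda>(c, x). c \<odot>\<^bsub>Q\<^esub> x)"
    proof (rule continuous_map_descend[OF open_map_map_prod[of euclidean euclidean "\<lambda>x. x", OF _ open_pi]])
      show "open_map euclidean euclidean (\<lambda>x::complex. x)" by (simp add: open_map_def)
      show "map_prod (\<lambda>x. x) \<pi> ` topspace (prod_topology euclidean (topo B)) = topspace (prod_topology euclidean (topo Q))"
        using map_prod_surj_on[OF _ pi_surj, of "\<lambda>x. x" UNIV UNIV] by simp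
      show "continuous_map (prod_topology euclidean (topo B)) (topo Q) (\<lambda>x. case map_prod (\<lambda>x. x) \<pi> x of (c, x) \<Rightarrow> c \<odot>\<^bsub>Q\<^esub> x)"
        by (rule continuous_map_eq[OF continuous_map_compose[OF cont_smult0 continuous_pi]]) (auto simp: Q_simps)
    qed
    show "Hausdorff_space (topo Q)"
      unfolding Hausdorff_space_def
    proof (intro allI impI, elim conjE)
      fix X Y assume XY: "X \<in> topspace (topo Q)" "Y \<in> topspace (topo Q)" "X \<noteq> Y"
      then obtain x y where xy: "X = \<pi> x" "Y = \<pi> y" "x \<in> carrier B" "y \<in> carrier B" using topspace_Q carrier_Q by auto
      \<comment> \<open>As \<open>J\<close> is closed, the pairs with difference outside
        \<open>J\<close> form an open set; the two factors of a product neighbourhood inside it have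
        disjoint images.\<close>
      have nJ: "x \<ominus> y \<notin> J" using XY xy pi_eq by blast
      have "openin (topo B) (carrier B - J)" using closed by (simp add: closedin_def)
      moreover have "continuous_map (prod_topology (topo B) (topo B)) (topo B) (\<lambda>z. fst z \<ominus> snd z)"
        by (intro cont_minus continuous_map_fst continuous_map_snd)
      ultimately have "openin (prod_topology (topo B) (topo B)) {z \<in> topspace (prod_topology (topo B) (topo B)). fst z \<ominus> snd z \<in> carrier B - J}"
        by (rule openin_continuous_map_preimage[rotated])
      moreover have "(x, y) \<in> {z \<in> topspace (prod_topology (topo B) (topo B)). fst z \<ominus> snd z \<in> carrier B - J}"
        using xy nJ by simp
      ultimately obtain C D where CD: "openin (topo B) C" "openin (topo B) D" "x \<in> C" "y \<in> D"
        "C \<times> D \<subseteq> {z \<in> topspace (prod_topology (topo B) (topo B)). fst z \<ominus> snd z \<in> carrier B - J}"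
        unfolding openin_prod_topology_alt by meson
      have "disjnt (\<pi> ` C) (\<pi> ` D)"
        unfolding disjnt_iff
      proof (intro allI notI, elim conjE imageE)
        fix Z c d assume "Z = \<pi> c" "c \<in> C" "Z = \<pi> d" "d \<in> D"
        moreover have "c \<in> carrier B" "d \<in> carrier B" using calculation CD(1,2)[THEN openin_subset] by auto
        ultimately have "c \<ominus> d \<in> J" using pi_eq[of c d] by simp
        moreover have "(c, d) \<in> C \<times> D" using \<open>c \<in> C\<close> \<open>d \<in> D\<close> by simp
        ultimately show False using CD(5) by fastforce
      qed
      then show "\<exists>U V. openin (topo Q) U \<and> openin (topo Q) V \<and> X \<in> U \<and> Y \<in> V \<and> disjnt U V"
        using open_pi CD xy unfolding open_map_def by blast
    qed
    fix W assume W: "openin (topo Q) W \<and> \<zero>\<^bsub>Q\<^esub> \<in> W"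
    then have "openin (topo B) {x \<in> carrier B. \<pi> x \<in> W}" "\<zero> \<in> {x \<in> carrier B. \<pi> x \<in> W}"
      using openin_Q Q_simps by auto
    from convex_nbhd[OF this] obtain C where C: "openin (topo B) C" "\<zero> \<in> C" "C \<subseteq> {x \<in> carrier B. \<pi> x \<in> W}"
      "\<forall>x\<in>C. \<forall>y\<in>C. \<forall>t\<in>{0..1}. (of_real t \<odot> x) \<oplus> (of_real (1 - t) \<odot> y) \<in> C" by blast
    show "\<exists>C. openin (topo Q) C \<and> \<zero>\<^bsub>Q\<^esub> \<in> C \<and> C \<subseteq> W \<and>
          (\<forall>x\<in>C. \<forall>y\<in>C. \<forall>t\<in>{0..1}. (of_real t \<odot>\<^bsub>Q\<^esub> x) \<oplus>\<^bsub>Q\<^esub> (of_real (1 - t) \<odot>\<^bsub>Q\<^esub> y) \<in> C)"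
    proof (intro exI[of _ "\<pi> ` C"] conjI ballI)
      show "openin (topo Q) (\<pi> ` C)" using open_pi C(1) by (simp add: open_map_def)
      fix X Y and t :: real assume "X \<in> \<pi> ` C" "Y \<in> \<pi> ` C" and t: "t \<in> {0..1}"
      then obtain x y where xy: "x \<in> C" "y \<in> C" "X = \<pi> x" "Y = \<pi> y" by auto
      have "x \<in> carrier B" "y \<in> carrier B" using xy C(3) by auto
      then have "(of_real t \<odot>\<^bsub>Q\<^esub> X) \<oplus>\<^bsub>Q\<^esub> (of_real (1 - t) \<odot>\<^bsub>Q\<^esub> Y) = \<pi> ((of_real t \<odot> x) \<oplus> (of_real (1 - t) \<odot> y))"
        using xy by (simp add: Q_simps)
      then show "(of_real t \<odot>\<^bsub>Q\<^esub> X) \<oplus>\<^bsub>Q\<^esub> (of_real (1 - t) \<odot>\<^bsub>Q\<^esub> Y) \<in> \<pi> ` C" using C(4) xy t by blast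
    qed (use C Q_simps in auto)
  qed
  then show ?thesis
    unfolding lc_algebra_def using ua bin[OF cont_mult0, of "\<lambda>(x, y). x \<otimes>\<^bsub>Q\<^esub> y"] Q_simps by auto
qed

end

section \<open>Dynamical systems\<close>

lemma BijI:
  assumes "f \<in> extensional S" "\<And>x. x \<in> S \<Longrightarrow> f x \<in> S" "\<And>x. x \<in> S \<Longrightarrow> g x \<in> S"
    "\<And>x. x \<in> S \<Longrightarrow> g (f x) = x" "\<And>x. x \<in> S \<Longrightarrow> f (g x) = x"
  shows "f \<in> Bij S"
  using assms bij_betw_byWitness[of S g f S] by (auto simp: Bij_def)

text \<open>Bijectivity comes from the group: the inverse of \<open>\<sigma> l\<close> is the action
  of the inverse of \<open>l\<close>. Extensionality is asked for because the members of
  \<open>Bij\<close> are undefined off the set.\<close>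

lemma action_Bij:
  assumes "group \<Lambda>" "\<And>l. l \<in> carrier \<Lambda> \<Longrightarrow> \<sigma> l \<in> extensional X"
    and "\<And>l x. l \<in> carrier \<Lambda> \<Longrightarrow> x \<in> X \<Longrightarrow> \<sigma> l x \<in> X"
    and "\<And>x. x \<in> X \<Longrightarrow> \<sigma> \<one>\<^bsub>\<Lambda>\<^esub> x = x"
    and "\<And>l m x. l \<in> carrier \<Lambda> \<Longrightarrow> m \<in> carrier \<Lambda> \<Longrightarrow> x \<in> X \<Longrightarrow> \<sigma> (l \<otimes>\<^bsub>\<Lambda>\<^esub> m) x = \<sigma> l (\<sigma> m x)"
    and l: "l \<in> carrier \<Lambda>"
  shows "\<sigma> l \<in> Bij X"
proof (rule BijI[where g="\<sigma> (inv\<^bsub>\<Lambda>\<^esub> l)"])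
  interpret group \<Lambda> by fact
  show "\<sigma> (inv\<^bsub>\<Lambda>\<^esub> l) (\<sigma> l x) = x" "\<sigma> l (\<sigma> (inv\<^bsub>\<Lambda>\<^esub> l) x) = x" if "x \<in> X" for x
    using assms(4)[OF that] assms(5)[of "inv\<^bsub>\<Lambda>\<^esub> l" l x] assms(5)[of l "inv\<^bsub>\<Lambda>\<^esub> l" x] l that by (simp_all add: l_inv r_inv)
qed (use assms in \<open>auto simp: group.inv_closed\<close>)

lemma group_actionI:
  assumes "group \<Lambda>" "\<And>l. l \<in> carrier \<Lambda> \<Longrightarrow> \<sigma> l \<in> extensional X"
    and "\<And>l x. l \<in> carrier \<Lambda> \<Longrightarrow> x \<in> X \<Longrightarrow> \<sigma> l x \<in> X"
    and "\<And>x. x \<in> X \<Longrightarrow> \<sigma> \<one>\<^bsub>\<Lambda>\<^esub> x = x"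
    and "\<And>l m x. l \<in> carrier \<Lambda> \<Longrightarrow> m \<in> carrier \<Lambda> \<Longrightarrow> x \<in> X \<Longrightarrow> \<sigma> (l \<otimes>\<^bsub>\<Lambda>\<^esub> m) x = \<sigma> l (\<sigma> m x)"
  shows "group_action \<Lambda> X \<sigma>"
proof -
  interpret group \<Lambda> by fact
  note B = action_Bij[OF assms]
  have "\<sigma> \<in> hom \<Lambda> (BijGroup X)"
  proof (rule homI)
    fix l m assume lm: "l \<in> carrier \<Lambda>" "m \<in> carrier \<Lambda>"
    show "\<sigma> (l \<otimes>\<^bsub>\<Lambda>\<^esub> m) = \<sigma> l \<otimes>\<^bsub>BijGroup X\<^esub> \<sigma> m"
    proof (rule extensionalityI[where A=X])
      show "\<sigma> l \<otimes>\<^bsub>BijGroup X\<^esub> \<sigma> m \<in> extensional X" using B lm by (simp add: BijGroup_def)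
    qed (use assms lm B in \<open>auto simp: BijGroup_def compose_def\<close>)
  qed (use B in \<open>simp add: BijGroup_def\<close>)
  then show ?thesis
    by (intro group_action.intro group_hom.intro group_axioms group_BijGroup) (simp add: group_hom_axioms_def)
qed

text \<open>The group is discrete, so the preimage of an open set under the action map is a union of
  slices over single group elements, and continuity of each \<open>\<sigma> l\<close>
  suffices.\<close>

lemma dynamical_systemI:
  assumes B: "lc_algebra B" and G: "group \<Lambda>" and h: "\<And>l. l \<in> carrier \<Lambda> \<Longrightarrow> \<sigma> l \<in> alg_hom B B"
    and ext: "\<And>l. l \<in> carrier \<Lambda> \<Longrightarrow> \<sigma> l \<in> extensional (carrier B)"
    and one: "\<And>x. x \<in> carrier B \<Longrightarrow> \<sigma> \<one>\<^bsub>\<Lambda>\<^esub> x = x"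
    and mult: "\<And>l m x. l \<in> carrier \<Lambda> \<Longrightarrow> m \<in> carrier \<Lambda> \<Longrightarrow> x \<in> carrier B \<Longrightarrow> \<sigma> (l \<otimes>\<^bsub>\<Lambda>\<^esub> m) x = \<sigma> l (\<sigma> m x)"
    and cont: "\<And>l. l \<in> carrier \<Lambda> \<Longrightarrow> continuous_map (topo B) (topo B) (\<sigma> l)"
  shows "dynamical_system B \<Lambda> \<sigma>"
proof -
  have cl: "\<sigma> l x \<in> carrier B" if "l \<in> carrier \<Lambda>" "x \<in> carrier B" for l x
    using h[OF that(1)] that(2) by (auto simp: alg_hom_def)
  note Bij = action_Bij[OF G ext cl one mult]
  have "\<sigma> \<in> hom \<Lambda> (AlgAut B)"
  proof (rule homI)
    fix l m assume lm: "l \<in> carrier \<Lambda>" "m \<in> carrier \<Lambda>"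
    then have lm': "l \<otimes>\<^bsub>\<Lambda>\<^esub> m \<in> carrier \<Lambda>" using G by (simp add: group.is_monoid monoid.m_closed)
    show "\<sigma> (l \<otimes>\<^bsub>\<Lambda>\<^esub> m) = \<sigma> l \<otimes>\<^bsub>AlgAut B\<^esub> \<sigma> m"
    proof (rule extensionalityI[where A="carrier B"])
      show "\<sigma> l \<otimes>\<^bsub>AlgAut B\<^esub> \<sigma> m \<in> extensional (carrier B)" using Bij lm by (simp add: AlgAut_def BijGroup_def)
    qed (use ext lm lm' Bij mult in \<open>auto simp: AlgAut_def BijGroup_def compose_def\<close>)
  qed (use h Bij in \<open>auto simp: AlgAut_def alg_auto_def BijGroup_def\<close>)
  moreover have "continuous_map (prod_topology (discrete_topology (carrier \<Lambda>)) (topo B)) (topo B) (\<lambda>(l, a). \<sigma> l a)"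
    unfolding continuous_map_def
  proof (intro conjI allI impI)
    show "(\<lambda>(l, a). \<sigma> l a) \<in> topspace (prod_topology (discrete_topology (carrier \<Lambda>)) (topo B)) \<rightarrow> topspace (topo B)"
      using continuous_map_image_subset_topspace[OF cont] by fastforce
    fix W assume W: "openin (topo B) W"
    have "{z \<in> topspace (prod_topology (discrete_topology (carrier \<Lambda>)) (topo B)). (case z of (l, a) \<Rightarrow> \<sigma> l a) \<in> W}
       = (\<Union>l\<in>carrier \<Lambda>. {l} \<times> {a \<in> topspace (topo B). \<sigma> l a \<in> W})" by auto
    also have "openin (prod_topology (discrete_topology (carrier \<Lambda>)) (topo B)) \<dots>"
      using openin_continuous_map_preimage[OF cont W] by (intro openin_clauses(3)) (auto simp: openin_prod_Times_iff)
    finally show "openin (prod_topology (discrete_topology (carrier \<Lambda>)) (topo B))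
      {z \<in> topspace (prod_topology (discrete_topology (carrier \<Lambda>)) (topo B)). (case z of (l, a) \<Rightarrow> \<sigma> l a) \<in> W}" .
  qed
  ultimately show ?thesis using B G by (simp add: dynamical_system_def)
qed

locale dyn_sys =
  fixes A :: "(complex, 'a) tvs" and \<Lambda> :: "('l, 'z) monoid_scheme" and \<alpha> :: "'l \<Rightarrow> 'a \<Rightarrow> 'a"
  assumes dyn: "dynamical_system A \<Lambda> \<alpha>"
begin

sublocale A: lca A using dyn by (simp add: dynamical_system_def lca_def)
sublocale L: group \<Lambda> using dyn by (simp add: dynamical_system_def)

lemma alpha_auto: "l \<in> carrier \<Lambda> \<Longrightarrow> \<alpha> l \<in> alg_auto A"
  using dyn by (auto simp: dynamical_system_def hom_def AlgAut_def)

lemma alpha_hom: "l \<in> carrier \<Lambda> \<Longrightarrow> \<alpha> l \<in> alg_hom A A"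
  using alpha_auto by (auto simp: alg_auto_def)

lemma alpha_closed: "l \<in> carrier \<Lambda> \<Longrightarrow> a \<in> carrier A \<Longrightarrow> \<alpha> l a \<in> carrier A"
  using alpha_hom[of l] by (auto simp: alg_hom_def)

lemma alpha_simps:
  assumes "l \<in> carrier \<Lambda>" "a \<in> carrier A"
  shows "b \<in> carrier A \<Longrightarrow> \<alpha> l (a \<oplus>\<^bsub>A\<^esub> b) = \<alpha> l a \<oplus>\<^bsub>A\<^esub> \<alpha> l b"
    "b \<in> carrier A \<Longrightarrow> \<alpha> l (a \<otimes>\<^bsub>A\<^esub> b) = \<alpha> l a \<otimes>\<^bsub>A\<^esub> \<alpha> l b"
    "\<alpha> l (c \<odot>\<^bsub>A\<^esub> a) = c \<odot>\<^bsub>A\<^esub> \<alpha> l a"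
  using alpha_hom[OF assms(1)] assms(2) by (auto simp: alg_hom_def)

lemma alpha_mult:
  assumes "l \<in> carrier \<Lambda>" "m \<in> carrier \<Lambda>" "a \<in> carrier A"
  shows "\<alpha> (l \<otimes>\<^bsub>\<Lambda>\<^esub> m) a = \<alpha> l (\<alpha> m a)"
proof -
  have "\<alpha> (l \<otimes>\<^bsub>\<Lambda>\<^esub> m) = \<alpha> l \<otimes>\<^bsub>AlgAut A\<^esub> \<alpha> m"
    using dyn assms by (auto simp: dynamical_system_def hom_def)
  then show ?thesis
    using assms alpha_auto[of l] alpha_auto[of m] by (simp add: AlgAut_def BijGroup_def alg_auto_def compose_def)
qed

text \<open>The map is idempotent by multiplicativity of \<open>\<alpha>\<close> and injective as an
  automorphism.\<close>

lemma alpha_one: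
  assumes "a \<in> carrier A"
  shows "\<alpha> \<one>\<^bsub>\<Lambda>\<^esub> a = a"
proof -
  have bij: "bij_betw (\<alpha> \<one>\<^bsub>\<Lambda>\<^esub>) (carrier A) (carrier A)"
    using alpha_auto[of "\<one>\<^bsub>\<Lambda>\<^esub>"] by (auto simp: alg_auto_def Bij_def)
  have "\<alpha> \<one>\<^bsub>\<Lambda>\<^esub> (\<alpha> \<one>\<^bsub>\<Lambda>\<^esub> a) = \<alpha> \<one>\<^bsub>\<Lambda>\<^esub> a"
    using alpha_mult[of "\<one>\<^bsub>\<Lambda>\<^esub>" "\<one>\<^bsub>\<Lambda>\<^esub>" a] assms by simp
  then show ?thesis
    using bij_betw_imp_inj_on[OF bij] assms alpha_closed[of "\<one>\<^bsub>\<Lambda>\<^esub>" a] by (auto dest: inj_onD)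
qed

text \<open>\<open>alg_hom\<close> does not include preservation of the unit. Surjectivity supplies
  \<open>u\<close> with \<open>\<alpha> l u = \<one>\<close>, and then
  \<open>\<one> = \<alpha> l (u \<otimes> \<one>) = \<alpha> l \<one>\<close>.\<close>

lemma alpha_unit: "l \<in> carrier \<Lambda> \<Longrightarrow> \<alpha> l \<one>\<^bsub>A\<^esub> = \<one>\<^bsub>A\<^esub>"
proof -
  assume l: "l \<in> carrier \<Lambda>"
  then have bij: "bij_betw (\<alpha> l) (carrier A) (carrier A)"
    using alpha_auto[of l] by (auto simp: alg_auto_def Bij_def)
  then obtain u where u: "u \<in> carrier A" "\<alpha> l u = \<one>\<^bsub>A\<^esub>"
    using A.one_closed by (metis bij_betw_iff_bijections)
  then show ?thesis using alpha_simps(2)[OF l u(1), of "\<one>\<^bsub>A\<^esub>"] alpha_closed[OF l A.one_closed] by simp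
qed

lemma alpha_continuous: "l \<in> carrier \<Lambda> \<Longrightarrow> continuous_map (topo A) (topo A) (\<alpha> l)"
proof -
  assume l: "l \<in> carrier \<Lambda>"
  have c: "continuous_map (prod_topology (discrete_topology (carrier \<Lambda>)) (topo A)) (topo A) (\<lambda>(l, a). \<alpha> l a)"
    using dyn by (simp add: dynamical_system_def)
  have "continuous_map (topo A) (prod_topology (discrete_topology (carrier \<Lambda>)) (topo A)) (\<lambda>a. (l, a))"
    using l by (intro continuous_map_pairedI) auto
  from continuous_map_compose[OF this c] show ?thesis by (simp add: o_def)
qed

end

section \<open>Smooth localization\<close>

abbreviation loc_gen :: "(complex, 'a) tvs \<Rightarrow> 'a \<Rightarrow> real \<Rightarrow> 'a" where
  "loc_gen A z \<equiv> \<lambda>t. \<one>\<^bsub>A\<^esub> \<ominus>\<^bsub>A\<^esub> (complex_of_real t \<odot>\<^bsub>A\<^esub> z)"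

text \<open>The generating curve is a constant plus a linear function of \<open>t\<close>; rewriting
  the difference as a sum with \<open>\<ominus> z\<close> makes both rules applicable.\<close>

lemma (in lca) loc_gen_smooth:
  assumes z: "z \<in> carrier A"
  shows "loc_gen A z \<in> smooth_curves A"
proof -
  have "smooth_family (discrete_topology {()}) scalars (real_tvs A) UNIV (\<lambda>_ t. \<one> \<oplus>\<^bsub>real_tvs A\<^esub> complex_of_real t \<odot> (\<ominus> z))"
  proof (intro smooth_family_add[OF lcs_scalars real_lcs] smooth_family_const[OF lcs_scalars real_lcs] smooth_family_linear[OF lcs_scalars real_lcs])
    show "continuous_map (topo (scalars :: (real, real) tvs)) (topo (real_tvs A)) (\<lambda>t. complex_of_real t \<odot> (\<ominus> z))"
      using z by (auto intro!: cont_smult continuous_intros)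
  qed (use z in \<open>auto simp: smult_ldistr smult_assoc\<close>)
  then have "(\<lambda>t. \<one> \<oplus> complex_of_real t \<odot> (\<ominus> z)) \<in> smooth_curves A"
    unfolding smooth_curves_iff by simp
  moreover have "loc_gen A z = (\<lambda>t. \<one> \<oplus> complex_of_real t \<odot> (\<ominus> z))"
    using z by (simp add: a_minus_def smult_neg)
  ultimately show ?thesis by simp
qed

lemma (in lca) loc_closed_ideal:
  assumes z: "z \<in> carrier A"
  shows "closed_ideal (smooth_curve_algebra A) (loc_ideal A z)"
proof -
  interpret C: lca "smooth_curve_algebra A" by (rule lca_smooth_curve_algebra)
  have "ideal (genideal (smooth_curve_algebra A) {loc_gen A z}) (smooth_curve_algebra A)"
    using loc_gen_smooth[OF z] by (intro C.genideal_ideal) simp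
  then have "ideal (loc_ideal A z) (smooth_curve_algebra A)"
    unfolding loc_ideal_def by (rule C.ideal_closure)
  then show ?thesis
    by (intro closed_ideal.intro closed_ideal_axioms.intro C.lca_axioms) (simp_all add: loc_ideal_def)
qed

lemma (in lca) loc_gen_mem:
  assumes z: "z \<in> carrier A"
  shows "loc_gen A z \<in> loc_ideal A z"
proof -
  interpret C: lca "smooth_curve_algebra A" by (rule lca_smooth_curve_algebra)
  have "loc_gen A z \<in> genideal (smooth_curve_algebra A) {loc_gen A z}"
    using loc_gen_smooth[OF z] by (intro C.genideal_self') simp
  moreover have "genideal (smooth_curve_algebra A) {loc_gen A z} \<subseteq> topspace (topo (smooth_curve_algebra A))"
    using ideal.Icarr[OF C.genideal_ideal[of "{loc_gen A z}"]] loc_gen_smooth[OF z] by auto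
  ultimately show ?thesis
    unfolding loc_ideal_def using closure_of_subset by blast
qed

lemma fixed_centerD:
  assumes "z \<in> carrier (fixed_center A \<Lambda> \<alpha>)"
  shows "z \<in> carrier A" "\<And>x. x \<in> carrier A \<Longrightarrow> z \<otimes>\<^bsub>A\<^esub> x = x \<otimes>\<^bsub>A\<^esub> z" "\<And>l. l \<in> carrier \<Lambda> \<Longrightarrow> \<alpha> l z = z"
  using assms by (auto simp: fixed_center_def alg_center_def)

locale localized_system = dyn_sys +
  fixes z
  assumes z: "z \<in> carrier (fixed_center A \<Lambda> \<alpha>)"
begin

abbreviation C where "C \<equiv> smooth_curve_algebra A"
abbreviation J where "J \<equiv> loc_ideal A z"
abbreviation Q where "Q \<equiv> smooth_localization A z"

lemma zc: "z \<in> carrier A" using fixed_centerD(1)[OF z] .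

sublocale C: closed_ideal C J
  rewrites "quotient_tvs C J = Q"
  by (rule A.loc_closed_ideal[OF zc]) (simp add: smooth_localization_def)

lemma alpha_curve: "l \<in> carrier \<Lambda> \<Longrightarrow> f \<in> smooth_curves A \<Longrightarrow> \<alpha> l \<circ> f \<in> smooth_curves A"
  by (rule A.smooth_curves_postlin[OF alpha_continuous alpha_hom])

lemma alpha_curve_simps:
  assumes "l \<in> carrier \<Lambda>" "f \<in> smooth_curves A"
  shows "h \<in> smooth_curves A \<Longrightarrow> \<alpha> l \<circ> (f \<oplus>\<^bsub>C\<^esub> h) = (\<alpha> l \<circ> f) \<oplus>\<^bsub>C\<^esub> (\<alpha> l \<circ> h)"
    "h \<in> smooth_curves A \<Longrightarrow> \<alpha> l \<circ> (f \<otimes>\<^bsub>C\<^esub> h) = (\<alpha> l \<circ> f) \<otimes>\<^bsub>C\<^esub> (\<alpha> l \<circ> h)"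
    "\<alpha> l \<circ> (c \<odot>\<^bsub>C\<^esub> f) = c \<odot>\<^bsub>C\<^esub> (\<alpha> l \<circ> f)"
  using assms by (auto simp: fun_eq_iff A.smooth_curves_carrier alpha_simps)

lemma alpha_gen: "l \<in> carrier \<Lambda> \<Longrightarrow> \<alpha> l \<circ> loc_gen A z = loc_gen A z"
proof -
  assume l: "l \<in> carrier \<Lambda>"
  have "\<alpha> l (\<one>\<^bsub>A\<^esub> \<oplus>\<^bsub>A\<^esub> c \<odot>\<^bsub>A\<^esub> z) = \<one>\<^bsub>A\<^esub> \<oplus>\<^bsub>A\<^esub> c \<odot>\<^bsub>A\<^esub> z" for c
    using l zc fixed_centerD(3)[OF z l] by (simp add: alpha_simps alpha_unit)
  then show ?thesis using zc
    by (auto simp: fun_eq_iff a_minus_def A.smult_uminus_one[symmetric] A.smult_assoc[symmetric] simp del: mult_minus1)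
qed

text \<open>The curves that \<open>\<alpha> l\<close> carries into \<open>J\<close> form a closed
  ideal, which contains the generator because \<open>z\<close> is fixed. By minimality of the
  generated ideal and of its closure it contains \<open>J\<close>.\<close>

lemma alpha_J:
  assumes l: "l \<in> carrier \<Lambda>" and f: "f \<in> J"
  shows "\<alpha> l \<circ> f \<in> J"
proof -
  let ?\<Phi> = "\<lambda>f. \<alpha> l \<circ> f"
  let ?I = "{f \<in> smooth_curves A. ?\<Phi> f \<in> J}"
  have c: "continuous_map (topo C) (topo C) ?\<Phi>"
    by (rule A.continuous_postlin[OF alpha_continuous alpha_hom]) (rule l)+
  have "ideal ?I C"
  proof (rule C.ideal_criterion)
    have "\<alpha> l \<zero>\<^bsub>A\<^esub> = \<zero>\<^bsub>A\<^esub>"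
      using alpha_simps(3)[OF l A.zero_closed, of 0] alpha_closed[OF l A.zero_closed] by simp
    then have "?\<Phi> \<zero>\<^bsub>C\<^esub> = \<zero>\<^bsub>C\<^esub>" by (simp add: fun_eq_iff)
    then show "\<zero>\<^bsub>C\<^esub> \<in> ?I" using C.J.zero_closed C.zero_closed by (simp del: smooth_curve_algebra_simps(4)) 
  next
    fix a b assume "a \<in> ?I" "b \<in> ?I"
    then show "a \<oplus>\<^bsub>C\<^esub> b \<in> ?I"
      using alpha_curve_simps(1)[OF l, of a b] C.J.a_closed[of "?\<Phi> a" "?\<Phi> b"] C.a_closed[of a b]
      by (simp del: smooth_curve_algebra_simps(5))
  next
    fix a x assume *: "a \<in> ?I" "x \<in> carrier C"
    then show "x \<otimes>\<^bsub>C\<^esub> a \<in> ?I"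
      using alpha_curve_simps(2)[OF l, of x a] C.J.I_l_closed[of "?\<Phi> a" "?\<Phi> x"] C.m_closed[of x a] alpha_curve[OF l]
      by (simp del: smooth_curve_algebra_simps(2))
    from * show "a \<otimes>\<^bsub>C\<^esub> x \<in> ?I"
      using alpha_curve_simps(2)[OF l, of a x] C.J.I_r_closed[of "?\<Phi> a" "?\<Phi> x"] C.m_closed[of a x] alpha_curve[OF l]
      by (simp del: smooth_curve_algebra_simps(2))
  qed auto
  moreover have "{loc_gen A z} \<subseteq> ?I"
    using A.loc_gen_smooth[OF zc] A.loc_gen_mem[OF zc] alpha_gen[OF l] by simp
  ultimately have "genideal C {loc_gen A z} \<subseteq> ?I" by (rule C.genideal_minimal)
  moreover have "closedin (topo C) ?I"
    using closedin_continuous_map_preimage[OF c C.closed] A.topspace_smooth_curve_algebra by simp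
  ultimately have "J \<subseteq> ?I" unfolding loc_ideal_def by (rule closure_of_minimal)
  then show ?thesis using f by blast
qed

text \<open>\<open>loc_action\<close> takes a union over all representatives of a class; by
  invariance of \<open>J\<close> all of them give the same coset.\<close>

lemma loc_action_pi:
  assumes l: "l \<in> carrier \<Lambda>" and f: "f \<in> smooth_curves A"
  shows "loc_action A \<alpha> z l (J +>\<^bsub>C\<^esub> f) = J +>\<^bsub>C\<^esub> (\<alpha> l \<circ> f)"
proof -
  have e: "J +>\<^bsub>C\<^esub> (\<alpha> l \<circ> h) = J +>\<^bsub>C\<^esub> (\<alpha> l \<circ> f)" if h: "h \<in> J +>\<^bsub>C\<^esub> f" for h
  proof -
    have hc: "h \<in> smooth_curves A" "h \<ominus>\<^bsub>C\<^esub> f \<in> J" using C.mem_pi[of f h] f h C.pi_eq[of h f] by auto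
    have m: "\<alpha> l \<circ> (h \<ominus>\<^bsub>C\<^esub> f) = (\<alpha> l \<circ> h) \<ominus>\<^bsub>C\<^esub> (\<alpha> l \<circ> f)"
    proof -
      have "h \<ominus>\<^bsub>C\<^esub> f = h \<oplus>\<^bsub>C\<^esub> (- 1) \<odot>\<^bsub>C\<^esub> f" "(\<alpha> l \<circ> h) \<ominus>\<^bsub>C\<^esub> (\<alpha> l \<circ> f) = (\<alpha> l \<circ> h) \<oplus>\<^bsub>C\<^esub> (- 1) \<odot>\<^bsub>C\<^esub> (\<alpha> l \<circ> f)"
        using C.smult_uminus_one[of f] C.smult_uminus_one[of "\<alpha> l \<circ> f"] alpha_curve[OF l] f
        by (simp_all add: a_minus_def del: smooth_curve_algebra_simps(5,6))
      moreover have "(- 1) \<odot>\<^bsub>C\<^esub> f \<in> smooth_curves A" using C.smult_closed[of f "-1"] f by simp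
      ultimately show ?thesis
        using alpha_curve_simps(1)[OF l hc(1), of "(- 1) \<odot>\<^bsub>C\<^esub> f"] alpha_curve_simps(3)[OF l f, of "- 1"] by metis
    qed
    then show ?thesis
      using alpha_J[OF l hc(2)] C.pi_eq[of "\<alpha> l \<circ> h" "\<alpha> l \<circ> f"] alpha_curve[OF l] hc(1) f by simp
  qed
  have ne: "J +>\<^bsub>C\<^esub> f \<noteq> {}" using C.J.a_rcos_self[of f] f by auto
  have "(\<Union>h\<in>J +>\<^bsub>C\<^esub> f. J +>\<^bsub>C\<^esub> (\<alpha> l \<circ> h)) = (\<Union>h\<in>J +>\<^bsub>C\<^esub> f. J +>\<^bsub>C\<^esub> (\<alpha> l \<circ> f))" by (rule SUP_cong[OF refl e])
  also have "\<dots> = J +>\<^bsub>C\<^esub> (\<alpha> l \<circ> f)" using ne by (simp only: UN_constant if_False)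
  finally have *: "(\<Union>h\<in>J +>\<^bsub>C\<^esub> f. J +>\<^bsub>C\<^esub> (\<alpha> l \<circ> h)) = J +>\<^bsub>C\<^esub> (\<alpha> l \<circ> f)" .
  have "J +>\<^bsub>C\<^esub> f \<in> carrier Q" using f C.carrier_Q by auto
  then show ?thesis unfolding loc_action_def by (simp add: *)
qed

lemma dynamical_system_localization: "dynamical_system Q \<Lambda> (loc_action A \<alpha> z)"
proof (rule dynamical_systemI)
  note QS = C.carrier_Q[unfolded smooth_curve_algebra_simps]
  note qs = C.Q_simps[unfolded smooth_curve_algebra_simps(1)]
  have cl: "f \<oplus>\<^bsub>C\<^esub> h \<in> smooth_curves A" "f \<otimes>\<^bsub>C\<^esub> h \<in> smooth_curves A" "c \<odot>\<^bsub>C\<^esub> f \<in> smooth_curves A"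
    if "f \<in> smooth_curves A" "h \<in> smooth_curves A" for f h c
    using C.a_closed[of f h] C.m_closed[of f h] C.smult_closed[of f c] that by (simp_all del: smooth_curve_algebra_simps(2,5,6))
  show "lc_algebra Q" by (rule C.lc_algebra_Q)
  show "group \<Lambda>" by (rule L.group_axioms)
  fix l assume l: "l \<in> carrier \<Lambda>"
  show "loc_action A \<alpha> z l \<in> extensional (carrier Q)" by (simp add: loc_action_def)
  note s = loc_action_pi[OF l] qs alpha_curve[OF l] alpha_curve_simps[OF l] cl
  show "loc_action A \<alpha> z l \<in> alg_hom Q Q"
    unfolding alg_hom_def QS
    by (auto simp: s simp del: smooth_curve_algebra_simps(2,5,6))
  \<comment> \<open>Continuity is checked upstairs on curves and descends along the open
    projection.\<close>
  show "continuous_map (topo Q) (topo Q) (loc_action A \<alpha> z l)"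
  proof (rule continuous_map_descend[OF C.open_pi C.pi_surj])
    have "continuous_map (topo C) (topo Q) (\<lambda>f. J +>\<^bsub>C\<^esub> (\<alpha> l \<circ> f))"
      using continuous_map_compose[OF A.continuous_postlin[OF alpha_continuous[OF l] alpha_hom[OF l]] C.continuous_pi] by (simp add: comp_def[of "\<lambda>x. J +>\<^bsub>C\<^esub> x"])
    then show "continuous_map (topo C) (topo Q) (\<lambda>f. loc_action A \<alpha> z l (J +>\<^bsub>C\<^esub> f))"
      by (rule continuous_map_eq) (simp add: loc_action_pi[OF l] A.topspace_smooth_curve_algebra)
  qed
next
  fix x assume "x \<in> carrier Q"
  then obtain f where f: "f \<in> smooth_curves A" "x = J +>\<^bsub>C\<^esub> f" using C.carrier_Q by auto
  have "\<alpha> \<one>\<^bsub>\<Lambda>\<^esub> \<circ> f = f" using f(1) by (auto simp: fun_eq_iff alpha_one A.smooth_curves_carrier)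
  then show "loc_action A \<alpha> z \<one>\<^bsub>\<Lambda>\<^esub> x = x" using loc_action_pi[OF L.one_closed f(1)] f(2) by simp
  fix l m assume lm: "l \<in> carrier \<Lambda>" "m \<in> carrier \<Lambda>"
  have "\<alpha> (l \<otimes>\<^bsub>\<Lambda>\<^esub> m) \<circ> f = \<alpha> l \<circ> (\<alpha> m \<circ> f)" using f(1) lm by (auto simp: fun_eq_iff alpha_mult A.smooth_curves_carrier)
  then show "loc_action A \<alpha> z (l \<otimes>\<^bsub>\<Lambda>\<^esub> m) x = loc_action A \<alpha> z l (loc_action A \<alpha> z m x)"
    using loc_action_pi[OF _ f(1)] loc_action_pi[OF lm(1) alpha_curve[OF lm(2) f(1)]] lm f(2) by simp
qed

text \<open>The reason is \<open>1 - p = (1 - p) (1 - t z)\<close>.\<close>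

lemma pi_const_one:
  assumes p: "p \<in> carrier A" "p \<otimes>\<^bsub>A\<^esub> z = z"
  shows "J +>\<^bsub>C\<^esub> (\<lambda>t. p) = \<one>\<^bsub>Q\<^esub>"
proof -
  let ?d = "\<lambda>t::real. p \<ominus>\<^bsub>A\<^esub> \<one>\<^bsub>A\<^esub>"
  have dc: "p \<ominus>\<^bsub>A\<^esub> \<one>\<^bsub>A\<^esub> \<in> carrier A" using p by simp
  have d: "?d \<in> smooth_curves A" by (rule A.smooth_curves_const[OF dc])
  have z0: "(p \<ominus>\<^bsub>A\<^esub> \<one>\<^bsub>A\<^esub>) \<otimes>\<^bsub>A\<^esub> z = \<zero>\<^bsub>A\<^esub>"
    using p zc by (simp add: a_minus_def A.l_distr A.l_minus A.r_neg)
  have "(p \<ominus>\<^bsub>A\<^esub> \<one>\<^bsub>A\<^esub>) \<otimes>\<^bsub>A\<^esub> loc_gen A z t = p \<ominus>\<^bsub>A\<^esub> \<one>\<^bsub>A\<^esub>" for t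
  proof -
    have "(p \<ominus>\<^bsub>A\<^esub> \<one>\<^bsub>A\<^esub>) \<otimes>\<^bsub>A\<^esub> loc_gen A z t = (p \<ominus>\<^bsub>A\<^esub> \<one>\<^bsub>A\<^esub>) \<otimes>\<^bsub>A\<^esub> (\<one>\<^bsub>A\<^esub> \<oplus>\<^bsub>A\<^esub> (- complex_of_real t) \<odot>\<^bsub>A\<^esub> z)"
      using zc A.smult_assoc[of z "- 1" "complex_of_real t"] by (simp add: a_minus_def[of A "\<one>\<^bsub>A\<^esub>"] A.smult_uminus_one)
    also have "\<dots> = (p \<ominus>\<^bsub>A\<^esub> \<one>\<^bsub>A\<^esub>) \<oplus>\<^bsub>A\<^esub> (- complex_of_real t) \<odot>\<^bsub>A\<^esub> ((p \<ominus>\<^bsub>A\<^esub> \<one>\<^bsub>A\<^esub>) \<otimes>\<^bsub>A\<^esub> z)"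
      using dc zc by (simp add: A.r_distr A.smult_mult_right)
    finally show ?thesis using z0 dc by simp
  qed
  then have "?d \<otimes>\<^bsub>C\<^esub> loc_gen A z = ?d" by (simp add: fun_eq_iff)
  then have "?d \<in> J" using C.J.I_l_closed[OF A.loc_gen_mem[OF zc], of ?d] d by (simp del: smooth_curve_algebra_simps(2))
  moreover have "(\<lambda>t. p) \<ominus>\<^bsub>C\<^esub> \<one>\<^bsub>C\<^esub> = ?d"
  proof -
    have "\<ominus>\<^bsub>C\<^esub> \<one>\<^bsub>C\<^esub> = (\<lambda>t. \<ominus>\<^bsub>A\<^esub> \<one>\<^bsub>A\<^esub>)"
      by (rule C.minus_equality) (auto simp: A.l_neg A.smooth_curves_const)
    then show ?thesis by (simp add: a_minus_def)
  qed
  ultimately show ?thesis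
    using C.pi_eq[of "\<lambda>t. p" "\<one>\<^bsub>C\<^esub>"] A.smooth_curves_const[OF p(1)] A.smooth_curves_const[of "\<one>\<^bsub>A\<^esub>"] C.Q_simps(4) by simp
qed

lemma pi_const_pow:
  assumes b: "b \<in> carrier A"
  shows "(J +>\<^bsub>C\<^esub> (\<lambda>t. b)) [^]\<^bsub>Q\<^esub> (n::nat) = J +>\<^bsub>C\<^esub> (\<lambda>t. b [^]\<^bsub>A\<^esub> n)"
proof (induction n)
  case 0
  then show ?case using C.Q_simps(4) by simp
next
  case (Suc n)
  interpret Q: lca Q by (rule lca.intro[OF C.lc_algebra_Q])
  have "(J +>\<^bsub>C\<^esub> (\<lambda>t. b [^]\<^bsub>A\<^esub> n)) \<otimes>\<^bsub>Q\<^esub> (J +>\<^bsub>C\<^esub> (\<lambda>t. b)) = J +>\<^bsub>C\<^esub> ((\<lambda>t. b [^]\<^bsub>A\<^esub> n) \<otimes>\<^bsub>C\<^esub> (\<lambda>t. b))"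
    by (rule C.Q_simps(2)) (use b A.smooth_curves_const A.nat_pow_closed in auto)
  then show ?case using Suc by simp
qed

text \<open>With \<open>n\<close> the order of \<open>s\<close>, the equation \<open>b^n = 1\<close>
  is demanded only after multiplication with \<open>z\<close>. In the localization at
  \<open>z\<close> it becomes an honest equation by \<open>pi_const_one\<close>, and the class of
  \<open>b\<close> is then a unit.\<close>

lemma trivial_localization:
  assumes fin: "finite (carrier \<Lambda>)" and S: "minimal_generators \<Lambda> S" "internal_direct_product \<Lambda> S"
    and gen: "\<And>s. s \<in> S \<Longrightarrow> \<exists>\<xi> \<in> hom \<Lambda> circle_group.
           \<xi> s = exp (2 * of_real pi * \<i> / of_nat (group.ord \<Lambda> s)) \<and> (\<forall>t\<in>S - {s}. \<xi> t = 1) \<and>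
           (\<exists>b \<in> isotypic A \<Lambda> \<alpha> \<xi>. (b [^]\<^bsub>A\<^esub> group.ord \<Lambda> s) \<otimes>\<^bsub>A\<^esub> z = z)"
  shows "trivial_ncp_bundle Q \<Lambda> (loc_action A \<alpha> z)"
  unfolding trivial_ncp_bundle_def
proof (intro conjI exI[of _ S] ballI)
  show "dynamical_system Q \<Lambda> (loc_action A \<alpha> z)" by (rule dynamical_system_localization)
  fix s assume s: "s \<in> S"
  then obtain \<xi> b where \<xi>: "\<xi> \<in> hom \<Lambda> circle_group" "\<xi> s = exp (2 * of_real pi * \<i> / of_nat (group.ord \<Lambda> s))" "\<forall>t\<in>S - {s}. \<xi> t = 1"
    and b: "b \<in> isotypic A \<Lambda> \<alpha> \<xi>" "(b [^]\<^bsub>A\<^esub> group.ord \<Lambda> s) \<otimes>\<^bsub>A\<^esub> z = z" using gen by blast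
  have bc: "b \<in> carrier A" using b by (simp add: isotypic_def)
  interpret Q: lca Q by (rule lca.intro[OF C.lc_algebra_Q])
  let ?a = "J +>\<^bsub>C\<^esub> (\<lambda>t. b)"
  let ?n = "group.ord \<Lambda> s"
  have ac: "?a \<in> carrier Q" using A.smooth_curves_const[OF bc] C.carrier_Q by auto
  have an: "?a [^]\<^bsub>Q\<^esub> ?n = \<one>\<^bsub>Q\<^esub>"
    unfolding pi_const_pow[OF bc] by (rule pi_const_one) (use bc b in auto)
  have "?a \<in> isotypic Q \<Lambda> (loc_action A \<alpha> z) \<xi>"
    unfolding isotypic_def
  proof (intro CollectI conjI ballI ac)
    fix l assume l: "l \<in> carrier \<Lambda>"
    have "\<alpha> l \<circ> (\<lambda>t. b) = \<xi> l \<odot>\<^bsub>C\<^esub> (\<lambda>t. b)" using b(1) l by (auto simp: isotypic_def fun_eq_iff)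
    then show "loc_action A \<alpha> z l ?a = \<xi> l \<odot>\<^bsub>Q\<^esub> ?a"
      using loc_action_pi[OF l A.smooth_curves_const[OF bc]] C.Q_simps(3)[of "\<lambda>t. b"] A.smooth_curves_const[OF bc]
      by (simp del: smooth_curve_algebra_simps(6))
  qed
  moreover have "?a \<in> Units Q"
  proof -
    have "s \<in> carrier \<Lambda>" using S(1) s by (auto simp: minimal_generators_def)
    \<comment> \<open>Finiteness of the group makes the order positive; the inverse of the class is
      its \<open>m\<close>-th power.\<close>
    then obtain m where m: "?n = Suc m" using L.ord_ge_1[OF fin] by (metis Suc_le_D One_nat_def)
    then have "?a [^]\<^bsub>Q\<^esub> m \<otimes>\<^bsub>Q\<^esub> ?a = \<one>\<^bsub>Q\<^esub>" "?a \<otimes>\<^bsub>Q\<^esub> ?a [^]\<^bsub>Q\<^esub> m = \<one>\<^bsub>Q\<^esub>"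
      using an Q.nat_pow_Suc2[OF ac, of m] by simp_all
    then show ?thesis using ac Q.nat_pow_closed[OF ac] unfolding Units_def by blast
  qed
  ultimately show "\<exists>\<xi>\<in>hom \<Lambda> circle_group. \<xi> s = exp (2 * complex_of_real pi * \<i> / of_nat (group.ord \<Lambda> s)) \<and>
      (\<forall>t\<in>S - {s}. \<xi> t = 1) \<and> (\<exists>a\<in>isotypic Q \<Lambda> (loc_action A \<alpha> z) \<xi> \<inter> Units Q. a [^]\<^bsub>Q\<^esub> group.ord \<Lambda> s = \<one>\<^bsub>Q\<^esub>)"
    using \<xi> an by blast
qed (use S in auto)

end

section \<open>The bundle defined by a cocycle\<close>

lemma smooth_on_cong:
  assumes E: "lcs E" and F: "lcs F" and f: "smooth_on E F U f" and "U' = U" "\<And>x. x \<in> U \<Longrightarrow> g x = f x"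
  shows "smooth_on E F U' g"
  using f assms(4,5) smooth_family_cong[OF E, of "discrete_topology {()}" F U "\<lambda>_. f" "\<lambda>_. g"]
  unfolding smooth_on_iff_family[OF E F] by auto

lemma smooth_on_subset:
  assumes E: "lcs E" and F: "lcs F" and f: "smooth_on E F U f" and "openin (topo E) V" "V \<subseteq> U"
  shows "smooth_on E F V f"
  using f smooth_family_subset[OF E F _ assms(4,5)] unfolding smooth_on_iff_family[OF E F] by blast

lemma smooth_on_pair:
  assumes E: "lcs E" and F: "lcs F" and G: "lcs G" and f: "smooth_on E F U f" and g: "smooth_on E G U g"
  shows "smooth_on E (prod_tvs F G) U (\<lambda>x. (f x, g x))"
  using smooth_family_pair[OF E F G] f g
  unfolding smooth_on_iff_family[OF E F] smooth_on_iff_family[OF E G] smooth_on_iff_family[OF E lcs_prod_tvs[OF F G]] by blast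

lemma smooth_on_postlin:
  assumes E: "lcs E" and F: "lcs F" and G: "lcs G"
    and L: "continuous_map (topo F) (topo G) L"
    "\<And>a b. a \<in> carrier F \<Longrightarrow> b \<in> carrier F \<Longrightarrow> L (a \<oplus>\<^bsub>F\<^esub> b) = L a \<oplus>\<^bsub>G\<^esub> L b"
    "\<And>c a. a \<in> carrier F \<Longrightarrow> L (c \<odot>\<^bsub>F\<^esub> a) = c \<odot>\<^bsub>G\<^esub> L a"
    and f: "smooth_on E F U f"
  shows "smooth_on E G U (\<lambda>x. L (f x))"
  unfolding smooth_on_iff_family[OF E G]
  by (rule smooth_family_postlin[OF E F G _ _ _ f[unfolded smooth_on_iff_family[OF E F]], where L="\<lambda>_. L"])
    (use L continuous_map_compose[OF continuous_map_snd L(1)] in \<open>auto simp: o_def\<close>)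

lemma smooth_on_prelin:
  assumes E: "lcs E" and E': "lcs E'" and F: "lcs F" and U': "openin (topo E') U'"
    and L: "continuous_map (topo E') (topo E) L"
    "\<And>a b. a \<in> carrier E' \<Longrightarrow> b \<in> carrier E' \<Longrightarrow> L (a \<oplus>\<^bsub>E'\<^esub> b) = L a \<oplus>\<^bsub>E\<^esub> L b"
    "\<And>c a. a \<in> carrier E' \<Longrightarrow> L (c \<odot>\<^bsub>E'\<^esub> a) = c \<odot>\<^bsub>E\<^esub> L a"
    and LU: "\<And>x. x \<in> U' \<Longrightarrow> L x \<in> U" and f: "smooth_on E F U f"
  shows "smooth_on E' F U' (\<lambda>x. f (L x))"
  unfolding smooth_on_iff_family[OF E' F]
proof (rule smooth_family_affine[OF E E' U' _ L(1) _ _ f[unfolded smooth_on_iff_family[OF E F]], where T="\<lambda>_. L"])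
  show "continuous_map (prod_topology (discrete_topology {()}) (subtopology (topo E') U')) (topo E) (\<lambda>z. L (snd z))"
    using continuous_map_compose[OF continuous_map_snd continuous_map_from_subtopology[OF L(1)]] by (simp add: o_def)
qed (use L LU lcs.smult_closed[OF E'] in auto)

lemma smooth_on_open: "smooth_on E F U f \<Longrightarrow> openin (topo E) U"
  by (simp add: smooth_on_def)

locale bundle_data = dyn_sys A \<Lambda> \<alpha>
  for A :: "(complex, 'a) tvs" and \<Lambda> :: "'l monoid" and \<alpha> :: "'l \<Rightarrow> 'a \<Rightarrow> 'a" +
  fixes n :: nat and M :: "('m, nat \<Rightarrow> real) manifold" and I :: "'i set" and U :: "'i \<Rightarrow> 'm set"
    and g :: "'i \<Rightarrow> 'i \<Rightarrow> 'm \<Rightarrow> 'a \<Rightarrow> 'a"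
  assumes M: "findim_manifold n M"
    and U_open: "\<And>i. i \<in> I \<Longrightarrow> openin (mtopo M) (U i)" and U_cover: "(\<Union>i\<in>I. U i) = topspace (mtopo M)"
    and g_auto: "\<And>i j x. i \<in> I \<Longrightarrow> j \<in> I \<Longrightarrow> x \<in> U i \<inter> U j \<Longrightarrow> g i j x \<in> equivariant_auto A \<Lambda> \<alpha>"
    and g_smooth: "\<And>i j. i \<in> I \<Longrightarrow> j \<in> I \<Longrightarrow>
           smooth_map (prod_manifold M (tvs_manifold (real_tvs A))) (tvs_manifold (real_tvs A))
             ((U i \<inter> U j) \<times> carrier A) (\<lambda>(x, a). g i j x a)"
    and g_one: "\<And>i x. i \<in> I \<Longrightarrow> x \<in> U i \<Longrightarrow> g i i x = \<one>\<^bsub>AlgAut A\<^esub>"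
    and g_cocycle: "\<And>i j k x. i \<in> I \<Longrightarrow> j \<in> I \<Longrightarrow> k \<in> I \<Longrightarrow> x \<in> U i \<inter> U j \<inter> U k \<Longrightarrow>
           g i j x \<otimes>\<^bsub>AlgAut A\<^esub> g j k x = g i k x"
begin

abbreviation X where "X \<equiv> topspace (mtopo M)"
abbreviation E where "E \<equiv> Rn n"
abbreviation F where "F \<equiv> real_tvs A"
abbreviation G where "G \<equiv> prod_tvs E F"
abbreviation C where "C \<equiv> carrier A"
abbreviation MA where "MA \<equiv> prod_topology (mtopo M) (topo A)"

lemma sm_M: "smooth_manifold M" and model_M [simp]: "model M = E"
  using M by (auto simp: findim_manifold_def)

lemma lcs_E: "lcs E" using sm_M by (simp add: smooth_manifold_def lcs_def)
lemma lcs_F: "lcs F" by (rule A.real_lcs)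
lemma lcs_G: "lcs G" by (rule lcs_prod_tvs[OF lcs_E lcs_F])

lemma carrier_E: "topspace (topo E) = carrier E" using lcs.topspace[OF lcs_E] .

lemma U_sub: "i \<in> I \<Longrightarrow> U i \<subseteq> X" using U_open openin_subset by blast

lemma chart:
  assumes "(V, \<psi>) \<in> atlas M"
  shows "openin (mtopo M) V" "openin (topo E) (\<psi> ` V)"
    "homeomorphic_map (subtopology (mtopo M) V) (subtopology (topo E) (\<psi> ` V)) \<psi>" "V \<subseteq> X" "inj_on \<psi> V"
    "continuous_map (subtopology (mtopo M) V) (topo E) \<psi>"
    "continuous_map (subtopology (topo E) (\<psi> ` V)) (mtopo M) (inv_into V \<psi>)"
    "\<And>N. openin (mtopo M) N \<Longrightarrow> N \<subseteq> V \<Longrightarrow> openin (topo E) (\<psi> ` N)"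
proof -
  show V: "openin (mtopo M) V" and pV: "openin (topo E) (\<psi> ` V)"
    and hm: "homeomorphic_map (subtopology (mtopo M) V) (subtopology (topo E) (\<psi> ` V)) \<psi>"
    using sm_M assms unfolding smooth_manifold_def by auto
  show VX: "V \<subseteq> X" using openin_subset[OF V] .
  have ts: "topspace (subtopology (mtopo M) V) = V" using VX by auto
  show inj: "inj_on \<psi> V" using homeomorphic_imp_injective_map[OF hm] unfolding ts .
  show "continuous_map (subtopology (mtopo M) V) (topo E) \<psi>"
    using homeomorphic_imp_continuous_map[OF hm] continuous_map_into_fulltopology by blast
  \<comment> \<open>The inverse provided by the homeomorphism agrees on the image with
    \<open>inv_into V \<psi>\<close>, the form used in the definitions of smooth maps and local
    representatives.\<close>
  obtain \<psi>' where \<psi>': "homeomorphic_maps (subtopology (mtopo M) V) (subtopology (topo E) (\<psi> ` V)) \<psi> \<psi>'"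
    using hm homeomorphic_map_maps by blast
  have "continuous_map (subtopology (topo E) (\<psi> ` V)) (mtopo M) \<psi>'"
    using \<psi>' continuous_map_into_fulltopology unfolding homeomorphic_maps_def by blast
  then show "continuous_map (subtopology (topo E) (\<psi> ` V)) (mtopo M) (inv_into V \<psi>)"
    by (rule continuous_map_eq) (use \<psi>' inj VX in \<open>auto simp: homeomorphic_maps_def\<close>)
  fix N assume N: "openin (mtopo M) N" "N \<subseteq> V"
  then have "openin (subtopology (mtopo M) V) N" by (simp add: openin_open_subtopology V)
  then have "openin (subtopology (topo E) (\<psi> ` V)) (\<psi> ` N)"
    using homeomorphic_imp_open_map[OF hm] by (simp add: open_map_def)
  then show "openin (topo E) (\<psi> ` N)" using pV by (simp add: openin_open_subtopology)
qed

lemma chart_ex: "x \<in> X \<Longrightarrow> \<exists>V \<psi>. (V, \<psi>) \<in> atlas M \<and> x \<in> V"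
proof -
  assume "x \<in> X"
  moreover have "\<Union> (fst ` atlas M) = X" using sm_M unfolding smooth_manifold_def by (elim conjE)
  ultimately have "x \<in> \<Union> (fst ` atlas M)" by simp
  then obtain c where "c \<in> atlas M" "x \<in> fst c" by blast
  then show ?thesis by (intro exI[of _ "fst c"] exI[of _ "snd c"]) simp
qed

lemma chart_trans:
  assumes "(V, \<psi>) \<in> atlas M" "(V', \<psi>') \<in> atlas M"
  shows "smooth_on E E (\<psi> ` (V \<inter> V')) (\<psi>' \<circ> inv_into V \<psi>)"
proof -
  have "\<forall>(U, \<phi>)\<in>atlas M. \<forall>(V, \<psi>)\<in>atlas M. smooth_on (model M) (model M) (\<phi> ` (U \<inter> V)) (\<psi> \<circ> inv_into U \<phi>)"
    using sm_M unfolding smooth_manifold_def by (elim conjE)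
  from bspec[OF this assms(1)]
  have "\<forall>(V', \<psi>')\<in>atlas M. smooth_on E E (\<psi> ` (V \<inter> V')) (\<psi>' \<circ> inv_into V \<psi>)" by simp
  from bspec[OF this assms(2)] show ?thesis by simp
qed

lemma g_props:
  assumes "i \<in> I" "j \<in> I" "x \<in> U i" "x \<in> U j"
  shows "a \<in> C \<Longrightarrow> g i j x a \<in> C"
    "a \<in> C \<Longrightarrow> b \<in> C \<Longrightarrow> g i j x (a \<oplus>\<^bsub>A\<^esub> b) = g i j x a \<oplus>\<^bsub>A\<^esub> g i j x b"
    "a \<in> C \<Longrightarrow> b \<in> C \<Longrightarrow> g i j x (a \<otimes>\<^bsub>A\<^esub> b) = g i j x a \<otimes>\<^bsub>A\<^esub> g i j x b"
    "a \<in> C \<Longrightarrow> g i j x (c \<odot>\<^bsub>A\<^esub> a) = c \<odot>\<^bsub>A\<^esub> g i j x a"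
    "bij_betw (g i j x) C C"
    "a \<in> C \<Longrightarrow> l \<in> carrier \<Lambda> \<Longrightarrow> \<alpha> l (g i j x a) = g i j x (\<alpha> l a)"
  using g_auto[of i j x] assms by (auto simp: equivariant_auto_def alg_auto_def alg_hom_def Bij_def)

lemma g_id: "i \<in> I \<Longrightarrow> x \<in> U i \<Longrightarrow> a \<in> C \<Longrightarrow> g i i x a = a"
  by (simp add: g_one AlgAut_def BijGroup_def)

lemma g_comp:
  assumes "i \<in> I" "j \<in> I" "k \<in> I" "x \<in> U i" "x \<in> U j" "x \<in> U k" "a \<in> C"
  shows "g i j x (g j k x a) = g i k x a"
proof -
  have "g i j x \<in> Bij C" "g j k x \<in> Bij C"
    using g_auto[of i j x] g_auto[of j k x] assms by (auto simp: equivariant_auto_def alg_auto_def)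
  then show ?thesis
    using g_cocycle[of i j k x] assms by (simp add: AlgAut_def BijGroup_def) (metis compose_eq)
qed

text \<open>Automorphisms are not unital by definition. The unit is recovered from surjectivity: by
  the cocycle identity \<open>g i j x\<close> maps \<open>g j i x \<one>\<close> to the
  unit.\<close>

lemma g_unit: "i \<in> I \<Longrightarrow> j \<in> I \<Longrightarrow> x \<in> U i \<Longrightarrow> x \<in> U j \<Longrightarrow> g i j x \<one>\<^bsub>A\<^esub> = \<one>\<^bsub>A\<^esub>"
proof -
  assume *: "i \<in> I" "j \<in> I" "x \<in> U i" "x \<in> U j"
  have "\<one>\<^bsub>A\<^esub> = g i j x (g j i x \<one>\<^bsub>A\<^esub>)" using g_comp[of i j i x "\<one>\<^bsub>A\<^esub>"] g_id * by simp
  also have "\<dots> = g i j x (g j i x \<one>\<^bsub>A\<^esub> \<otimes>\<^bsub>A\<^esub> \<one>\<^bsub>A\<^esub>)" using * by (simp add: g_props)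
  also have "\<dots> = g i j x (g j i x \<one>\<^bsub>A\<^esub>) \<otimes>\<^bsub>A\<^esub> g i j x \<one>\<^bsub>A\<^esub>" using * by (intro g_props) (auto simp: g_props)
  also have "\<dots> = g i j x \<one>\<^bsub>A\<^esub>" using g_comp[of i j i x "\<one>\<^bsub>A\<^esub>"] g_id * by (simp add: g_props)
  finally show ?thesis by simp
qed

lemma g_continuous:
  assumes "i \<in> I" "j \<in> I"
  shows "continuous_map (subtopology MA ((U i \<inter> U j) \<times> C)) (topo A) (\<lambda>(x, a). g i j x a)"
  using g_smooth[OF assms] by (simp add: smooth_map_def prod_manifold_def tvs_manifold_def)

lemma map_prod_chart:
  assumes "(V, \<psi>) \<in> atlas M" "x \<in> V" "a \<in> D"
  shows "inv_into (V \<times> D) (map_prod \<psi> id) (\<psi> x, a) = (x, a)"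
  using inv_into_f_f[of "map_prod \<psi> id" "V \<times> D" "(x, a)"] assms map_prod_inj_on[OF chart(5)[OF assms(1)], of id D]
  by auto

text \<open>The space \<open>A\<close> carries its single identity chart, so in coordinates only the
  base variable is changed.\<close>

lemma g_smooth_local:
  assumes "i \<in> I" "j \<in> I" "(V, \<psi>) \<in> atlas M"
  shows "smooth_on G F (\<psi> ` (U i \<inter> U j \<inter> V) \<times> C) (\<lambda>(y, a). g i j (inv_into V \<psi> y) a)"
proof (rule smooth_on_cong[OF lcs_G lcs_F])
  have "(V \<times> C, map_prod \<psi> id) \<in> atlas (prod_manifold M (tvs_manifold (real_tvs A)))"
    using assms(3) by (auto simp: prod_manifold_def tvs_manifold_def)
  then show "smooth_on G F (map_prod \<psi> id ` ((V \<times> C) \<inter> ((U i \<inter> U j) \<times> C) \<inter> (\<lambda>(x, a). g i j x a) -` C))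
     (id \<circ> (\<lambda>(x, a). g i j x a) \<circ> inv_into (V \<times> C) (map_prod \<psi> id))"
    using g_smooth[OF assms(1,2)] unfolding smooth_map_def
    by (auto simp: prod_manifold_def tvs_manifold_def)
  show "\<psi> ` (U i \<inter> U j \<inter> V) \<times> C = map_prod \<psi> id ` ((V \<times> C) \<inter> ((U i \<inter> U j) \<times> C) \<inter> (\<lambda>(x, a). g i j x a) -` C)"
    using assms(1,2) by (force simp: g_props)
  fix z assume "z \<in> map_prod \<psi> id ` ((V \<times> C) \<inter> ((U i \<inter> U j) \<times> C) \<inter> (\<lambda>(x, a). g i j x a) -` C)"
  then obtain x a where "z = (\<psi> x, a)" "x \<in> V" "a \<in> C" by auto
  then show "(case z of (y, a) \<Rightarrow> g i j (inv_into V \<psi> y) a) = (id \<circ> (\<lambda>(x, a). g i j x a) \<circ> inv_into (V \<times> C) (map_prod \<psi> id)) z"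
    using map_prod_chart[OF assms(3), of x a C] chart(5)[OF assms(3)] by simp
qed

lemma fst_linear:
  "continuous_map (topo G) (topo E) fst"
  "a \<in> carrier G \<Longrightarrow> b \<in> carrier G \<Longrightarrow> fst (a \<oplus>\<^bsub>G\<^esub> b) = fst a \<oplus>\<^bsub>E\<^esub> fst b"
  "a \<in> carrier G \<Longrightarrow> fst (c \<odot>\<^bsub>G\<^esub> a) = c \<odot>\<^bsub>E\<^esub> fst a"
  by (auto simp: continuous_map_fst)

lemma snd_linear:
  "continuous_map (topo G) (topo F) snd"
  "a \<in> carrier G \<Longrightarrow> b \<in> carrier G \<Longrightarrow> snd (a \<oplus>\<^bsub>G\<^esub> b) = snd a \<oplus>\<^bsub>F\<^esub> snd b"
  "a \<in> carrier G \<Longrightarrow> snd (c \<odot>\<^bsub>G\<^esub> a) = c \<odot>\<^bsub>F\<^esub> snd a"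
  by (auto simp: continuous_map_snd)

lemma open_Times_C: "openin (topo E) D \<Longrightarrow> openin (topo G) (D \<times> C)"
  using openin_topspace[of "topo A"] by (auto simp: openin_prod_Times_iff)

lemma base_trans_smooth:
  assumes "(V, \<psi>) \<in> atlas M" "(V', \<psi>') \<in> atlas M" "openin (mtopo M) N" "N \<subseteq> V \<inter> V'"
  shows "smooth_on G E (\<psi> ` N \<times> C) (\<lambda>(y, a). \<psi>' (inv_into V \<psi> y))"
proof -
  have o: "openin (topo E) (\<psi> ` N)" using chart(8)[OF assms(1,3)] assms(4) by blast
  have "smooth_on E E (\<psi> ` N) (\<psi>' \<circ> inv_into V \<psi>)"
    using assms(4) by (intro smooth_on_subset[OF lcs_E lcs_E chart_trans[OF assms(1,2)] o]) auto
  from smooth_on_prelin[OF lcs_E lcs_G lcs_E open_Times_C[OF o] fst_linear _ this]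
  show ?thesis by (auto simp: o_def case_prod_unfold)
qed

text \<open>Changes of charts of the total space, the bundle charts and their inverses all take this
  form in coordinates, so that their smoothness is a matter of identifying domains and
  formulas.\<close>

lemma trans_smooth:
  assumes "i \<in> I" "j \<in> I" "(V, \<psi>) \<in> atlas M" "(V', \<psi>') \<in> atlas M"
  shows "smooth_on G G (\<psi> ` (U i \<inter> U j \<inter> V \<inter> V') \<times> C) (\<lambda>(y, a). (\<psi>' (inv_into V \<psi> y), g i j (inv_into V \<psi> y) a))"
proof -
  let ?N = "U i \<inter> U j \<inter> V \<inter> V'"
  have N: "openin (mtopo M) ?N"
    using U_open[OF assms(1)] U_open[OF assms(2)] chart(1)[OF assms(3)] chart(1)[OF assms(4)] by auto
  have "smooth_on G F (\<psi> ` ?N \<times> C) (\<lambda>(y, a). g i j (inv_into V \<psi> y) a)"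
    using open_Times_C chart(8)[OF assms(3) N]
    by (intro smooth_on_subset[OF lcs_G lcs_F g_smooth_local[OF assms(1-3)]]) auto
  from smooth_on_pair[OF lcs_G lcs_E lcs_F base_trans_smooth[OF assms(3,4) N] this]
  show ?thesis by (simp add: case_prod_unfold Int_assoc) (auto simp: case_prod_unfold Int_assoc)
qed

definition idx where "idx x = (SOME i. i \<in> I \<and> x \<in> U i)"

lemma idx: "x \<in> X \<Longrightarrow> idx x \<in> I" "x \<in> X \<Longrightarrow> x \<in> U (idx x)"
  unfolding idx_def using U_cover by (metis (mono_tags, lifting) UN_iff someI_ex)+

lemma idx_U: "i \<in> I \<Longrightarrow> x \<in> U i \<Longrightarrow> idx x \<in> I" "i \<in> I \<Longrightarrow> x \<in> U i \<Longrightarrow> x \<in> U (idx x)"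
  using idx U_sub by blast+

text \<open>The total space is \<open>M \<times> A\<close> as a set; the fibre over \<open>x\<close> is identified with \<open>A\<close> by means of
  the chart with the chosen index \<open>idx x\<close>.\<close>

definition \<phi> where "\<phi> i = (\<lambda>(x, a). (x, g (idx x) i x a))"
text \<open>The fibre component of the inverse of \<open>\<phi> i\<close>, see
  \<open>inv_phi\<close>, given by a formula in \<open>g\<close> instead of
  \<open>inv_into\<close>.\<close>

definition \<rho> where "\<rho> i = (\<lambda>(x, b). g i (idx x) x b)"

lemma phi_C: "i \<in> I \<Longrightarrow> x \<in> U i \<Longrightarrow> a \<in> C \<Longrightarrow> \<phi> i (x, a) \<in> U i \<times> C"
  by (simp add: \<phi>_def g_props idx_U)

lemma rho_C: "i \<in> I \<Longrightarrow> x \<in> U i \<Longrightarrow> a \<in> C \<Longrightarrow> \<rho> i (x, a) \<in> C"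
  by (simp add: \<rho>_def g_props idx_U)

lemma rho_phi: "i \<in> I \<Longrightarrow> j \<in> I \<Longrightarrow> x \<in> U i \<Longrightarrow> x \<in> U j \<Longrightarrow> a \<in> C \<Longrightarrow> \<rho> i (\<phi> j (x, a)) = g i j x a"
  by (simp add: \<rho>_def \<phi>_def g_comp idx_U)

lemma rho_phi_same: "i \<in> I \<Longrightarrow> x \<in> U i \<Longrightarrow> a \<in> C \<Longrightarrow> \<rho> i (\<phi> i (x, a)) = a"
  by (simp add: rho_phi g_id)

lemma phi_rho: "i \<in> I \<Longrightarrow> x \<in> U i \<Longrightarrow> b \<in> C \<Longrightarrow> \<phi> i (x, \<rho> i (x, b)) = (x, b)"
  by (simp add: \<rho>_def \<phi>_def g_comp g_id idx_U)

lemma bij_phi: "i \<in> I \<Longrightarrow> D \<subseteq> U i \<Longrightarrow> bij_betw (\<phi> i) (D \<times> C) (D \<times> C)"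
  by (rule bij_betw_byWitness[where f'="\<lambda>z. (fst z, \<rho> i z)"])
    (use phi_C rho_C rho_phi_same phi_rho in \<open>auto simp: \<phi>_def split: prod.splits\<close>)

lemma inv_phi: "i \<in> I \<Longrightarrow> x \<in> U i \<Longrightarrow> b \<in> C \<Longrightarrow> inv_into (U i \<times> C) (\<phi> i) (x, b) = (x, \<rho> i (x, b))"
  by (rule inv_into_f_eq) (use bij_phi[of i "U i"] rho_C phi_rho in \<open>auto simp: bij_betw_def\<close>)

text \<open>The final topology of the maps \<open>\<phi> i\<close>. In general it differs from the
  product topology on the same set, because \<open>idx\<close> jumps.\<close>

definition T_open where "T_open W \<longleftrightarrow> W \<subseteq> X \<times> C \<and> (\<forall>i\<in>I. openin MA {z \<in> U i \<times> C. \<phi> i z \<in> W})"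

definition chT where "chT i \<psi> = (\<lambda>e. (\<psi> (fst e), \<rho> i e))"

definition T :: "('m \<times> 'a, (nat \<Rightarrow> real) \<times> 'a) manifold" where
  "T = \<lparr>mtopo = topology T_open, model = G,
     atlas = {((U i \<inter> V) \<times> C, chT i \<psi>) |i V \<psi>. i \<in> I \<and> (V, \<psi>) \<in> atlas M}\<rparr>"

lemma T_simps [simp]: "model T = G" "atlas T = {((U i \<inter> V) \<times> C, chT i \<psi>) |i V \<psi>. i \<in> I \<and> (V, \<psi>) \<in> atlas M}"
  by (simp_all add: T_def)

lemma openin_T: "openin (mtopo T) W \<longleftrightarrow> T_open W"
proof -
  have "istopology T_open"
    unfolding istopology_def
  proof (intro conjI allI impI)
    fix S W assume *: "T_open S" "T_open W"
    have "{z \<in> U i \<times> C. \<phi> i z \<in> S \<inter> W} = {z \<in> U i \<times> C. \<phi> i z \<in> S} \<inter> {z \<in> U i \<times> C. \<phi> i z \<in> W}" for i by blast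
    then show "T_open (S \<inter> W)" using * unfolding T_open_def by auto
  next
    fix K assume *: "\<forall>S\<in>K. T_open S"
    have "{z \<in> U i \<times> C. \<phi> i z \<in> \<Union>K} = (\<Union>S\<in>K. {z \<in> U i \<times> C. \<phi> i z \<in> S})" for i by blast
    then show "T_open (\<Union>K)" using * unfolding T_open_def by auto
  qed
  then show ?thesis by (simp add: T_def topology_inverse')
qed

lemma UC_open: "openin (mtopo M) D \<Longrightarrow> openin MA (D \<times> C)"
  using openin_topspace[of "topo A"] by (auto simp: openin_prod_Times_iff)

lemma topspace_T [simp]: "topspace (mtopo T) = X \<times> C"
proof -
  have "{z \<in> U i \<times> C. \<phi> i z \<in> X \<times> C} = U i \<times> C" if "i \<in> I" for i
    using phi_C[OF that] U_sub[OF that] by fastforce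
  then have "T_open (X \<times> C)" unfolding T_open_def using UC_open U_open by auto
  then have "openin (mtopo T) (X \<times> C)" by (simp add: openin_T)
  moreover have "topspace (mtopo T) \<subseteq> X \<times> C" using openin_topspace[of "mtopo T"] unfolding openin_T T_open_def by blast
  ultimately show ?thesis using openin_subset by blast
qed

lemma continuous_phi: "i \<in> I \<Longrightarrow> continuous_map (subtopology MA (U i \<times> C)) (mtopo T) (\<phi> i)"
  unfolding continuous_map_def
proof (intro conjI allI impI)
  assume i: "i \<in> I"
  have ts: "topspace (subtopology MA (U i \<times> C)) = U i \<times> C" using U_sub[OF i] by auto
  show "\<phi> i \<in> topspace (subtopology MA (U i \<times> C)) \<rightarrow> topspace (mtopo T)"
    unfolding ts using phi_C[OF i] U_sub[OF i] by fastforce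
  fix W assume "openin (mtopo T) W"
  then show "openin (subtopology MA (U i \<times> C)) {z \<in> topspace (subtopology MA (U i \<times> C)). \<phi> i z \<in> W}"
    unfolding ts openin_T T_open_def using i by (auto simp: openin_open_subtopology UC_open U_open)
qed

text \<open>Seen in the chart with index \<open>j\<close>, the image of \<open>N\<close> is the
  preimage of \<open>N\<close> under \<open>(x, a) \<mapsto> (x, g i j x a)\<close> over the
  overlap. Thus continuity of the cocycle makes \<open>\<phi> i\<close> open.\<close>

lemma open_phi:
  assumes i: "i \<in> I" and N: "openin MA N" "N \<subseteq> U i \<times> C"
  shows "openin (mtopo T) (\<phi> i ` N)"
  unfolding openin_T T_open_def
proof (intro conjI ballI)
  show "\<phi> i ` N \<subseteq> X \<times> C"
    using image_mono[OF N(2), of "\<phi> i"] bij_betw_imp_surj_on[OF bij_phi[OF i order_refl]] U_sub[OF i] by auto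
  fix j assume j: "j \<in> I"
  let ?S = "subtopology MA ((U i \<inter> U j) \<times> C)"
  have ts: "topspace ?S = (U i \<inter> U j) \<times> C" using U_sub[OF i] by auto
  have c: "continuous_map ?S MA (\<lambda>z. (fst z, (\<lambda>(x, a). g i j x a) z))"
    by (intro continuous_map_pairedI g_continuous i j continuous_map_from_subtopology[OF continuous_map_fst])
  have "{z \<in> U j \<times> C. \<phi> j z \<in> \<phi> i ` N} = {z \<in> topspace ?S. (fst z, (\<lambda>(x, a). g i j x a) z) \<in> N}"
    unfolding ts
  proof (intro equalityI subsetI)
    fix z assume "z \<in> {z \<in> U j \<times> C. \<phi> j z \<in> \<phi> i ` N}"
    then obtain x a b where z: "z = (x, a)" "x \<in> U j" "a \<in> C" "\<phi> j (x, a) = \<phi> i (x, b)" "(x, b) \<in> N"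
      by (auto simp: \<phi>_def)
    then have x: "x \<in> U i" "b \<in> C" using N by auto
    have "b = g i j x a" using rho_phi[OF i j x(1) z(2,3)] rho_phi_same[OF i x] z(4) by simp
    then show "z \<in> {z \<in> (U i \<inter> U j) \<times> C. (fst z, (\<lambda>(x, a). g i j x a) z) \<in> N}" using z x by simp
  next
    fix z assume "z \<in> {z \<in> (U i \<inter> U j) \<times> C. (fst z, (\<lambda>(x, a). g i j x a) z) \<in> N}"
    then obtain x a where z: "z = (x, a)" "x \<in> U j" "x \<in> U i" "a \<in> C" "(x, g i j x a) \<in> N" by auto
    have "\<phi> i (x, g i j x a) = \<phi> j (x, a)" using z i j by (simp add: \<phi>_def g_comp idx_U)
    then show "z \<in> {z \<in> U j \<times> C. \<phi> j z \<in> \<phi> i ` N}" using z by (auto intro!: image_eqI[of _ _ "(x, g i j x a)"])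
  qed
  moreover have "openin ?S {z \<in> topspace ?S. (fst z, (\<lambda>(x, a). g i j x a) z) \<in> N}"
    by (rule openin_continuous_map_preimage[OF c N(1)])
  ultimately show "openin MA {z \<in> U j \<times> C. \<phi> j z \<in> \<phi> i ` N}"
    using UC_open[of "U i \<inter> U j"] U_open[OF i] U_open[OF j] by (simp add: openin_open_subtopology openin_Int)
qed

lemma open_T_Times: "openin (mtopo M) D \<Longrightarrow> openin (mtopo T) (D \<times> C)"
  unfolding openin_T T_open_def
proof (intro conjI ballI)
  assume D: "openin (mtopo M) D"
  show "D \<times> C \<subseteq> X \<times> C" using openin_subset[OF D] by auto
  fix i assume i: "i \<in> I"
  have "{z \<in> U i \<times> C. \<phi> i z \<in> D \<times> C} = (U i \<inter> D) \<times> C" using phi_C[OF i] by (auto simp: \<phi>_def)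
  then show "openin MA {z \<in> U i \<times> C. \<phi> i z \<in> D \<times> C}" using UC_open[of "U i \<inter> D"] U_open[OF i] D by (simp add: openin_Int)
qed

text \<open>Preimages under the inverse of \<open>\<phi> i\<close> are images under
  \<open>\<phi> i\<close>, so this is openness again.\<close>

lemma continuous_rho:
  assumes i: "i \<in> I"
  shows "continuous_map (subtopology (mtopo T) (U i \<times> C)) MA (\<lambda>e. (fst e, \<rho> i e))"
  unfolding continuous_map_def
proof (intro conjI allI impI)
  have ts: "topspace (subtopology (mtopo T) (U i \<times> C)) = U i \<times> C" using U_sub[OF i] by auto
  show "(\<lambda>e. (fst e, \<rho> i e)) \<in> topspace (subtopology (mtopo T) (U i \<times> C)) \<rightarrow> topspace MA"
    unfolding ts using rho_C[OF i] U_sub[OF i] by auto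
  fix N assume N: "openin MA N"
  have "{e \<in> U i \<times> C. (fst e, \<rho> i e) \<in> N} = \<phi> i ` (N \<inter> (U i \<times> C))"
  proof (intro equalityI subsetI)
    fix e assume "e \<in> {e \<in> U i \<times> C. (fst e, \<rho> i e) \<in> N}"
    then obtain x b where e: "e = (x, b)" "x \<in> U i" "b \<in> C" "(x, \<rho> i (x, b)) \<in> N" by auto
    then show "e \<in> \<phi> i ` (N \<inter> (U i \<times> C))"
      using phi_rho[OF i e(2,3)] rho_C[OF i e(2,3)] by (intro image_eqI[of _ _ "(x, \<rho> i (x, b))"]) auto
  next
    fix e assume "e \<in> \<phi> i ` (N \<inter> (U i \<times> C))"
    then obtain x a where e: "e = \<phi> i (x, a)" "x \<in> U i" "a \<in> C" "(x, a) \<in> N" by auto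
    then show "e \<in> {e \<in> U i \<times> C. (fst e, \<rho> i e) \<in> N}"
      using rho_phi_same[OF i e(2,3)] phi_C[OF i e(2,3)] by (auto simp: \<phi>_def)
  qed
  moreover have "openin (mtopo T) (\<phi> i ` (N \<inter> (U i \<times> C)))"
    by (rule open_phi[OF i]) (use N UC_open U_open i in auto)
  moreover have "openin (mtopo T) (U i \<times> C)" using open_T_Times U_open i by blast
  ultimately show "openin (subtopology (mtopo T) (U i \<times> C)) {e \<in> topspace (subtopology (mtopo T) (U i \<times> C)). (fst e, \<rho> i e) \<in> N}"
    unfolding ts by (auto simp: openin_open_subtopology)
qed

lemma chT_image:
  assumes i: "i \<in> I" and D: "D \<subseteq> U i"
  shows "chT i \<psi> ` (D \<times> C) = \<psi> ` D \<times> C"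
proof (intro equalityI subsetI)
  fix z assume "z \<in> \<psi> ` D \<times> C"
  then obtain x a where "z = (\<psi> x, a)" "x \<in> D" "a \<in> C" by auto
  then show "z \<in> chT i \<psi> ` (D \<times> C)"
    using D rho_phi_same[OF i, of x a] phi_C[OF i, of x a]
    by (intro image_eqI[of _ _ "\<phi> i (x, a)"]) (auto simp: chT_def \<phi>_def)
qed (use rho_C[OF i] D in \<open>auto simp: chT_def\<close>)

lemma inv_chT:
  assumes i: "i \<in> I" and V: "(V, \<psi>) \<in> atlas M" and D: "D \<subseteq> U i \<inter> V" and x: "x \<in> D" and a: "a \<in> C"
  shows "inv_into (D \<times> C) (chT i \<psi>) (\<psi> x, a) = \<phi> i (x, a)"
proof (rule inv_into_f_eq)
  show "inj_on (chT i \<psi>) (D \<times> C)"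
  proof (rule inj_onI)
    fix e e' assume *: "e \<in> D \<times> C" "e' \<in> D \<times> C" "chT i \<psi> e = chT i \<psi> e'"
    then obtain x b y c where e: "e = (x, b)" "e' = (y, c)" "x \<in> D" "y \<in> D" "b \<in> C" "c \<in> C" by auto
    have "x = y" using inj_onD[OF chart(5)[OF V], of x y] *(3) e D by (auto simp: chT_def)
    moreover have "\<rho> i (x, b) = \<rho> i (y, c)" using *(3) e by (simp add: chT_def)
    ultimately show "e = e'" using e D phi_rho[OF i, of x b] phi_rho[OF i, of x c] by auto
  qed
  show "\<phi> i (x, a) \<in> D \<times> C" using phi_C[OF i, of x a] D x a by (auto simp: \<phi>_def)
  show "chT i \<psi> (\<phi> i (x, a)) = (\<psi> x, a)" using rho_phi_same[OF i, of x a] D x a by (auto simp: chT_def \<phi>_def)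
qed

lemma smooth_manifold_T: "smooth_manifold T"
  unfolding smooth_manifold_def
proof (intro conjI)
  show "lc_space (model T)" using lcs_G by (simp add: lcs_def)
  show "\<Union> (fst ` atlas T) = topspace (mtopo T)"
  proof (intro equalityI subsetI)
    fix e assume "e \<in> topspace (mtopo T)"
    then obtain x b where e: "e = (x, b)" "x \<in> X" "b \<in> C" by auto
    obtain V \<psi> where V: "(V, \<psi>) \<in> atlas M" "x \<in> V" using chart_ex[OF e(2)] by blast
    have "((U (idx x) \<inter> V) \<times> C, chT (idx x) \<psi>) \<in> atlas T" using idx(1)[OF e(2)] V by auto
    moreover have "e \<in> (U (idx x) \<inter> V) \<times> C" using e V idx(2)[OF e(2)] by simp
    ultimately show "e \<in> \<Union> (fst ` atlas T)" by (metis UnionI fst_conv image_eqI)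
  qed (use U_sub in auto)
  show "Hausdorff_space (mtopo T)"
    unfolding Hausdorff_space_def
  proof (intro allI impI, elim conjE)
    fix e e' assume *: "e \<in> topspace (mtopo T)" "e' \<in> topspace (mtopo T)" "e \<noteq> e'"
    obtain x b y c where e: "e = (x, b)" "e' = (y, c)" "x \<in> X" "y \<in> X" "b \<in> C" "c \<in> C" using * by auto
    show "\<exists>N N'. openin (mtopo T) N \<and> openin (mtopo T) N' \<and> e \<in> N \<and> e' \<in> N' \<and> disjnt N N'"
    \<comment> \<open>Points over different base points are separated in \<open>M\<close>, points of
      one fibre in the chart with index \<open>idx x\<close>.\<close>
    proof (cases "x = y")
      case False
      have "Hausdorff_space (mtopo M)" using sm_M by (simp add: smooth_manifold_def)
      then obtain D D' where "openin (mtopo M) D" "openin (mtopo M) D'" "x \<in> D" "y \<in> D'" "disjnt D D'"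
        using e False unfolding Hausdorff_space_def by meson
      then show ?thesis using e open_T_Times by (intro exI[of _ "D \<times> C"] exI[of _ "D' \<times> C"]) (auto simp: disjnt_iff)
    next
      case True
      let ?i = "idx x"
      have i: "?i \<in> I" "x \<in> U ?i" using idx e by auto
      have "\<rho> ?i (x, b) \<noteq> \<rho> ?i (x, c)" using phi_rho[OF i e(5)] phi_rho[OF i e(6)] e * True by auto
      moreover have "\<rho> ?i (x, b) \<in> topspace (topo A)" "\<rho> ?i (x, c) \<in> topspace (topo A)" using rho_C[OF i] e by auto
      ultimately obtain D D' where D: "openin (topo A) D" "openin (topo A) D'" "\<rho> ?i (x, b) \<in> D" "\<rho> ?i (x, c) \<in> D'" "disjnt D D'"
        using A.hausdorff unfolding Hausdorff_space_def by meson
      have DC: "D \<subseteq> C" "D' \<subseteq> C" using D(1,2)[THEN openin_subset] by auto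
      have "openin (mtopo T) (\<phi> ?i ` (U ?i \<times> D))" "openin (mtopo T) (\<phi> ?i ` (U ?i \<times> D'))"
        using D DC U_open[OF i(1)] by (intro open_phi[OF i(1)]; auto simp: openin_prod_Times_iff)+
      moreover have "e \<in> \<phi> ?i ` (U ?i \<times> D)" "e' \<in> \<phi> ?i ` (U ?i \<times> D')"
        using phi_rho[OF i] D e True i by (metis SigmaI image_eqI)+
      moreover have "disjnt (\<phi> ?i ` (U ?i \<times> D)) (\<phi> ?i ` (U ?i \<times> D'))"
        unfolding disjnt_iff
      proof (intro allI notI, elim conjE imageE)
        fix w u u' assume u: "w = \<phi> ?i u" "u \<in> U ?i \<times> D" "w = \<phi> ?i u'" "u' \<in> U ?i \<times> D'"
        have "inj_on (\<phi> ?i) (U ?i \<times> C)" using bij_phi[OF i(1) order_refl] by (simp add: bij_betw_def)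
        then have "u = u'" using u DC by (auto dest: inj_onD)
        then show False using u D(5) by (auto simp: disjnt_iff)
      qed
      ultimately show ?thesis by blast
    qed
  qed
  show "\<forall>(W, \<kappa>)\<in>atlas T. openin (mtopo T) W \<and> openin (topo (model T)) (\<kappa> ` W) \<and>
        homeomorphic_map (subtopology (mtopo T) W) (subtopology (topo (model T)) (\<kappa> ` W)) \<kappa>"
  proof (intro ballI, clarify)
    fix W \<kappa> assume "(W, \<kappa>) \<in> atlas T"
    then obtain i V \<psi> where W: "W = (U i \<inter> V) \<times> C" "\<kappa> = chT i \<psi>" "i \<in> I" "(V, \<psi>) \<in> atlas M" by auto
    have D: "openin (mtopo M) (U i \<inter> V)" using U_open[OF W(3)] chart(1)[OF W(4)] by auto
    have im: "\<kappa> ` W = \<psi> ` (U i \<inter> V) \<times> C" unfolding W by (rule chT_image[OF W(3)]) auto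
    have oim: "openin (topo E) (\<psi> ` (U i \<inter> V))" using chart(8)[OF W(4) D] by auto
    have oW: "openin (mtopo T) W" unfolding W by (rule open_T_Times[OF D])
    have oG: "openin (topo G) (\<kappa> ` W)" unfolding im by (rule open_Times_C[OF oim])
    have UX: "U i \<subseteq> X" "V \<subseteq> X" using U_sub[OF W(3)] chart(4)[OF W(4)] by auto
    have tsW: "topspace (subtopology (mtopo T) W) = W" using W UX by auto
    have tsG: "topspace (subtopology (topo G) (\<kappa> ` W)) = \<kappa> ` W" using openin_subset[OF oG] by auto
    \<comment> \<open>The inverse chart in explicit form: continuity then follows from that of
      \<open>\<phi> i\<close> and of the inverse base chart.\<close>
    let ?inv = "\<lambda>(y, a). \<phi> i (inv_into V \<psi> y, a)"
    have "homeomorphic_maps (subtopology (mtopo T) W) (subtopology (topo G) (\<kappa> ` W)) \<kappa> ?inv"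
      unfolding homeomorphic_maps_def tsW tsG
    proof (intro conjI ballI)
      have r: "continuous_map (subtopology (mtopo T) W) MA (\<lambda>e. (fst e, \<rho> i e))"
        by (rule continuous_map_from_subtopology_mono[OF continuous_rho[OF W(3)]]) (use W in auto)
      have r1: "continuous_map (subtopology (mtopo T) W) (subtopology (mtopo M) V) fst"
        unfolding continuous_map_in_subtopology tsW
      proof
        show "continuous_map (subtopology (mtopo T) W) (mtopo M) fst"
          using continuous_map_compose[OF r continuous_map_fst] by (simp add: o_def)
        show "fst \<in> W \<rightarrow> V" unfolding W(1) by auto
      qed
      have r2: "continuous_map (subtopology (mtopo T) W) (topo A) (\<rho> i)"
        using continuous_map_compose[OF r continuous_map_snd] by (simp add: o_def)
      have "continuous_map (subtopology (mtopo T) W) (topo G) \<kappa>"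
        unfolding W(2) chT_def prod_tvs_simps real_tvs_simps
        by (intro continuous_map_pairedI r2 continuous_map_compose[OF r1 chart(6)[OF W(4)], unfolded o_def])
      then show "continuous_map (subtopology (mtopo T) W) (subtopology (topo G) (\<kappa> ` W)) \<kappa>"
        unfolding continuous_map_in_subtopology tsW by blast
      have "continuous_map (subtopology (topo G) (\<kappa> ` W)) (subtopology (topo E) (\<psi> ` V)) fst"
        unfolding continuous_map_in_subtopology tsG
      proof
        show "continuous_map (subtopology (topo G) (\<kappa> ` W)) (topo E) fst"
          by (rule continuous_map_from_subtopology[OF fst_linear(1)])
        show "fst \<in> \<kappa> ` W \<rightarrow> \<psi> ` V" unfolding im by auto
      qed
      from continuous_map_compose[OF this chart(7)[OF W(4)]]
      have "continuous_map (subtopology (topo G) (\<kappa> ` W)) (mtopo M) (\<lambda>z. inv_into V \<psi> (fst z))" by (simp add: o_def)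
      moreover have "continuous_map (subtopology (topo G) (\<kappa> ` W)) (topo A) snd"
        by (rule continuous_map_from_subtopology) (simp add: continuous_map_snd)
      ultimately have "continuous_map (subtopology (topo G) (\<kappa> ` W)) MA (\<lambda>z. (inv_into V \<psi> (fst z), snd z))"
        by (rule continuous_map_pairedI)
      moreover have ii: "(inv_into V \<psi> (fst z), snd z) \<in> U i \<times> C" "inv_into V \<psi> (fst z) \<in> V" if "z \<in> \<kappa> ` W" for z
        using that chart(5)[OF W(4)] unfolding im by auto
      ultimately have "continuous_map (subtopology (topo G) (\<kappa> ` W)) (subtopology MA (U i \<times> C)) (\<lambda>z. (inv_into V \<psi> (fst z), snd z))"
        unfolding continuous_map_in_subtopology tsG by blast
      from continuous_map_compose[OF this continuous_phi[OF W(3)]]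
      have "continuous_map (subtopology (topo G) (\<kappa> ` W)) (mtopo T) ?inv" by (simp add: o_def case_prod_unfold)
      moreover have "?inv z \<in> W" if "z \<in> \<kappa> ` W" for z
        using ii[OF that] phi_C[OF W(3), of "inv_into V \<psi> (fst z)" "snd z"] unfolding W(1) by (auto simp: \<phi>_def case_prod_unfold)
      ultimately show "continuous_map (subtopology (topo G) (\<kappa> ` W)) (subtopology (mtopo T) W) ?inv"
        unfolding continuous_map_in_subtopology tsG by auto
      show "?inv (\<kappa> e) = e" if "e \<in> W" for e
        using that chart(5)[OF W(4)] phi_rho[OF W(3)] unfolding W(1,2) by (auto simp: chT_def)
      show "\<kappa> (?inv z) = z" if z: "z \<in> \<kappa> ` W" for z
      proof -
        obtain x a where xa: "z = (\<psi> x, a)" "x \<in> U i" "x \<in> V" "a \<in> C" using z unfolding im by auto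
        then have "inv_into V \<psi> (\<psi> x) = x" using chart(5)[OF W(4)] by simp
        then show ?thesis using xa rho_phi_same[OF W(3), of x a] unfolding W(2) by (simp add: chT_def \<phi>_def)
      qed
    qed
    then show "openin (mtopo T) W \<and> openin (topo (model T)) (\<kappa> ` W) \<and>
        homeomorphic_map (subtopology (mtopo T) W) (subtopology (topo (model T)) (\<kappa> ` W)) \<kappa>"
      using oW oG homeomorphic_map_maps by (simp only: T_simps) blast
  qed
  show "\<forall>(W, \<kappa>)\<in>atlas T. \<forall>(W', \<theta>)\<in>atlas T. smooth_on (model T) (model T) (\<kappa> ` (W \<inter> W')) (\<theta> \<circ> inv_into W \<kappa>)"
  proof (intro ballI, clarify)
    fix W \<kappa> W' \<theta> assume "(W, \<kappa>) \<in> atlas T" "(W', \<theta>) \<in> atlas T"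
    then obtain i V \<psi> j V' \<psi>' where W: "W = (U i \<inter> V) \<times> C" "\<kappa> = chT i \<psi>" "i \<in> I" "(V, \<psi>) \<in> atlas M"
       "W' = (U j \<inter> V') \<times> C" "\<theta> = chT j \<psi>'" "j \<in> I" "(V', \<psi>') \<in> atlas M" by (simp only: T_simps) blast
    \<comment> \<open>From chart \<open>i\<close> to chart \<open>j\<close> the fibre coordinate
      changes by \<open>g j i\<close>, which dictates the order of the indices.\<close>
    have WW: "W \<inter> W' = (U j \<inter> U i \<inter> V \<inter> V') \<times> C" unfolding W by blast
    show "smooth_on (model T) (model T) (\<kappa> ` (W \<inter> W')) (\<theta> \<circ> inv_into W \<kappa>)"
      unfolding T_simps
    proof (rule smooth_on_cong[OF lcs_G lcs_G trans_smooth[OF W(7,3,4,8)]])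
      show "\<kappa> ` (W \<inter> W') = \<psi> ` (U j \<inter> U i \<inter> V \<inter> V') \<times> C"
        unfolding WW W(2) by (rule chT_image[OF W(3)]) auto
      fix z assume "z \<in> \<psi> ` (U j \<inter> U i \<inter> V \<inter> V') \<times> C"
      then obtain x a where z: "z = (\<psi> x, a)" "x \<in> U i" "x \<in> U j" "x \<in> V" "a \<in> C" by auto
      have "inv_into W \<kappa> z = \<phi> i (x, a)" unfolding z W(1,2) by (rule inv_chT[OF W(3,4)]) (use z in auto)
      then show "(\<theta> \<circ> inv_into W \<kappa>) z = (case z of (y, a) \<Rightarrow> (\<psi>' (inv_into V \<psi> y), g j i (inv_into V \<psi> y) a))"
        using z W chart(5)[OF W(4)] rho_phi[OF W(7,3) z(3,2,5)] by (simp add: chT_def) (simp add: \<phi>_def)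
    qed
  qed
qed

end

lemma smooth_on_continuous:
  assumes E: "lcs E" and f: "smooth_on E F U f"
  shows "continuous_map (subtopology (topo E) U) (topo F) f"
proof -
  have 1: "continuous_map (jet_topology E U 0) (topo F) (\<lambda>(x, v). dder E F f 0 x v)"
    using f unfolding smooth_on_def by blast
  \<comment> \<open>The function \<open>\<lambda>_. undefined\<close> is the only point of the empty
    product of directions.\<close>
  have "continuous_map (subtopology (topo E) U) (jet_topology E U 0) (\<lambda>x. (x, \<lambda>_. undefined))"
    unfolding jet_topology_def by (intro continuous_map_pairedI) auto
  from continuous_map_compose[OF this 1] show ?thesis by (simp add: o_def)
qed

section \<open>Fibre algebras, bundle charts and the action on the total space\<close>

context bundle_data begin

text \<open>The structure of \<open>A\<close> can be copied because \<open>\<phi> (idx x)\<close> is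
  the identity over \<open>x\<close>; the other charts differ from it by algebra
  automorphisms.\<close>

definition fib :: "'m \<Rightarrow> (complex, 'm \<times> 'a) module" where
  "fib x = \<lparr>carrier = {x} \<times> C, mult = (\<lambda>e f. (x, snd e \<otimes>\<^bsub>A\<^esub> snd f)), one = (x, \<one>\<^bsub>A\<^esub>), ring.zero = (x, \<zero>\<^bsub>A\<^esub>),
     add = (\<lambda>e f. (x, snd e \<oplus>\<^bsub>A\<^esub> snd f)), smult = (\<lambda>c e. (x, c \<odot>\<^bsub>A\<^esub> snd e))\<rparr>"

lemma fib_simps [simp]:
  "carrier (fib x) = {x} \<times> C" "e \<otimes>\<^bsub>fib x\<^esub> f = (x, snd e \<otimes>\<^bsub>A\<^esub> snd f)" "\<one>\<^bsub>fib x\<^esub> = (x, \<one>\<^bsub>A\<^esub>)"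
  "\<zero>\<^bsub>fib x\<^esub> = (x, \<zero>\<^bsub>A\<^esub>)" "e \<oplus>\<^bsub>fib x\<^esub> f = (x, snd e \<oplus>\<^bsub>A\<^esub> snd f)" "c \<odot>\<^bsub>fib x\<^esub> e = (x, c \<odot>\<^bsub>A\<^esub> snd e)"
  by (simp_all add: fib_def)

lemma unital_algebra_fib: "unital_algebra (fib x)"
  by (rule unital_algebra_pointwise[where X="{()}" and F="\<lambda>_. A" and ev="\<lambda>_. snd"]) (auto simp: A.ua)

definition \<sigma> where "\<sigma> l = (\<lambda>e \<in> X \<times> C. (fst e, \<alpha> l (snd e)))"

abbreviation PM where "PM \<equiv> prod_manifold M (tvs_manifold (real_tvs A))"

lemma PM_simps [simp]: "mtopo PM = MA" "model PM = G" "atlas PM = {(V \<times> C, map_prod \<psi> id) |V \<psi>. (V, \<psi>) \<in> atlas M}"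
  by (auto simp: prod_manifold_def tvs_manifold_def)

lemma T_over: "D \<subseteq> X \<Longrightarrow> {e \<in> topspace (mtopo T). fst e \<in> D} = D \<times> C"
  by auto

lemma atlas_TE:
  assumes "(W, \<kappa>) \<in> atlas T"
  obtains i V \<psi> where "W = (U i \<inter> V) \<times> C" "\<kappa> = chT i \<psi>" "i \<in> I" "(V, \<psi>) \<in> atlas M"
  using assms by (simp only: T_simps) blast

lemma atlas_PME:
  assumes "(W, \<kappa>) \<in> atlas PM"
  obtains V \<psi> where "W = V \<times> C" "\<kappa> = map_prod \<psi> id" "(V, \<psi>) \<in> atlas M"
  using assms by (simp only: PM_simps) blast

lemma smooth_mapI:
  assumes "openin (mtopo Y) W" "continuous_map (subtopology (mtopo Y) W) (mtopo Z) f"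
    and "\<And>N \<kappa> N' \<theta>. (N, \<kappa>) \<in> atlas Y \<Longrightarrow> (N', \<theta>) \<in> atlas Z \<Longrightarrow>
      smooth_on (model Y) (model Z) (\<kappa> ` (N \<inter> W \<inter> f -` N')) (\<theta> \<circ> f \<circ> inv_into N \<kappa>)"
  shows "smooth_map Y Z W f"
  using assms unfolding smooth_map_def by blast

lemma smooth_mapD:
  assumes "smooth_map Y Z W f" "(N, \<kappa>) \<in> atlas Y" "(N', \<theta>) \<in> atlas Z"
  shows "smooth_on (model Y) (model Z) (\<kappa> ` (N \<inter> W \<inter> f -` N')) (\<theta> \<circ> f \<circ> inv_into N \<kappa>)"
proof -
  have "\<forall>(U, \<phi>)\<in>atlas Y. \<forall>(V, \<psi>)\<in>atlas Z. smooth_on (model Y) (model Z) (\<phi> ` (U \<inter> W \<inter> f -` V)) (\<psi> \<circ> f \<circ> inv_into U \<phi>)"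
    using assms(1) unfolding smooth_map_def by (elim conjE)
  from bspec[OF this assms(2)]
  have "\<forall>(V, \<psi>)\<in>atlas Z. smooth_on (model Y) (model Z) (\<kappa> ` (N \<inter> W \<inter> f -` V)) (\<psi> \<circ> f \<circ> inv_into N \<kappa>)" by simp
  from bspec[OF this assms(3)] show ?thesis by simp
qed

lemma smooth_map_phi:
  assumes i: "i \<in> I"
  shows "smooth_map PM T (U i \<times> C) (\<phi> i)"
proof (rule smooth_mapI)
  show "openin (mtopo PM) (U i \<times> C)" using UC_open U_open[OF i] by simp
  show "continuous_map (subtopology (mtopo PM) (U i \<times> C)) (mtopo T) (\<phi> i)" using continuous_phi[OF i] by simp
  fix N \<kappa> N' \<theta> assume "(N, \<kappa>) \<in> atlas PM" "(N', \<theta>) \<in> atlas T"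
  then obtain V \<psi> j V' \<psi>' where N: "N = V \<times> C" "\<kappa> = map_prod \<psi> id" "(V, \<psi>) \<in> atlas M"
      "N' = (U j \<inter> V') \<times> C" "\<theta> = chT j \<psi>'" "j \<in> I" "(V', \<psi>') \<in> atlas M"
    by (elim atlas_PME atlas_TE)
  have eq: "N \<inter> (U i \<times> C) \<inter> \<phi> i -` N' = (U j \<inter> U i \<inter> V \<inter> V') \<times> C"
    unfolding N using phi_C[OF i] by (auto simp: \<phi>_def)
  show "smooth_on (model PM) (model T) (\<kappa> ` (N \<inter> (U i \<times> C) \<inter> \<phi> i -` N')) (\<theta> \<circ> \<phi> i \<circ> inv_into N \<kappa>)"
    unfolding PM_simps T_simps
  proof (rule smooth_on_cong[OF lcs_G lcs_G trans_smooth[OF N(6) i N(3,7)]])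
    show "\<kappa> ` (N \<inter> (U i \<times> C) \<inter> \<phi> i -` N') = \<psi> ` (U j \<inter> U i \<inter> V \<inter> V') \<times> C"
      unfolding eq N(2) by (auto simp: map_prod_surj_on)
    fix z assume "z \<in> \<psi> ` (U j \<inter> U i \<inter> V \<inter> V') \<times> C"
    then obtain x a where z: "z = (\<psi> x, a)" "x \<in> U i" "x \<in> U j" "x \<in> V" "a \<in> C" by auto
    have "inv_into N \<kappa> z = (x, a)" unfolding z(1) N by (rule map_prod_chart[OF N(3) z(4,5)])
    then show "(\<theta> \<circ> \<phi> i \<circ> inv_into N \<kappa>) z = (case z of (y, a) \<Rightarrow> (\<psi>' (inv_into V \<psi> y), g j i (inv_into V \<psi> y) a))"
      using z N chart(5)[OF N(3)] rho_phi[OF N(6) i z(3,2,5)] by (simp add: chT_def) (simp add: \<phi>_def)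
  qed
qed

lemma smooth_map_inv_phi:
  assumes i: "i \<in> I"
  shows "smooth_map T PM (U i \<times> C) (inv_into (U i \<times> C) (\<phi> i))"
proof (rule smooth_mapI)
  show "openin (mtopo T) (U i \<times> C)" using open_T_Times U_open[OF i] by simp
  have "continuous_map (subtopology (mtopo T) (U i \<times> C)) MA (inv_into (U i \<times> C) (\<phi> i))"
    by (rule continuous_map_eq[OF continuous_rho[OF i]]) (use inv_phi[OF i] in auto)
  then show "continuous_map (subtopology (mtopo T) (U i \<times> C)) (mtopo PM) (inv_into (U i \<times> C) (\<phi> i))" by simp
  fix N \<kappa> N' \<theta> assume "(N, \<kappa>) \<in> atlas T" "(N', \<theta>) \<in> atlas PM"
  then obtain V \<psi> j V' \<psi>' where N: "N' = V' \<times> C" "\<theta> = map_prod \<psi>' id" "(V', \<psi>') \<in> atlas M"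
      "N = (U j \<inter> V) \<times> C" "\<kappa> = chT j \<psi>" "j \<in> I" "(V, \<psi>) \<in> atlas M"
    by (elim atlas_PME atlas_TE)
  have eq: "N \<inter> (U i \<times> C) \<inter> inv_into (U i \<times> C) (\<phi> i) -` N' = (U i \<inter> U j \<inter> V \<inter> V') \<times> C"
    unfolding N using inv_phi[OF i] rho_C[OF i] by auto
  show "smooth_on (model T) (model PM) (\<kappa> ` (N \<inter> (U i \<times> C) \<inter> inv_into (U i \<times> C) (\<phi> i) -` N')) (\<theta> \<circ> inv_into (U i \<times> C) (\<phi> i) \<circ> inv_into N \<kappa>)"
    unfolding PM_simps T_simps
  proof (rule smooth_on_cong[OF lcs_G lcs_G trans_smooth[OF i N(6,7,3)]])
    show "\<kappa> ` (N \<inter> (U i \<times> C) \<inter> inv_into (U i \<times> C) (\<phi> i) -` N') = \<psi> ` (U i \<inter> U j \<inter> V \<inter> V') \<times> C"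
      unfolding eq N(5) by (rule chT_image[OF N(6)]) auto
    fix z assume "z \<in> \<psi> ` (U i \<inter> U j \<inter> V \<inter> V') \<times> C"
    then obtain x a where z: "z = (\<psi> x, a)" "x \<in> U i" "x \<in> U j" "x \<in> V" "a \<in> C" by auto
    have iv: "inv_into N \<kappa> z = \<phi> j (x, a)" unfolding z(1) N by (rule inv_chT[OF N(6,7)]) (use z in auto)
    obtain b where b: "\<phi> j (x, a) = (x, b)" "b \<in> C" using phi_C[OF N(6) z(3,5)] by (auto simp: \<phi>_def)
    have "inv_into (U i \<times> C) (\<phi> i) (\<phi> j (x, a)) = (x, g i j x a)"
      using inv_phi[OF i z(2) b(2)] rho_phi[OF i N(6) z(2,3,5)] b by simp
    then show "(\<theta> \<circ> inv_into (U i \<times> C) (\<phi> i) \<circ> inv_into N \<kappa>) z = (case z of (y, a) \<Rightarrow> (\<psi>' (inv_into V \<psi> y), g i j (inv_into V \<psi> y) a))"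
      using iv z N chart(5)[OF N(7)] by simp
  qed
qed

lemma inv_phi_phi:
  assumes "i \<in> I" "j \<in> I" "x \<in> U i" "x \<in> U j" "a \<in> C"
  shows "inv_into (U i \<times> C) (\<phi> i) (\<phi> j (x, a)) = (x, g i j x a)"
proof -
  obtain b where b: "\<phi> j (x, a) = (x, b)" "b \<in> C" using phi_C[OF assms(2,4,5)] by (auto simp: \<phi>_def)
  then show ?thesis using inv_phi[OF assms(1,3) b(2)] rho_phi[OF assms] by simp
qed

lemma phi_alg_iso: "i \<in> I \<Longrightarrow> x \<in> U i \<Longrightarrow> (\<lambda>a. \<phi> i (x, a)) \<in> alg_iso A (fib x)"
proof -
  assume i: "i \<in> I" "x \<in> U i"
  have "bij_betw (\<lambda>a. \<phi> i (x, a)) C ({x} \<times> C)"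
    by (rule bij_betw_byWitness[where f'="\<rho> i"]) (use i phi_C[OF i] rho_C[OF i] rho_phi_same[OF i] phi_rho[OF i] in \<open>auto simp: \<phi>_def\<close>)
  then show ?thesis
    using i idx_U[OF i] by (auto simp: alg_iso_def alg_hom_def \<phi>_def g_props)
qed

lemma bundle_chart_phi: "i \<in> I \<Longrightarrow> bundle_chart T M A fst fib (U i) (\<phi> i)"
  unfolding bundle_chart_def
proof (intro conjI)
  assume i: "i \<in> I"
  show "openin (mtopo M) (U i)" by (rule U_open[OF i])
  show "bij_betw (\<phi> i) (U i \<times> C) {e \<in> topspace (mtopo T). fst e \<in> U i}"
    unfolding T_over[OF U_sub[OF i]] by (rule bij_phi[OF i order_refl])
  show "smooth_map PM T (U i \<times> C) (\<phi> i)" by (rule smooth_map_phi[OF i])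
  show "smooth_map T PM {e \<in> topspace (mtopo T). fst e \<in> U i} (inv_into (U i \<times> C) (\<phi> i))"
    unfolding T_over[OF U_sub[OF i]] by (rule smooth_map_inv_phi[OF i])
  show "\<forall>x\<in>U i. (\<lambda>a. \<phi> i (x, a)) \<in> alg_iso A (fib x)" using phi_alg_iso[OF i] by blast
qed (simp add: \<phi>_def)

lemma continuous_fst_T: "continuous_map (mtopo T) (mtopo M) fst"
  unfolding continuous_map_def
proof (intro conjI allI impI)
  fix D assume D: "openin (mtopo M) D"
  have "{e \<in> topspace (mtopo T). fst e \<in> D} = D \<times> C" by (rule T_over[OF openin_subset[OF D]])
  then show "openin (mtopo T) {e \<in> topspace (mtopo T). fst e \<in> D}" using open_T_Times[OF D] by simp
qed auto

lemma algebra_bundle_T: "algebra_bundle T M A fst fib"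
  unfolding algebra_bundle_def
proof (intro conjI ballI)
  show "smooth_manifold T" "smooth_manifold M" "lc_algebra A" by (rule smooth_manifold_T sm_M A.lca)+
  show "smooth_map T M (topspace (mtopo T)) fst"
  proof (rule smooth_mapI)
    show "continuous_map (subtopology (mtopo T) (topspace (mtopo T))) (mtopo M) fst" using continuous_fst_T by (simp only: subtopology_topspace)
    fix N \<kappa> V' \<psi>' assume "(N, \<kappa>) \<in> atlas T" and V': "(V', \<psi>') \<in> atlas M"
    then obtain V \<psi> j where N: "N = (U j \<inter> V) \<times> C" "\<kappa> = chT j \<psi>" "j \<in> I" "(V, \<psi>) \<in> atlas M"
      by (elim atlas_TE)
    let ?D = "U j \<inter> V \<inter> V'"
    have oD: "openin (mtopo M) ?D" using U_open[OF N(3)] chart(1)[OF N(4)] chart(1)[OF V'] by auto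
    have eq: "N \<inter> topspace (mtopo T) \<inter> fst -` V' = ?D \<times> C" unfolding N using U_sub[OF N(3)] by auto
    show "smooth_on (model T) (model M) (\<kappa> ` (N \<inter> topspace (mtopo T) \<inter> fst -` V')) (\<psi>' \<circ> fst \<circ> inv_into N \<kappa>)"
      unfolding T_simps model_M
    proof (rule smooth_on_cong[OF lcs_G lcs_E base_trans_smooth[OF N(4) V' oD]])
      show "\<kappa> ` (N \<inter> topspace (mtopo T) \<inter> fst -` V') = \<psi> ` ?D \<times> C"
        unfolding eq N(2) by (rule chT_image[OF N(3)]) auto
      fix z assume "z \<in> \<psi> ` ?D \<times> C"
      then obtain x a where z: "z = (\<psi> x, a)" "x \<in> U j" "x \<in> V" "a \<in> C" by auto
      have iv: "inv_into N \<kappa> z = \<phi> j (x, a)" unfolding z(1) N by (rule inv_chT[OF N(3,4)]) (use z in auto)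
      then show "(\<psi>' \<circ> fst \<circ> inv_into N \<kappa>) z = (case z of (y, a) \<Rightarrow> \<psi>' (inv_into V \<psi> y))"
        using z chart(5)[OF N(4)] by (simp add: \<phi>_def)
    qed auto
  qed (rule openin_topspace)
  show "fst ` topspace (mtopo T) = X" using A.zero_closed by force
  fix x assume x: "x \<in> X"
  show "unital_algebra (fib x)" by (rule unital_algebra_fib)
  show "carrier (fib x) = {e \<in> topspace (mtopo T). fst e = x}" using x by auto
  show "\<exists>U \<phi>. x \<in> U \<and> bundle_chart T M A fst fib U \<phi>"
    using bundle_chart_phi[OF idx(1)[OF x]] idx(2)[OF x] by blast
qed

text \<open>\<open>\<sigma>\<close> is defined by the formula of the chart \<open>idx x\<close>;
  since the cocycle commutes with \<open>\<alpha>\<close>, it has the same form in every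
  chart.\<close>

lemma sigma_phi:
  assumes "l \<in> carrier \<Lambda>" "i \<in> I" "x \<in> U i" "a \<in> C"
  shows "\<sigma> l (\<phi> i (x, a)) = \<phi> i (x, \<alpha> l a)"
  using assms phi_C[OF assms(2-4)] U_sub[OF assms(2)] idx_U[OF assms(2,3)]
  by (auto simp: \<sigma>_def \<phi>_def g_props)

lemma group_action_sigma: "group_action \<Lambda> (topspace (mtopo T)) \<sigma>"
  unfolding topspace_T
  by (rule group_actionI[OF L.group_axioms]) (auto simp: \<sigma>_def alpha_closed alpha_one alpha_mult)

text \<open>The restriction is taken because an element of \<open>alg_auto\<close> must be undefined
  outside the carrier.\<close>

lemma sigma_alg_auto:
  assumes l: "l \<in> carrier \<Lambda>" and x: "x \<in> X"
  shows "restrict (\<sigma> l) (carrier (fib x)) \<in> alg_auto (fib x)"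
proof -
  have "restrict (\<sigma> l) ({x} \<times> C) \<in> Bij ({x} \<times> C)"
  proof (rule BijI[where g="\<sigma> (inv\<^bsub>\<Lambda>\<^esub> l)"])
    have "\<alpha> (inv\<^bsub>\<Lambda>\<^esub> l) (\<alpha> l a) = a" "\<alpha> l (\<alpha> (inv\<^bsub>\<Lambda>\<^esub> l) a) = a" if "a \<in> C" for a
      using alpha_mult[of "inv\<^bsub>\<Lambda>\<^esub> l" l a] alpha_mult[of l "inv\<^bsub>\<Lambda>\<^esub> l" a] l that alpha_one by simp_all
    then show "\<sigma> (inv\<^bsub>\<Lambda>\<^esub> l) (restrict (\<sigma> l) ({x} \<times> C) e) = e" "restrict (\<sigma> l) ({x} \<times> C) (\<sigma> (inv\<^bsub>\<Lambda>\<^esub> l) e) = e" if "e \<in> {x} \<times> C" for e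
      using that x l by (auto simp: \<sigma>_def alpha_closed)
  qed (use l x in \<open>auto simp: \<sigma>_def alpha_closed\<close>)
  then show ?thesis
    using l x by (auto simp: alg_auto_def alg_hom_def \<sigma>_def alpha_closed alpha_simps)
qed

lemma smooth_map_sigma:
  assumes l: "l \<in> carrier \<Lambda>"
  shows "smooth_map T T (topspace (mtopo T)) (\<sigma> l)"
proof (rule smooth_mapI)
  show "continuous_map (subtopology (mtopo T) (topspace (mtopo T))) (mtopo T) (\<sigma> l)"
    unfolding subtopology_topspace
  \<comment> \<open>Over \<open>U i\<close> the map is the inverse of \<open>\<phi> i\<close>,
    followed by \<open>\<alpha> l\<close> on the fibre coordinate, followed by
    \<open>\<phi> i\<close>.\<close>
  proof (rule pasting_lemma[where I=I and T="\<lambda>i. U i \<times> C" and f="\<lambda>i. \<sigma> l"])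
    fix i assume i: "i \<in> I"
    show "openin (mtopo T) (U i \<times> C)" using open_T_Times U_open[OF i] by blast
    let ?S = "subtopology (mtopo T) (U i \<times> C)"
    have ts: "topspace ?S = U i \<times> C" using U_sub[OF i] by auto
    have "continuous_map ?S MA (\<lambda>e. (fst e, \<alpha> l (\<rho> i e)))"
      using continuous_map_compose[OF continuous_rho[OF i] continuous_map_fst]
        continuous_map_compose[OF continuous_map_compose[OF continuous_rho[OF i] continuous_map_snd] alpha_continuous[OF l]]
      by (intro continuous_map_pairedI) (simp_all add: o_def)
    then have "continuous_map ?S (subtopology MA (U i \<times> C)) (\<lambda>e. (fst e, \<alpha> l (\<rho> i e)))"
      unfolding continuous_map_in_subtopology ts using rho_C[OF i] alpha_closed[OF l] by auto
    from continuous_map_compose[OF this continuous_phi[OF i]]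
    have "continuous_map ?S (mtopo T) (\<lambda>e. \<phi> i (fst e, \<alpha> l (\<rho> i e)))" by (simp add: o_def)
    then show "continuous_map ?S (mtopo T) (\<sigma> l)"
    proof (rule continuous_map_eq)
      fix e assume "e \<in> topspace ?S"
      then obtain x b where e: "e = (x, b)" "x \<in> U i" "b \<in> C" unfolding ts by auto
      show "\<phi> i (fst e, \<alpha> l (\<rho> i e)) = \<sigma> l e"
        using sigma_phi[OF l i e(2) rho_C[OF i e(2,3)]] phi_rho[OF i e(2,3)] e by simp
    qed
  next
    fix e assume "e \<in> topspace (mtopo T)"
    then show "\<exists>i. i \<in> I \<and> e \<in> U i \<times> C \<and> \<sigma> l e = \<sigma> l e" using idx by (intro exI[of _ "idx (fst e)"]) auto
  qed simp
  fix N \<kappa> N' \<theta> assume "(N, \<kappa>) \<in> atlas T" "(N', \<theta>) \<in> atlas T"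
  then obtain V \<psi> i j V' \<psi>' where N: "N = (U i \<inter> V) \<times> C" "\<kappa> = chT i \<psi>" "i \<in> I" "(V, \<psi>) \<in> atlas M"
      "N' = (U j \<inter> V') \<times> C" "\<theta> = chT j \<psi>'" "j \<in> I" "(V', \<psi>') \<in> atlas M"
    by (elim atlas_TE)
  have eq: "N \<inter> topspace (mtopo T) \<inter> \<sigma> l -` N' = (U j \<inter> U i \<inter> V \<inter> V') \<times> C"
    unfolding N using U_sub[OF N(3)] alpha_closed[OF l] by (auto simp: \<sigma>_def)
  let ?D = "\<psi> ` (U j \<inter> U i \<inter> V \<inter> V') \<times> C"
  note tr = trans_smooth[OF N(7,3,4,8)]
  show "smooth_on (model T) (model T) (\<kappa> ` (N \<inter> topspace (mtopo T) \<inter> \<sigma> l -` N')) (\<theta> \<circ> \<sigma> l \<circ> inv_into N \<kappa>)"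
    unfolding T_simps
  proof (rule smooth_on_cong[OF lcs_G lcs_G])
    \<comment> \<open>A change of charts precomposed with the continuous linear map that is the
      identity on the base and \<open>\<alpha> l\<close> on the fibre.\<close>
    show "smooth_on G G ?D (\<lambda>z. (\<lambda>(y, a). (\<psi>' (inv_into V \<psi> y), g j i (inv_into V \<psi> y) a)) (fst z, \<alpha> l (snd z)))"
    proof (rule smooth_on_prelin[OF lcs_G lcs_G lcs_G smooth_on_open[OF tr] _ _ _ _ tr])
      show "continuous_map (topo G) (topo G) (\<lambda>z. (fst z, \<alpha> l (snd z)))"
        unfolding prod_tvs_simps real_tvs_simps
        by (intro continuous_map_pairedI continuous_map_fst continuous_map_compose[OF continuous_map_snd alpha_continuous[OF l], unfolded o_def])
    qed (auto simp: alpha_simps[OF l] alpha_closed[OF l])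
    show "\<kappa> ` (N \<inter> topspace (mtopo T) \<inter> \<sigma> l -` N') = ?D"
      unfolding eq N(2) by (rule chT_image[OF N(3)]) auto
    fix z assume "z \<in> ?D"
    then obtain x a where z: "z = (\<psi> x, a)" "x \<in> U i" "x \<in> U j" "x \<in> V" "a \<in> C" by auto
    have "inv_into N \<kappa> z = \<phi> i (x, a)" unfolding z(1) N by (rule inv_chT[OF N(3,4)]) (use z in auto)
    then show "(\<theta> \<circ> \<sigma> l \<circ> inv_into N \<kappa>) z = (\<lambda>(y, a). (\<psi>' (inv_into V \<psi> y), g j i (inv_into V \<psi> y) a)) (fst z, \<alpha> l (snd z))"
      using z N chart(5)[OF N(4)] rho_phi[OF N(7,3) z(3,2) alpha_closed[OF l z(5)]] sigma_phi[OF l N(3) z(2,5)]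
      by (simp add: chT_def) (simp add: \<phi>_def)
  qed
qed (rule openin_topspace)

section \<open>Sections\<close>

lemma section_carrier:
  assumes "s \<in> smooth_sections T M fst" "x \<in> X"
  shows "s x \<in> {x} \<times> C"
proof -
  have "continuous_map (mtopo M) (mtopo T) s"
    using assms(1) by (simp add: smooth_sections_def smooth_map_def)
  then have "s x \<in> X \<times> C" using assms(2) continuous_map_image_subset_topspace by fastforce
  moreover have "fst (s x) = x" using assms by (simp add: smooth_sections_def)
  ultimately show ?thesis by auto
qed

lemma section_smooth:
  assumes s: "s \<in> smooth_sections T M fst" and i: "i \<in> I" and V: "(V, \<psi>) \<in> atlas M"
  shows "smooth_on E F (\<psi> ` (U i \<inter> V)) (\<lambda>y. \<rho> i (s (inv_into V \<psi> y)))"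
proof -
  have c: "((U i \<inter> V) \<times> C, chT i \<psi>) \<in> atlas T" using i V by auto
  have "smooth_map M T X s" using s by (simp add: smooth_sections_def)
  from smooth_mapD[OF this V c]
  have "smooth_on E G (\<psi> ` (V \<inter> X \<inter> s -` ((U i \<inter> V) \<times> C))) (chT i \<psi> \<circ> s \<circ> inv_into V \<psi>)" by simp
  moreover have "V \<inter> X \<inter> s -` ((U i \<inter> V) \<times> C) = U i \<inter> V"
    using section_carrier[OF s] U_sub[OF i] by fastforce
  ultimately have "smooth_on E G (\<psi> ` (U i \<inter> V)) (chT i \<psi> \<circ> s \<circ> inv_into V \<psi>)" by simp
  from smooth_on_postlin[OF lcs_E lcs_G lcs_F snd_linear this]
  show ?thesis by (simp add: chT_def)
qed

text \<open>Only fibre coordinates have to be tested: the base component of a section is the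
  identity, hence in coordinates a change of charts of \<open>M\<close>. Continuity into
  \<open>T\<close> is pasted from the chart domains.\<close>

lemma sectionI:
  assumes ext: "s \<in> extensional X" and car: "\<And>x. x \<in> X \<Longrightarrow> s x \<in> {x} \<times> C"
    and sm: "\<And>i V \<psi>. i \<in> I \<Longrightarrow> (V, \<psi>) \<in> atlas M \<Longrightarrow> smooth_on E F (\<psi> ` (U i \<inter> V)) (\<lambda>y. \<rho> i (s (inv_into V \<psi> y)))"
  shows "s \<in> smooth_sections T M fst"
proof -
  have "smooth_map M T X s"
  proof (rule smooth_mapI)
    show "continuous_map (subtopology (mtopo M) X) (mtopo T) s"
      unfolding subtopology_topspace
    proof (rule pasting_lemma[where I="{(i, V, \<psi>). i \<in> I \<and> (V, \<psi>) \<in> atlas M}" and T="\<lambda>(i, V, \<psi>). U i \<inter> V" and f="\<lambda>_. s"])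
      fix p assume p: "p \<in> {(i, V, \<psi>). i \<in> I \<and> (V, \<psi>) \<in> atlas M}"
      obtain i V \<psi> where iV: "p = (i, V, \<psi>)" "i \<in> I" "(V, \<psi>) \<in> atlas M" using p by auto
      show "openin (mtopo M) (case p of (i, V, \<psi>) \<Rightarrow> U i \<inter> V)" using iV U_open chart(1)[OF iV(3)] by auto
      let ?S = "subtopology (mtopo M) (U i \<inter> V)"
      have ts: "topspace ?S = U i \<inter> V" using U_sub[OF iV(2)] by auto
      have "continuous_map ?S (subtopology (topo E) (\<psi> ` (U i \<inter> V))) \<psi>"
        unfolding continuous_map_in_subtopology ts
        using continuous_map_from_subtopology_mono[OF chart(6)[OF iV(3)], of "U i \<inter> V"] by auto
      from continuous_map_compose[OF this smooth_on_continuous[OF lcs_E sm[OF iV(2,3)]]]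
      have "continuous_map ?S (topo A) ((\<lambda>y. \<rho> i (s (inv_into V \<psi> y))) \<circ> \<psi>)" by simp
      then have "continuous_map ?S (topo A) (\<lambda>x. \<rho> i (s x))"
        by (rule continuous_map_eq) (use ts chart(5)[OF iV(3)] in auto)
      then have "continuous_map ?S MA (\<lambda>x. (x, \<rho> i (s x)))"
        by (intro continuous_map_pairedI continuous_map_from_subtopology[OF continuous_map_id, unfolded id_def])
      moreover have rc: "\<rho> i (s x) \<in> C \<and> s x = (x, snd (s x)) \<and> snd (s x) \<in> C" if "x \<in> U i" for x
      proof -
        have "s x \<in> {x} \<times> C" using car that U_sub[OF iV(2)] by blast
        then show ?thesis using rho_C[OF iV(2) that, of "snd (s x)"] by auto
      qed
      ultimately have "continuous_map ?S (subtopology MA (U i \<times> C)) (\<lambda>x. (x, \<rho> i (s x)))"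
        unfolding continuous_map_in_subtopology ts by blast
      from continuous_map_compose[OF this continuous_phi[OF iV(2)]]
      have "continuous_map ?S (mtopo T) (\<lambda>x. \<phi> i (x, \<rho> i (s x)))" by (simp add: o_def)
      then have "continuous_map ?S (mtopo T) s"
      proof (rule continuous_map_eq)
        fix x assume x: "x \<in> topspace ?S"
        then show "\<phi> i (x, \<rho> i (s x)) = s x" unfolding ts using rc[of x] phi_rho[OF iV(2), of x "snd (s x)"] by auto
      qed
      then show "continuous_map (subtopology (mtopo M) (case p of (i, V, \<psi>) \<Rightarrow> U i \<inter> V)) (mtopo T) s" using iV by simp
    next
      fix x assume x: "x \<in> X"
      obtain V \<psi> where "(V, \<psi>) \<in> atlas M" "x \<in> V" using chart_ex[OF x] by blast
      then show "\<exists>p. p \<in> {(i, V, \<psi>). i \<in> I \<and> (V, \<psi>) \<in> atlas M} \<and> x \<in> (case p of (i, V, \<psi>) \<Rightarrow> U i \<inter> V) \<and> s x = s x"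
        using idx[OF x] by (intro exI[of _ "(idx x, V, \<psi>)"]) auto
    qed simp
    fix V \<psi> N' \<theta> assume V: "(V, \<psi>) \<in> atlas M" and "(N', \<theta>) \<in> atlas T"
    then obtain j V' \<psi>' where N: "N' = (U j \<inter> V') \<times> C" "\<theta> = chT j \<psi>'" "j \<in> I" "(V', \<psi>') \<in> atlas M"
      by (elim atlas_TE)
    have eq: "V \<inter> X \<inter> s -` N' = U j \<inter> V \<inter> V'" unfolding N using car U_sub[OF N(3)] by fastforce
    have o: "openin (topo E) (\<psi> ` (U j \<inter> V \<inter> V'))" by (rule chart(8)[OF V]) (use U_open[OF N(3)] chart(1)[OF V] chart(1)[OF N(4)] in auto)
    have "smooth_on E G (\<psi> ` (U j \<inter> V \<inter> V')) (\<lambda>y. ((\<psi>' \<circ> inv_into V \<psi>) y, \<rho> j (s (inv_into V \<psi> y))))"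
      by (intro smooth_on_pair[OF lcs_E lcs_E lcs_F] smooth_on_subset[OF lcs_E lcs_E chart_trans[OF V N(4)] o]
           smooth_on_subset[OF lcs_E lcs_F sm[OF N(3) V] o]) auto
    then show "smooth_on (model M) (model T) (\<psi> ` (V \<inter> X \<inter> s -` N')) (\<theta> \<circ> s \<circ> inv_into V \<psi>)"
      unfolding eq T_simps model_M
    proof (rule smooth_on_cong[OF lcs_E lcs_G _ refl])
      fix y assume "y \<in> \<psi> ` (U j \<inter> V \<inter> V')"
      then obtain x where x: "y = \<psi> x" "x \<in> V" "x \<in> U j" by auto
      have "x \<in> X" using x U_sub[OF N(3)] by blast
      then have "fst (s x) = x" using car[of x] by auto
      then show "(\<theta> \<circ> s \<circ> inv_into V \<psi>) y = ((\<psi>' \<circ> inv_into V \<psi>) y, \<rho> j (s (inv_into V \<psi> y)))"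
        using x chart(5)[OF V] N by (simp add: chT_def)
    qed
  qed simp
  moreover have "\<forall>x\<in>X. fst (s x) = x" using car by fastforce
  ultimately show ?thesis using ext by (simp add: smooth_sections_def)
qed


lemma section_algebra_simps [simp]:
  "carrier (section_algebra T M A fst fib) = smooth_sections T M fst"
  "s \<otimes>\<^bsub>section_algebra T M A fst fib\<^esub> r = (\<lambda>x\<in>X. (x, snd (s x) \<otimes>\<^bsub>A\<^esub> snd (r x)))"
  "\<one>\<^bsub>section_algebra T M A fst fib\<^esub> = (\<lambda>x\<in>X. (x, \<one>\<^bsub>A\<^esub>))"
  "\<zero>\<^bsub>section_algebra T M A fst fib\<^esub> = (\<lambda>x\<in>X. (x, \<zero>\<^bsub>A\<^esub>))"
  "s \<oplus>\<^bsub>section_algebra T M A fst fib\<^esub> r = (\<lambda>x\<in>X. (x, snd (s x) \<oplus>\<^bsub>A\<^esub> snd (r x)))"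
  "c \<odot>\<^bsub>section_algebra T M A fst fib\<^esub> s = (\<lambda>x\<in>X. (x, c \<odot>\<^bsub>A\<^esub> snd (s x)))"
  by (simp_all add: section_algebra_def)

abbreviation \<Gamma> where "\<Gamma> \<equiv> smooth_sections T M fst"
abbreviation \<Gamma>A where "\<Gamma>A \<equiv> section_algebra T M A fst fib"

lemma section_snd: "s \<in> \<Gamma> \<Longrightarrow> x \<in> X \<Longrightarrow> snd (s x) \<in> C" "s \<in> \<Gamma> \<Longrightarrow> x \<in> X \<Longrightarrow> s x = (x, snd (s x))"
  using section_carrier by force+

lemma inv_chart:
  assumes "(V, \<psi>) \<in> atlas M" "y \<in> \<psi> ` D" "D \<subseteq> V"
  shows "inv_into V \<psi> y \<in> D" "inv_into V \<psi> y \<in> X" "\<psi> (inv_into V \<psi> y) = y"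
proof -
  obtain x where x: "y = \<psi> x" "x \<in> D" using assms(2) by blast
  have "inv_into V \<psi> y = x" using x chart(5)[OF assms(1)] assms(3) by (simp add: subset_iff)
  then show "inv_into V \<psi> y \<in> D" "inv_into V \<psi> y \<in> X" "\<psi> (inv_into V \<psi> y) = y"
    using x chart(4)[OF assms(1)] assms(3) by auto
qed

lemma section_of_local:
  assumes car: "\<And>x. x \<in> X \<Longrightarrow> f x \<in> C"
    and sm: "\<And>i V \<psi>. i \<in> I \<Longrightarrow> (V, \<psi>) \<in> atlas M \<Longrightarrow>
       smooth_on E F (\<psi> ` (U i \<inter> V)) (\<lambda>y. \<rho> i (inv_into V \<psi> y, f (inv_into V \<psi> y)))"
  shows "(\<lambda>x\<in>X. (x, f x)) \<in> \<Gamma>"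
proof (rule sectionI)
  fix i V \<psi> assume *: "i \<in> I" "(V, \<psi>) \<in> atlas M"
  show "smooth_on E F (\<psi> ` (U i \<inter> V)) (\<lambda>y. \<rho> i ((\<lambda>x\<in>X. (x, f x)) (inv_into V \<psi> y)))"
    by (rule smooth_on_cong[OF lcs_E lcs_F sm[OF *] refl]) (use inv_chart(2)[OF *(2), of _ "U i \<inter> V"] in auto)
qed (use car in auto)

lemma rho_ops:
  assumes i: "i \<in> I" "x \<in> U i" and b: "b \<in> C" 
  shows "c \<in> C \<Longrightarrow> \<rho> i (x, b \<oplus>\<^bsub>A\<^esub> c) = \<rho> i (x, b) \<oplus>\<^bsub>A\<^esub> \<rho> i (x, c)"
    "c \<in> C \<Longrightarrow> \<rho> i (x, b \<otimes>\<^bsub>A\<^esub> c) = \<rho> i (x, b) \<otimes>\<^bsub>A\<^esub> \<rho> i (x, c)"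
    "\<rho> i (x, t \<odot>\<^bsub>A\<^esub> b) = t \<odot>\<^bsub>A\<^esub> \<rho> i (x, b)"
    "\<rho> i (x, \<one>\<^bsub>A\<^esub>) = \<one>\<^bsub>A\<^esub>" "\<rho> i (x, \<zero>\<^bsub>A\<^esub>) = \<zero>\<^bsub>A\<^esub>"
proof -
  have *: "\<rho> i (x, t \<odot>\<^bsub>A\<^esub> b) = t \<odot>\<^bsub>A\<^esub> \<rho> i (x, b)" if "b \<in> C" for t b
    using i idx_U[OF i] that by (simp add: \<rho>_def g_props)
  show "c \<in> C \<Longrightarrow> \<rho> i (x, b \<oplus>\<^bsub>A\<^esub> c) = \<rho> i (x, b) \<oplus>\<^bsub>A\<^esub> \<rho> i (x, c)"
    "c \<in> C \<Longrightarrow> \<rho> i (x, b \<otimes>\<^bsub>A\<^esub> c) = \<rho> i (x, b) \<otimes>\<^bsub>A\<^esub> \<rho> i (x, c)"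
    "\<rho> i (x, t \<odot>\<^bsub>A\<^esub> b) = t \<odot>\<^bsub>A\<^esub> \<rho> i (x, b)" "\<rho> i (x, \<one>\<^bsub>A\<^esub>) = \<one>\<^bsub>A\<^esub>"
    using i idx_U[OF i] b * by (simp_all add: \<rho>_def g_props g_unit)
  show "\<rho> i (x, \<zero>\<^bsub>A\<^esub>) = \<zero>\<^bsub>A\<^esub>"
    using *[OF A.zero_closed, of 0] rho_C[OF i A.zero_closed] by simp
qed

abbreviation pt :: "unit topology" where "pt \<equiv> discrete_topology {()}"

lemma section_family:
  assumes "s \<in> \<Gamma>" "i \<in> I" "(V, \<psi>) \<in> atlas M"
  shows "smooth_family pt E F (\<psi> ` (U i \<inter> V)) (\<lambda>_ y. \<rho> i (s (inv_into V \<psi> y)))"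
  using section_smooth[OF assms] smooth_on_iff_family[OF lcs_E lcs_F] by blast

text \<open>Each \<open>\<rho> i\<close> is fibrewise a homomorphism, so the coordinates of a sum or
  product are the sums or products of the coordinates, and the rules for smooth families apply in
  every given chart.\<close>

lemma section_ops_closed:
  assumes s: "s \<in> \<Gamma>" and r: "r \<in> \<Gamma>"
  shows "s \<oplus>\<^bsub>\<Gamma>A\<^esub> r \<in> \<Gamma>" "s \<otimes>\<^bsub>\<Gamma>A\<^esub> r \<in> \<Gamma>" "c \<odot>\<^bsub>\<Gamma>A\<^esub> s \<in> \<Gamma>"
proof -
  have e: "\<rho> i (s x) = \<rho> i (x, snd (s x))" "\<rho> i (r x) = \<rho> i (x, snd (r x))" if "x \<in> X" for i x
    using section_snd(2)[OF s that] section_snd(2)[OF r that] by metis+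
  have cong: "smooth_on E F (\<psi> ` (U i \<inter> V)) (\<lambda>y. \<rho> i (inv_into V \<psi> y, f (inv_into V \<psi> y)))"
    if "smooth_family pt E F (\<psi> ` (U i \<inter> V)) (\<lambda>_. h)" "(V, \<psi>) \<in> atlas M"
      "\<And>y. inv_into V \<psi> y \<in> U i \<Longrightarrow> inv_into V \<psi> y \<in> X \<Longrightarrow> h y = \<rho> i (inv_into V \<psi> y, f (inv_into V \<psi> y))" for i V \<psi> h f
    unfolding smooth_on_iff_family[OF lcs_E lcs_F]
    by (rule smooth_family_cong[OF lcs_E that(1)]) (rule that(3); use inv_chart[OF that(2), of _ "U i \<inter> V"] in auto)
  show "s \<oplus>\<^bsub>\<Gamma>A\<^esub> r \<in> \<Gamma>"
    unfolding section_algebra_simps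
  proof (rule section_of_local)
    fix i V \<psi> assume *: "i \<in> I" "(V, \<psi>) \<in> atlas M"
    show "smooth_on E F (\<psi> ` (U i \<inter> V)) (\<lambda>y. \<rho> i (inv_into V \<psi> y, snd (s (inv_into V \<psi> y)) \<oplus>\<^bsub>A\<^esub> snd (r (inv_into V \<psi> y))))"
      by (rule cong[OF smooth_family_add[OF lcs_E lcs_F section_family[OF s *] section_family[OF r *]] *(2)])
        (use rho_ops(1)[OF *(1)] e section_snd[OF s] section_snd[OF r] in auto)
  qed (use section_snd[OF s] section_snd[OF r] in auto)
  show "s \<otimes>\<^bsub>\<Gamma>A\<^esub> r \<in> \<Gamma>"
    unfolding section_algebra_simps
  proof (rule section_of_local)
    fix i V \<psi> assume *: "i \<in> I" "(V, \<psi>) \<in> atlas M"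
    show "smooth_on E F (\<psi> ` (U i \<inter> V)) (\<lambda>y. \<rho> i (inv_into V \<psi> y, snd (s (inv_into V \<psi> y)) \<otimes>\<^bsub>A\<^esub> snd (r (inv_into V \<psi> y))))"
      by (rule cong[OF A.smooth_family_mult[OF lcs_E section_family[OF s *] section_family[OF r *]] *(2)])
        (use rho_ops(2)[OF *(1)] e section_snd[OF s] section_snd[OF r] in auto)
  qed (use section_snd[OF s] section_snd[OF r] in auto)
  show "c \<odot>\<^bsub>\<Gamma>A\<^esub> s \<in> \<Gamma>"
    unfolding section_algebra_simps
  proof (rule section_of_local)
    fix i V \<psi> assume *: "i \<in> I" "(V, \<psi>) \<in> atlas M"
    show "smooth_on E F (\<psi> ` (U i \<inter> V)) (\<lambda>y. \<rho> i (inv_into V \<psi> y, c \<odot>\<^bsub>A\<^esub> snd (s (inv_into V \<psi> y))))"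
      by (rule cong[OF A.smooth_family_smult[OF lcs_E section_family[OF s *], of "\<lambda>_. c"] *(2)])
        (use rho_ops(3)[OF *(1)] e section_snd[OF s] in auto)
  qed (use section_snd[OF s] in auto)
qed

lemma section_const_closed: "\<one>\<^bsub>\<Gamma>A\<^esub> \<in> \<Gamma>" "\<zero>\<^bsub>\<Gamma>A\<^esub> \<in> \<Gamma>"
proof -
  \<comment> \<open>Elements whose coordinate is the same in all charts give constant
    representatives; this applies to the unit and to zero.\<close>
  have *: "(\<lambda>x\<in>X. (x, b)) \<in> \<Gamma>" if b: "b \<in> C" "\<And>i x. i \<in> I \<Longrightarrow> x \<in> U i \<Longrightarrow> \<rho> i (x, b) = b" for b
  proof (rule section_of_local)
    fix i V \<psi> assume *: "i \<in> I" "(V, \<psi>) \<in> atlas M"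
    have "openin (topo E) (\<psi> ` (U i \<inter> V))" by (rule chart(8)[OF *(2)]) (use U_open[OF *(1)] chart(1)[OF *(2)] in auto)
    then have "smooth_on E F (\<psi> ` (U i \<inter> V)) (\<lambda>_. b)"
      unfolding smooth_on_iff_family[OF lcs_E lcs_F] using b by (intro smooth_family_const[OF lcs_E lcs_F]) auto
    then show "smooth_on E F (\<psi> ` (U i \<inter> V)) (\<lambda>y. \<rho> i (inv_into V \<psi> y, b))"
      by (rule smooth_on_cong[OF lcs_E lcs_F _ refl]) (rule b(2)[OF *(1)], use inv_chart(1)[OF *(2), of _ "U i \<inter> V"] in auto)
  qed (rule b)
  show "\<one>\<^bsub>\<Gamma>A\<^esub> \<in> \<Gamma>" "\<zero>\<^bsub>\<Gamma>A\<^esub> \<in> \<Gamma>"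
    unfolding section_algebra_simps by (intro * A.one_closed A.zero_closed rho_ops(4,5)[where b="\<zero>\<^bsub>A\<^esub>"]; assumption)+
qed

lemma unital_algebra_sections: "unital_algebra \<Gamma>A"
proof (rule unital_algebra_pointwise[where X=X and F=fib and ev="\<lambda>x s. s x"])
  fix b b' assume *: "b \<in> carrier \<Gamma>A" "b' \<in> carrier \<Gamma>A" "\<And>x. x \<in> X \<Longrightarrow> b x = b' x"
  then show "b = b'" by (intro extensionalityI[of b X b']) (auto simp: smooth_sections_def)
next
  fix b b' assume "b \<in> carrier \<Gamma>A" "b' \<in> carrier \<Gamma>A"
  then show "b \<oplus>\<^bsub>\<Gamma>A\<^esub> b' \<in> carrier \<Gamma>A" "b \<otimes>\<^bsub>\<Gamma>A\<^esub> b' \<in> carrier \<Gamma>A"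
    using section_ops_closed by (simp_all del: section_algebra_simps(2-6))
next
  fix c b assume "b \<in> carrier \<Gamma>A"
  then show "c \<odot>\<^bsub>\<Gamma>A\<^esub> b \<in> carrier \<Gamma>A" using section_ops_closed by (simp del: section_algebra_simps(2-6))
next
  show "\<one>\<^bsub>\<Gamma>A\<^esub> \<in> carrier \<Gamma>A" "\<zero>\<^bsub>\<Gamma>A\<^esub> \<in> carrier \<Gamma>A" using section_const_closed by (simp_all del: section_algebra_simps(2-6))
qed (use unital_algebra_fib section_snd section_carrier in auto)

text \<open>The topology of the section algebra refers to arbitrary bundle charts, not only to the given
  ones; two bundle charts differ by a smooth map that is linear in the fibre.\<close>

definition rep where "rep U' \<phi>' e = snd (inv_into (U' \<times> C) \<phi>' e)"

text \<open>An arbitrary bundle chart is fibrewise an isomorphism from \<open>A\<close>, so reading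
  off coordinates is a homomorphism on each fibre. This gives linearity of transition maps and
  multiplicativity of local representatives.\<close>

lemma rep_hom:
  assumes bc: "bundle_chart T M A fst fib U' \<phi>'" and x: "x \<in> U'"
  shows "x \<in> X" "e \<in> {x} \<times> C \<Longrightarrow> rep U' \<phi>' e \<in> C"
    "e \<in> {x} \<times> C \<Longrightarrow> inv_into (U' \<times> C) \<phi>' e = (x, rep U' \<phi>' e)"
    "b \<in> C \<Longrightarrow> c \<in> C \<Longrightarrow> rep U' \<phi>' (x, b \<oplus>\<^bsub>A\<^esub> c) = rep U' \<phi>' (x, b) \<oplus>\<^bsub>A\<^esub> rep U' \<phi>' (x, c)"
    "b \<in> C \<Longrightarrow> c \<in> C \<Longrightarrow> rep U' \<phi>' (x, b \<otimes>\<^bsub>A\<^esub> c) = rep U' \<phi>' (x, b) \<otimes>\<^bsub>A\<^esub> rep U' \<phi>' (x, c)"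
    "b \<in> C \<Longrightarrow> rep U' \<phi>' (x, t \<odot>\<^bsub>A\<^esub> b) = t \<odot>\<^bsub>A\<^esub> rep U' \<phi>' (x, b)"
proof -
  have oU: "openin (mtopo M) U'" using bc by (simp add: bundle_chart_def)
  then have UX: "U' \<subseteq> X" by (rule openin_subset)
  then show xX: "x \<in> X" using x by blast
  have bij: "bij_betw \<phi>' (U' \<times> C) (U' \<times> C)"
    using bc unfolding bundle_chart_def T_over[OF UX] by blast
  have iso: "(\<lambda>a. \<phi>' (x, a)) \<in> alg_iso A (fib x)" using bc x by (simp add: bundle_chart_def)
  have k: "rep U' \<phi>' (\<phi>' (x, a)) = a \<and> inv_into (U' \<times> C) \<phi>' (\<phi>' (x, a)) = (x, a)" if "a \<in> C" for a
    using bij_betw_imp_inj_on[OF bij] x that by (simp add: rep_def)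
  have bijx: "bij_betw (\<lambda>a. \<phi>' (x, a)) C ({x} \<times> C)" using iso by (simp add: alg_iso_def)
  have ex: "\<exists>a\<in>C. e = \<phi>' (x, a)" if "e \<in> {x} \<times> C" for e
    using bij_betw_imp_surj_on[OF bijx] that by blast
  show rc: "rep U' \<phi>' e \<in> C" and "inv_into (U' \<times> C) \<phi>' e = (x, rep U' \<phi>' e)" if "e \<in> {x} \<times> C" for e
    using ex[OF that] k by auto
  have hom: "\<phi>' (x, a \<oplus>\<^bsub>A\<^esub> b) = (x, snd (\<phi>' (x, a)) \<oplus>\<^bsub>A\<^esub> snd (\<phi>' (x, b)))"
    "\<phi>' (x, a \<otimes>\<^bsub>A\<^esub> b) = (x, snd (\<phi>' (x, a)) \<otimes>\<^bsub>A\<^esub> snd (\<phi>' (x, b)))"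
    "\<phi>' (x, t \<odot>\<^bsub>A\<^esub> a) = (x, t \<odot>\<^bsub>A\<^esub> snd (\<phi>' (x, a)))" if "a \<in> C" "b \<in> C" for a b t
    using iso that by (simp_all add: alg_iso_def alg_hom_def)
  have ab: "\<exists>a\<in>C. \<phi>' (x, a) = (x, b)" if "b \<in> C" for b using ex[of "(x, b)"] that by auto
  show "rep U' \<phi>' (x, b \<oplus>\<^bsub>A\<^esub> c) = rep U' \<phi>' (x, b) \<oplus>\<^bsub>A\<^esub> rep U' \<phi>' (x, c)"
    "rep U' \<phi>' (x, b \<otimes>\<^bsub>A\<^esub> c) = rep U' \<phi>' (x, b) \<otimes>\<^bsub>A\<^esub> rep U' \<phi>' (x, c)" if bc: "b \<in> C" "c \<in> C" for b c
  proof -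
    obtain b' c' where b': "b' \<in> C" "\<phi>' (x, b') = (x, b)" "c' \<in> C" "\<phi>' (x, c') = (x, c)" using ab bc by meson
    have "rep U' \<phi>' (x, b) = b'" "rep U' \<phi>' (x, c) = c'" using k[OF b'(1)] k[OF b'(3)] b' by simp_all
    then show "rep U' \<phi>' (x, b \<oplus>\<^bsub>A\<^esub> c) = rep U' \<phi>' (x, b) \<oplus>\<^bsub>A\<^esub> rep U' \<phi>' (x, c)"
      "rep U' \<phi>' (x, b \<otimes>\<^bsub>A\<^esub> c) = rep U' \<phi>' (x, b) \<otimes>\<^bsub>A\<^esub> rep U' \<phi>' (x, c)"
      using hom(1,2)[OF b'(1,3)] b' k[of "b' \<oplus>\<^bsub>A\<^esub> c'"] k[of "b' \<otimes>\<^bsub>A\<^esub> c'"] by simp_all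
  qed
  show "rep U' \<phi>' (x, t \<odot>\<^bsub>A\<^esub> b) = t \<odot>\<^bsub>A\<^esub> rep U' \<phi>' (x, b)" if b: "b \<in> C" for b t
  proof -
    obtain b' where b': "b' \<in> C" "\<phi>' (x, b') = (x, b)" using ab b by meson
    then show ?thesis using hom(3)[OF b'(1) b'(1), of t] k[OF b'(1)] k[of "t \<odot>\<^bsub>A\<^esub> b'"] by simp
  qed
qed

text \<open>Smoothness of the inverse chart on the total space, expressed in the chart with index
  \<open>i\<close>, is joint smoothness in \<open>(y, a)\<close>. Restricting to directions in the
  base turns \<open>a\<close> into a continuous parameter, which is the form that
  \<open>smooth_family_fibre_linear\<close> takes.\<close>

lemma rep_transition_smooth:
  assumes bc: "bundle_chart T M A fst fib U' \<phi>'" and i: "i \<in> I" and V: "(V, \<psi>) \<in> atlas M"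
  shows "smooth_family (topo A) E F (\<psi> ` (U' \<inter> U i \<inter> V)) (\<lambda>a y. rep U' \<phi>' (\<phi> i (inv_into V \<psi> y, a)))"
proof -
  let ?D = "U' \<inter> U i \<inter> V"
  let ?f = "\<lambda>z. rep U' \<phi>' (\<phi> i (inv_into V \<psi> (fst z), snd z))"
  have oU: "openin (mtopo M) U'" using bc by (simp add: bundle_chart_def)
  then have UX: "U' \<subseteq> X" by (rule openin_subset)
  have oD: "openin (topo E) (\<psi> ` ?D)" by (rule chart(8)[OF V]) (use oU U_open[OF i] chart(1)[OF V] in auto)
  have inv: "smooth_map T PM (U' \<times> C) (inv_into (U' \<times> C) \<phi>')"
    using bc unfolding bundle_chart_def T_over[OF UX] by blast
  have phi_x: "\<phi> i (x, a) \<in> {x} \<times> C" if "x \<in> U i" "a \<in> C" for x a using phi_C[OF i that] by (auto simp: \<phi>_def)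
  have c1: "((U i \<inter> V) \<times> C, chT i \<psi>) \<in> atlas T" using i V by auto
  have c2: "(V \<times> C, map_prod \<psi> id) \<in> atlas PM" using V by auto
  have "smooth_on G G (chT i \<psi> ` ((U i \<inter> V) \<times> C \<inter> U' \<times> C \<inter> inv_into (U' \<times> C) \<phi>' -` (V \<times> C)))
      (map_prod \<psi> id \<circ> inv_into (U' \<times> C) \<phi>' \<circ> inv_into ((U i \<inter> V) \<times> C) (chT i \<psi>))"
    using smooth_mapD[OF inv c1 c2] by simp
  moreover have "(U i \<inter> V) \<times> C \<inter> U' \<times> C \<inter> inv_into (U' \<times> C) \<phi>' -` (V \<times> C) = ?D \<times> C"
  proof (intro equalityI subsetI)
    fix e assume "e \<in> ?D \<times> C"
    then obtain x b where e: "e = (x, b)" "x \<in> ?D" "b \<in> C" by auto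
    then have "inv_into (U' \<times> C) \<phi>' e = (x, rep U' \<phi>' e)" "rep U' \<phi>' e \<in> C"
      using rep_hom(2,3)[OF bc, of x e] by auto
    then show "e \<in> (U i \<inter> V) \<times> C \<inter> U' \<times> C \<inter> inv_into (U' \<times> C) \<phi>' -` (V \<times> C)" using e by auto
  qed auto
  moreover have "chT i \<psi> ` (?D \<times> C) = \<psi> ` ?D \<times> C" by (rule chT_image[OF i]) auto
  ultimately have "smooth_on G G (\<psi> ` ?D \<times> C) (map_prod \<psi> id \<circ> inv_into (U' \<times> C) \<phi>' \<circ> inv_into ((U i \<inter> V) \<times> C) (chT i \<psi>))" by simp
  from smooth_on_postlin[OF lcs_G lcs_G lcs_F snd_linear this]
  have "smooth_on G F (\<psi> ` ?D \<times> C) ?f"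
  proof (rule smooth_on_cong[OF lcs_G lcs_F _ refl])
    fix z assume "z \<in> \<psi> ` ?D \<times> C"
    then obtain x a where z: "z = (\<psi> x, a)" "x \<in> U'" "x \<in> U i" "x \<in> V" "a \<in> C" by auto
    have "inv_into ((U i \<inter> V) \<times> C) (chT i \<psi>) z = \<phi> i (x, a)" unfolding z by (rule inv_chT[OF i V]) (use z in auto)
    then show "?f z = snd ((map_prod \<psi> id \<circ> inv_into (U' \<times> C) \<phi>' \<circ> inv_into ((U i \<inter> V) \<times> C) (chT i \<psi>)) z)"
      using z chart(5)[OF V] by (simp add: rep_def)
  qed
  then have "smooth_family pt G F (\<psi> ` ?D \<times> C) (\<lambda>_. ?f)" unfolding smooth_on_iff_family[OF lcs_G lcs_F] .
  from smooth_family_pull[OF _ this, of "topo A" "\<lambda>_. ()"]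
  have fam: "smooth_family (topo A) G F (\<psi> ` ?D \<times> C) (\<lambda>_. ?f)" by simp
  have "smooth_family (topo A) E F (\<psi> ` ?D) (\<lambda>a y. ?f (y, a))"
  \<comment> \<open>The substitution \<open>y \<mapsto> (y, a)\<close> is affine with linear part
    \<open>v \<mapsto> (v, \<zero>)\<close>.\<close>
  proof (rule smooth_family_affine[OF lcs_G lcs_E oD _ _ _ _ fam, where T="\<lambda>a y. (y, a)" and L="\<lambda>v. (v, \<zero>\<^bsub>A\<^esub>)"])
    show "continuous_map (prod_topology (topo A) (subtopology (topo E) (\<psi> ` ?D))) (topo G) (\<lambda>z. (snd z, fst z))"
      unfolding prod_tvs_simps real_tvs_simps
      by (intro continuous_map_pairedI continuous_map_fst continuous_map_into_fulltopology[OF continuous_map_snd])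
    show "continuous_map (topo E) (topo G) (\<lambda>v. (v, \<zero>\<^bsub>A\<^esub>))"
      unfolding prod_tvs_simps real_tvs_simps by (intro continuous_map_pairedI) auto
  qed auto
  then show ?thesis by simp
qed

text \<open>Passes from the given charts to an arbitrary bundle chart. Near a point the
  representative is the transition map applied to the coordinate in the chart chosen by
  \<open>idx\<close>, and that transition is linear in the fibre.\<close>

lemma rep_family:
  assumes bc: "bundle_chart T M A fst fib U' \<phi>'" and V: "(V, \<psi>) \<in> atlas M"
    and s: "\<And>p x. p \<in> topspace S \<Longrightarrow> x \<in> X \<Longrightarrow> s p x \<in> {x} \<times> C"
    and sm: "\<And>i. i \<in> I \<Longrightarrow> smooth_family S E F (\<psi> ` (U i \<inter> V)) (\<lambda>p y. \<rho> i (s p (inv_into V \<psi> y)))"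
  shows "smooth_family S E F (\<psi> ` (U' \<inter> V)) (\<lambda>p. local_rep A U' \<phi>' V \<psi> (s p))"
proof (rule smooth_family_local[OF lcs_E lcs_F])
  have oU: "openin (mtopo M) U'" using bc by (simp add: bundle_chart_def)
  then have UX: "U' \<subseteq> X" by (rule openin_subset)
  show "openin (topo E) (\<psi> ` (U' \<inter> V))" by (rule chart(8)[OF V]) (use oU chart(1)[OF V] in auto)
  fix y assume y: "y \<in> \<psi> ` (U' \<inter> V)"
  let ?x = "inv_into V \<psi> y"
  have x: "?x \<in> U' \<inter> V" "?x \<in> X" "\<psi> ?x = y" using inv_chart[OF V y] by auto
  let ?i = "idx ?x"
  have i: "?i \<in> I" "?x \<in> U ?i" using idx x by auto
  let ?D = "U' \<inter> U ?i \<inter> V"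
  have oD: "openin (topo E) (\<psi> ` ?D)" by (rule chart(8)[OF V]) (use oU U_open[OF i(1)] chart(1)[OF V] in auto)
  let ?H = "\<lambda>(p::'b, a) y. rep U' \<phi>' (\<phi> ?i (inv_into V \<psi> y, a))"
  have H: "smooth_family (prod_topology S (topo F)) E F (\<psi> ` ?D) ?H"
    using smooth_family_pull[OF continuous_map_snd rep_transition_smooth[OF bc i(1) V], of S] by (simp add: case_prod_unfold)
  have f: "smooth_family S E F (\<psi> ` ?D) (\<lambda>p y. \<rho> ?i (s p (inv_into V \<psi> y)))"
    by (rule smooth_family_subset[OF lcs_E lcs_F sm[OF i(1)] oD]) auto
  have lin: "rep U' \<phi>' (\<phi> ?i (x, a \<oplus>\<^bsub>A\<^esub> b)) = rep U' \<phi>' (\<phi> ?i (x, a)) \<oplus>\<^bsub>A\<^esub> rep U' \<phi>' (\<phi> ?i (x, b))"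
     "rep U' \<phi>' (\<phi> ?i (x, t \<odot>\<^bsub>A\<^esub> a)) = t \<odot>\<^bsub>A\<^esub> rep U' \<phi>' (\<phi> ?i (x, a))"
    if x: "x \<in> U'" "x \<in> U ?i" and ab: "a \<in> C" "b \<in> C" for x a b t
    using idx_U[OF i(1) x(2)] i(1) x ab rep_hom(4,6)[OF bc x(1)] by (simp_all add: \<phi>_def g_props)
  have "smooth_family S E F (\<psi> ` ?D) (\<lambda>p y. ?H (p, \<rho> ?i (s p (inv_into V \<psi> y))) y)"
  proof (rule smooth_family_fibre_linear[OF lcs_E lcs_F lcs_F f H])
    fix p y a b t assume *: "y \<in> \<psi> ` ?D" "a \<in> carrier F"
    have d: "inv_into V \<psi> y \<in> U'" "inv_into V \<psi> y \<in> U ?i" using inv_chart[OF V *(1)] by auto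
    then show "?H (p, t \<odot>\<^bsub>F\<^esub> a) y = t \<odot>\<^bsub>F\<^esub> ?H (p, a) y" using lin(2)[OF d] * by simp
    assume "b \<in> carrier F"
    then show "?H (p, a \<oplus>\<^bsub>F\<^esub> b) y = ?H (p, a) y \<oplus>\<^bsub>F\<^esub> ?H (p, b) y" using lin(1)[OF d] * by simp
  qed
  then have "smooth_family S E F (\<psi> ` ?D) (\<lambda>p. local_rep A U' \<phi>' V \<psi> (s p))"
  proof (rule smooth_family_cong[OF lcs_E])
    fix p y assume *: "p \<in> topspace S" "y \<in> \<psi> ` ?D"
    have d: "inv_into V \<psi> y \<in> U ?i" "inv_into V \<psi> y \<in> X" using inv_chart[OF V *(2)] by auto
    obtain b where b: "s p (inv_into V \<psi> y) = (inv_into V \<psi> y, b)" "b \<in> C" using s[OF *(1) d(2)] by auto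
    show "?H (p, \<rho> ?i (s p (inv_into V \<psi> y))) y = local_rep A U' \<phi>' V \<psi> (s p) y"
      using phi_rho[OF i(1) d(1) b(2)] b by (simp add: local_rep_def rep_def)
  qed
  moreover have "y \<in> \<psi> ` ?D" using x i by (intro image_eqI[of _ _ ?x]) auto
  ultimately show "\<exists>W. y \<in> W \<and> W \<subseteq> \<psi> ` (U' \<inter> V) \<and> smooth_family S E F W (\<lambda>p. local_rep A U' \<phi>' V \<psi> (s p))"
    by (intro exI[of _ "\<psi> ` ?D"]) auto
qed

definition chart_pairs where
  "chart_pairs = {(U', \<phi>', V, \<psi>). bundle_chart T M A fst fib U' \<phi>' \<and> (V, \<psi>) \<in> atlas M}"

abbreviation chart_dom where "chart_dom \<equiv> (\<lambda>(U' :: 'm set, \<phi>' :: 'm \<times> 'a \<Rightarrow> 'm \<times> 'a, V, \<psi> :: 'm \<Rightarrow> nat \<Rightarrow> real). \<psi> ` (U' \<inter> V))"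

abbreviation chart_rep where "chart_rep \<equiv> (\<lambda>(U' :: 'm set, \<phi>' :: 'm \<times> 'a \<Rightarrow> 'm \<times> 'a, V, \<psi> :: 'm \<Rightarrow> nat \<Rightarrow> real). local_rep A U' \<phi>' V \<psi>)"

lemma section_space:
  "smooth_function_space A \<Gamma>A E chart_pairs chart_dom chart_rep"
proof (rule smooth_function_space.intro)
  show "lc_algebra A" "lcs E" "unital_algebra \<Gamma>A" by (rule A.lca lcs_E unital_algebra_sections)+
  show "locally_compact_space (topo E)" by (simp add: Rn_def locally_compact_Euclidean_space)
next
  fix p assume "p \<in> chart_pairs"
  then obtain U' \<phi>' V \<psi> where p: "p = (U', \<phi>', V, \<psi>)" "bundle_chart T M A fst fib U' \<phi>'" "(V, \<psi>) \<in> atlas M" by (auto simp: chart_pairs_def)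
  have oU: "openin (mtopo M) U'" using p by (simp add: bundle_chart_def)
  show "openin (topo E) (chart_dom p)"
    unfolding p prod.case by (rule chart(8)[OF p(3)]) (use oU chart(1)[OF p(3)] in auto)
  fix s assume "s \<in> carrier \<Gamma>A"
  then have s: "s \<in> \<Gamma>" by simp
  show "smooth_on E (real_tvs A) (chart_dom p) (chart_rep p s)"
    unfolding p prod.case smooth_on_iff_family[OF lcs_E lcs_F]
    by (rule rep_family[OF p(2,3)]) (use section_carrier[OF s] section_family[OF s _ p(3)] in auto)
next
  show "topo \<Gamma>A = topology_generated_by (insert (carrier \<Gamma>A)
       {{b \<in> carrier \<Gamma>A. dclose E (real_tvs A) k K W (chart_rep p b) (chart_rep p r)} |r p k K W.
          r \<in> carrier \<Gamma>A \<and> p \<in> chart_pairs \<and> compactin (jet_topology E (chart_dom p) k) K \<and> openin (topo A) W \<and> \<zero>\<^bsub>A\<^esub> \<in> W})"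
  proof -
    have "topo \<Gamma>A = topology_generated_by (insert \<Gamma>
      {{s \<in> \<Gamma>. dclose E (real_tvs A) k K W (local_rep A U \<phi> V \<psi> s) (local_rep A U \<phi> V \<psi> r)}
        |r U \<phi> V \<psi> k K W.
         r \<in> \<Gamma> \<and> bundle_chart T M A fst fib U \<phi> \<and> (V, \<psi>) \<in> atlas M \<and>
         compactin (jet_topology E (\<psi> ` (U \<inter> V)) k) K \<and> openin (topo A) W \<and> \<zero>\<^bsub>A\<^esub> \<in> W})"
      by (simp add: section_algebra_def)
    \<comment> \<open>Merely gathers the two charts of a representative into one index.\<close>
    also have "\<dots> = topology_generated_by (insert (carrier \<Gamma>A)
       {{b \<in> carrier \<Gamma>A. dclose E (real_tvs A) k K W (chart_rep p b) (chart_rep p r)} |r p k K W.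
          r \<in> carrier \<Gamma>A \<and> p \<in> chart_pairs \<and> compactin (jet_topology E (chart_dom p) k) K \<and> openin (topo A) W \<and> \<zero>\<^bsub>A\<^esub> \<in> W})"
      unfolding section_algebra_simps(1)
    proof (rule arg_cong[where f="\<lambda>S. topology_generated_by (insert \<Gamma> S)"], intro equalityI subsetI, goal_cases)
      case (1 N)
      then obtain r U \<phi> V \<psi> k K W where N: "N = {s \<in> \<Gamma>. dclose E (real_tvs A) k K W (local_rep A U \<phi> V \<psi> s) (local_rep A U \<phi> V \<psi> r)}"
         "r \<in> \<Gamma>" "bundle_chart T M A fst fib U \<phi>" "(V, \<psi>) \<in> atlas M"
         "compactin (jet_topology E (\<psi> ` (U \<inter> V)) k) K" "openin (topo A) W" "\<zero>\<^bsub>A\<^esub> \<in> W" by blast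
      then show ?case
        by (intro CollectI exI[of _ r] exI[of _ "(U, \<phi>, V, \<psi>)"] exI[of _ k] exI[of _ K] exI[of _ W]) (simp add: chart_pairs_def)
    next
      case (2 N)
      then obtain r p k K W where N: "N = {b \<in> \<Gamma>. dclose E (real_tvs A) k K W (chart_rep p b) (chart_rep p r)}"
         "r \<in> \<Gamma>" "p \<in> chart_pairs" "compactin (jet_topology E (chart_dom p) k) K" "openin (topo A) W" "\<zero>\<^bsub>A\<^esub> \<in> W" by blast
      obtain U \<phi> V \<psi> where p: "p = (U, \<phi>, V, \<psi>)" "bundle_chart T M A fst fib U \<phi>" "(V, \<psi>) \<in> atlas M" using N(3) by (auto simp: chart_pairs_def)
      show ?case using N p by (intro CollectI exI[of _ r] exI[of _ U] exI[of _ \<phi>] exI[of _ V] exI[of _ \<psi>] exI[of _ k] exI[of _ K] exI[of _ W]) simp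
    qed
    finally show ?thesis .
  qed
next
  fix p b b' y assume "p \<in> chart_pairs" and b: "b \<in> carrier \<Gamma>A" "b' \<in> carrier \<Gamma>A" and "y \<in> chart_dom p"
  then obtain U' \<phi>' V \<psi> where p: "p = (U', \<phi>', V, \<psi>)" "bundle_chart T M A fst fib U' \<phi>'" "(V, \<psi>) \<in> atlas M" "y \<in> \<psi> ` (U' \<inter> V)" by (auto simp: chart_pairs_def)
  let ?x = "inv_into V \<psi> y"
  have x: "?x \<in> U'" "?x \<in> X" using inv_chart[OF p(3,4)] by auto
  note h = rep_hom(4-6)[OF p(2) x(1)]
  have bb: "snd (b ?x) \<in> C" "b ?x = (?x, snd (b ?x))" "snd (b' ?x) \<in> C" "b' ?x = (?x, snd (b' ?x))"
    using section_snd[OF _ x(2)] b by simp_all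
  have lr: "local_rep A U' \<phi>' V \<psi> s y = rep U' \<phi>' (s ?x)" for s by (simp add: local_rep_def rep_def)
  show "chart_rep p (b \<oplus>\<^bsub>\<Gamma>A\<^esub> b') y =
     chart_rep p b y \<oplus>\<^bsub>A\<^esub> chart_rep p b' y"
    unfolding p prod.case lr using h(1)[OF bb(1,3)] bb(2,4) x by simp
  show "chart_rep p (b \<otimes>\<^bsub>\<Gamma>A\<^esub> b') y =
     chart_rep p b y \<otimes>\<^bsub>A\<^esub> chart_rep p b' y"
    unfolding p prod.case lr using h(2)[OF bb(1,3)] bb(2,4) x by simp
next
  fix p b c y assume "p \<in> chart_pairs" and b: "b \<in> carrier \<Gamma>A" and "y \<in> chart_dom p"
  then obtain U' \<phi>' V \<psi> where p: "p = (U', \<phi>', V, \<psi>)" "bundle_chart T M A fst fib U' \<phi>'" "(V, \<psi>) \<in> atlas M" "y \<in> \<psi> ` (U' \<inter> V)" by (auto simp: chart_pairs_def)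
  let ?x = "inv_into V \<psi> y"
  have x: "?x \<in> U'" "?x \<in> X" using inv_chart[OF p(3,4)] by auto
  have bb: "snd (b ?x) \<in> C" "b ?x = (?x, snd (b ?x))" using section_snd[OF _ x(2)] b by simp_all
  have lr: "local_rep A U' \<phi>' V \<psi> s y = rep U' \<phi>' (s ?x)" for s by (simp add: local_rep_def rep_def)
  show "chart_rep p (c \<odot>\<^bsub>\<Gamma>A\<^esub> b) y =
     c \<odot>\<^bsub>A\<^esub> chart_rep p b y"
    unfolding p prod.case lr using rep_hom(6)[OF p(2) x(1) bb(1), of c] bb(2) x by simp
next
  fix b b' assume *: "b \<in> carrier \<Gamma>A" "b' \<in> carrier \<Gamma>A"
    "\<And>p y. p \<in> chart_pairs \<Longrightarrow> y \<in> chart_dom p \<Longrightarrow>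
      chart_rep p b y = chart_rep p b' y"
  show "b = b'"
  proof (rule extensionalityI[of b X b'])
    fix x assume x: "x \<in> X"
    obtain V \<psi> where V: "(V, \<psi>) \<in> atlas M" "x \<in> V" using chart_ex[OF x] by blast
    have i: "idx x \<in> I" "x \<in> U (idx x)" using idx[OF x] by auto
    have "local_rep A (U (idx x)) (\<phi> (idx x)) V \<psi> b (\<psi> x) = local_rep A (U (idx x)) (\<phi> (idx x)) V \<psi> b' (\<psi> x)"
      using *(3)[of "(U (idx x), \<phi> (idx x), V, \<psi>)" "\<psi> x"] V i bundle_chart_phi[OF i(1)] by (auto simp: chart_pairs_def)
    then have "rep (U (idx x)) (\<phi> (idx x)) (b x) = rep (U (idx x)) (\<phi> (idx x)) (b' x)"
      using V chart(5)[OF V(1)] by (simp add: local_rep_def rep_def)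
    moreover have bb: "snd (b x) \<in> C" "b x = (x, snd (b x))" "snd (b' x) \<in> C" "b' x = (x, snd (b' x))"
      using section_snd[OF _ x] * by simp_all
    ultimately have "\<rho> (idx x) (b x) = \<rho> (idx x) (b' x)"
      using inv_phi[OF i bb(1)] inv_phi[OF i bb(3)] by (simp add: rep_def)
    then show "b x = b' x" using phi_rho[OF i bb(1)] phi_rho[OF i bb(3)] bb by metis
  qed (use * in \<open>auto simp: smooth_sections_def\<close>)
qed

lemma lc_algebra_sections: "lc_algebra \<Gamma>A"
  by (rule smooth_function_space.lc_algebra_B[OF section_space])

abbreviation \<beta> where "\<beta> \<equiv> section_action T M fst \<sigma>"

lemma beta_eq: "l \<in> carrier \<Lambda> \<Longrightarrow> s \<in> \<Gamma> \<Longrightarrow> \<beta> l s = (\<lambda>x\<in>X. (x, \<alpha> l (snd (s x))))"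
  using section_carrier by (force simp: section_action_def \<sigma>_def fun_eq_iff)

lemma rho_alpha:
  assumes "l \<in> carrier \<Lambda>" "i \<in> I" "x \<in> U i" "b \<in> C"
  shows "\<rho> i (x, \<alpha> l b) = \<alpha> l (\<rho> i (x, b))"
  using assms idx_U[OF assms(2,3)] by (simp add: \<rho>_def g_props)

lemma beta_closed:
  assumes l: "l \<in> carrier \<Lambda>" and s: "s \<in> \<Gamma>"
  shows "\<beta> l s \<in> \<Gamma>"
  unfolding beta_eq[OF l s]
proof (rule section_of_local)
  fix i V \<psi> assume *: "i \<in> I" "(V, \<psi>) \<in> atlas M"
  have "smooth_on E F (\<psi> ` (U i \<inter> V)) (\<lambda>y. \<alpha> l (\<rho> i (s (inv_into V \<psi> y))))"
    by (rule smooth_on_postlin[OF lcs_E lcs_F lcs_F _ _ _ section_smooth[OF s *]])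
      (auto simp: alpha_continuous[OF l] alpha_simps[OF l])
  then show "smooth_on E F (\<psi> ` (U i \<inter> V)) (\<lambda>y. \<rho> i (inv_into V \<psi> y, \<alpha> l (snd (s (inv_into V \<psi> y)))))"
  proof (rule smooth_on_cong[OF lcs_E lcs_F _ refl])
    fix y assume y: "y \<in> \<psi> ` (U i \<inter> V)"
    have x: "inv_into V \<psi> y \<in> U i" "inv_into V \<psi> y \<in> X" using inv_chart[OF *(2) y] by auto
    show "\<rho> i (inv_into V \<psi> y, \<alpha> l (snd (s (inv_into V \<psi> y)))) = \<alpha> l (\<rho> i (s (inv_into V \<psi> y)))"
      using rho_alpha[OF l *(1) x(1)] section_snd[OF s x(2)] by metis
  qed
qed (use section_snd[OF s] alpha_closed[OF l] in auto)

lemma local_rep_phi: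
  assumes "i \<in> I" "(V, \<psi>) \<in> atlas M" "y \<in> \<psi> ` (U i \<inter> V)" "s \<in> \<Gamma>"
  shows "local_rep A (U i) (\<phi> i) V \<psi> s y = \<rho> i (s (inv_into V \<psi> y))"
proof -
  have x: "inv_into V \<psi> y \<in> U i" "inv_into V \<psi> y \<in> X" using inv_chart[OF assms(2,3)] by auto
  show ?thesis
    using inv_phi[OF assms(1) x(1) section_snd(1)[OF assms(4) x(2)]] section_snd(2)[OF assms(4) x(2)]
    by (simp add: local_rep_def)
qed

lemma dynamical_system_sections: "dynamical_system \<Gamma>A \<Lambda> \<beta>"
proof (rule dynamical_systemI)
  show "lc_algebra \<Gamma>A" "group \<Lambda>" by (rule lc_algebra_sections L.group_axioms)+
  note ts = smooth_function_space.topspace_B[OF section_space, unfolded section_algebra_simps]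
  fix l assume l: "l \<in> carrier \<Lambda>"
  note cl = section_ops_closed[unfolded section_algebra_simps]
  show "\<beta> l \<in> alg_hom \<Gamma>A \<Gamma>A"
    unfolding alg_hom_def section_algebra_simps
  proof (intro CollectI conjI ballI allI)
    show "\<beta> l \<in> \<Gamma> \<rightarrow> \<Gamma>" using beta_closed[OF l] by blast
    fix s r c assume s: "s \<in> \<Gamma>"
    show "\<beta> l (\<lambda>x\<in>X. (x, c \<odot>\<^bsub>A\<^esub> snd (s x))) = (\<lambda>x\<in>X. (x, c \<odot>\<^bsub>A\<^esub> snd (\<beta> l s x)))"
      unfolding beta_eq[OF l cl(3)[OF s s]] beta_eq[OF l s]
      by (rule restrict_ext) (simp add: alpha_simps[OF l] section_snd(1)[OF s])
    assume r: "r \<in> \<Gamma>"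
    show "\<beta> l (\<lambda>x\<in>X. (x, snd (s x) \<oplus>\<^bsub>A\<^esub> snd (r x))) = (\<lambda>x\<in>X. (x, snd (\<beta> l s x) \<oplus>\<^bsub>A\<^esub> snd (\<beta> l r x)))"
      "\<beta> l (\<lambda>x\<in>X. (x, snd (s x) \<otimes>\<^bsub>A\<^esub> snd (r x))) = (\<lambda>x\<in>X. (x, snd (\<beta> l s x) \<otimes>\<^bsub>A\<^esub> snd (\<beta> l r x)))"
      unfolding beta_eq[OF l cl(1)[OF s r]] beta_eq[OF l cl(2)[OF s r]] beta_eq[OF l s] beta_eq[OF l r]
      by (rule restrict_ext; simp add: alpha_simps[OF l] section_snd(1)[OF s] section_snd(1)[OF r])+
  qed
  show "\<beta> l \<in> extensional (carrier \<Gamma>A)" by (simp add: section_action_def)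
  show "continuous_map (topo \<Gamma>A) (topo \<Gamma>A) (\<beta> l)"
  \<comment> \<open>Continuity is tested on the universal family of sections. In the given charts
    the action is postcomposition with \<open>\<alpha> l\<close>, and \<open>rep_family\<close>
    carries this over to all bundle charts.\<close>
  proof (rule smooth_function_space.smooth_into[OF section_space])
    fix p assume "p \<in> chart_pairs"
    then obtain U' \<phi>' V \<psi> where p: "p = (U', \<phi>', V, \<psi>)" "bundle_chart T M A fst fib U' \<phi>'" "(V, \<psi>) \<in> atlas M" by (auto simp: chart_pairs_def)
    show "smooth_family (topo \<Gamma>A) E (real_tvs A) (chart_dom p) (\<lambda>s. chart_rep p (\<beta> l s))"
      unfolding p prod.case
    proof (rule rep_family[OF p(2,3)])
      fix s x assume *: "s \<in> topspace (topo \<Gamma>A)" "x \<in> X"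
      then show "\<beta> l s x \<in> {x} \<times> C" using section_carrier[OF beta_closed[OF l]] ts by blast
    next
      fix i assume i: "i \<in> I"
      have "(U i, \<phi> i, V, \<psi>) \<in> chart_pairs" using bundle_chart_phi[OF i] p(3) by (simp add: chart_pairs_def)
      from smooth_function_space.smooth_eval[OF section_space this]
      have ev: "smooth_family (topo \<Gamma>A) E F (\<psi> ` (U i \<inter> V)) (local_rep A (U i) (\<phi> i) V \<psi>)" by simp
      have "smooth_family (topo \<Gamma>A) E F (\<psi> ` (U i \<inter> V)) (\<lambda>s y. \<alpha> l (local_rep A (U i) (\<phi> i) V \<psi> s y))"
        by (rule smooth_family_postlin[OF lcs_E lcs_F lcs_F _ _ _ ev, where L="\<lambda>_. \<alpha> l"])
          (use continuous_map_compose[OF continuous_map_snd alpha_continuous[OF l]] in \<open>auto simp: alpha_simps[OF l] o_def\<close>)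
      then show "smooth_family (topo \<Gamma>A) E F (\<psi> ` (U i \<inter> V)) (\<lambda>s y. \<rho> i (\<beta> l s (inv_into V \<psi> y)))"
      proof (rule smooth_family_cong[OF lcs_E])
        fix s y assume s: "s \<in> topspace (topo \<Gamma>A)" and y: "y \<in> \<psi> ` (U i \<inter> V)"
        have s': "s \<in> \<Gamma>" using s ts by blast
        have x: "inv_into V \<psi> y \<in> U i" "inv_into V \<psi> y \<in> X" using inv_chart[OF p(3) y] by auto
        have "\<rho> i (s (inv_into V \<psi> y)) = \<rho> i (inv_into V \<psi> y, snd (s (inv_into V \<psi> y)))"
          using section_snd(2)[OF s' x(2)] by metis
        then show "\<alpha> l (local_rep A (U i) (\<phi> i) V \<psi> s y) = \<rho> i (\<beta> l s (inv_into V \<psi> y))"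
          unfolding local_rep_phi[OF i p(3) y s'] beta_eq[OF l s']
          using rho_alpha[OF l i x(1) section_snd(1)[OF s' x(2)]] x(2) by simp
      qed
    qed
  qed (use beta_closed[OF l] ts in auto)
next
  fix s assume s: "s \<in> carrier \<Gamma>A"
  then have s': "s \<in> \<Gamma>" by simp
  have ext: "s \<in> extensional X" using s' by (simp add: smooth_sections_def)
  show "\<beta> \<one>\<^bsub>\<Lambda>\<^esub> s = s"
    by (rule extensionalityI[OF _ ext]) (use section_snd[OF s'] in \<open>auto simp: beta_eq[OF L.one_closed s'] alpha_one\<close>)
  fix l m assume lm: "l \<in> carrier \<Lambda>" "m \<in> carrier \<Lambda>"
  show "\<beta> (l \<otimes>\<^bsub>\<Lambda>\<^esub> m) s = \<beta> l (\<beta> m s)"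
    using lm section_snd[OF s'] beta_eq[OF lm(1) beta_closed[OF lm(2) s']]
    by (auto simp: beta_eq[OF L.m_closed[OF lm] s'] beta_eq[OF lm(2) s'] fun_eq_iff alpha_mult)
qed

lemma group_action_sections: "group_action \<Lambda> \<Gamma> \<beta>"
proof -
  interpret S: dyn_sys \<Gamma>A \<Lambda> \<beta> by (rule dyn_sys.intro[OF dynamical_system_sections])
  show ?thesis
    using S.alpha_closed S.alpha_one S.alpha_mult
    by (intro group_actionI[OF L.group_axioms]) (auto simp: section_action_def)
qed

lemma beta_alg_auto: "l \<in> carrier \<Lambda> \<Longrightarrow> \<beta> l \<in> alg_auto \<Gamma>A"
proof -
  interpret S: dyn_sys \<Gamma>A \<Lambda> \<beta> by (rule dyn_sys.intro[OF dynamical_system_sections])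
  show "l \<in> carrier \<Lambda> \<Longrightarrow> \<beta> l \<in> alg_auto \<Gamma>A" by (rule S.alpha_auto)
qed

end

section \<open>Smooth bump functions\<close>

text \<open>The extra power of \<open>s\<close> makes the induction over the coefficients work,
  since \<open>pCons a p\<close> has the value \<open>a + s * poly p s\<close>.\<close>

lemma poly_times_exp_tendsto_0: "((\<lambda>s::real. s ^ k * poly p s * exp (- s)) \<longlongrightarrow> 0) at_top"
proof (induction p arbitrary: k)
  case (pCons a p)
  have "((\<lambda>s::real. a * (s ^ k / exp s) + s ^ Suc k * poly p s * exp (- s)) \<longlongrightarrow> a * 0 + 0) at_top"
    by (intro tendsto_intros tendsto_power_div_exp_0 pCons.IH)
  then show ?case by (simp add: algebra_simps exp_minus divide_inverse)
qed simp

text \<open>The functions \<open>p(1/t) exp(-1/t)\<close>, extended by zero, form a family closed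
  under differentiation; it contains every derivative of the classical flat function, which is
  \<open>flat 1\<close>.\<close>

definition flat :: "real poly \<Rightarrow> real \<Rightarrow> real" where
  "flat p t = (if t > 0 then poly p (1 / t) * exp (- (1 / t)) else 0)"

text \<open>With \<open>s = 1/t\<close> one has \<open>d/dt = - s^2 d/ds\<close>, and the derivative
  of \<open>p(s) exp(-s)\<close> in \<open>s\<close> is \<open>(p' - p)(s) exp(-s)\<close>; hence
  the factor \<open>[:0, 0, 1:]\<close> and the difference \<open>p - pderiv p\<close>. At zero the
  quotient from the right is \<open>s p(s) exp(-s)\<close>, which tends to zero.\<close>

lemma flat_deriv: "(flat p has_real_derivative flat ([:0, 0, 1:] * (p - pderiv p)) t) (at t)"
proof -
  consider "t > 0" | "t < 0" | "t = 0" by linarith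
  then show ?thesis
  proof cases
    case 1
    have d: "((\<lambda>t. poly p (1 / t) * exp (- (1 / t))) has_real_derivative flat ([:0, 0, 1:] * (p - pderiv p)) t) (at t)"
      using 1 by (auto intro!: derivative_eq_intros DERIV_chain2[OF poly_DERIV] simp: flat_def field_simps power2_eq_square)
    have ev: "\<forall>\<^sub>F u in nhds t. flat p u = poly p (1 / u) * exp (- (1 / u))"
      using eventually_nhds_in_open[of "{0<..}" t] 1 by (auto simp: flat_def elim!: eventually_mono)
    show ?thesis unfolding DERIV_cong_ev[OF refl ev refl] by (rule d)
  next
    case 2
    have ev: "\<forall>\<^sub>F u in nhds t. flat p u = 0"
      using eventually_nhds_in_open[of "{..<0}" t] 2 by (auto simp: flat_def elim!: eventually_mono)
    have "(flat p has_real_derivative 0) (at t)"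
      unfolding DERIV_cong_ev[OF refl ev refl] by simp
    then show ?thesis using 2 by (simp add: flat_def)
  next
    case 3
    have "((\<lambda>h. flat p h / h) \<longlongrightarrow> 0) (at_right 0)"
    proof -
      have "filterlim (\<lambda>h::real. inverse h) at_top (at_right 0)" by (rule filterlim_inverse_at_top_right)
      from filterlim_compose[OF poly_times_exp_tendsto_0[of 1 p] this]
      have "((\<lambda>h::real. inverse h ^ 1 * poly p (inverse h) * exp (- inverse h)) \<longlongrightarrow> 0) (at_right 0)" .
      moreover have "\<forall>\<^sub>F h in at_right 0. inverse h ^ 1 * poly p (inverse h) * exp (- inverse h) = flat p h / h"
        by (auto simp: eventually_at_filter flat_def divide_inverse intro!: always_eventually)
      ultimately show ?thesis by (rule Lim_transform_eventually)
    qed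
    moreover have "((\<lambda>h. flat p h / h) \<longlongrightarrow> 0) (at_left 0)"
      by (rule tendsto_eventually) (auto simp: eventually_at_filter flat_def intro!: always_eventually)
    ultimately have "((\<lambda>h. flat p h / h) \<longlongrightarrow> 0) (at 0)" by (simp add: filterlim_at_split)
    then show ?thesis using 3 by (simp add: DERIV_def flat_def[of _ 0])
  qed
qed

text \<open>Of \<open>t\<close> and \<open>1 - t\<close> at least one is positive; hence the
  denominator never vanishes.\<close>

definition smooth_step :: "real \<Rightarrow> real" where
  "smooth_step t = flat 1 t * inverse (flat 1 t + flat 1 (1 - t))"

lemma flat_sum_pos: "flat 1 t + flat 1 (1 - t) > 0"
  by (cases "t > 0") (auto simp: flat_def intro!: add_pos_nonneg)

lemma smooth_step_props: "0 \<le> smooth_step t" "smooth_step t \<le> 1" "t \<le> 0 \<Longrightarrow> smooth_step t = 0" "t \<ge> 1 \<Longrightarrow> smooth_step t = 1"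
proof -
  have nn: "0 \<le> flat 1 t" for t by (simp add: flat_def)
  show "0 \<le> smooth_step t" using nn[of t] flat_sum_pos[of t] by (simp add: smooth_step_def)
  show "smooth_step t \<le> 1"
    using nn[of "1 - t"] flat_sum_pos[of t] by (simp add: smooth_step_def divide_inverse[symmetric] divide_le_eq)
  show "t \<le> 0 \<Longrightarrow> smooth_step t = 0" by (simp add: smooth_step_def flat_def)
  show "t \<ge> 1 \<Longrightarrow> smooth_step t = 1" by (simp add: smooth_step_def flat_def)
qed

abbreviation Re1 :: "(real, real) tvs" where "Re1 \<equiv> scalars"

lemma smooth_family_real_const: "lcs E \<Longrightarrow> openin (topo E) U \<Longrightarrow> smooth_family S E Re1 U (\<lambda>s x. c)"
  by (rule smooth_family_const[OF _ lcs_scalars]) auto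

lemma smooth_family_real_add:
  "lcs E \<Longrightarrow> smooth_family S E Re1 U f \<Longrightarrow> smooth_family S E Re1 U h \<Longrightarrow> smooth_family S E Re1 U (\<lambda>s x. f s x + h s x)"
  using smooth_family_add[OF _ lcs_scalars, of E S U f h] by simp

lemma smooth_family_real_mult:
  "lcs E \<Longrightarrow> smooth_family S E Re1 U f \<Longrightarrow> smooth_family S E Re1 U h \<Longrightarrow> smooth_family S E Re1 U (\<lambda>s x. f s x * h s x)"
  using Ck_real_mult[of E U S _ 0 "\<lambda>s x v. f s x" "\<lambda>s x v. h s x"] by (simp add: smooth_family_def)

lemma smooth_family_real_prod:
  assumes "lcs E" "openin (topo E) U" "finite K" "\<And>k. k \<in> K \<Longrightarrow> smooth_family S E Re1 U (f k)"
  shows "smooth_family S E Re1 U (\<lambda>s x. \<Prod>k\<in>K. f k s x)"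
  using assms(3,4)
proof (induction K rule: finite_induct)
  case empty
  then show ?case using smooth_family_real_const[OF assms(1,2), of S 1] by simp
next
  case (insert k K)
  then show ?case using smooth_family_real_mult[OF assms(1), of S U "f k" "\<lambda>s x. \<Prod>k\<in>K. f k s x"] by simp
qed

lemma smooth_family_real_inverse:
  assumes "lcs E" "smooth_family S E Re1 U f" "\<And>s x. s \<in> topspace S \<Longrightarrow> x \<in> U \<Longrightarrow> f s x > 0"
  shows "smooth_family S E Re1 U (\<lambda>s x. inverse (f s x))"
proof -
  \<comment> \<open>The explicit \<open>j\<close>-th derivative of \<open>inverse\<close>.\<close>
  define d where "d j t = (- 1) ^ j * fact j * inverse t ^ Suc j" for j :: nat and t :: real
  have "(d j has_real_derivative d (Suc j) t) (at t)" if "t \<in> {0<..}" for j t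
  proof -
    have "((\<lambda>t. inverse t ^ Suc j) has_real_derivative of_nat (Suc j) * (- (inverse t ^ Suc (Suc 0)) * inverse t ^ (Suc j - Suc 0))) (at t)"
      using that by (intro DERIV_power DERIV_inverse) simp
    from DERIV_cmult[OF this, of "(- 1) ^ j * fact j"] show ?thesis
      by (simp add: d_def[abs_def] algebra_simps)
  qed
  from smooth_family_real_comp[where d=d and D="{0<..}", OF assms(1) this assms(2)] assms(3) show ?thesis by (simp add: d_def)
qed

lemma smooth_family_flat:
  assumes "lcs E" "smooth_family S E Re1 U f"
  shows "smooth_family S E Re1 U (\<lambda>s x. flat 1 (f s x))"
proof -
  \<comment> \<open>Iterating the rule of \<open>flat_deriv\<close> lists the polynomials belonging
    to all derivatives of \<open>flat 1\<close>.\<close>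
  define p where "p j = ((\<lambda>p. [:0, 0, 1:] * (p - pderiv p)) ^^ j) (1 :: real poly)" for j
  have "(flat (p j) has_real_derivative flat (p (Suc j)) t) (at t)" for j t
    using flat_deriv[of "p j" t] by (simp add: p_def)
  from smooth_family_real_comp[where D=UNIV and d="\<lambda>j. flat (p j)", OF assms(1) this assms(2)] show ?thesis by (simp add: p_def)
qed

lemma smooth_family_step:
  assumes E: "lcs E" and f: "smooth_family S E Re1 U f"
  shows "smooth_family S E Re1 U (\<lambda>s x. smooth_step (f s x))"
proof -
  have "smooth_family S E Re1 U (\<lambda>s x. 1 + (- 1) * f s x)"
    by (intro smooth_family_real_add smooth_family_real_mult smooth_family_real_const E f smooth_family_open[OF f])
  then have "smooth_family S E Re1 U (\<lambda>s x. 1 - f s x)" by simp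
  then show ?thesis unfolding smooth_step_def
    by (intro smooth_family_real_mult E smooth_family_flat f smooth_family_real_inverse smooth_family_real_add flat_sum_pos)
qed

lemma (in lca) smooth_family_real_smult:
  assumes E: "lcs E" and f: "smooth_family S E Re1 U f" and h: "smooth_family S E (real_tvs A) U h"
  shows "smooth_family S E (real_tvs A) U (\<lambda>s x. complex_of_real (f s x) \<odot> h s x)"
proof (rule smooth_family_bilinear[OF E lcs_scalars real_lcs real_lcs _ _ _ _ _ f h])
  show "continuous_map (prod_topology (topo Re1) (topo (real_tvs A))) (topo (real_tvs A)) (\<lambda>z. complex_of_real (fst z) \<odot> snd z)"
    unfolding real_tvs_simps scalars_simps
    by (intro cont_smult continuous_map_snd continuous_map_real_fun[OF continuous_map_fst] continuous_intros)
qed (auto simp: smult_ldistr smult_rdistr smult_assoc[symmetric] mult.commute)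

section \<open>Smooth real functions on the base and cut-off functions\<close>

context bundle_data begin

definition smooth_real :: "('m \<Rightarrow> real) \<Rightarrow> bool" where
  "smooth_real f \<longleftrightarrow> (\<forall>(V, \<psi>)\<in>atlas M. smooth_family pt E Re1 (\<psi> ` V) (\<lambda>_ y. f (inv_into V \<psi> y)))"

lemma smooth_realI:
  assumes "\<And>V \<psi> x. (V, \<psi>) \<in> atlas M \<Longrightarrow> x \<in> V \<Longrightarrow> \<exists>N. openin (mtopo M) N \<and> x \<in> N \<and> N \<subseteq> V \<and>
      smooth_family pt E Re1 (\<psi> ` N) (\<lambda>_ y. f (inv_into V \<psi> y))"
  shows "smooth_real f"
  unfolding smooth_real_def
proof clarify
  fix V \<psi> assume V: "(V, \<psi>) \<in> atlas M"
  show "smooth_family pt E Re1 (\<psi> ` V) (\<lambda>_ y. f (inv_into V \<psi> y))"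
  proof (rule smooth_family_local[OF lcs_E lcs_scalars chart(2)[OF V]])
    fix y assume "y \<in> \<psi> ` V"
    then obtain x where x: "y = \<psi> x" "x \<in> V" by blast
    from assms[OF V x(2)] obtain N where "x \<in> N" "N \<subseteq> V" "smooth_family pt E Re1 (\<psi> ` N) (\<lambda>_ y. f (inv_into V \<psi> y))" by blast
    then show "\<exists>W. y \<in> W \<and> W \<subseteq> \<psi> ` V \<and> smooth_family pt E Re1 W (\<lambda>_ y. f (inv_into V \<psi> y))"
      using x by (intro exI[of _ "\<psi> ` N"]) auto
  qed
qed

lemma smooth_realD: "smooth_real f \<Longrightarrow> (V, \<psi>) \<in> atlas M \<Longrightarrow> smooth_family pt E Re1 (\<psi> ` V) (\<lambda>_ y. f (inv_into V \<psi> y))"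
  unfolding smooth_real_def by blast

lemma smooth_real_subset:
  assumes "smooth_real f" "(V, \<psi>) \<in> atlas M" "openin (mtopo M) N" "N \<subseteq> V"
  shows "smooth_family pt E Re1 (\<psi> ` N) (\<lambda>_ y. f (inv_into V \<psi> y))"
  by (rule smooth_family_subset[OF lcs_E lcs_scalars smooth_realD[OF assms(1,2)] chart(8)[OF assms(2-4)]]) (use assms in auto)

lemma smooth_real_ops:
  shows smooth_real_const: "smooth_real (\<lambda>_. c)"
    and smooth_real_add: "smooth_real f \<Longrightarrow> smooth_real h \<Longrightarrow> smooth_real (\<lambda>x. f x + h x)"
    and smooth_real_mult: "smooth_real f \<Longrightarrow> smooth_real h \<Longrightarrow> smooth_real (\<lambda>x. f x * h x)"
  using smooth_family_real_const[OF lcs_E chart(2)] smooth_family_real_add[OF lcs_E] smooth_family_real_mult[OF lcs_E]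
  unfolding smooth_real_def by blast+

lemma smooth_real_prod: "finite K \<Longrightarrow> (\<And>k. k \<in> K \<Longrightarrow> smooth_real (f k)) \<Longrightarrow> smooth_real (\<lambda>x. \<Prod>k\<in>K. f k x)"
  by (induction K rule: finite_induct) (auto intro: smooth_real_const smooth_real_mult)

lemma smooth_real_sum: "finite K \<Longrightarrow> (\<And>k. k \<in> K \<Longrightarrow> smooth_real (f k)) \<Longrightarrow> smooth_real (\<lambda>x. \<Sum>k\<in>K. f k x)"
  by (induction K rule: finite_induct) (auto intro: smooth_real_const smooth_real_add)

lemma smooth_real_inverse:
  assumes "smooth_real f" "\<And>x. x \<in> X \<Longrightarrow> f x > 0"
  shows "smooth_real (\<lambda>x. inverse (f x))"
  unfolding smooth_real_def
proof clarify
  fix V \<psi> assume V: "(V, \<psi>) \<in> atlas M"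
  show "smooth_family pt E Re1 (\<psi> ` V) (\<lambda>_ y. inverse (f (inv_into V \<psi> y)))"
    by (rule smooth_family_real_inverse[OF lcs_E smooth_realD[OF assms(1) V]]) (rule assms(2)[OF inv_chart(2)[OF V _ order_refl]])
qed

lemma smooth_real_local:
  assumes "\<And>x. x \<in> X \<Longrightarrow> \<exists>N f'. openin (mtopo M) N \<and> x \<in> N \<and> smooth_real f' \<and> (\<forall>y\<in>N. f y = f' y)"
  shows "smooth_real f"
proof (rule smooth_realI)
  fix V \<psi> x assume V: "(V, \<psi>) \<in> atlas M" and x: "x \<in> V"
  obtain N f' where N: "openin (mtopo M) N" "x \<in> N" "smooth_real f'" "\<forall>y\<in>N. f y = f' y"
    using assms[of x] chart(4)[OF V] x by blast
  have o: "openin (mtopo M) (N \<inter> V)" using N(1) chart(1)[OF V] by auto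
  have "smooth_family pt E Re1 (\<psi> ` (N \<inter> V)) (\<lambda>_ y. f (inv_into V \<psi> y))"
    by (rule smooth_family_cong[OF lcs_E smooth_real_subset[OF N(3) V o]]) (use N(4) inv_chart(1)[OF V, of _ "N \<inter> V"] in auto)
  then show "\<exists>N. openin (mtopo M) N \<and> x \<in> N \<and> N \<subseteq> V \<and> smooth_family pt E Re1 (\<psi> ` N) (\<lambda>_ y. f (inv_into V \<psi> y))"
    using o N(2) x by blast
qed

definition box :: "(nat \<Rightarrow> real) \<Rightarrow> real \<Rightarrow> (nat \<Rightarrow> real) set" where
  "box c r = {y \<in> carrier E. \<forall>l<n. \<bar>y l - c l\<bar> \<le> r}"

lemma E_simps: "carrier E = {x. \<forall>i\<ge>n. x i = 0}" "topo E = Euclidean_space n"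
  "x \<oplus>\<^bsub>E\<^esub> y = (\<lambda>i. x i + y i)" "t \<odot>\<^bsub>E\<^esub> x = (\<lambda>i. t * x i)"
  by (simp_all add: Rn_def)

lemma continuous_coord: "continuous_map (topo E) euclideanreal (\<lambda>y. y l)"
  unfolding E_simps Euclidean_space_def
  by (intro continuous_map_from_subtopology continuous_map_product_projection) simp

text \<open>Inside the space of all sequences the box is a product of compact intervals and, from
  index \<open>n\<close> on, of the singleton of zero, so it is compact by Tychonoff's
  theorem.\<close>

lemma compact_box: "c \<in> carrier E \<Longrightarrow> compactin (topo E) (box c r)"
proof -
  assume c: "c \<in> carrier E"
  have "box c r = (\<Pi>\<^sub>E l\<in>UNIV. if l < n then {c l - r..c l + r} else {0})"
  proof (rule Set.set_eqI)
    fix y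
    have "y l \<in> (if l < n then {c l - r..c l + r} else {0}) \<longleftrightarrow> (l < n \<longrightarrow> \<bar>y l - c l\<bar> \<le> r) \<and> (l \<ge> n \<longrightarrow> y l = 0)" for l
      by (simp add: abs_le_iff) linarith
    then show "y \<in> box c r \<longleftrightarrow> y \<in> (\<Pi>\<^sub>E l\<in>UNIV. if l < n then {c l - r..c l + r} else {0})"
      unfolding box_def E_simps PiE_UNIV_domain Pi_def by blast
  qed
  moreover have "compactin (powertop_real UNIV) (\<Pi>\<^sub>E l\<in>UNIV. if l < n then {c l - r..c l + r} else {0})"
    unfolding compactin_PiE by auto
  ultimately show ?thesis
    unfolding E_simps Euclidean_space_def compactin_subtopology by (auto simp: box_def E_simps)
qed

text \<open>Boxes play the role of balls: in the product topology a basic open set restricts each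
  coordinate separately.\<close>

lemma box_nbhd:
  assumes D: "openin (topo E) D" "c \<in> D"
  shows "\<exists>r>0. box c r \<subseteq> D"
proof -
  obtain O' where O': "openin (powertop_real UNIV) O'" "D = O' \<inter> {x. \<forall>i\<ge>n. x i = 0}"
    using D(1) unfolding E_simps Euclidean_space_def openin_subtopology by blast
  have "c \<in> O'" using O' D(2) by auto
  from product_topology_open_contains_basis[OF O'(1) this]
  have "\<exists>W. c \<in> (\<Pi>\<^sub>E l\<in>UNIV. W l) \<and> (\<forall>l. open (W l)) \<and> (\<Pi>\<^sub>E l\<in>UNIV. W l) \<subseteq> O'" by auto
  then obtain W where W: "\<forall>l. open (W l)" "c \<in> (\<Pi>\<^sub>E l\<in>UNIV. W l)" "(\<Pi>\<^sub>E l\<in>UNIV. W l) \<subseteq> O'" by (elim exE conjE)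
  have "\<exists>r>0. \<forall>t. \<bar>t - c l\<bar> \<le> r \<longrightarrow> t \<in> W l" for l
  proof -
    obtain e where "e > 0" "cball (c l) e \<subseteq> W l" using W(1,2) open_contains_cball[of "W l"] by (metis PiE_mem UNIV_I)
    then show ?thesis by (intro exI[of _ e]) (auto simp: dist_real_def subset_iff abs_minus_commute)
  qed
  then obtain r where r: "\<And>l. r l > 0" "\<And>l t. \<bar>t - c l\<bar> \<le> r l \<Longrightarrow> t \<in> W l" by metis
  \<comment> \<open>Only the first \<open>n\<close> coordinates are free, so a minimum of finitely
    many radii suffices; the inserted \<open>1\<close> covers the case \<open>n = 0\<close>.\<close>
  define r0 where "r0 = Min (insert 1 (r ` {..<n}))"
  have r0: "r0 > 0" "\<And>l. l < n \<Longrightarrow> r0 \<le> r l" using r(1) by (auto simp: r0_def)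
  have c0: "c l = 0" if "l \<ge> n" for l using D(2) O'(2) that by auto
  have "box c r0 \<subseteq> D"
  proof
    fix y assume y: "y \<in> box c r0"
    have "y l \<in> W l" for l
    proof (cases "l < n")
      case True
      then show ?thesis using y r0(2)[OF True] by (intro r(2)) (auto simp: box_def)
    next
      case False
      then have "y l = c l" using y c0[of l] by (simp add: box_def E_simps)
      then show ?thesis using W(2) by (auto simp: PiE_iff)
    qed
    then show "y \<in> D" using W(3) y O'(2) by (auto simp: box_def E_simps)
  qed
  then show ?thesis using r0 by blast
qed

text \<open>The argument of the step is at least one for coordinate distance at most
  \<open>r\<close> and at most zero from distance \<open>sqrt 2 * r\<close> on, in particular beyond
  \<open>2 * r\<close>. The square avoids the kink of an absolute value.\<close>

definition bump :: "'m set \<Rightarrow> ('m \<Rightarrow> nat \<Rightarrow> real) \<Rightarrow> (nat \<Rightarrow> real) \<Rightarrow> real \<Rightarrow> 'm \<Rightarrow> real" where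
  "bump V \<psi> c r x = (if x \<in> V then \<Prod>l<n. smooth_step (2 - ((\<psi> x l - c l) / r)\<^sup>2) else 0)"

lemma bump_range: "0 \<le> bump V \<psi> c r x" "bump V \<psi> c r x \<le> 1"
  unfolding bump_def using smooth_step_props(1,2) by (auto intro!: prod_nonneg prod_le_1)

lemma bump_one:
  assumes "r > 0" "x \<in> V" "\<And>l. l < n \<Longrightarrow> \<bar>\<psi> x l - c l\<bar> \<le> r"
  shows "bump V \<psi> c r x = 1"
proof -
  have "((\<psi> x l - c l) / r)\<^sup>2 \<le> 1" if "l < n" for l
    using assms(1) assms(3)[OF that] by (simp add: abs_square_le_1)
  then show ?thesis using assms(2) smooth_step_props(4) by (auto simp: bump_def intro!: prod.neutral)
qed

lemma bump_zero:
  assumes "r > 0" "\<psi> ` V \<subseteq> carrier E" "x \<notin> V \<or> \<psi> x \<notin> box c (2 * r)"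
  shows "bump V \<psi> c r x = 0"
proof (cases "x \<in> V")
  case True
  then obtain l where l: "l < n" "\<bar>\<psi> x l - c l\<bar> > 2 * r" using assms(2,3) by (auto simp: box_def not_le)
  have "\<bar>(\<psi> x l - c l) / r\<bar> > 2" using l assms(1) by (simp add: less_divide_eq)
  then have "2\<^sup>2 < ((\<psi> x l - c l) / r)\<^sup>2" by (metis abs_numeral abs_square_less_1 power2_abs power_strict_mono zero_less_numeral abs_ge_zero less_le pos2)
  then have "smooth_step (2 - ((\<psi> x l - c l) / r)\<^sup>2) = 0" by (intro smooth_step_props) simp
  then show ?thesis using True l by (auto simp: bump_def)
qed (simp add: bump_def)

text \<open>The box is compact, so its preimage under the chart is compact in the Hausdorff space
  \<open>M\<close> and therefore closed there, not only in \<open>V\<close>. This is what makes the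
  extension by zero smooth at boundary points of \<open>V\<close>.\<close>

lemma bump_support_closed:
  assumes V: "(V, \<psi>) \<in> atlas M" and c: "c \<in> carrier E" and b: "box c r \<subseteq> \<psi> ` V"
  shows "closedin (mtopo M) (V \<inter> \<psi> -` box c r)"
proof -
  have "compactin (subtopology (topo E) (\<psi> ` V)) (box c r)"
    using compact_box[OF c] b by (simp add: compactin_subtopology)
  from image_compactin[OF this chart(7)[OF V]] have "compactin (mtopo M) (inv_into V \<psi> ` box c r)" .
  moreover have "inv_into V \<psi> ` box c r = V \<inter> \<psi> -` box c r"
  proof (intro equalityI subsetI)
    fix x assume "x \<in> inv_into V \<psi> ` box c r"
    then show "x \<in> V \<inter> \<psi> -` box c r" using b inv_into_into[of _ \<psi> V] f_inv_into_f[of _ \<psi> V] by auto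
  next
    fix x assume "x \<in> V \<inter> \<psi> -` box c r"
    then show "x \<in> inv_into V \<psi> ` box c r" using chart(5)[OF V] by (intro image_eqI[of _ _ "\<psi> x"]) auto
  qed
  ultimately have "compactin (mtopo M) (V \<inter> \<psi> -` box c r)" by simp
  moreover have "Hausdorff_space (mtopo M)" using sm_M by (simp add: smooth_manifold_def)
  ultimately show ?thesis using compactin_imp_closedin by blast
qed

lemma bump_smooth:
  assumes V: "(V, \<psi>) \<in> atlas M" and c: "c \<in> carrier E" and r: "r > 0" and b: "box c (2 * r) \<subseteq> \<psi> ` V"
  shows "smooth_real (bump V \<psi> c r)"
proof (rule smooth_realI)
  fix V' \<psi>' x assume V': "(V', \<psi>') \<in> atlas M" and x: "x \<in> V'"
  have pV: "\<psi> ` V \<subseteq> carrier E" using openin_subset[OF chart(2)[OF V]] carrier_E by simp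
  show "\<exists>N. openin (mtopo M) N \<and> x \<in> N \<and> N \<subseteq> V' \<and> smooth_family pt E Re1 (\<psi>' ` N) (\<lambda>_ y. bump V \<psi> c r (inv_into V' \<psi>' y))"
  proof (cases "x \<in> V")
    case True
    let ?N = "V' \<inter> V"
    have oN: "openin (mtopo M) ?N" using chart(1)[OF V] chart(1)[OF V'] by auto
    have oD: "openin (topo E) (\<psi>' ` ?N)" by (rule chart(8)[OF V' oN]) auto
    have co: "smooth_family pt E Re1 (\<psi>' ` ?N) (\<lambda>_ y. (\<psi> \<circ> inv_into V' \<psi>') y l)" for l
      by (rule smooth_family_postlin[OF lcs_E lcs_E lcs_scalars _ _ _ chart_trans[OF V' V, unfolded smooth_on_iff_family[OF lcs_E lcs_E]], where L="\<lambda>_ y. y l"])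
        (use continuous_map_compose[OF continuous_map_snd continuous_coord] in \<open>auto simp: o_def E_simps(3,4)\<close>)
    \<comment> \<open>Difference, quotient and square are unfolded into sums and products so that
      the rules for real families match.\<close>
    have "smooth_family pt E Re1 (\<psi>' ` ?N) (\<lambda>_ y. \<Prod>l<n. smooth_step (2 + (- 1) * ((((\<psi> \<circ> inv_into V' \<psi>') y l + (- c l)) * inverse r) * (((\<psi> \<circ> inv_into V' \<psi>') y l + (- c l)) * inverse r))))"
      by (intro smooth_family_real_prod lcs_E oD finite_lessThan smooth_family_step smooth_family_real_add smooth_family_real_mult smooth_family_real_const co)
    then have "smooth_family pt E Re1 (\<psi>' ` ?N) (\<lambda>_ y. bump V \<psi> c r (inv_into V' \<psi>' y))"
      by (rule smooth_family_cong[OF lcs_E]) (use inv_chart(1)[OF V', of _ ?N] in \<open>auto simp: bump_def power2_eq_square divide_inverse\<close>)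
    then show ?thesis using oN True x by blast
  next
    case False
    \<comment> \<open>A point outside \<open>V\<close> lies in the complement of the closed support,
      an open set on which the bump vanishes.\<close>
    let ?K = "V \<inter> \<psi> -` box c (2 * r)"
    let ?N = "V' - ?K"
    have oN: "openin (mtopo M) ?N" using openin_diff[OF chart(1)[OF V'] bump_support_closed[OF V c b]] .
    have oD: "openin (topo E) (\<psi>' ` ?N)" by (rule chart(8)[OF V' oN]) auto
    have "smooth_family pt E Re1 (\<psi>' ` ?N) (\<lambda>_ y. bump V \<psi> c r (inv_into V' \<psi>' y))"
    proof (rule smooth_family_cong[OF lcs_E smooth_family_real_const[OF lcs_E oD, of _ 0]])
      fix y assume "y \<in> \<psi>' ` ?N"
      then have "inv_into V' \<psi>' y \<in> ?N" using inv_chart(1)[OF V', of y ?N] by auto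
      then show "0 = bump V \<psi> c r (inv_into V' \<psi>' y)" using bump_zero[OF r pV, of "inv_into V' \<psi>' y" c] by auto
    qed
    then show ?thesis using oN False x by blast
  qed
qed

text \<open>The multiple of the unit section by \<open>e\<close> will be the localizing element,
  while \<open>p\<close> extends sections of the chart over \<open>U i\<close> by zero. The
  condition \<open>p x * e x = e x\<close> says that \<open>p\<close> is one wherever
  \<open>e\<close> is not zero; the closed set \<open>K\<close> keeps the extension smooth.\<close>

definition cutoff where
  "cutoff i e p \<longleftrightarrow> i \<in> I \<and> smooth_real e \<and> smooth_real p \<and> (\<forall>x. 0 \<le> e x \<and> e x \<le> 1) \<and> (\<forall>x. p x * e x = e x) \<and>
     (\<exists>K. closedin (mtopo M) K \<and> K \<subseteq> U i \<and> (\<forall>x\<in>X - K. p x = 0))"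

lemma cutoff_exists:
  assumes x: "x \<in> X"
  shows "\<exists>i e p N. cutoff i e p \<and> openin (mtopo M) N \<and> x \<in> N \<and> (\<forall>y\<in>N. e y = 1)"
proof -
  have i: "idx x \<in> I" "x \<in> U (idx x)" using idx[OF x] by auto
  obtain V \<psi> where V: "(V, \<psi>) \<in> atlas M" "x \<in> V" using chart_ex[OF x] by blast
  let ?D = "\<psi> ` (U (idx x) \<inter> V)"
  have oD: "openin (topo E) ?D" by (rule chart(8)[OF V(1)]) (use U_open[OF i(1)] chart(1)[OF V(1)] in auto)
  have pV: "\<psi> ` V \<subseteq> carrier E" using openin_subset[OF chart(2)[OF V(1)]] carrier_E by simp
  define c where "c = \<psi> x"
  have c: "c \<in> carrier E" "c \<in> ?D" using pV V i by (auto simp: c_def)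
  obtain R where R: "R > 0" "box c R \<subseteq> ?D" using box_nbhd[OF oD c(2)] by blast
  \<comment> \<open>The bump \<open>e\<close> of radius \<open>r\<close> vanishes off the box of
    size \<open>2 * r\<close>, where the bump \<open>p\<close> of radius \<open>2 * r\<close> is
    one; \<open>p\<close> in turn vanishes off the box of size \<open>4 * r = R\<close>, which lies
    in the image of \<open>U (idx x) \<inter> V\<close>.\<close>
  define r where "r = R / 4"
  have r: "r > 0" "4 * r = R" using R by (auto simp: r_def)
  have b2: "box c (2 * r) \<subseteq> \<psi> ` V" "box c (2 * (2 * r)) \<subseteq> \<psi> ` V"
    using R(2) r by (auto simp: box_def) (smt (verit) IntD2 imageE image_eqI mem_Collect_eq subset_iff)+
  let ?e = "bump V \<psi> c r" and ?p = "bump V \<psi> c (2 * r)"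
  have pe: "?p y * ?e y = ?e y" for y
  proof (cases "y \<in> V \<and> \<psi> y \<in> box c (2 * r)")
    case True
    then have "?p y = 1" using r by (intro bump_one) (auto simp: box_def)
    then show ?thesis by simp
  next
    case False
    then show ?thesis using bump_zero[OF r(1) pV, of y c] by auto
  qed
  let ?K = "V \<inter> \<psi> -` box c (2 * (2 * r))"
  have "?K \<subseteq> U (idx x)"
  proof
    fix y assume y: "y \<in> ?K"
    then have "\<psi> y \<in> ?D" using R(2) r by (auto simp: subset_iff)
    then show "y \<in> U (idx x)" using inj_on_image_mem_iff[OF chart(5)[OF V(1)], of y "U (idx x) \<inter> V"] y by auto
  qed
  moreover have "\<forall>y\<in>X - ?K. ?p y = 0" using bump_zero[of "2 * r" \<psi> V _ c] r pV by auto
  ultimately have "cutoff (idx x) ?e ?p"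
    unfolding cutoff_def using i bump_range pe bump_smooth[OF V(1) c(1) r(1) b2(1)] bump_smooth[OF V(1) c(1) _ b2(2)] r
      bump_support_closed[OF V(1) c(1) b2(2)] by (intro conjI exI[of _ ?K]) auto
  moreover have "\<exists>N. openin (mtopo M) N \<and> x \<in> N \<and> (\<forall>y\<in>N. ?e y = 1)"
  proof -
    let ?W = "\<lambda>l. {y \<in> topspace (subtopology (mtopo M) V). \<psi> y l \<in> {c l - r<..<c l + r}}"
    have "openin (subtopology (mtopo M) V) (?W l)" for l
      using continuous_map_compose[OF chart(6)[OF V(1)] continuous_coord[of l]]
      by (intro openin_continuous_map_preimage[of _ euclideanreal]) (auto simp: o_def)
    then have oW: "openin (mtopo M) (?W l)" for l using chart(1)[OF V(1)] by (simp add: openin_open_subtopology)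
    have "openin (mtopo M) (V \<inter> (\<Inter>l\<in>{..<n}. ?W l))"
    \<comment> \<open>For \<open>n = 0\<close> the intersection runs over the empty family, hence is
      the whole type rather than an open set of \<open>M\<close>.\<close>
    proof (cases "n = 0")
      case True
      then show ?thesis using chart(1)[OF V(1)] by simp
    next
      case False
      then have "openin (mtopo M) (\<Inter>l\<in>{..<n}. ?W l)" using oW by (intro openin_Inter) auto
      then show ?thesis using chart(1)[OF V(1)] by auto
    qed
    moreover have "x \<in> V \<inter> (\<Inter>l\<in>{..<n}. ?W l)" using V x r by (auto simp: c_def)
    moreover have "?e y = 1" if "y \<in> V \<inter> (\<Inter>l\<in>{..<n}. ?W l)" for y
    proof (rule bump_one[OF r(1)])
      show "y \<in> V" using that by blast
      fix l assume "l < n"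
      then have "\<psi> y l \<in> {c l - r<..<c l + r}" using that by blast
      then show "\<bar>\<psi> y l - c l\<bar> \<le> r" by (simp add: abs_le_iff)
    qed
    ultimately show ?thesis by blast
  qed
  ultimately show ?thesis by blast
qed

text \<open>A second countable space is Lindelof, so countably many of the neighbourhoods cover.
  \<open>from_nat_into\<close> enumerates the countable index set, with repetitions if it is finite;
  for this it must be nonempty.\<close>

lemma cutoff_sequence:
  assumes "X \<noteq> {}"
  shows "\<exists>i e p. (\<forall>k::nat. cutoff (i k) (e k) (p k)) \<and> (\<forall>x\<in>X. \<exists>k N. openin (mtopo M) N \<and> x \<in> N \<and> (\<forall>y\<in>N. e k y = 1))"
proof -
  obtain i e p N where *: "\<And>x. x \<in> X \<Longrightarrow> cutoff (i x) (e x) (p x) \<and> openin (mtopo M) (N x) \<and> x \<in> N x \<and> (\<forall>y\<in>N x. e x y = 1)"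
    using cutoff_exists by metis
  have "Lindelof_space (mtopo M)" using M by (simp add: findim_manifold_def second_countable_imp_Lindelof_space)
  moreover have "\<forall>W\<in>N ` X. openin (mtopo M) W" "\<Union>(N ` X) = X" using * openin_subset by blast+
  ultimately obtain \<V> where V: "countable \<V>" "\<V> \<subseteq> N ` X" "\<Union>\<V> = X"
    unfolding Lindelof_space_def by meson
  obtain Y where Y: "countable Y" "Y \<subseteq> X" "\<V> = N ` Y" using V(1,2) countable_subset_image[of \<V> N X] by auto
  have ne: "Y \<noteq> {}" using V(3) Y(3) assms by blast
  let ?y = "from_nat_into Y"
  have y: "?y k \<in> X" for k using from_nat_into[OF ne] Y by blast
  have "\<exists>k N. openin (mtopo M) N \<and> x \<in> N \<and> (\<forall>y\<in>N. e (?y k) y = 1)" if x: "x \<in> X" for x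
  proof -
    obtain w where w: "w \<in> Y" "x \<in> N w" using x V(3) Y by auto
    obtain k where "?y k = w" using w(1) Y(1) from_nat_into_surj by metis
    then show ?thesis using *[of w] w Y(2) by blast
  qed
  then show ?thesis using *[OF y] by (intro exI[of _ "\<lambda>k. i (?y k)"] exI[of _ "\<lambda>k. e (?y k)"] exI[of _ "\<lambda>k. p (?y k)"]) blast
qed

end

section \<open>Characters of the fixed centre\<close>

context bundle_data begin

definition unit_section :: "('m \<Rightarrow> real) \<Rightarrow> 'm \<Rightarrow> 'm \<times> 'a" where
  "unit_section f = (\<lambda>x\<in>X. (x, complex_of_real (f x) \<odot>\<^bsub>A\<^esub> \<one>\<^bsub>A\<^esub>))"

lemma unit_section_cong: "(\<And>x. x \<in> X \<Longrightarrow> f x = h x) \<Longrightarrow> unit_section f = unit_section h"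
  unfolding unit_section_def by (rule restrict_ext) simp

lemma unit_section_closed:
  assumes f: "smooth_real f"
  shows "unit_section f \<in> \<Gamma>"
  unfolding unit_section_def
proof (rule section_of_local)
  fix i V \<psi> assume *: "i \<in> I" "(V, \<psi>) \<in> atlas M"
  have o: "openin (mtopo M) (U i \<inter> V)" using U_open[OF *(1)] chart(1)[OF *(2)] by auto
  have oD: "openin (topo E) (\<psi> ` (U i \<inter> V))" by (rule chart(8)[OF *(2) o]) auto
  have "smooth_family pt E F (\<psi> ` (U i \<inter> V)) (\<lambda>_ y. complex_of_real (f (inv_into V \<psi> y)) \<odot>\<^bsub>A\<^esub> \<one>\<^bsub>A\<^esub>)"
    by (intro A.smooth_family_real_smult lcs_E smooth_real_subset[OF f *(2) o] smooth_family_const[OF lcs_E lcs_F oD]) auto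
  then have "smooth_on E F (\<psi> ` (U i \<inter> V)) (\<lambda>y. complex_of_real (f (inv_into V \<psi> y)) \<odot>\<^bsub>A\<^esub> \<one>\<^bsub>A\<^esub>)"
    unfolding smooth_on_iff_family[OF lcs_E lcs_F] .
  then show "smooth_on E F (\<psi> ` (U i \<inter> V)) (\<lambda>y. \<rho> i (inv_into V \<psi> y, complex_of_real (f (inv_into V \<psi> y)) \<odot>\<^bsub>A\<^esub> \<one>\<^bsub>A\<^esub>))"
  proof (rule smooth_on_cong[OF lcs_E lcs_F _ refl])
    fix y assume "y \<in> \<psi> ` (U i \<inter> V)"
    then have "inv_into V \<psi> y \<in> U i" using inv_chart(1)[OF *(2), of y "U i \<inter> V"] by auto
    then show "\<rho> i (inv_into V \<psi> y, complex_of_real (f (inv_into V \<psi> y)) \<odot>\<^bsub>A\<^esub> \<one>\<^bsub>A\<^esub>) = complex_of_real (f (inv_into V \<psi> y)) \<odot>\<^bsub>A\<^esub> \<one>\<^bsub>A\<^esub>"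
      using rho_ops(3,4)[OF *(1), of "inv_into V \<psi> y" "\<one>\<^bsub>A\<^esub>"] by simp
  qed
qed simp

lemma smult_one_mult:
  "a \<in> C \<Longrightarrow> (c \<odot>\<^bsub>A\<^esub> \<one>\<^bsub>A\<^esub>) \<otimes>\<^bsub>A\<^esub> a = c \<odot>\<^bsub>A\<^esub> a" "a \<in> C \<Longrightarrow> a \<otimes>\<^bsub>A\<^esub> (c \<odot>\<^bsub>A\<^esub> \<one>\<^bsub>A\<^esub>) = c \<odot>\<^bsub>A\<^esub> a"
  by (simp_all add: A.smult_mult_left A.smult_mult_right)

text \<open>Scalar multiples of the unit commute with everything in each fibre, and they are fixed
  because every \<open>\<alpha> l\<close> preserves the unit.\<close>

lemma unit_section_fixed_center:
  assumes f: "smooth_real f"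
  shows "unit_section f \<in> carrier (fixed_center \<Gamma>A \<Lambda> \<beta>)"
proof -
  have "unit_section f \<otimes>\<^bsub>\<Gamma>A\<^esub> s = s \<otimes>\<^bsub>\<Gamma>A\<^esub> unit_section f" if "s \<in> \<Gamma>" for s
    unfolding section_algebra_simps
    by (rule restrict_ext) (simp add: unit_section_def smult_one_mult section_snd(1)[OF that])
  moreover have "\<beta> l (unit_section f) = unit_section f" if l: "l \<in> carrier \<Lambda>" for l
    unfolding beta_eq[OF l unit_section_closed[OF f]] unfolding unit_section_def
    by (rule restrict_ext) (simp add: alpha_simps[OF l] alpha_unit[OF l])
  ultimately show ?thesis
    using unit_section_closed[OF f] by (simp add: fixed_center_def alg_center_def del: section_algebra_simps(2))
qed

lemma unit_section_ops:
  "unit_section f \<oplus>\<^bsub>\<Gamma>A\<^esub> unit_section h = unit_section (\<lambda>x. f x + h x)"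
  "unit_section f \<otimes>\<^bsub>\<Gamma>A\<^esub> unit_section h = unit_section (\<lambda>x. f x * h x)"
  "complex_of_real c \<odot>\<^bsub>\<Gamma>A\<^esub> unit_section f = unit_section (\<lambda>x. c * f x)"
proof -
  show "unit_section f \<oplus>\<^bsub>\<Gamma>A\<^esub> unit_section h = unit_section (\<lambda>x. f x + h x)"
    unfolding section_algebra_simps unit_section_def by (rule restrict_ext) (simp add: A.smult_ldistr)
  show "unit_section f \<otimes>\<^bsub>\<Gamma>A\<^esub> unit_section h = unit_section (\<lambda>x. f x * h x)"
    unfolding section_algebra_simps unit_section_def by (rule restrict_ext) (simp add: A.smult_mult_left A.smult_assoc)
  show "complex_of_real c \<odot>\<^bsub>\<Gamma>A\<^esub> unit_section f = unit_section (\<lambda>x. c * f x)"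
    unfolding section_algebra_simps unit_section_def by (rule restrict_ext) (simp add: A.smult_assoc)
qed

lemma section_pow:
  assumes b: "b \<in> \<Gamma>" and x: "x \<in> X"
  shows "snd ((b [^]\<^bsub>\<Gamma>A\<^esub> (m::nat)) x) = snd (b x) [^]\<^bsub>A\<^esub> m"
proof (induction m)
  case 0
  then show ?case using x by (simp add: nat_pow_def)
next
  case (Suc m)
  interpret S: lca \<Gamma>A by (rule lca.intro[OF lc_algebra_sections])
  have "b [^]\<^bsub>\<Gamma>A\<^esub> Suc m = (b [^]\<^bsub>\<Gamma>A\<^esub> m) \<otimes>\<^bsub>\<Gamma>A\<^esub> b" by (rule S.nat_pow_Suc)
  then show ?case using Suc x by simp
qed

lemma character_nonzero:
  assumes \<xi>: "\<xi> \<in> alg_characters (fixed_center \<Gamma>A \<Lambda> \<beta>)"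
    and e: "\<And>k::nat. smooth_real (e k)" "\<And>k x. 0 \<le> e k x" "\<And>k x. e k x \<le> 1"
    and cover: "\<And>x. x \<in> X \<Longrightarrow> \<exists>k N. openin (mtopo M) N \<and> x \<in> N \<and> (\<forall>y\<in>N. e k y = 1)"
  shows "\<exists>k. \<xi> (unit_section (e k)) \<noteq> 0"
proof (rule ccontr)
  assume "\<not> (\<exists>k. \<xi> (unit_section (e k)) \<noteq> 0)"
  then have zero: "\<xi> (unit_section (e k)) = 0" for k by blast
  let ?Z = "fixed_center \<Gamma>A \<Lambda> \<beta>"
  have Zops: "add ?Z = add \<Gamma>A" "mult ?Z = mult \<Gamma>A" "smult ?Z = smult \<Gamma>A" by (simp_all add: fixed_center_def)
  have h: "\<xi> (s \<oplus>\<^bsub>\<Gamma>A\<^esub> r) = \<xi> s + \<xi> r" "\<xi> (s \<otimes>\<^bsub>\<Gamma>A\<^esub> r) = \<xi> s * \<xi> r" "\<xi> (c \<odot>\<^bsub>\<Gamma>A\<^esub> s) = c * \<xi> s"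
    if "s \<in> carrier ?Z" "r \<in> carrier ?Z" for s r c
    using \<xi> that unfolding alg_characters_def alg_hom_def Zops scalars_simps by blast+
  define \<eta> where "\<eta> f = \<xi> (unit_section f)" for f
  note fc = unit_section_fixed_center
  have add: "\<eta> (\<lambda>x. f x + f' x) = \<eta> f + \<eta> f'" and mult: "\<eta> (\<lambda>x. f x * f' x) = \<eta> f * \<eta> f'"
    if "smooth_real f" "smooth_real f'" for f f'
    using h(1,2)[OF fc[OF that(1)] fc[OF that(2)]] unfolding unit_section_ops \<eta>_def by auto
  have smult: "\<eta> (\<lambda>x. c * f x) = c * \<eta> f" if "smooth_real f" for f c
    using h(3)[OF fc[OF that] fc[OF that], of "complex_of_real c"] unfolding unit_section_ops \<eta>_def .
  \<comment> \<open>A character is only required to be nonzero; a value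
    \<open>\<xi> s \<noteq> 0\<close> can be cancelled from the equation that \<open>\<xi>\<close>
    assigns to the product of the unit section and \<open>s\<close>.\<close>
  have one: "\<eta> (\<lambda>_. 1) = 1"
  proof -
    obtain s where s: "s \<in> carrier ?Z" "\<xi> s \<noteq> 0" using \<xi> by (auto simp: alg_characters_def)
    have sG: "s \<in> \<Gamma>" using fixed_centerD(1)[OF s(1)] by simp
    have "unit_section (\<lambda>_. 1) \<otimes>\<^bsub>\<Gamma>A\<^esub> s = s"
    proof (rule extensionalityI[of _ X])
      show "s \<in> extensional X" using sG by (simp add: smooth_sections_def)
      fix x assume x: "x \<in> X"
      show "(unit_section (\<lambda>_. 1) \<otimes>\<^bsub>\<Gamma>A\<^esub> s) x = s x"
        using x section_snd[OF sG x] by (simp add: unit_section_def)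
    qed simp
    then show ?thesis using h(2)[OF fc[OF smooth_real_const[of 1]] s(1)] s(2) unfolding \<eta>_def by auto
  qed
  have const: "\<eta> (\<lambda>_. c) = c" for c using smult[OF smooth_real_const[of 1], of c] one by simp
  \<comment> \<open>At a point of \<open>X\<close> this is the first index whose cut-off equals one.
    All products \<open>w m x\<close> with \<open>m \<ge> K x\<close> vanish, so the sum in
    \<open>f\<close> is the full series.\<close>
  define K where "K x = (LEAST k. e k x = 1)" for x
  have K1: "e (K x) x = 1" if "x \<in> X" for x
    unfolding K_def using cover[OF that] by (metis (mono_tags, lifting) LeastI)
  define w where "w m x = (\<Prod>j\<le>m. 1 - e j x)" for m x
  define f where "f x = (\<Sum>m<K x. w m x)" for x
  have wnn: "0 \<le> w m x" for m x unfolding w_def using e(3) by (intro prod_nonneg) auto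
  have w0: "w m x = 0" if "e k x = 1" "k \<le> m" for k m x
    unfolding w_def using that by (intro prod_zero) auto
  have sw: "smooth_real (w m)" for m
  proof -
    have "smooth_real (\<lambda>x. \<Prod>j\<le>m. 1 + (- 1) * e j x)"
      by (intro smooth_real_prod finite_atMost smooth_real_add smooth_real_const smooth_real_mult e(1))
    then show ?thesis by (simp add: w_def[abs_def])
  qed
  \<comment> \<open>Any index \<open>k\<close> with \<open>e k x = 1\<close> may serve as upper
    bound. On an open set where \<open>e k\<close> is one the same finite sum therefore describes
    \<open>f\<close>, which gives smoothness.\<close>
  have f_eq: "f x = (\<Sum>m<k. w m x)" if "e k x = 1" for k x
  proof -
    have Kk: "K x \<le> k" "e (K x) x = 1" unfolding K_def using that by (auto intro: Least_le LeastI)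
    have "(\<Sum>m<k. w m x) = (\<Sum>m<K x. w m x)"
      by (rule sum.mono_neutral_right) (use Kk w0 in auto)
    then show ?thesis by (simp add: f_def)
  qed
  have sf: "smooth_real f"
  proof (rule smooth_real_local)
    fix x assume "x \<in> X"
    then obtain k N where "openin (mtopo M) N" "x \<in> N" "\<forall>y\<in>N. e k y = 1" using cover by blast
    then show "\<exists>N f'. openin (mtopo M) N \<and> x \<in> N \<and> smooth_real f' \<and> (\<forall>y\<in>N. f y = f' y)"
      using f_eq smooth_real_sum[OF finite_lessThan sw] by (intro exI[of _ N] exI[of _ "\<lambda>x. \<Sum>m<k. w m x"]) auto
  qed
  define c where "c = \<eta> f"
  obtain N :: nat where N: "cmod c < N" using reals_Archimedean2 by blast
  \<comment> \<open>The first three summands are the squared modulus of \<open>f - c\<close>,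
    expanded so that only real coefficients occur.\<close>
  define u where "u x = ((f x * f x + (- 2 * Re c) * f x) + (cmod c)\<^sup>2) + (\<Sum>k<N. e k x)" for x
  have su1: "smooth_real (\<lambda>x. f x * f x)" "smooth_real (\<lambda>x. (- 2 * Re c) * f x)"
    "smooth_real (\<lambda>x. \<Sum>k<m. e k x)" for m
    by (intro smooth_real_mult smooth_real_const sf smooth_real_sum finite_lessThan e(1))+
  have su: "smooth_real u" unfolding u_def[abs_def] by (intro smooth_real_add su1 smooth_real_const)
  have u_pos: "u x > 0" if x: "x \<in> X" for x
  proof -
    have sq: "(f x * f x + (- 2 * Re c) * f x) + (cmod c)\<^sup>2 = (f x - Re c)\<^sup>2 + (Im c)\<^sup>2"
      unfolding cmod_power2 by (simp add: power2_eq_square algebra_simps)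
    show ?thesis
    proof (cases "\<exists>k<N. e k x > 0")
      case True
      then obtain k where k: "k < N" "e k x > 0" by blast
      have "(\<Sum>k<N. e k x) > 0" by (rule sum_pos2[of _ k]) (use k e(2) in auto)
      then show ?thesis unfolding u_def sq by (simp add: add_nonneg_pos)
    next
      case False
      then have e0: "e k x = 0" if "k < N" for k using e(2)[of k x] that by force
      \<comment> \<open>With the first \<open>N\<close> cut-offs zero at \<open>x\<close>, the index
        \<open>K x\<close> is at least \<open>N\<close> and the first \<open>N\<close> summands of
        \<open>f x\<close> are one; so \<open>f x\<close> exceeds the modulus of \<open>c\<close>
        and the square is positive.\<close>
      have "N \<le> K x" using K1[OF x] e0[of "K x"] by (cases "K x < N") auto
      then have "(\<Sum>m<N. w m x) \<le> f x" unfolding f_def by (intro sum_mono2) (auto simp: wnn)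
      moreover have "w m x = 1" if "m < N" for m using e0 that by (simp add: w_def)
      ultimately have "real N \<le> f x" by simp
      then have "f x - Re c > 0" using N complex_Re_le_cmod[of c] by linarith
      then have "(f x - Re c)\<^sup>2 > 0" by simp
      moreover have "(\<Sum>k<N. e k x) = 0" using e0 by simp
      ultimately show ?thesis unfolding u_def sq by (simp add: add_pos_nonneg)
    qed
  qed
  have sum0: "\<eta> (\<lambda>x. \<Sum>k<m. e k x) = 0" for m
  proof (induction m)
    case 0
    then show ?case using const[of 0] by simp
  next
    case (Suc m)
    then show ?case using add[OF su1(3)[of m] e(1)[of m]] zero[of m] by (simp add: \<eta>_def)
  qed
  have "\<eta> u = c * c + complex_of_real (- 2 * Re c) * c + complex_of_real ((cmod c)\<^sup>2)"
    unfolding u_def[abs_def]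
    using add[OF smooth_real_add[OF smooth_real_add[OF su1(1,2)] smooth_real_const] su1(3)[of N]]
      add[OF smooth_real_add[OF su1(1,2)] smooth_real_const[of "(cmod c)\<^sup>2"]]
      add[OF su1(1,2)] mult[OF sf sf] smult[OF sf, of "- 2 * Re c"] sum0[of N] const[of "(cmod c)\<^sup>2"]
    by (simp add: c_def)
  \<comment> \<open>The quadratic polynomial has the roots \<open>c\<close> and its
    conjugate.\<close>
  also have "\<dots> = 0"
    unfolding complex_norm_square[of c] complex_add_cnj[of c, symmetric] by (simp add: algebra_simps complex_eq_iff)
  finally have u0: "\<eta> u = 0" .
  have "\<eta> (\<lambda>x. u x * inverse (u x)) = 0"
    using mult[OF su smooth_real_inverse[OF su u_pos]] u0 by simp
  moreover have "\<eta> (\<lambda>x. u x * inverse (u x)) = \<eta> (\<lambda>_. 1)"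
    unfolding \<eta>_def using unit_section_cong[of "\<lambda>x. u x * inverse (u x)" "\<lambda>_. 1"] u_pos by fastforce
  ultimately show False using one by simp
qed

section \<open>Local triviality\<close>

text \<open>Over \<open>U i\<close> this is \<open>p\<close> times the section that is constantly
  \<open>a\<close> in the chart with index \<open>i\<close>; the factor \<open>g (idx x) i x\<close>
  expresses that section in the underlying set of the total space.\<close>

definition cut_section where
  "cut_section i p a = (\<lambda>x\<in>X. (x, complex_of_real (p x) \<odot>\<^bsub>A\<^esub> (if x \<in> U i then g (idx x) i x a else \<zero>\<^bsub>A\<^esub>)))"

text \<open>The open set \<open>U i\<close> and the complement of \<open>K\<close> cover
  \<open>M\<close>. On the first the coordinates are \<open>p\<close> times a transition map, on the
  second they are zero.\<close>

lemma cut_section_closed: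
  assumes c: "cutoff i e p" and a: "a \<in> C"
  shows "cut_section i p a \<in> \<Gamma>"
  unfolding cut_section_def
proof (rule section_of_local)
  have i: "i \<in> I" and p: "smooth_real p" using c by (auto simp: cutoff_def)
  obtain K where K: "closedin (mtopo M) K" "K \<subseteq> U i" "\<forall>x\<in>X - K. p x = 0" using c by (auto simp: cutoff_def)
  show "complex_of_real (p x) \<odot>\<^bsub>A\<^esub> (if x \<in> U i then g (idx x) i x a else \<zero>\<^bsub>A\<^esub>) \<in> C" if "x \<in> X" for x
    using a i idx[OF that] by (auto simp: g_props)
  fix j V \<psi> assume j: "j \<in> I" and V: "(V, \<psi>) \<in> atlas M"
  let ?D = "U j \<inter> V"
  let ?f = "\<lambda>y. \<rho> j (inv_into V \<psi> y, complex_of_real (p (inv_into V \<psi> y)) \<odot>\<^bsub>A\<^esub> (if inv_into V \<psi> y \<in> U i then g (idx (inv_into V \<psi> y)) i (inv_into V \<psi> y) a else \<zero>\<^bsub>A\<^esub>))"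
  have oD: "openin (mtopo M) ?D" using U_open[OF j] chart(1)[OF V] by auto
  have "smooth_family pt E F (\<psi> ` ?D) (\<lambda>_. ?f)"
  proof (rule smooth_family_local[OF lcs_E lcs_F])
    show "openin (topo E) (\<psi> ` ?D)" by (rule chart(8)[OF V oD]) auto
    fix y assume "y \<in> \<psi> ` ?D"
    then obtain x where x: "y = \<psi> x" "x \<in> U j" "x \<in> V" by auto
    show "\<exists>W. y \<in> W \<and> W \<subseteq> \<psi> ` ?D \<and> smooth_family pt E F W (\<lambda>_. ?f)"
    proof (cases "x \<in> U i")
      case True
      let ?N = "U j \<inter> U i \<inter> V"
      have oN: "openin (mtopo M) ?N" using U_open[OF j] U_open[OF i] chart(1)[OF V] by auto
      have "smooth_family pt E F (\<psi> ` ?N) (\<lambda>_ y. rep (U j) (\<phi> j) (\<phi> i (inv_into V \<psi> y, a)))"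
        using smooth_family_pull[OF _ rep_transition_smooth[OF bundle_chart_phi[OF j] i V], of pt "\<lambda>_. a"] a by simp
      then have "smooth_family pt E F (\<psi> ` ?N) (\<lambda>_ y. complex_of_real (p (inv_into V \<psi> y)) \<odot>\<^bsub>A\<^esub> rep (U j) (\<phi> j) (\<phi> i (inv_into V \<psi> y, a)))"
        by (intro A.smooth_family_real_smult lcs_E smooth_real_subset[OF p V oN]) auto
      then have "smooth_family pt E F (\<psi> ` ?N) (\<lambda>_. ?f)"
      proof (rule smooth_family_cong[OF lcs_E])
        fix y assume "y \<in> \<psi> ` ?N"
        then have x: "inv_into V \<psi> y \<in> U j" "inv_into V \<psi> y \<in> U i" using inv_chart(1)[OF V, of y ?N] by auto
        have "rep (U j) (\<phi> j) (\<phi> i (inv_into V \<psi> y, a)) = \<rho> j (inv_into V \<psi> y, g (idx (inv_into V \<psi> y)) i (inv_into V \<psi> y) a)"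
          using inv_phi_phi[OF j i x a] rho_phi[OF j i x a] by (simp add: rep_def \<phi>_def)
        then show "complex_of_real (p (inv_into V \<psi> y)) \<odot>\<^bsub>A\<^esub> rep (U j) (\<phi> j) (\<phi> i (inv_into V \<psi> y, a)) = ?f y"
          using rho_ops(3)[OF j x(1), of "g (idx (inv_into V \<psi> y)) i (inv_into V \<psi> y) a"] x i a idx_U[OF i x(2)] by (simp add: g_props)
      qed
      then show ?thesis using x True by (intro exI[of _ "\<psi> ` ?N"]) auto
    next
      case False
      let ?N = "?D - K"
      have oN: "openin (mtopo M) ?N" using openin_diff[OF oD K(1)] .
      have oN': "openin (topo E) (\<psi> ` ?N)" by (rule chart(8)[OF V oN]) auto
      have "smooth_family pt E F (\<psi> ` ?N) (\<lambda>_ y. \<zero>\<^bsub>A\<^esub>)" by (rule smooth_family_const[OF lcs_E lcs_F oN']) simp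
      then have "smooth_family pt E F (\<psi> ` ?N) (\<lambda>_. ?f)"
      proof (rule smooth_family_cong[OF lcs_E])
        fix y assume "y \<in> \<psi> ` ?N"
        then have x: "inv_into V \<psi> y \<in> U j" "inv_into V \<psi> y \<in> X - K" using inv_chart(1,2)[OF V, of y ?N] by auto
        let ?b = "if inv_into V \<psi> y \<in> U i then g (idx (inv_into V \<psi> y)) i (inv_into V \<psi> y) a else \<zero>\<^bsub>A\<^esub>"
        have "?b \<in> C" using a i idx[of "inv_into V \<psi> y"] x(2) by (auto simp: g_props)
        then have "complex_of_real (p (inv_into V \<psi> y)) \<odot>\<^bsub>A\<^esub> ?b = \<zero>\<^bsub>A\<^esub>" using K(3) x(2) by simp
        then show "\<zero>\<^bsub>A\<^esub> = ?f y" using rho_ops(5)[OF j x(1) A.zero_closed] by simp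
      qed
      then show ?thesis using x False K(2) by (intro exI[of _ "\<psi> ` ?N"]) auto
    qed
  qed
  then show "smooth_on E F (\<psi> ` ?D) ?f" unfolding smooth_on_iff_family[OF lcs_E lcs_F] .
qed

text \<open>Equivariance of the cocycle makes the value in each fibre isotypic, and scalars commute
  with the action.\<close>

lemma cut_section_isotypic:
  assumes c: "cutoff i e p" and a: "a \<in> isotypic A \<Lambda> \<alpha> \<xi>"
  shows "cut_section i p a \<in> isotypic \<Gamma>A \<Lambda> \<beta> \<xi>"
proof -
  have i: "i \<in> I" using c by (simp add: cutoff_def)
  have aC: "a \<in> C" using a by (simp add: isotypic_def)
  note cl = cut_section_closed[OF c aC]
  have "\<beta> l (cut_section i p a) = \<xi> l \<odot>\<^bsub>\<Gamma>A\<^esub> cut_section i p a" if l: "l \<in> carrier \<Lambda>" for l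
    unfolding beta_eq[OF l cl] section_algebra_simps
  proof (rule restrict_ext)
    fix x assume x: "x \<in> X"
    have al: "\<alpha> l a = \<xi> l \<odot>\<^bsub>A\<^esub> a" using a l by (simp add: isotypic_def)
    let ?b = "if x \<in> U i then g (idx x) i x a else \<zero>\<^bsub>A\<^esub>"
    have bC: "?b \<in> C" using aC i idx[OF x] by (auto simp: g_props)
    have "\<alpha> l \<zero>\<^bsub>A\<^esub> = \<zero>\<^bsub>A\<^esub>" using alpha_simps(3)[OF l A.zero_closed, of 0] alpha_closed[OF l A.zero_closed] by simp
    then have "\<alpha> l ?b = \<xi> l \<odot>\<^bsub>A\<^esub> ?b" using idx[OF x] i aC l al by (simp add: g_props)
    then have "\<alpha> l (complex_of_real (p x) \<odot>\<^bsub>A\<^esub> ?b) = \<xi> l \<odot>\<^bsub>A\<^esub> (complex_of_real (p x) \<odot>\<^bsub>A\<^esub> ?b)"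
      unfolding alpha_simps(3)[OF l bC] using bC by (simp only: A.smult_assoc[symmetric] mult.commute)
    then show "(x, \<alpha> l (snd (cut_section i p a x))) = (x, \<xi> l \<odot>\<^bsub>A\<^esub> snd (cut_section i p a x))"
      using x by (simp add: cut_section_def)
  qed
  then show ?thesis using cl by (simp add: isotypic_def del: section_algebra_simps(6))
qed

text \<open>Over \<open>U i\<close> the power is \<open>p^m\<close> times the unit, and
  \<open>p^m e = e\<close> follows from \<open>p e = e\<close> by iteration. Elsewhere
  \<open>e\<close> vanishes together with \<open>p\<close>, so that both sides are zero.\<close>

lemma cut_section_pow:
  assumes c: "cutoff i e p" and a: "a \<in> C" "a [^]\<^bsub>A\<^esub> m = \<one>\<^bsub>A\<^esub>"
  shows "(cut_section i p a [^]\<^bsub>\<Gamma>A\<^esub> (m::nat)) \<otimes>\<^bsub>\<Gamma>A\<^esub> unit_section e = unit_section e"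
  unfolding section_algebra_simps
proof (subst (2) unit_section_def, rule restrict_ext)
  fix x assume x: "x \<in> X"
  have i: "i \<in> I" using c by (simp add: cutoff_def)
  have pe: "p x * e x = e x" using c by (simp add: cutoff_def)
  have pm: "p x ^ k * e x = e x" for k
  proof (induction k)
    case (Suc k)
    have "p x ^ Suc k * e x = p x * (p x ^ k * e x)" by (simp only: power_Suc mult.assoc)
    then show ?case by (simp only: Suc pe)
  qed simp
  note cl = cut_section_closed[OF c a(1)]
  interpret S: lca \<Gamma>A by (rule lca.intro[OF lc_algebra_sections])
  have eq: "snd ((cut_section i p a [^]\<^bsub>\<Gamma>A\<^esub> m) x) = snd (cut_section i p a x) [^]\<^bsub>A\<^esub> m" by (rule section_pow[OF cl x])
  have "snd (cut_section i p a x) [^]\<^bsub>A\<^esub> m \<otimes>\<^bsub>A\<^esub> (complex_of_real (e x) \<odot>\<^bsub>A\<^esub> \<one>\<^bsub>A\<^esub>) = complex_of_real (e x) \<odot>\<^bsub>A\<^esub> \<one>\<^bsub>A\<^esub>"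
  proof (cases "x \<in> U i")
    case True
    let ?b = "g (idx x) i x a"
    have bC: "?b \<in> C" using a i idx[OF x] True by (simp add: g_props)
    have b_pow: "?b [^]\<^bsub>A\<^esub> k = g (idx x) i x (a [^]\<^bsub>A\<^esub> k)" for k :: nat
      by (induction k) (use a i idx[OF x] True in \<open>simp_all add: g_props g_unit\<close>)
    have sp: "(t \<odot>\<^bsub>A\<^esub> ?b) [^]\<^bsub>A\<^esub> k = (t ^ k) \<odot>\<^bsub>A\<^esub> (?b [^]\<^bsub>A\<^esub> k)" for k :: nat and t
      by (induction k) (use bC in \<open>simp_all add: A.smult_mult_left A.smult_mult_right A.smult_assoc[symmetric] mult.commute\<close>)
    have "?b [^]\<^bsub>A\<^esub> m = \<one>\<^bsub>A\<^esub>" using b_pow[of m] a(2) g_unit[OF idx(1)[OF x] i idx(2)[OF x] True] by simp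
    then have "snd (cut_section i p a x) [^]\<^bsub>A\<^esub> m = complex_of_real (p x ^ m) \<odot>\<^bsub>A\<^esub> \<one>\<^bsub>A\<^esub>"
      using x True sp[of "complex_of_real (p x)" m] by (simp add: cut_section_def)
    moreover have "complex_of_real (p x ^ m) * complex_of_real (e x) = complex_of_real (e x)"
      using pm[of m] by (metis of_real_mult)
    ultimately show ?thesis
      using A.smult_assoc[of "\<one>\<^bsub>A\<^esub>" "complex_of_real (p x ^ m)" "complex_of_real (e x)"]
        smult_one_mult(1)[of "complex_of_real (e x) \<odot>\<^bsub>A\<^esub> \<one>\<^bsub>A\<^esub>" "complex_of_real (p x ^ m)"]
      by (metis A.one_closed A.smult_closed)
  next
    case False
    obtain K where K: "K \<subseteq> U i" "\<forall>x\<in>X - K. p x = 0" using c by (auto simp: cutoff_def)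
    then have "p x = 0" using False x by blast
    then have "e x = 0" using pe by simp
    moreover have "snd (cut_section i p a x) \<in> C" using section_snd(1)[OF cl x] .
    ultimately show ?thesis by simp
  qed
  then show "(x, snd ((cut_section i p a [^]\<^bsub>\<Gamma>A\<^esub> m) x) \<otimes>\<^bsub>A\<^esub> snd (unit_section e x)) = (x, complex_of_real (e x) \<odot>\<^bsub>A\<^esub> \<one>\<^bsub>A\<^esub>)"
    unfolding eq using x by (simp add: unit_section_def)
qed

lemma nc_principal_bundle_sections:
  assumes fin: "finite (carrier \<Lambda>)" and triv: "trivial_ncp_bundle A \<Lambda> \<alpha>"
  shows "nc_principal_bundle \<Gamma>A \<Lambda> \<beta>"
  unfolding nc_principal_bundle_def
proof (intro conjI ballI)
  show "dynamical_system \<Gamma>A \<Lambda> \<beta>" by (rule dynamical_system_sections)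
  fix \<xi> assume \<xi>: "\<xi> \<in> alg_characters (fixed_center \<Gamma>A \<Lambda> \<beta>)"
  \<comment> \<open>Over the empty base all sections coincide, hence the sum of \<open>s\<close>
    with itself is \<open>s\<close> and every character would vanish; the enumeration of cut-offs
    needs a point.\<close>
  have ne: "X \<noteq> {}"
  proof
    assume X: "X = {}"
    obtain s where s: "s \<in> carrier (fixed_center \<Gamma>A \<Lambda> \<beta>)" "\<xi> s \<noteq> 0" using \<xi> by (auto simp: alg_characters_def)
    have "s \<oplus>\<^bsub>\<Gamma>A\<^esub> s = s"
    proof (rule extensionalityI[of _ X])
      show "s \<in> extensional X" using fixed_centerD(1)[OF s(1)] by (simp add: smooth_sections_def)
      show "s \<oplus>\<^bsub>\<Gamma>A\<^esub> s \<in> extensional X" by simp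
      fix x assume "x \<in> X"
      then show "(s \<oplus>\<^bsub>\<Gamma>A\<^esub> s) x = s x" using X by blast
    qed
    moreover have "\<xi> (s \<oplus>\<^bsub>\<Gamma>A\<^esub> s) = \<xi> s + \<xi> s"
      using \<xi> s(1) unfolding alg_characters_def alg_hom_def by (simp add: fixed_center_def del: section_algebra_simps(5))
    ultimately show False using s(2) by simp
  qed
  obtain i e p where cut: "\<And>k::nat. cutoff (i k) (e k) (p k)"
    and cov: "\<And>x. x \<in> X \<Longrightarrow> \<exists>k N. openin (mtopo M) N \<and> x \<in> N \<and> (\<forall>y\<in>N. e k y = 1)"
    using cutoff_sequence[OF ne] by blast
  obtain k where k: "\<xi> (unit_section (e k)) \<noteq> 0"
    using character_nonzero[OF \<xi> _ _ _ cov] cut unfolding cutoff_def by blast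
  have z: "unit_section (e k) \<in> carrier (fixed_center \<Gamma>A \<Lambda> \<beta>)"
    using unit_section_fixed_center cut[of k] by (auto simp: cutoff_def)
  interpret LS: localized_system \<Gamma>A \<Lambda> \<beta> "unit_section (e k)"
    by (intro localized_system.intro dyn_sys.intro localized_system_axioms.intro dynamical_system_sections z)
  obtain S where S: "minimal_generators \<Lambda> S" "internal_direct_product \<Lambda> S"
     "\<forall>s\<in>S. \<exists>\<xi> \<in> hom \<Lambda> circle_group. \<xi> s = exp (2 * of_real pi * \<i> / of_nat (group.ord \<Lambda> s)) \<and>
           (\<forall>t\<in>S - {s}. \<xi> t = 1) \<and> (\<exists>a \<in> isotypic A \<Lambda> \<alpha> \<xi> \<inter> Units A. a [^]\<^bsub>A\<^esub> group.ord \<Lambda> s = \<one>\<^bsub>A\<^esub>)"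
    using triv unfolding trivial_ncp_bundle_def by blast
  \<comment> \<open>The generators of the group and the characters of the trivialization of
    \<open>A\<close> are kept; only the elements \<open>a\<close> are replaced by cut-off
    sections.\<close>
  have "trivial_ncp_bundle (smooth_localization \<Gamma>A (unit_section (e k))) \<Lambda> (loc_action \<Gamma>A \<beta> (unit_section (e k)))"
  proof (rule LS.trivial_localization[OF fin S(1,2)])
    fix s assume "s \<in> S"
    then obtain \<zeta> a where \<zeta>: "\<zeta> \<in> hom \<Lambda> circle_group" "\<zeta> s = exp (2 * of_real pi * \<i> / of_nat (group.ord \<Lambda> s))" "\<forall>t\<in>S - {s}. \<zeta> t = 1"
      and a: "a \<in> isotypic A \<Lambda> \<alpha> \<zeta>" "a [^]\<^bsub>A\<^esub> group.ord \<Lambda> s = \<one>\<^bsub>A\<^esub>" using S(3) by blast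
    have aC: "a \<in> C" using a(1) by (simp add: isotypic_def)
    show "\<exists>\<xi>\<in>hom \<Lambda> circle_group. \<xi> s = exp (2 * complex_of_real pi * \<i> / of_nat (group.ord \<Lambda> s)) \<and> (\<forall>t\<in>S - {s}. \<xi> t = 1) \<and>
       (\<exists>b\<in>isotypic \<Gamma>A \<Lambda> \<beta> \<xi>. (b [^]\<^bsub>\<Gamma>A\<^esub> group.ord \<Lambda> s) \<otimes>\<^bsub>\<Gamma>A\<^esub> unit_section (e k) = unit_section (e k))"
      using \<zeta> cut_section_isotypic[OF cut[of k] a(1)] cut_section_pow[OF cut[of k] aC a(2)] by blast
  qed
  then show "\<exists>z\<in>carrier (fixed_center \<Gamma>A \<Lambda> \<beta>). \<xi> z \<noteq> 0 \<and> trivial_ncp_bundle (smooth_localization \<Gamma>A z) \<Lambda> (loc_action \<Gamma>A \<beta> z)"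
    using k z by blast
qed

end

theorem theorem5p9:
  fixes \<Lambda> :: "'l monoid"
    and A :: "(complex, 'a) tvs"
    and \<alpha> :: "'l \<Rightarrow> 'a \<Rightarrow> 'a"
    and n :: nat
    and M :: "('m, nat \<Rightarrow> real) manifold"
    and I :: "'i set"
    and U :: "'i \<Rightarrow> 'm set"
    and g :: "'i \<Rightarrow> 'i \<Rightarrow> 'm \<Rightarrow> 'a \<Rightarrow> 'a"
  assumes "comm_group \<Lambda>" and "finite (carrier \<Lambda>)"
    and "frechet_algebra A"
    and "trivial_ncp_bundle A \<Lambda> \<alpha>"
    and "\<exists>h. h \<in> alg_iso (fixed_center A \<Lambda> \<alpha>) (scalars :: (complex, complex) tvs)"
    and "findim_manifold n M"
    and "\<And>i. i \<in> I \<Longrightarrow> openin (mtopo M) (U i)" and "(\<Union>i\<in>I. U i) = topspace (mtopo M)"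
    and "\<And>i j x. i \<in> I \<Longrightarrow> j \<in> I \<Longrightarrow> x \<in> U i \<inter> U j \<Longrightarrow> g i j x \<in> equivariant_auto A \<Lambda> \<alpha>"
    and "\<And>i j. i \<in> I \<Longrightarrow> j \<in> I \<Longrightarrow>
           smooth_map (prod_manifold M (tvs_manifold (real_tvs A))) (tvs_manifold (real_tvs A))
             ((U i \<inter> U j) \<times> carrier A) (\<lambda>(x, a). g i j x a)"
    and "\<And>i x. i \<in> I \<Longrightarrow> x \<in> U i \<Longrightarrow> g i i x = \<one>\<^bsub>AlgAut A\<^esub>"
    and "\<And>i j k x. i \<in> I \<Longrightarrow> j \<in> I \<Longrightarrow> k \<in> I \<Longrightarrow> x \<in> U i \<inter> U j \<inter> U k \<Longrightarrow>
           g i j x \<otimes>\<^bsub>AlgAut A\<^esub> g j k x = g i k x"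
  shows "\<exists>(T :: ('m \<times> 'a, (nat \<Rightarrow> real) \<times> 'a) manifold) q fib \<phi> \<sigma>.
    algebra_bundle T M A q fib \<and>
    (\<forall>i\<in>I. bundle_chart T M A q fib (U i) (\<phi> i)) \<and>
    (\<forall>i\<in>I. \<forall>j\<in>I. \<forall>x\<in>U i \<inter> U j. \<forall>a\<in>carrier A.
       inv_into (U i \<times> carrier A) (\<phi> i) (\<phi> j (x, a)) = (x, g i j x a)) \<and>
    (\<forall>l\<in>carrier \<Lambda>. \<forall>i\<in>I. \<forall>x\<in>U i. \<forall>a\<in>carrier A. \<sigma> l (\<phi> i (x, a)) = \<phi> i (x, \<alpha> l a)) \<and>
    group_action \<Lambda> (topspace (mtopo T)) \<sigma> \<and>
    (\<forall>l\<in>carrier \<Lambda>. smooth_map T T (topspace (mtopo T)) (\<sigma> l)) \<and>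
    (\<forall>l\<in>carrier \<Lambda>. \<forall>x\<in>topspace (mtopo M).
       restrict (\<sigma> l) (carrier (fib x)) \<in> alg_auto (fib x)) \<and>
    group_action \<Lambda> (smooth_sections T M q) (section_action T M q \<sigma>) \<and>
    (\<forall>l\<in>carrier \<Lambda>. section_action T M q \<sigma> l \<in> alg_auto (section_algebra T M A q fib)) \<and>
    nc_principal_bundle (section_algebra T M A q fib) \<Lambda> (section_action T M q \<sigma>)"
proof -
  have "dynamical_system A \<Lambda> \<alpha>" using assms(4) by (simp add: trivial_ncp_bundle_def)
  then interpret bundle_data A \<Lambda> \<alpha> n M I U g
    by (intro bundle_data.intro dyn_sys.intro bundle_data_axioms.intro assms(6-12))
  show ?thesis
  proof (intro exI conjI ballI)
    show "algebra_bundle T M A fst fib" by (rule algebra_bundle_T)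
    show "bundle_chart T M A fst fib (U i) (\<phi> i)" if "i \<in> I" for i by (rule bundle_chart_phi[OF that])
    show "inv_into (U i \<times> carrier A) (\<phi> i) (\<phi> j (x, a)) = (x, g i j x a)"
      if "i \<in> I" "j \<in> I" "x \<in> U i \<inter> U j" "a \<in> carrier A" for i j x a using inv_phi_phi that by blast
    show "\<sigma> l (\<phi> i (x, a)) = \<phi> i (x, \<alpha> l a)"
      if "l \<in> carrier \<Lambda>" "i \<in> I" "x \<in> U i" "a \<in> carrier A" for l i x a by (rule sigma_phi[OF that])
    show "group_action \<Lambda> (topspace (mtopo T)) \<sigma>" by (rule group_action_sigma)
    show "smooth_map T T (topspace (mtopo T)) (\<sigma> l)" if "l \<in> carrier \<Lambda>" for l by (rule smooth_map_sigma[OF that])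
    show "restrict (\<sigma> l) (carrier (fib x)) \<in> alg_auto (fib x)" if "l \<in> carrier \<Lambda>" "x \<in> topspace (mtopo M)" for l x
      by (rule sigma_alg_auto[OF that])
    show "group_action \<Lambda> (smooth_sections T M fst) (section_action T M fst \<sigma>)" by (rule group_action_sections)
    show "section_action T M fst \<sigma> l \<in> alg_auto (section_algebra T M A fst fib)" if "l \<in> carrier \<Lambda>" for l
      by (rule beta_alg_auto[OF that])
    show "nc_principal_bundle (section_algebra T M A fst fib) \<Lambda> (section_action T M fst \<sigma>)"
      by (rule nc_principal_bundle_sections[OF assms(2,4)])
  qed
qed

end
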